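(* Let $L>0$, $c\in\mathbb{R}$, $\beta\in L^\infty(0,L)$ real-valued, and let $\alpha>1$ be such that $c\neq\frac{1}{2L}\log\big(\frac{\alpha-1}{\alpha+1}\big)+\frac{n^2\pi^2}{L^2}$ for every $n\in\mathbb{N}^*$. With $\mathcal{A}$, $\phi_{1,n}$, $\phi_{2,m}$ and $\mathcal{H}^0$ as in the context, the family $\Phi=\{\phi_{1,n}\mid n\in\mathbb{N}^*\}\cup\{\phi_{2,m}\mid m\in\mathbb{Z}\}$ is a Riesz basis of $\mathcal{H}^0$. Hence, $\mathcal{A}$ is a Riesz spectral operator that generates a $C_0$-semigroup on $\mathcal{H}^0$.
   Context: $\mathbb{N}^*=\{1,2,\dots\}$. $H^1_{(0)}(0,L)=\{g\in H^1(0,L)\mid g(0)=0\}$; $\mathcal{H}^0=L^2(0,L)\times H^1_{(0)}(0,L)\times L^2(0,L)$ (complex-valued functions) with inner product $\int_0^L(f_1\overline{f_2}+g_1'\overline{g_2'}+h_1\overline{h_2})$. $\mathcal{A}(f,g,h)=(f''+cf+\beta g,h,g'')$ with domain $D(\mathcal{A})=\{(f,g,h)\in H^2\times H^2\times H^1\mid f(0)=f(L)=g(0)=h(0)=0,\ g'(L)+\alpha h(L)=0\}$. Its eigenvalues are $\lambda_{1,n}=c-\frac{n^2\pi^2}{L^2}$ ($n\in\mathbb{N}^*$) and $\lambda_{2,m}=\frac{1}{2L}\log(\frac{\alpha-1}{\alpha+1})+i\frac{m\pi}{L}$ ($m\in\mathbb{Z}$), with eigenvectors $\phi_{1,n}=(\sqrt{2/L}\sin(\frac{n\pi}{L}x),0,0)$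 and $\phi_{2,m}=(\phi^1_{2,m},\phi^2_{2,m},\phi^3_{2,m})$, where $\phi^2_{2,m}(x)=\frac{1}{A_m}\sinh(\lambda_{2,m}x)$, $\phi^3_{2,m}(x)=\frac{\lambda_{2,m}}{A_m}\sinh(\lambda_{2,m}x)$, $A_m=\frac{1}{L\sqrt{2\mu}}\sqrt{(\mu^2L^2+m^2\pi^2)\sinh(2\mu L)}$, $\mu=-\frac{1}{2L}\log(\frac{\alpha-1}{\alpha+1})>0$, and $\phi^1_{2,m}$ is the unique solution of $f''+(c-\lambda_{2,m})f=-\beta\phi^2_{2,m}$, $f(0)=f(L)=0$. A Riesz spectral operator (in the sense of Curtain–Zwart) is a closed operator with simple eigenvalues, whose eigenvectors form a Riesz basis and such that the closure of the set of eigenvalues is totally disconnected. *)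

theory Defs
  imports "HOL-Analysis.Analysis" "HOL-Library.Function_Algebras"
begin

class complex_vector = ab_group_add +
  fixes scaleC :: "complex \<Rightarrow> 'a \<Rightarrow> 'a"  (infixr \<open>*\<^sub>C\<close> 75)
  assumes scaleC_add_right: "a *\<^sub>C (x + y) = a *\<^sub>C x + a *\<^sub>C y"
    and scaleC_add_left: "(a + b) *\<^sub>C x = a *\<^sub>C x + b *\<^sub>C x"
    and scaleC_scaleC: "a *\<^sub>C b *\<^sub>C x = (a * b) *\<^sub>C x"
    and scaleC_one: "1 *\<^sub>C x = x"

instantiation complex :: complex_vector
begin
definition "a *\<^sub>C (x::complex) = a * x"
instance by standard (simp_all add: scaleC_complex_def algebra_simps)
end

instantiation "fun" :: (type, complex_vector) complex_vector
begin
definition "a *\<^sub>C f = (\<lambda>x. a *\<^sub>C f x)"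
instance
  by standard
    (simp_all add: scaleC_fun_def plus_fun_def fun_eq_iff scaleC_add_right scaleC_add_left
      scaleC_scaleC scaleC_one)
end

instantiation prod :: (complex_vector, complex_vector) complex_vector
begin
definition "a *\<^sub>C p = (a *\<^sub>C fst p, a *\<^sub>C snd p)"
instance
  by standard
    (simp_all add: scaleC_prod_def prod_eq_iff scaleC_add_right scaleC_add_left
      scaleC_scaleC scaleC_one)
end

global_interpretation complex_vector: vector_space "scaleC :: complex \<Rightarrow> 'a \<Rightarrow> 'a::complex_vector"
  defines csubspace = complex_vector.subspace
    and cspan = complex_vector.span
  by standard (simp_all add: scaleC_add_right scaleC_add_left scaleC_scaleC scaleC_one)

text \<open>
  A space is given by a carrier \<open>V\<close> and a seminorm \<open>nm\<close> on it, and stands for the quotient of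
  \<open>V\<close> by the null vectors of \<open>nm\<close>: as usual for \<open>L\<^sup>2\<close>, the elements are functions, and \<open>u\<close>, \<open>v\<close>
  are the same element of the space iff \<open>nm (u - v) = 0\<close>. Every notion below is stated so that
  it is invariant under this identification. An operator is given by its domain \<open>D\<close> and
  a map \<open>A\<close> that matters only on \<open>D\<close> and only up to null vectors.
\<close>

definition linear_operator :: "'v::complex_vector set \<Rightarrow> ('v \<Rightarrow> real) \<Rightarrow> 'v set \<Rightarrow> ('v \<Rightarrow> 'v) \<Rightarrow> bool"
  where "linear_operator V nm D A \<longleftrightarrow>
    csubspace D \<and> D \<subseteq> V \<and> A ` D \<subseteq> V \<and>
    (\<forall>u\<in>D. \<forall>v\<in>D. nm (A (u + v) - (A u + A v)) = 0) \<and>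
    (\<forall>a. \<forall>u\<in>D. nm (A (a *\<^sub>C u) - a *\<^sub>C A u) = 0) \<and>
    (\<forall>u\<in>D. \<forall>v\<in>V. nm (u - v) = 0 \<longrightarrow> v \<in> D \<and> nm (A u - A v) = 0)"

definition closed_operator :: "'v::complex_vector set \<Rightarrow> ('v \<Rightarrow> real) \<Rightarrow> 'v set \<Rightarrow> ('v \<Rightarrow> 'v) \<Rightarrow> bool"
  where "closed_operator V nm D A \<longleftrightarrow>
    linear_operator V nm D A \<and>
    (\<forall>u x y. (\<forall>n::nat. u n \<in> D) \<and> x \<in> V \<and> y \<in> V \<and>
       (\<lambda>n. nm (u n - x)) \<longlonglongrightarrow> 0 \<and> (\<lambda>n. nm (A (u n) - y)) \<longlonglongrightarrow> 0 \<longrightarrow>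
       x \<in> D \<and> nm (A x - y) = 0)"

definition eigenvector :: "('v::complex_vector \<Rightarrow> real) \<Rightarrow> 'v set \<Rightarrow> ('v \<Rightarrow> 'v) \<Rightarrow> complex \<Rightarrow> 'v \<Rightarrow> bool"
  where "eigenvector nm D A \<zeta> u \<longleftrightarrow> u \<in> D \<and> nm u \<noteq> 0 \<and> nm (A u - \<zeta> *\<^sub>C u) = 0"

definition eigenvalues :: "('v::complex_vector \<Rightarrow> real) \<Rightarrow> 'v set \<Rightarrow> ('v \<Rightarrow> 'v) \<Rightarrow> complex set"
  where "eigenvalues nm D A = {\<zeta>. \<exists>u. eigenvector nm D A \<zeta> u}"

text \<open>\<open>gen_ker V nm D A \<zeta> k\<close> is the kernel of \<open>(A - \<zeta>)\<^sup>k\<close> on its natural domain.\<close>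

primrec gen_ker ::
  "'v::complex_vector set \<Rightarrow> ('v \<Rightarrow> real) \<Rightarrow> 'v set \<Rightarrow> ('v \<Rightarrow> 'v) \<Rightarrow> complex \<Rightarrow> nat \<Rightarrow> 'v set"
  where
    "gen_ker V nm D A \<zeta> 0 = {u \<in> V. nm u = 0}"
  | "gen_ker V nm D A \<zeta> (Suc k) = {u \<in> D. A u - \<zeta> *\<^sub>C u \<in> gen_ker V nm D A \<zeta> k}"

text \<open>Simple means that the algebraic multiplicity (hence also the geometric one) is 1.\<close>

definition simple_eigenvalue ::
  "'v::complex_vector set \<Rightarrow> ('v \<Rightarrow> real) \<Rightarrow> 'v set \<Rightarrow> ('v \<Rightarrow> 'v) \<Rightarrow> complex \<Rightarrow> bool"
  where "simple_eigenvalue V nm D A \<zeta> \<longleftrightarrow>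
    (\<exists>u. eigenvector nm D A \<zeta> u \<and>
      (\<forall>k. \<forall>v\<in>gen_ker V nm D A \<zeta> k. \<exists>a. nm (v - a *\<^sub>C u) = 0))"

definition riesz_basis ::
  "'v::complex_vector set \<Rightarrow> ('v \<Rightarrow> real) \<Rightarrow> 'i set \<Rightarrow> ('i \<Rightarrow> 'v) \<Rightarrow> bool"
  where "riesz_basis V nm I \<phi> \<longleftrightarrow>
    \<phi> ` I \<subseteq> V \<and>
    (\<forall>v\<in>V. \<forall>\<epsilon>>0. \<exists>w\<in>cspan (\<phi> ` I). nm (v - w) < \<epsilon>) \<and>
    (\<exists>m M. 0 < m \<and> 0 < M \<and>
      (\<forall>F a. finite F \<and> F \<subseteq> I \<longrightarrow>
        m * (\<Sum>i\<in>F. (cmod (a i))\<^sup>2) \<le> (nm (\<Sum>i\<in>F. a i *\<^sub>C \<phi> i))\<^sup>2 \<and>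
        (nm (\<Sum>i\<in>F. a i *\<^sub>C \<phi> i))\<^sup>2 \<le> M * (\<Sum>i\<in>F. (cmod (a i))\<^sup>2)))"

definition totally_disconnected :: "'a::topological_space set \<Rightarrow> bool"
  where "totally_disconnected S \<longleftrightarrow> (\<forall>T. T \<subseteq> S \<and> connected T \<longrightarrow> (\<exists>x. T \<subseteq> {x}))"

definition riesz_spectral_operator ::
  "'v::complex_vector set \<Rightarrow> ('v \<Rightarrow> real) \<Rightarrow> 'v set \<Rightarrow> ('v \<Rightarrow> 'v) \<Rightarrow> bool"
  where "riesz_spectral_operator V nm D A \<longleftrightarrow>
    closed_operator V nm D A \<and>
    (\<forall>\<zeta>\<in>eigenvalues nm D A. simple_eigenvalue V nm D A \<zeta>) \<and>
    (\<exists>(\<zeta> :: nat \<Rightarrow> complex) \<phi>.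
      range \<zeta> = eigenvalues nm D A \<and>
      (\<forall>n. eigenvector nm D A (\<zeta> n) (\<phi> n)) \<and>
      riesz_basis V nm UNIV \<phi>) \<and>
    totally_disconnected (closure (eigenvalues nm D A))"

definition C0_semigroup ::
  "'v::complex_vector set \<Rightarrow> ('v \<Rightarrow> real) \<Rightarrow> (real \<Rightarrow> 'v \<Rightarrow> 'v) \<Rightarrow> bool"
  where "C0_semigroup V nm T \<longleftrightarrow>
    (\<forall>t\<ge>0. linear_operator V nm V (T t) \<and> (\<exists>K. \<forall>u\<in>V. nm (T t u) \<le> K * nm u)) \<and>
    (\<forall>u\<in>V. nm (T 0 u - u) = 0) \<and>
    (\<forall>s\<ge>0. \<forall>t\<ge>0. \<forall>u\<in>V. nm (T (s + t) u - T s (T t u)) = 0) \<and>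
    (\<forall>u\<in>V. ((\<lambda>t. nm (T t u - u)) \<longlongrightarrow> 0) (at_right 0))"

definition generator_of ::
  "'v::complex_vector set \<Rightarrow> ('v \<Rightarrow> real) \<Rightarrow> 'v set \<Rightarrow> ('v \<Rightarrow> 'v) \<Rightarrow> (real \<Rightarrow> 'v \<Rightarrow> 'v) \<Rightarrow> bool"
  where "generator_of V nm D A T \<longleftrightarrow>
    D = {u\<in>V. \<exists>w\<in>V. ((\<lambda>t. nm (complex_of_real (1 / t) *\<^sub>C (T t u - u) - w)) \<longlongrightarrow> 0) (at_right 0)} \<and>
    (\<forall>u\<in>D. A u \<in> V \<and>
      ((\<lambda>t. nm (complex_of_real (1 / t) *\<^sub>C (T t u - u) - A u)) \<longlongrightarrow> 0) (at_right 0))"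

definition generates_C0_semigroup ::
  "'v::complex_vector set \<Rightarrow> ('v \<Rightarrow> real) \<Rightarrow> 'v set \<Rightarrow> ('v \<Rightarrow> 'v) \<Rightarrow> bool"
  where "generates_C0_semigroup V nm D A \<longleftrightarrow>
    (\<exists>T. C0_semigroup V nm T \<and> generator_of V nm D A T)"

abbreviation leb :: "real \<Rightarrow> real measure"
  where "leb L \<equiv> lebesgue_on {0<..<L}"

definition Linf_real :: "real \<Rightarrow> (real \<Rightarrow> real) set"
  where "Linf_real L = {b. b \<in> borel_measurable (leb L) \<and> (\<exists>B. AE x in leb L. \<bar>b x\<bar> \<le> B)}"

definition L2 :: "real \<Rightarrow> (real \<Rightarrow> complex) set"
  where "L2 L = {f. f \<in> borel_measurable (leb L) \<and> integrable (leb L) (\<lambda>x. (cmod (f x))\<^sup>2)}"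

text \<open>
  Weak derivatives are tested against continuously differentiable functions with compact
  support in \<open>(0,L)\<close>.
\<close>

definition weak_deriv :: "real \<Rightarrow> (real \<Rightarrow> complex) \<Rightarrow> (real \<Rightarrow> complex) \<Rightarrow> bool"
  where "weak_deriv L f f' \<longleftrightarrow>
    (\<forall>\<psi> \<psi>' :: real \<Rightarrow> real.
      (\<forall>x. (\<psi> has_real_derivative \<psi>' x) (at x)) \<and> continuous_on UNIV \<psi>' \<and>
      (\<exists>a b. 0 < a \<and> b < L \<and> (\<forall>x. x \<notin> {a..b} \<longrightarrow> \<psi> x = 0)) \<longrightarrow>
      (LINT x|leb L. f x * complex_of_real (\<psi>' x)) = - (LINT x|leb L. f' x * complex_of_real (\<psi> x)))"

definition H1 :: "real \<Rightarrow> (real \<Rightarrow> complex) set"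
  where "H1 L = {f \<in> L2 L. \<exists>f'\<in>L2 L. weak_deriv L f f'}"

text \<open>For \<open>f\<close> in \<open>H1 L\<close> the weak derivative is unique up to null sets; we pick one.\<close>

definition wderiv :: "real \<Rightarrow> (real \<Rightarrow> complex) \<Rightarrow> real \<Rightarrow> complex"
  where "wderiv L f = (SOME f'. f' \<in> L2 L \<and> weak_deriv L f f')"

definition H2 :: "real \<Rightarrow> (real \<Rightarrow> complex) set"
  where "H2 L = {f \<in> H1 L. wderiv L f \<in> H1 L}"

text \<open>
  The value at \<open>x\<close> in \<open>[0,L]\<close> of a function in \<open>H1 L\<close>, i.e.\ that of its continuous
  representative on \<open>[0,L]\<close>.
\<close>

definition pt_value :: "real \<Rightarrow> (real \<Rightarrow> complex) \<Rightarrow> real \<Rightarrow> complex"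
  where "pt_value L f x =
    (THE y. \<exists>F. continuous_on {0..L} F \<and> (AE t in leb L. F t = f t) \<and> F x = y)"

definition H1_left :: "real \<Rightarrow> (real \<Rightarrow> complex) set"
  where "H1_left L = {g \<in> H1 L. pt_value L g 0 = 0}"

type_synonym state = "(real \<Rightarrow> complex) \<times> (real \<Rightarrow> complex) \<times> (real \<Rightarrow> complex)"

definition H0 :: "real \<Rightarrow> state set"
  where "H0 L = L2 L \<times> H1_left L \<times> L2 L"

definition H0_inner :: "real \<Rightarrow> state \<Rightarrow> state \<Rightarrow> complex"
  where "H0_inner L = (\<lambda>(f\<^sub>1, g\<^sub>1, h\<^sub>1) (f\<^sub>2, g\<^sub>2, h\<^sub>2).
    LINT x|leb L. f\<^sub>1 x * cnj (f\<^sub>2 x) + wderiv L g\<^sub>1 x * cnj (wderiv L g\<^sub>2 x) + h\<^sub>1 x * cnj (h\<^sub>2 x))"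

definition H0_norm :: "real \<Rightarrow> state \<Rightarrow> real"
  where "H0_norm L u = sqrt (Re (H0_inner L u u))"

definition A_dom :: "real \<Rightarrow> real \<Rightarrow> state set"
  where "A_dom L \<alpha> = {(f, g, h). f \<in> H2 L \<and> g \<in> H2 L \<and> h \<in> H1 L \<and>
    pt_value L f 0 = 0 \<and> pt_value L f L = 0 \<and> pt_value L g 0 = 0 \<and> pt_value L h 0 = 0 \<and>
    pt_value L (wderiv L g) L + complex_of_real \<alpha> * pt_value L h L = 0}"

definition A_op :: "real \<Rightarrow> real \<Rightarrow> (real \<Rightarrow> real) \<Rightarrow> state \<Rightarrow> state"
  where "A_op L c \<beta> = (\<lambda>(f, g, h).
    (\<lambda>x. wderiv L (wderiv L f) x + complex_of_real c * f x + complex_of_real (\<beta> x) * g x,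
     h,
     wderiv L (wderiv L g)))"

definition mu :: "real \<Rightarrow> real \<Rightarrow> real"
  where "mu L \<alpha> = - (1 / (2 * L)) * ln ((\<alpha> - 1) / (\<alpha> + 1))"

definition lambda2 :: "real \<Rightarrow> real \<Rightarrow> int \<Rightarrow> complex"
  where "lambda2 L \<alpha> m =
    complex_of_real (1 / (2 * L) * ln ((\<alpha> - 1) / (\<alpha> + 1))) + \<i> * complex_of_real (of_int m * pi / L)"

definition A_coef :: "real \<Rightarrow> real \<Rightarrow> int \<Rightarrow> real"
  where "A_coef L \<alpha> m =
    1 / (L * sqrt (2 * mu L \<alpha>)) *
    sqrt (((mu L \<alpha>)\<^sup>2 * L\<^sup>2 + (of_int m)\<^sup>2 * pi\<^sup>2) * sinh (2 * mu L \<alpha> * L))"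

definition phi2_snd :: "real \<Rightarrow> real \<Rightarrow> int \<Rightarrow> real \<Rightarrow> complex"
  where "phi2_snd L \<alpha> m x =
    1 / complex_of_real (A_coef L \<alpha> m) * sinh (lambda2 L \<alpha> m * complex_of_real x)"

definition phi2_thd :: "real \<Rightarrow> real \<Rightarrow> int \<Rightarrow> real \<Rightarrow> complex"
  where "phi2_thd L \<alpha> m x =
    lambda2 L \<alpha> m / complex_of_real (A_coef L \<alpha> m) * sinh (lambda2 L \<alpha> m * complex_of_real x)"

text \<open>The boundary value problem has a unique solution as an element of \<open>L\<^sup>2\<close>, hence \<open>SOME\<close>.\<close>

definition phi2_fst :: "real \<Rightarrow> real \<Rightarrow> (real \<Rightarrow> real) \<Rightarrow> real \<Rightarrow> int \<Rightarrow> real \<Rightarrow> complex"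
  where "phi2_fst L c \<beta> \<alpha> m = (SOME f. f \<in> H2 L \<and>
    (AE x in leb L. wderiv L (wderiv L f) x + (complex_of_real c - lambda2 L \<alpha> m) * f x =
       - complex_of_real (\<beta> x) * phi2_snd L \<alpha> m x) \<and>
    pt_value L f 0 = 0 \<and> pt_value L f L = 0)"

definition phi1 :: "real \<Rightarrow> nat \<Rightarrow> state"
  where "phi1 L n = (\<lambda>x. complex_of_real (sqrt (2 / L) * sin (of_nat n * pi / L * x)), 0, 0)"

definition phi2 :: "real \<Rightarrow> real \<Rightarrow> (real \<Rightarrow> real) \<Rightarrow> real \<Rightarrow> int \<Rightarrow> state"
  where "phi2 L c \<beta> \<alpha> m = (phi2_fst L c \<beta> \<alpha> m, phi2_snd L \<alpha> m, phi2_thd L \<alpha> m)"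

text \<open>The family of all eigenvectors, indexed by the disjoint union of \<open>{1..}\<close> and the integers.\<close>

definition Phi_index :: "(nat + int) set"
  where "Phi_index = {1..} <+> UNIV"

definition Phi :: "real \<Rightarrow> real \<Rightarrow> (real \<Rightarrow> real) \<Rightarrow> real \<Rightarrow> nat + int \<Rightarrow> state"
  where "Phi L c \<beta> \<alpha> = case_sum (phi1 L) (phi2 L c \<beta> \<alpha>)"

end

theory Submission
  imports Defs
begin

text \<open>
  In the unknowns \<open>cosh (\<mu> x) g' + sinh (\<mu> x) h\<close> and \<open>sinh (\<mu> x) g' + cosh (\<mu> x) h\<close> the wave
  components of the \<open>phi2\<close> become, up to factors of constant modulus, the orthogonal system
  \<open>(cos (m \<pi> x / L), \<i> sin (m \<pi> x / L))\<close>; this gives a Riesz basis of the wave part. The heat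
  components are \<open>phi2_fst = (\<Delta> - (\<lambda> - c))\<^sup>-\<^sup>1 (- \<beta> phi2_snd)\<close> with \<open>\<Delta>\<close> the Dirichlet Laplacian. Since
  \<open>phi2_snd\<close> has norm \<open>O(1/|m|)\<close> and the distance of \<open>\<lambda> - c\<close> to the spectrum of \<open>\<Delta>\<close> is bounded below by
  the hypothesis on \<open>c\<close>, their norms are square summable, and the whole family, which is triangular
  with respect to the heat and wave parts, is a Riesz basis.

  A closed operator that has a Riesz basis of eigenvectors and is injective after subtraction of some
  \<open>\<zeta>\<^sub>0\<close> at positive distance from the eigenvalues is the diagonal operator in that basis. This yields
  the spectrum, the simplicity of the eigenvalues and the semigroup, and also, applied to \<open>\<Delta>\<close> and the
  sine basis, the resolvent estimate for \<open>\<Delta>\<close> used above.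
\<close>

section \<open>Riesz bases and diagonal operators\<close>

text \<open>The unknowns \<open>E\<close> and \<open>O\<close> of the wave part are weighted Riemann
  invariants: their sum is exp (\<mu> x) (g' + h), their difference exp (- \<mu> x) (g' - h). The
  condition at \<open>L\<close> reflects one invariant into the other with the factor (\<alpha> - 1)
  / (\<alpha> + 1) = exp (- 2 \<mu> L) in modulus, and the weights spread this loss evenly over the
  interval. A pair (\<open>E\<close>, \<open>O\<close>) on (0, L) stands for the even and odd parts
  of a function on (-L, L), whence the frequencies m \<pi> / L with m any integer.

  The hypothesis on \<open>c\<close> keeps - \<mu>, the only real eigenvalue of the wave part, apart
  from every c - n^2 \<pi>^2 / L^2. This serves twice: to solve the boundary value problem for
  \<open>phi2_fst\<close> and to keep the eigenvalues simple.

  Vectors are functions identified up to null sets, and \<open>wderiv\<close>,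
  \<open>pt_value\<close> and \<open>phi2_fst\<close> are arbitrary choices. The analysis is
  therefore done on relations between functions and primitives of L2 functions, whose boundary
  values are plain values; the operators are recovered from these relations.\<close>

lemma norm_add_sq_le: "(norm (x + y))\<^sup>2 \<le> 2 * (norm x)\<^sup>2 + 2 * (norm (y::'a::real_normed_vector))\<^sup>2"
proof -
  have "(norm (x + y))\<^sup>2 \<le> (norm x + norm y)\<^sup>2"
    by (intro power_mono norm_triangle_ineq) auto
  also have "\<dots> \<le> 2 * (norm x)\<^sup>2 + 2 * (norm y)\<^sup>2"
    using sum_squares_ge_zero[of "norm x - norm y" 0] by (simp add: power2_eq_square algebra_simps)
  finally show ?thesis .
qed

lemma summable_norm_sq_add:
  fixes a b :: "nat \<Rightarrow> 'a::real_normed_vector"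
  assumes "summable (\<lambda>i. (norm (a i))\<^sup>2)" "summable (\<lambda>i. (norm (b i))\<^sup>2)"
  shows "summable (\<lambda>i. (norm (a i + b i))\<^sup>2)"
proof (rule summable_comparison_test')
  show "summable (\<lambda>i. 2 * (norm (a i))\<^sup>2 + 2 * (norm (b i))\<^sup>2)"
    using assms by (intro summable_add summable_mult)
  show "norm ((norm (a i + b i))\<^sup>2) \<le> 2 * (norm (a i))\<^sup>2 + 2 * (norm (b i))\<^sup>2" if "i \<ge> 0" for i
    using norm_add_sq_le[of "a i" "b i"] by simp
qed

lemma summable_norm_sq_mult:
  fixes a b :: "nat \<Rightarrow> complex"
  assumes "summable (\<lambda>i. (norm (a i))\<^sup>2)" "\<And>i. norm (b i) \<le> K"
  shows "summable (\<lambda>i. (norm (b i * a i))\<^sup>2)"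
proof (rule summable_comparison_test')
  show "summable (\<lambda>i. K\<^sup>2 * (norm (a i))\<^sup>2)"
    using assms by (intro summable_mult)
  show "norm ((norm (b i * a i))\<^sup>2) \<le> K\<^sup>2 * (norm (a i))\<^sup>2" if "i \<ge> 0" for i
    using power_mono[OF assms(2)[of i] norm_ge_zero, of 2]
    by (simp add: norm_mult power_mult_distrib mult_right_mono)
qed

section \<open>Seminormed spaces whose null vectors are not divided out\<close>

locale seminormed_space =
  fixes V :: "'v::complex_vector set" and nm :: "'v \<Rightarrow> real"
  assumes subspace: "csubspace V"
    and nm_add: "u \<in> V \<Longrightarrow> v \<in> V \<Longrightarrow> nm (u + v) \<le> nm u + nm v"
    and nm_scale: "u \<in> V \<Longrightarrow> nm (a *\<^sub>C u) = cmod a * nm u"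
begin

lemma zero_mem [simp]: "0 \<in> V"
  and add_mem [simp]: "u \<in> V \<Longrightarrow> v \<in> V \<Longrightarrow> u + v \<in> V"
  and diff_mem [simp]: "u \<in> V \<Longrightarrow> v \<in> V \<Longrightarrow> u - v \<in> V"
  and scale_mem [simp]: "u \<in> V \<Longrightarrow> a *\<^sub>C u \<in> V"
  using subspace
  by (auto simp: complex_vector.subspace_0 complex_vector.subspace_add
      complex_vector.subspace_diff complex_vector.subspace_scale)

lemma sum_mem: "(\<And>i. i \<in> F \<Longrightarrow> f i \<in> V) \<Longrightarrow> sum f F \<in> V"
  using subspace by (rule complex_vector.subspace_sum)

lemma nm_zero [simp]: "nm 0 = 0"
  using nm_scale[of 0 0] by simp

lemma nm_minus: "u \<in> V \<Longrightarrow> nm (- u) = nm u"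
  using nm_scale[of u "-1"] complex_vector.scale_minus_left[of 1 u]
  by (simp add: scaleC_one)

lemma nm_diff_commute: "u \<in> V \<Longrightarrow> v \<in> V \<Longrightarrow> nm (u - v) = nm (v - u)"
  using nm_minus[of "u - v"] by simp

lemma nm_nonneg: "u \<in> V \<Longrightarrow> 0 \<le> nm u"
  using nm_add[of u "- u"] nm_minus[of u] diff_mem[of 0 u] by simp

lemma nm_triangle: "u \<in> V \<Longrightarrow> v \<in> V \<Longrightarrow> w \<in> V \<Longrightarrow> nm (u - w) \<le> nm (u - v) + nm (v - w)"
  using nm_add[of "u - v" "v - w"] by simp

lemma nm_abs_diff: "u \<in> V \<Longrightarrow> v \<in> V \<Longrightarrow> \<bar>nm u - nm v\<bar> \<le> nm (u - v)"
  using nm_add[of "u - v" v] nm_add[of "v - u" u] nm_diff_commute[of u v] by simp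

lemma nm_null_cong: "u \<in> V \<Longrightarrow> v \<in> V \<Longrightarrow> nm (u - v) = 0 \<Longrightarrow> nm u = nm v"
  using nm_abs_diff[of u v] by simp

text \<open>Together with \<open>nm_null_add\<close> this replaces equational reasoning in the
  quotient by the null vectors.\<close>

lemma nm_null_trans:
  "u \<in> V \<Longrightarrow> v \<in> V \<Longrightarrow> w \<in> V \<Longrightarrow> nm (u - v) = 0 \<Longrightarrow> nm (v - w) = 0 \<Longrightarrow> nm (u - w) = 0"
  using nm_triangle[of u v w] nm_nonneg[of "u - w"] by simp

lemma nm_null_add:
  "u \<in> V \<Longrightarrow> v \<in> V \<Longrightarrow> u' \<in> V \<Longrightarrow> v' \<in> V \<Longrightarrow> nm (u - u') = 0 \<Longrightarrow> nm (v - v') = 0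
    \<Longrightarrow> nm ((u + v) - (u' + v')) = 0"
  using nm_add[of "u - u'" "v - v'"] nm_nonneg[of "(u - u') + (v - v')"]
  by (simp add: algebra_simps)

lemma nm_tendsto_zero_le:
  assumes "\<And>n. x n \<in> V" "\<And>n. nm (x n) \<le> f n" "(f \<longlongrightarrow> 0) F"
  shows "((\<lambda>n. nm (x n)) \<longlongrightarrow> 0) F"
  by (rule tendsto_sandwich[OF _ _ tendsto_const assms(3)])
    (use assms nm_nonneg in \<open>auto intro!: always_eventually\<close>)

lemma nm_tendsto:
  assumes "\<And>n. x n \<in> V" "u \<in> V" "((\<lambda>n. nm (x n - u)) \<longlongrightarrow> 0) F"
  shows "((\<lambda>n. nm (x n)) \<longlongrightarrow> nm u) F"
proof -
  have "((\<lambda>n. nm (x n) - nm u) \<longlongrightarrow> 0) F"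
    by (rule tendsto_rabs_zero_cancel, rule tendsto_sandwich[OF _ _ tendsto_const assms(3)])
      (auto intro!: always_eventually nm_abs_diff assms)
  then show ?thesis by (simp add: LIM_zero_iff)
qed

end

locale complete_seminormed_space = seminormed_space +
  assumes complete: "(\<And>n::nat. x n \<in> V) \<Longrightarrow>
    (\<And>e::real. e > 0 \<Longrightarrow> \<exists>N. \<forall>m\<ge>N. \<forall>n\<ge>N. nm (x m - x n) < e) \<Longrightarrow>
    \<exists>u\<in>V. (\<lambda>n. nm (x n - u)) \<longlonglongrightarrow> 0"

section \<open>Expansions in a Riesz basis\<close>

locale riesz_sequence_space = complete_seminormed_space V nm
  for V :: "'a::complex_vector set" and nm +
  fixes \<phi> :: "nat \<Rightarrow> 'a" and m M :: real
  assumes phi_mem [simp]: "\<phi> i \<in> V"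
    and phi_dense: "v \<in> V \<Longrightarrow> \<epsilon> > 0 \<Longrightarrow> \<exists>w\<in>cspan (range \<phi>). nm (v - w) < \<epsilon>"
    and m_pos: "0 < m" and M_pos: "0 < M"
    and riesz_lower: "finite F \<Longrightarrow> m * (\<Sum>i\<in>F. (cmod (a i))\<^sup>2) \<le> (nm (\<Sum>i\<in>F. a i *\<^sub>C \<phi> i))\<^sup>2"
    and riesz_upper: "finite F \<Longrightarrow> (nm (\<Sum>i\<in>F. a i *\<^sub>C \<phi> i))\<^sup>2 \<le> M * (\<Sum>i\<in>F. (cmod (a i))\<^sup>2)"
begin

definition psum :: "(nat \<Rightarrow> complex) \<Rightarrow> nat \<Rightarrow> 'a"
  where "psum a n = (\<Sum>i<n. a i *\<^sub>C \<phi> i)"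

text \<open>A relation instead of a coefficient functional: it respects the identification of
  vectors up to null vectors, and its linearity can be proved before existence and uniqueness of the
  coefficients are known.\<close>

definition has_coeffs :: "(nat \<Rightarrow> complex) \<Rightarrow> 'a \<Rightarrow> bool"
  where "has_coeffs a u \<longleftrightarrow> u \<in> V \<and> summable (\<lambda>i. (cmod (a i))\<^sup>2) \<and> (\<lambda>n. nm (psum a n - u)) \<longlonglongrightarrow> 0"

lemma psum_mem [simp]: "psum a n \<in> V"
  unfolding psum_def by (intro sum_mem) simp

lemma psum_Suc: "psum a (Suc n) = psum a n + a n *\<^sub>C \<phi> n"
  by (simp add: psum_def)

lemma psum_add: "psum (\<lambda>i. a i + b i) n = psum a n + psum b n"
  by (simp add: psum_def scaleC_add_left sum.distrib)

lemma psum_scale: "psum (\<lambda>i. c * a i) n = c *\<^sub>C psum a n"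
  by (simp add: psum_def scaleC_scaleC complex_vector.scale_sum_right)

lemma has_coeffsD:
  assumes "has_coeffs a u"
  shows "u \<in> V" "summable (\<lambda>i. (cmod (a i))\<^sup>2)" "(\<lambda>n. nm (psum a n - u)) \<longlonglongrightarrow> 0"
  using assms unfolding has_coeffs_def by auto

lemma has_coeffs_add:
  assumes "has_coeffs a u" "has_coeffs b v"
  shows "has_coeffs (\<lambda>i. a i + b i) (u + v)"
  unfolding has_coeffs_def
proof (intro conjI)
  note a = has_coeffsD[OF assms(1)] and b = has_coeffsD[OF assms(2)]
  show "u + v \<in> V" using a b by simp
  show "summable (\<lambda>i. (cmod (a i + b i))\<^sup>2)" using a b by (intro summable_norm_sq_add)
  have le: "nm (psum (\<lambda>i. a i + b i) n - (u + v)) \<le> nm (psum a n - u) + nm (psum b n - v)" for n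
    using nm_add[of "psum a n - u" "psum b n - v"] a b by (simp add: psum_add algebra_simps)
  show "(\<lambda>n. nm (psum (\<lambda>i. a i + b i) n - (u + v))) \<longlonglongrightarrow> 0"
    by (rule nm_tendsto_zero_le[OF _ le tendsto_add_zero]) (use a b in auto)
qed

lemma has_coeffs_scale:
  assumes "has_coeffs a u"
  shows "has_coeffs (\<lambda>i. c * a i) (c *\<^sub>C u)"
  unfolding has_coeffs_def
proof (intro conjI)
  note a = has_coeffsD[OF assms(1)]
  show "c *\<^sub>C u \<in> V" using a by simp
  show "summable (\<lambda>i. (cmod (c * a i))\<^sup>2)" using a by (intro summable_norm_sq_mult) auto
  have "nm (psum (\<lambda>i. c * a i) n - c *\<^sub>C u) = cmod c * nm (psum a n - u)" for n
    using nm_scale[of "psum a n - u" c] a by (simp add: psum_scale complex_vector.scale_right_diff_distrib)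
  then show "(\<lambda>n. nm (psum (\<lambda>i. c * a i) n - c *\<^sub>C u)) \<longlonglongrightarrow> 0"
    using a by (auto intro!: tendsto_mult_right_zero)
qed

lemma has_coeffs_diff:
  assumes "has_coeffs a u" "has_coeffs b v"
  shows "has_coeffs (\<lambda>i. a i - b i) (u - v)"
  using has_coeffs_add[OF assms(1) has_coeffs_scale[OF assms(2), of "-1"]]
  by (simp add: scaleC_one)

lemma has_coeffs_null:
  assumes "has_coeffs a u" "v \<in> V" "nm (u - v) = 0"
  shows "has_coeffs a v"
  unfolding has_coeffs_def
proof (intro conjI)
  note a = has_coeffsD[OF assms(1)]
  show "v \<in> V" "summable (\<lambda>i. (cmod (a i))\<^sup>2)" using a assms by auto
  have "nm (psum a n - v) \<le> nm (psum a n - u)" for n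
    using nm_triangle[of "psum a n" u v] a assms by simp
  then show "(\<lambda>n. nm (psum a n - v)) \<longlonglongrightarrow> 0"
    by (rule nm_tendsto_zero_le[OF _ _ a(3), rotated]) (use assms in auto)
qed

lemma has_coeffs_nm_bounds:
  assumes "has_coeffs a u"
  shows "m * (\<Sum>i. (cmod (a i))\<^sup>2) \<le> (nm u)\<^sup>2" "(nm u)\<^sup>2 \<le> M * (\<Sum>i. (cmod (a i))\<^sup>2)"
proof -
  note a = has_coeffsD[OF assms(1)]
  have lim: "(\<lambda>n. (nm (psum a n))\<^sup>2) \<longlonglongrightarrow> (nm u)\<^sup>2"
    by (intro tendsto_power nm_tendsto a) simp
  have lim2: "(\<lambda>n. k * (\<Sum>i<n. (cmod (a i))\<^sup>2)) \<longlonglongrightarrow> k * (\<Sum>i. (cmod (a i))\<^sup>2)" for k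
    by (intro tendsto_mult tendsto_const summable_LIMSEQ a)
  show "m * (\<Sum>i. (cmod (a i))\<^sup>2) \<le> (nm u)\<^sup>2"
    by (rule LIMSEQ_le[OF lim2 lim]) (simp add: psum_def riesz_lower)
  show "(nm u)\<^sup>2 \<le> M * (\<Sum>i. (cmod (a i))\<^sup>2)"
    by (rule LIMSEQ_le[OF lim lim2]) (simp add: psum_def riesz_upper)
qed

lemma has_coeffs_partial_sum_le:
  assumes "has_coeffs a u" "finite F"
  shows "m * (\<Sum>i\<in>F. (cmod (a i))\<^sup>2) \<le> (nm u)\<^sup>2"
proof -
  have "(\<Sum>i\<in>F. (cmod (a i))\<^sup>2) \<le> (\<Sum>i. (cmod (a i))\<^sup>2)"
    using has_coeffsD[OF assms(1)] assms(2) by (intro sum_le_suminf) auto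
  then show ?thesis
    using has_coeffs_nm_bounds(1)[OF assms(1)] m_pos
    by (meson mult_left_mono order_trans less_imp_le)
qed

text \<open>Continuity of the coordinate functionals, from the lower Riesz bound for a single index.
  Uniqueness of the coefficients and the coordinatewise limits in \<open>analysis\<close> and
  \<open>semigroup_generator\<close> depend on it.\<close>

lemma has_coeffs_coeff_le:
  assumes "has_coeffs a u"
  shows "cmod (a i) \<le> nm u / sqrt m"
proof -
  have "m * (cmod (a i))\<^sup>2 \<le> (nm u)\<^sup>2"
    using has_coeffs_partial_sum_le[OF assms, of "{i}"] by simp
  then have "(cmod (a i))\<^sup>2 \<le> (nm u / sqrt m)\<^sup>2"
    using m_pos by (simp add: power_divide field_simps)
  then show ?thesis
    by (rule power2_le_imp_le) (use m_pos nm_nonneg has_coeffsD(1)[OF assms] in auto)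
qed

lemma has_coeffs_unique:
  assumes "has_coeffs a u" "has_coeffs b v" "nm (u - v) = 0"
  shows "a = b"
proof
  fix i show "a i = b i"
    using has_coeffs_coeff_le[OF has_coeffs_diff[OF assms(1,2)], of i] assms(3) by simp
qed

lemma has_coeffs_same:
  assumes "has_coeffs a u" "has_coeffs a v"
  shows "nm (u - v) = 0"
proof -
  have "(nm (u - v))\<^sup>2 \<le> M * (\<Sum>i. (cmod (a i - a i))\<^sup>2)"
    by (rule has_coeffs_nm_bounds(2)[OF has_coeffs_diff[OF assms]])
  then show ?thesis by simp
qed

lemma has_coeffs_basis: "has_coeffs (\<lambda>i. if i = j then 1 else 0) (\<phi> j)"
  unfolding has_coeffs_def
proof (intro conjI)
  let ?a = "\<lambda>i. if i = j then (1::complex) else 0"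
  show "summable (\<lambda>i. (cmod (?a i))\<^sup>2)"
    by (rule summable_finite[of "{j}"]) auto
  have "psum ?a n = \<phi> j" if "n > j" for n
  proof -
    have "psum ?a n = (\<Sum>i<n. if i = j then \<phi> j else 0)"
      unfolding psum_def by (intro sum.cong) (auto simp: scaleC_one)
    then show ?thesis using that by simp
  qed
  then show "(\<lambda>n. nm (psum ?a n - \<phi> j)) \<longlonglongrightarrow> 0"
    by (intro tendsto_eventually eventually_sequentiallyI[of "Suc j"]) auto
qed simp

lemma has_coeffs_zero: "has_coeffs (\<lambda>_. 0) 0"
  using has_coeffs_scale[OF has_coeffs_basis[of 0], of 0] by simp

text \<open>The upper Riesz bound turns tails of the square sum into tails of the vector series, so
  the partial sums are Cauchy and completeness applies.\<close>

lemma synthesis: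
  assumes "summable (\<lambda>i. (cmod (a i))\<^sup>2)"
  shows "\<exists>u. has_coeffs a u"
proof -
  have "\<exists>N. \<forall>p\<ge>N. \<forall>q\<ge>N. nm (psum a p - psum a q) < e" if "e > 0" for e :: real
  proof -
    from assms have "\<exists>N. \<forall>p\<ge>N. \<forall>q. norm (\<Sum>i\<in>{p..<q}. (cmod (a i))\<^sup>2) < e\<^sup>2 / M"
      using that M_pos by (simp add: summable_Cauchy)
    then obtain N where N: "\<And>p q. p \<ge> N \<Longrightarrow> norm (\<Sum>i\<in>{p..<q}. (cmod (a i))\<^sup>2) < e\<^sup>2 / M"
      by blast
    have *: "nm (psum a q - psum a p) < e" if "p \<ge> N" "p \<le> q" for p q
    proof -
      have "psum a q - psum a p = (\<Sum>i\<in>{p..<q}. a i *\<^sub>C \<phi> i)"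
        using that(2) sum_diff_nat_ivl[of 0 p q "\<lambda>i. a i *\<^sub>C \<phi> i"]
        by (simp add: psum_def atLeast0LessThan)
      then have "(nm (psum a q - psum a p))\<^sup>2 \<le> M * (\<Sum>i\<in>{p..<q}. (cmod (a i))\<^sup>2)"
        using riesz_upper[of "{p..<q}" a] by simp
      also have "\<dots> < e\<^sup>2"
        using N[OF that(1), of q] M_pos by (simp add: field_simps sum_nonneg)
      finally show ?thesis using \<open>e > 0\<close> by (simp add: power_less_imp_less_base)
    qed
    have "nm (psum a p - psum a q) < e" if "p \<ge> N" "q \<ge> N" for p q
      using *[of p q] *[of q p] that nm_diff_commute[of "psum a p" "psum a q"]
      by (cases "p \<le> q") auto
    then show ?thesis by blast
  qed
  then obtain u where "u \<in> V" "(\<lambda>n. nm (psum a n - u)) \<longlonglongrightarrow> 0"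
    using complete[of "psum a"] by auto
  then show ?thesis using assms unfolding has_coeffs_def by auto
qed

text \<open>Vectors of the span have finite expansions. Along a sequence from the span that tends to
  \<open>u\<close>, the lower Riesz bound makes the coefficients Cauchy among the square summable
  sequences, and the upper bound carries their limit back to \<open>u\<close>.\<close>

lemma analysis:
  assumes "u \<in> V"
  shows "\<exists>a. has_coeffs a u"
proof -
  let ?W = "{w. \<exists>b. has_coeffs b w}"
  have "csubspace ?W"
  proof (rule complex_vector.subspaceI)
    show "0 \<in> ?W" using has_coeffs_zero by blast
    show "x + y \<in> ?W" if "x \<in> ?W" "y \<in> ?W" for x y
      using that has_coeffs_add by blast
    show "c *\<^sub>C x \<in> ?W" if "x \<in> ?W" for c x
      using that has_coeffs_scale by blast
  qed
  moreover have "range \<phi> \<subseteq> ?W" using has_coeffs_basis by blast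
  ultimately have W: "cspan (range \<phi>) \<subseteq> ?W"
    by (intro complex_vector.span_minimal)
  have "\<exists>w b. has_coeffs b w \<and> nm (u - w) < 1 / real (Suc k)" for k
    using phi_dense[OF assms, of "1 / real (Suc k)"] W by fastforce
  then obtain w b where b: "\<And>k. has_coeffs (b k) (w k)" and w: "\<And>k. nm (u - w k) < 1 / real (Suc k)"
    by metis
  have wV: "w k \<in> V" for k using b has_coeffsD by blast
  have ww: "nm (w k - w l) \<le> 1 / real (Suc k) + 1 / real (Suc l)" for k l
    using nm_triangle[of "w k" u "w l"] nm_diff_commute[of u "w k"] w[of k] w[of l] wV assms by auto
  have est: "m * (\<Sum>i\<in>F. (cmod (b k i - b l i))\<^sup>2) \<le> (1 / real (Suc k) + 1 / real (Suc l))\<^sup>2"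
    if "finite F" for F k l
  proof -
    have "m * (\<Sum>i\<in>F. (cmod (b k i - b l i))\<^sup>2) \<le> (nm (w k - w l))\<^sup>2"
      using has_coeffs_partial_sum_le[OF has_coeffs_diff[OF b[of k] b[of l]] that] .
    also have "\<dots> \<le> (1 / real (Suc k) + 1 / real (Suc l))\<^sup>2"
      using wV by (intro power_mono ww nm_nonneg) auto
    finally show ?thesis .
  qed
  have inv0: "(\<lambda>l. 1 / real (Suc l)) \<longlonglongrightarrow> 0"
    using LIMSEQ_inverse_real_of_nat by (simp add: inverse_eq_divide)
  have "\<exists>\<beta>. (\<lambda>k. b k i) \<longlonglongrightarrow> \<beta>" for i
  proof -
    have "Cauchy (\<lambda>k. b k i)"
    proof (rule CauchyI)
      fix e :: real assume "e > 0"
      have "(\<lambda>l. 2 / sqrt m * (1 / real (Suc l))) \<longlonglongrightarrow> 0"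
        using tendsto_mult_right_zero[OF inv0] .
      from order_tendstoD(2)[OF this \<open>e > 0\<close>] obtain N
        where N: "\<And>l. l \<ge> N \<Longrightarrow> 2 / sqrt m * (1 / real (Suc l)) < e"
        unfolding eventually_sequentially by blast
      have "norm (b k i - b l i) < e" if "k \<ge> N" "l \<ge> N" for k l
      proof -
        have "1 / real (Suc k) + 1 / real (Suc l) \<le> 2 / real (Suc N)"
          using that frac_le[of 1 1 "real (Suc N)" "real (Suc k)"]
            frac_le[of 1 1 "real (Suc N)" "real (Suc l)"] by simp
        then have "nm (w k - w l) / sqrt m \<le> (2 / real (Suc N)) / sqrt m"
          using ww[of k l] m_pos by (intro divide_right_mono) auto
        also have "\<dots> < e" using N[of N] by (simp add: mult.commute)
        finally have lt: "nm (w k - w l) / sqrt m < e" .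
        have "cmod (b k i - b l i) \<le> nm (w k - w l) / sqrt m"
          using has_coeffs_coeff_le[OF has_coeffs_diff[OF b[of k] b[of l]], of i] .
        then show ?thesis using lt by simp
      qed
      then show "\<exists>N. \<forall>k\<ge>N. \<forall>l\<ge>N. norm (b k i - b l i) < e" by blast
    qed
    then show ?thesis using Cauchy_convergent convergent_def by blast
  qed
  then obtain \<beta> where \<beta>: "\<And>i. (\<lambda>k. b k i) \<longlonglongrightarrow> \<beta> i" by metis
  \<comment> \<open>Only finitely many indices are kept while \<open>l\<close> tends to infinity, so
    coordinatewise convergence suffices; the resulting bound is uniform in \<open>n\<close>.\<close>
  have est2: "(\<Sum>i<n. (cmod (b k i - \<beta> i))\<^sup>2) \<le> (1 / real (Suc k))\<^sup>2 / m" for n k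
  proof -
    have "m * (\<Sum>i<n. (cmod (b k i - \<beta> i))\<^sup>2) \<le> (1 / real (Suc k) + 0)\<^sup>2"
    proof (rule LIMSEQ_le)
      show "(\<lambda>l. m * (\<Sum>i<n. (cmod (b k i - b l i))\<^sup>2)) \<longlonglongrightarrow> m * (\<Sum>i<n. (cmod (b k i - \<beta> i))\<^sup>2)"
        by (intro tendsto_intros \<beta>)
      show "(\<lambda>l. (1 / real (Suc k) + 1 / real (Suc l))\<^sup>2) \<longlonglongrightarrow> (1 / real (Suc k) + 0)\<^sup>2"
        by (intro tendsto_power tendsto_add tendsto_const inv0)
      show "\<exists>N. \<forall>l\<ge>N. m * (\<Sum>i<n. (cmod (b k i - b l i))\<^sup>2) \<le> (1 / real (Suc k) + 1 / real (Suc l))\<^sup>2"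
        using est by blast
    qed
    then show ?thesis using m_pos by (simp add: field_simps)
  qed
  have sumd: "summable (\<lambda>i. (cmod (b k i - \<beta> i))\<^sup>2)" for k
    using est2[where k = k] by (intro summableI_nonneg_bounded) auto
  \<comment> \<open>Writes \<open>\<beta>\<close> as the difference of the square summable sequences
    \<open>b 0\<close> and \<open>b 0 - \<beta>\<close>.\<close>
  have "summable (\<lambda>i. (cmod (b 0 i + - (b 0 i - \<beta> i)))\<^sup>2)"
    by (intro summable_norm_sq_add) (use sumd[of 0] has_coeffsD[OF b] in \<open>auto simp: norm_minus_commute\<close>)
  then have "summable (\<lambda>i. (cmod (\<beta> i))\<^sup>2)" by simp
  then obtain u' where u': "has_coeffs \<beta> u'" using synthesis by blast
  have u'V: "u' \<in> V" using u' has_coeffsD by blast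
  have wu': "nm (w k - u') \<le> sqrt (M / m) * (1 / real (Suc k))" for k
  proof -
    have "(nm (w k - u'))\<^sup>2 \<le> M * (\<Sum>i. (cmod (b k i - \<beta> i))\<^sup>2)"
      using has_coeffs_nm_bounds(2)[OF has_coeffs_diff[OF b[of k] u']] .
    also have "\<dots> \<le> M * ((1 / real (Suc k))\<^sup>2 / m)"
      using M_pos est2 sumd by (intro mult_left_mono suminf_le_const) auto
    also have "\<dots> = (sqrt (M / m) * (1 / real (Suc k)))\<^sup>2"
      using M_pos m_pos by (simp add: power_mult_distrib power_divide)
    finally show ?thesis
      by (rule power2_le_imp_le) (use M_pos m_pos in auto)
  qed
  have le: "nm (u - u') \<le> (1 + sqrt (M / m)) * (1 / real (Suc k))" for k
  proof -
    have "nm (u - u') \<le> 1 / real (Suc k) + sqrt (M / m) * (1 / real (Suc k))"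
      using nm_triangle[of u "w k" u'] w[of k] assms wV[of k] u'V wu'[of k] by simp
    then show ?thesis by (simp only: distrib_right mult_1)
  qed
  have "nm (u - u') \<le> (1 + sqrt (M / m)) * 0"
    by (rule LIMSEQ_le_const[OF tendsto_mult[OF tendsto_const inv0]]) (use le in blast)
  then have "nm (u' - u) = 0"
    using nm_nonneg[of "u - u'"] nm_diff_commute[of u u'] assms u'V by simp
  then show ?thesis using has_coeffs_null[OF u' assms] by blast
qed

end

section \<open>Closed operators with a Riesz basis of eigenvectors\<close>

locale diagonal_operator = riesz_sequence_space V nm \<phi> m M
  for V :: "'a::complex_vector set" and nm \<phi> m M +
  fixes D :: "'a set" and A :: "'a \<Rightarrow> 'a" and ev :: "nat \<Rightarrow> complex" and \<zeta>\<^sub>0 :: complex and \<delta> :: real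
  assumes closed: "closed_operator V nm D A"
    and phi_dom: "\<phi> i \<in> D"
    and phi_eigen: "nm (A (\<phi> i) - ev i *\<^sub>C \<phi> i) = 0"
    and delta_pos: "\<delta> > 0" and gap: "\<delta> \<le> cmod (ev i - \<zeta>\<^sub>0)"
    and inj: "u \<in> D \<Longrightarrow> nm (A u - \<zeta>\<^sub>0 *\<^sub>C u) = 0 \<Longrightarrow> nm u = 0"
begin

lemma linear: "linear_operator V nm D A"
  using closed unfolding closed_operator_def by simp

lemma dom_subspace: "csubspace D" and dom_V: "u \<in> D \<Longrightarrow> u \<in> V" and A_mem: "u \<in> D \<Longrightarrow> A u \<in> V"
  and A_add: "u \<in> D \<Longrightarrow> v \<in> D \<Longrightarrow> nm (A (u + v) - (A u + A v)) = 0"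
  and A_scale: "u \<in> D \<Longrightarrow> nm (A (a *\<^sub>C u) - a *\<^sub>C A u) = 0"
  and A_null: "u \<in> D \<Longrightarrow> v \<in> V \<Longrightarrow> nm (u - v) = 0 \<Longrightarrow> v \<in> D \<and> nm (A u - A v) = 0"
  using linear unfolding linear_operator_def by blast+

lemma A_closed:
  "(\<And>n::nat. u n \<in> D) \<Longrightarrow> x \<in> V \<Longrightarrow> y \<in> V \<Longrightarrow> (\<lambda>n. nm (u n - x)) \<longlonglongrightarrow> 0 \<Longrightarrow>
    (\<lambda>n. nm (A (u n) - y)) \<longlonglongrightarrow> 0 \<Longrightarrow> x \<in> D \<and> nm (A x - y) = 0"
  using closed unfolding closed_operator_def by blast

lemma psum_dom: "psum a n \<in> D"
  unfolding psum_def
  by (intro complex_vector.subspace_sum[OF dom_subspace]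
      complex_vector.subspace_scale[OF dom_subspace] phi_dom)

lemma A_diff: "u \<in> D \<Longrightarrow> v \<in> D \<Longrightarrow> nm (A (u - v) - (A u - A v)) = 0"
proof -
  assume uv: "u \<in> D" "v \<in> D"
  have v': "(-1) *\<^sub>C v \<in> D" using uv complex_vector.subspace_scale[OF dom_subspace] by blast
  have 1: "nm (A (u + (-1) *\<^sub>C v) - (A u + A ((-1) *\<^sub>C v))) = 0" using A_add uv v' by blast
  have 2: "nm ((A u + A ((-1) *\<^sub>C v)) - (A u + (-1) *\<^sub>C A v)) = 0"
    using A_scale[OF uv(2), of "-1"] by simp
  have "u + (-1) *\<^sub>C v \<in> D" using uv v' complex_vector.subspace_add[OF dom_subspace] by blast
  then have "nm (A (u + (-1) *\<^sub>C v) - (A u + (-1) *\<^sub>C A v)) = 0"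
    using nm_null_trans[OF _ _ _ 1 2] A_mem uv v' by auto
  then show ?thesis by (simp add: scaleC_one)
qed

text \<open>\<open>A\<close> is linear only modulo null vectors, so the finite combination is taken
  apart one term at a time.\<close>

lemma A_psum: "nm (A (psum a n) - psum (\<lambda>i. ev i * a i) n) = 0"
proof (induction n)
  case 0
  have "nm (A (0 *\<^sub>C \<phi> 0) - 0 *\<^sub>C A (\<phi> 0)) = 0" using A_scale[OF phi_dom] .
  then show ?case by (simp add: psum_def)
next
  case (Suc n)
  have d: "a n *\<^sub>C \<phi> n \<in> D" "psum a n \<in> D" "psum a (Suc n) \<in> D"
    using complex_vector.subspace_scale[OF dom_subspace] phi_dom psum_dom by auto
  have 1: "nm (A (psum a n + a n *\<^sub>C \<phi> n) - (A (psum a n) + A (a n *\<^sub>C \<phi> n))) = 0"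
    using A_add d by blast
  have "nm (a n *\<^sub>C A (\<phi> n) - a n *\<^sub>C ev n *\<^sub>C \<phi> n) = 0"
    using nm_scale[of "A (\<phi> n) - ev n *\<^sub>C \<phi> n" "a n"] phi_eigen[of n] A_mem[OF phi_dom, of n]
    by (simp add: complex_vector.scale_right_diff_distrib)
  then have "nm (A (a n *\<^sub>C \<phi> n) - a n *\<^sub>C ev n *\<^sub>C \<phi> n) = 0"
    using nm_null_trans[OF _ _ _ A_scale[OF phi_dom]] A_mem[OF d(1)] A_mem[OF phi_dom] by auto
  then have 2: "nm ((A (psum a n) + A (a n *\<^sub>C \<phi> n)) - (psum (\<lambda>i. ev i * a i) n + a n *\<^sub>C ev n *\<^sub>C \<phi> n)) = 0"
    using nm_null_add[OF _ _ _ _ Suc] A_mem[OF d(1)] A_mem[OF d(2)] by simp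
  have "nm (A (psum a n + a n *\<^sub>C \<phi> n) - (psum (\<lambda>i. ev i * a i) n + a n *\<^sub>C ev n *\<^sub>C \<phi> n)) = 0"
    by (rule nm_null_trans[OF _ _ _ 1 2])
      (use A_mem[OF d(1)] A_mem[OF d(2)] A_mem[OF d(3)] in \<open>auto simp: psum_Suc\<close>)
  then show ?case by (simp add: psum_Suc scaleC_scaleC mult.commute)
qed

text \<open>Closedness applied to the partial sums: they converge to \<open>u\<close>, and by
  \<open>A_psum\<close> their images converge to a vector with coefficients
  \<open>ev i * a i\<close>.\<close>

lemma dom_synthesis:
  assumes "has_coeffs a u" "summable (\<lambda>i. (cmod (ev i * a i))\<^sup>2)"
  shows "u \<in> D" "has_coeffs (\<lambda>i. ev i * a i) (A u)"
proof -
  obtain v where v: "has_coeffs (\<lambda>i. ev i * a i) v" using synthesis[OF assms(2)] by blast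
  note V = A_mem[OF psum_dom] psum_mem has_coeffsD(1)[OF v]
  have le: "nm (A (psum a n) - v) \<le> nm (psum (\<lambda>i. ev i * a i) n - v)" for n
    using nm_triangle[OF V(1) V(2) V(3), of a n "\<lambda>i. ev i * a i" n] unfolding A_psum by simp
  have "(\<lambda>n. nm (A (psum a n) - v)) \<longlonglongrightarrow> 0"
    by (rule nm_tendsto_zero_le[OF _ le has_coeffsD(3)[OF v]]) (intro diff_mem V)
  then have *: "u \<in> D \<and> nm (A u - v) = 0"
    by (intro A_closed[of "psum a"] psum_dom has_coeffsD[OF v] has_coeffsD[OF assms(1)])
  then show "u \<in> D" by blast
  have "nm (v - A u) = 0" using * nm_diff_commute[of v "A u"] A_mem has_coeffsD[OF v] by simp
  then show "has_coeffs (\<lambda>i. ev i * a i) (A u)"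
    using has_coeffs_null[OF v] * A_mem by blast
qed

lemma ev_minus_nonzero: "ev i - \<zeta>\<^sub>0 \<noteq> 0"
  using gap[of i] delta_pos by auto

text \<open>The domain is no larger than that of the diagonal operator, since the latter minus
  \<open>\<zeta>\<^sub>0\<close> is already onto while \<open>A - \<zeta>\<^sub>0\<close> is injective.\<close>

lemma dom_analysis:
  assumes "has_coeffs a u" "u \<in> D"
  shows "summable (\<lambda>i. (cmod (ev i * a i))\<^sup>2)" "has_coeffs (\<lambda>i. ev i * a i) (A u)"
proof -
  have V: "u \<in> V" "A u - \<zeta>\<^sub>0 *\<^sub>C u \<in> V" using assms(2) dom_V A_mem by auto
  obtain b where b: "has_coeffs b (A u - \<zeta>\<^sub>0 *\<^sub>C u)" using analysis V by blast
  \<comment> \<open>Coefficients of the preimage of \<open>A u - \<zeta>\<^sub>0 *\<^sub>C u\<close>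
    under the diagonal operator minus \<open>\<zeta>\<^sub>0\<close>; the goal is
    \<open>a' = a\<close>.\<close>
  define a' where "a' i = 1 / (ev i - \<zeta>\<^sub>0) * b i" for i
  have bd1: "cmod (1 / (ev i - \<zeta>\<^sub>0)) \<le> 1 / \<delta>" for i
    using gap[of i] delta_pos by (simp add: norm_divide frac_le)
  have s1: "summable (\<lambda>i. (cmod (a' i))\<^sup>2)"
    unfolding a'_def by (rule summable_norm_sq_mult[OF has_coeffsD(2)[OF b] bd1])
  \<comment> \<open>Since \<open>ev i = (ev i - \<zeta>\<^sub>0) + \<zeta>\<^sub>0\<close>, the
    factor in front of \<open>b i\<close> stays bounded even if the \<open>ev i\<close> do
    not.\<close>
  have eva': "ev i * a' i = (1 + \<zeta>\<^sub>0 / (ev i - \<zeta>\<^sub>0)) * b i" for i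
    using ev_minus_nonzero[of i] unfolding a'_def by (simp add: field_simps)
  have bd2: "cmod (1 + \<zeta>\<^sub>0 / (ev i - \<zeta>\<^sub>0)) \<le> 1 + cmod \<zeta>\<^sub>0 * (1 / \<delta>)" for i
  proof -
    have "cmod (1 + \<zeta>\<^sub>0 * (1 / (ev i - \<zeta>\<^sub>0))) \<le> 1 + cmod \<zeta>\<^sub>0 * cmod (1 / (ev i - \<zeta>\<^sub>0))"
      by (rule order_trans[OF norm_triangle_ineq]) (simp only: norm_mult norm_one order_refl)
    also have "\<dots> \<le> 1 + cmod \<zeta>\<^sub>0 * (1 / \<delta>)" by (intro add_left_mono mult_left_mono bd1 norm_ge_zero)
    finally show ?thesis by simp
  qed
  have s2: "summable (\<lambda>i. (cmod (ev i * a' i))\<^sup>2)"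
    unfolding eva' by (rule summable_norm_sq_mult[OF has_coeffsD(2)[OF b] bd2])
  obtain u' where u': "has_coeffs a' u'" using synthesis[OF s1] by blast
  note u'D = dom_synthesis[OF u' s2]
  have "has_coeffs (\<lambda>i. ev i * a' i - \<zeta>\<^sub>0 * a' i) (A u' - \<zeta>\<^sub>0 *\<^sub>C u')"
    by (intro has_coeffs_diff has_coeffs_scale u' u'D)
  moreover have "(\<lambda>i. ev i * a' i - \<zeta>\<^sub>0 * a' i) = b"
    using ev_minus_nonzero by (simp add: a'_def fun_eq_iff diff_divide_distrib[symmetric] left_diff_distrib[symmetric])
  ultimately have "nm ((A u' - \<zeta>\<^sub>0 *\<^sub>C u') - (A u - \<zeta>\<^sub>0 *\<^sub>C u)) = 0"
    using has_coeffs_same[OF _ b] by simp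
  then have e: "nm ((A u' - A u) - \<zeta>\<^sub>0 *\<^sub>C (u' - u)) = 0"
    by (simp add: complex_vector.scale_right_diff_distrib algebra_simps)
  have D': "u' - u \<in> D" using u'D assms(2) complex_vector.subspace_diff[OF dom_subspace] by blast
  have "nm ((A (u' - u) - \<zeta>\<^sub>0 *\<^sub>C (u' - u)) - ((A u' - A u) - \<zeta>\<^sub>0 *\<^sub>C (u' - u))) = 0"
    using A_diff[OF u'D(1) assms(2)] by simp
  then have "nm (A (u' - u) - \<zeta>\<^sub>0 *\<^sub>C (u' - u)) = 0"
    using nm_null_cong[of "A (u' - u) - \<zeta>\<^sub>0 *\<^sub>C (u' - u)" "(A u' - A u) - \<zeta>\<^sub>0 *\<^sub>C (u' - u)"]
      e A_mem[OF D'] A_mem[OF u'D(1)] A_mem[OF assms(2)] dom_V[OF D'] by simp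
  then have n: "nm (u' - u) = 0" using inj D' by blast
  then have "a' = a" using has_coeffs_unique[OF u' assms(1)] by blast
  then show "summable (\<lambda>i. (cmod (ev i * a i))\<^sup>2)" using s2 by simp
  have "nm (A u' - A u) = 0" using A_null[OF u'D(1) V(1) n] by blast
  then show "has_coeffs (\<lambda>i. ev i * a i) (A u)"
    using has_coeffs_null[OF u'D(2)] A_mem[OF assms(2)] \<open>a' = a\<close> by blast
qed

lemma dom_iff: "has_coeffs a u \<Longrightarrow> u \<in> D \<longleftrightarrow> summable (\<lambda>i. (cmod (ev i * a i))\<^sup>2)"
  using dom_synthesis(1)[of a u] dom_analysis(1)[of a u] by blast

end

text \<open>Mean value bound on the half plane Re w \<le> B: it is convex, contains \<open>0\<close>
  because \<open>B\<close> is nonnegative, and the modulus of exp is at most exp B on it.\<close>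

lemma norm_exp_minus_one_le:
  fixes z :: complex
  assumes "Re z \<le> B" "0 \<le> B"
  shows "cmod (exp z - 1) \<le> exp B * cmod z"
proof -
  have "norm (exp z - exp 0) \<le> exp B * norm (z - 0)"
  proof (rule field_differentiable_bound)
    show "convex {w. Re w \<le> B}" by (rule convex_halfspace_Re_le)
    show "(exp has_field_derivative exp w) (at w within {w. Re w \<le> B})" for w :: complex
      by (auto intro!: derivative_eq_intros)
    show "norm (exp w) \<le> exp B" if "w \<in> {w. Re w \<le> B}" for w
      using that by (simp add: norm_exp_eq_Re)
  qed (use assms in auto)
  then show ?thesis by simp
qed

lemma tendsto_suminf_zero_dominated:
  fixes f :: "'b \<Rightarrow> nat \<Rightarrow> real"
  assumes "\<And>i. ((\<lambda>t. f t i) \<longlongrightarrow> 0) F"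
    and "\<forall>\<^sub>F t in F. \<forall>i. \<bar>f t i\<bar> \<le> g i" "summable g" "F \<noteq> bot"
  shows "((\<lambda>t. \<Sum>i. f t i) \<longlongrightarrow> 0) F"
proof -
  have "\<forall>\<^sub>F (k, n) in at_top \<times>\<^sub>F F. norm (f n k) \<le> g k"
    unfolding eventually_prod_filter using assms(2)
    by (intro exI[of _ "\<lambda>_. True"] exI[of _ "\<lambda>t. \<forall>i. \<bar>f t i\<bar> \<le> g i"]) auto
  from tannerys_theorem[OF assms(1) this assms(3,4)] show ?thesis by simp
qed

context riesz_sequence_space
begin

lemma phi_nonnull: "nm (\<phi> i) \<noteq> 0"
  using riesz_lower[of "{i}" "\<lambda>_. 1"] m_pos by (auto simp: scaleC_one)

text \<open>The factor \<open>sqrt (M / m)\<close> is the price of passing from vectors to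
  coefficients and back; it would be 1 for an orthonormal basis.\<close>

lemma has_coeffs_nm_le:
  assumes "has_coeffs a u" "has_coeffs b v" "\<And>i. cmod (b i) \<le> K * cmod (a i)" "0 \<le> K"
  shows "nm v \<le> sqrt (M / m) * K * nm u"
proof (rule power2_le_imp_le)
  have "(\<Sum>i. (cmod (b i))\<^sup>2) \<le> (\<Sum>i. K\<^sup>2 * (cmod (a i))\<^sup>2)"
    using has_coeffsD(2)[OF assms(1)] has_coeffsD(2)[OF assms(2)]
    by (intro suminf_le summable_mult)
      (auto simp: power_mult_distrib[symmetric] intro!: power_mono assms)
  also have "\<dots> = K\<^sup>2 * (\<Sum>i. (cmod (a i))\<^sup>2)"
    by (rule suminf_mult[OF has_coeffsD(2)[OF assms(1)]])
  finally have "M * (\<Sum>i. (cmod (b i))\<^sup>2) \<le> M * (K\<^sup>2 * (\<Sum>i. (cmod (a i))\<^sup>2))"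
    using M_pos by simp
  also have "\<dots> \<le> M * (K\<^sup>2 * ((nm u)\<^sup>2 / m))"
    using has_coeffs_nm_bounds(1)[OF assms(1)] M_pos m_pos
    by (intro mult_left_mono) (auto simp: field_simps)
  also have "\<dots> = (sqrt (M / m) * K * nm u)\<^sup>2"
    using M_pos m_pos by (simp add: power_mult_distrib)
  finally show "(nm v)\<^sup>2 \<le> (sqrt (M / m) * K * nm u)\<^sup>2"
    using has_coeffs_nm_bounds(2)[OF assms(2)] by linarith
  show "0 \<le> sqrt (M / m) * K * nm u"
    using M_pos m_pos assms(4) nm_nonneg[OF has_coeffsD(1)[OF assms(1)]] by simp
qed

text \<open>Dominated convergence in the space of coefficients. Strong continuity of the semigroup
  and convergence of its difference quotients are both instances.\<close>

lemma has_coeffs_tendsto_zero: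
  assumes "\<And>t. t \<in> T \<Longrightarrow> has_coeffs (a t) (u t)" "\<forall>\<^sub>F t in F. t \<in> T"
    and "\<And>i. ((\<lambda>t. a t i) \<longlongrightarrow> 0) F"
    and "\<And>t i. t \<in> T \<Longrightarrow> cmod (a t i) \<le> K * cmod (b i)" "summable (\<lambda>i. (cmod (b i))\<^sup>2)" "F \<noteq> bot"
  shows "((\<lambda>t. nm (u t)) \<longlongrightarrow> 0) F"
proof -
  have "((\<lambda>t. \<Sum>i. (cmod (a t i))\<^sup>2) \<longlongrightarrow> 0) F"
  proof (rule tendsto_suminf_zero_dominated[where g = "\<lambda>i. K\<^sup>2 * (cmod (b i))\<^sup>2"])
    show "((\<lambda>t. (cmod (a t i))\<^sup>2) \<longlongrightarrow> 0) F" for i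
      using tendsto_power[OF tendsto_norm[OF assms(3)[of i]], of 2] by simp
    show "\<forall>\<^sub>F t in F. \<forall>i. \<bar>(cmod (a t i))\<^sup>2\<bar> \<le> K\<^sup>2 * (cmod (b i))\<^sup>2"
      using assms(2)
    proof (rule eventually_mono, intro allI)
      fix t i assume "t \<in> T"
      then have "(cmod (a t i))\<^sup>2 \<le> (K * cmod (b i))\<^sup>2" by (intro power_mono assms(4)) auto
      then show "\<bar>(cmod (a t i))\<^sup>2\<bar> \<le> K\<^sup>2 * (cmod (b i))\<^sup>2" by (simp add: power_mult_distrib)
    qed
  qed (use assms in \<open>auto intro: summable_mult\<close>)
  then have "((\<lambda>t. sqrt (M * (\<Sum>i. (cmod (a t i))\<^sup>2))) \<longlongrightarrow> sqrt (M * 0)) F"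
    by (intro tendsto_intros)
  then have lim: "((\<lambda>t. sqrt (M * (\<Sum>i. (cmod (a t i))\<^sup>2))) \<longlongrightarrow> 0) F" by simp
  show ?thesis
  proof (rule tendsto_sandwich[OF _ _ tendsto_const lim])
    show "\<forall>\<^sub>F t in F. 0 \<le> nm (u t)"
      using assms(2)
      by (rule eventually_mono) (use assms(1) has_coeffsD(1) nm_nonneg in blast)
    show "\<forall>\<^sub>F t in F. nm (u t) \<le> sqrt (M * (\<Sum>i. (cmod (a t i))\<^sup>2))"
      using assms(2)
      by (rule eventually_mono) (use assms(1) has_coeffs_nm_bounds(2) real_le_rsqrt in blast)
  qed
qed

definition coeffs :: "'a \<Rightarrow> nat \<Rightarrow> complex"
  where "coeffs u = (SOME a. has_coeffs a u)"

lemma has_coeffs_coeffs: "u \<in> V \<Longrightarrow> has_coeffs (coeffs u) u"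
  unfolding coeffs_def using someI_ex[OF analysis] by blast

text \<open>Determined up to null vectors only, hence \<open>SOME\<close>; for bounded
  \<open>b\<close> a suitable vector exists by \<open>synthesis\<close>.\<close>

definition multiplier :: "(nat \<Rightarrow> complex) \<Rightarrow> 'a \<Rightarrow> 'a"
  where "multiplier b u = (SOME v. has_coeffs (\<lambda>i. b i * coeffs u i) v)"

lemma has_coeffs_multiplier:
  assumes "has_coeffs a u" "\<And>i. cmod (b i) \<le> K"
  shows "has_coeffs (\<lambda>i. b i * a i) (multiplier b u)"
proof -
  have "coeffs u = a"
    using has_coeffs_unique[OF has_coeffs_coeffs assms(1)] has_coeffsD(1)[OF assms(1)] by simp
  moreover have "summable (\<lambda>i. (cmod (b i * a i))\<^sup>2)"
    by (rule summable_norm_sq_mult[OF has_coeffsD(2)[OF assms(1)] assms(2)])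
  ultimately show ?thesis
    unfolding multiplier_def using someI_ex[OF synthesis[of "\<lambda>i. b i * a i"]] by simp
qed

end

section \<open>Spectrum, semigroup and resolvent of a diagonal operator\<close>

context diagonal_operator
begin

lemma shifted_has_coeffs:
  assumes "has_coeffs a u" "u \<in> D"
  shows "has_coeffs (\<lambda>i. (ev i - z) * a i) (A u - z *\<^sub>C u)"
  using has_coeffs_diff[OF dom_analysis(2)[OF assms] has_coeffs_scale[OF assms(1)], of z]
  by (simp add: left_diff_distrib)

lemma eigenvector_phi: "eigenvector nm D A (ev i) (\<phi> i)"
  unfolding eigenvector_def using phi_dom phi_eigen phi_nonnull by blast

lemma null_has_coeffs:
  assumes "has_coeffs a u" "nm u = 0"
  shows "a i = 0"
  using has_coeffs_unique[OF assms(1) has_coeffs_zero] assms(2) by simp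

lemma eigenvalues_eq: "eigenvalues nm D A = range ev"
proof
  show "range ev \<subseteq> eigenvalues nm D A"
    unfolding eigenvalues_def using eigenvector_phi by blast
  show "eigenvalues nm D A \<subseteq> range ev"
  proof
    fix z assume "z \<in> eigenvalues nm D A"
    then obtain u where u: "u \<in> D" "nm u \<noteq> 0" "nm (A u - z *\<^sub>C u) = 0"
      unfolding eigenvalues_def eigenvector_def by blast
    obtain a where a: "has_coeffs a u" using analysis[OF dom_V[OF u(1)]] by blast
    have *: "(ev i - z) * a i = 0" for i
      using null_has_coeffs[OF shifted_has_coeffs[OF a u(1)] u(3)] .
    show "z \<in> range ev"
    proof (rule ccontr)
      assume "z \<notin> range ev"
      then have "ev i - z \<noteq> 0" for i by auto
      then have "a = (\<lambda>_. 0)" using * by (auto simp: fun_eq_iff)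
      then have "nm (u - 0) = 0" using has_coeffs_same[of "\<lambda>_. 0" u 0] a has_coeffs_zero by simp
      then show False using u(2) by simp
    qed
  qed
qed

text \<open>Each application of \<open>A - z\<close> multiplies the coefficient at \<open>i\<close>
  by the nonzero number \<open>ev i - z\<close>, and after \<open>k\<close> applications a null
  vector remains. Hence no generalized eigenvector has a component belonging to another
  eigenvalue.\<close>

lemma gen_ker_coeffs:
  "v \<in> gen_ker V nm D A z k \<Longrightarrow> has_coeffs a v \<Longrightarrow> ev i \<noteq> z \<Longrightarrow> a i = 0"
proof (induction k arbitrary: v a)
  case 0
  then show ?case using null_has_coeffs by auto
next
  case (Suc k)
  then have v: "v \<in> D" "A v - z *\<^sub>C v \<in> gen_ker V nm D A z k" by auto
  have "(ev i - z) * a i = 0"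
    by (rule Suc.IH[OF v(2) shifted_has_coeffs[OF Suc.prems(2) v(1), of z] Suc.prems(3)])
  then show ?case using Suc.prems(3) by simp
qed

lemma gen_ker_subset: "gen_ker V nm D A z k \<subseteq> V"
  using dom_V by (cases k) auto

lemma simple_eigenvalues:
  assumes "inj ev" "z \<in> eigenvalues nm D A"
  shows "simple_eigenvalue V nm D A z"
proof -
  obtain j where j: "z = ev j" using assms(2) eigenvalues_eq by blast
  have "\<exists>a. nm (v - a *\<^sub>C \<phi> j) = 0" if v: "v \<in> gen_ker V nm D A z k" for k v
  proof -
    obtain a where a: "has_coeffs a v" using analysis v gen_ker_subset by blast
    \<comment> \<open>As \<open>ev\<close> is injective, \<open>j\<close> is the only index whose
      eigenvalue is \<open>z\<close>.\<close>
    have "a i = a j * (if i = j then 1 else 0)" for i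
      using gen_ker_coeffs[OF v a, of i] inj_eq[OF assms(1)] j by auto
    then have eq: "a = (\<lambda>i. a j * (if i = j then 1 else 0))" by (rule ext)
    have "has_coeffs a (a j *\<^sub>C \<phi> j)"
      by (subst eq) (rule has_coeffs_scale[OF has_coeffs_basis])
    then show ?thesis using has_coeffs_same[OF a] by blast
  qed
  then show ?thesis
    unfolding simple_eigenvalue_def using eigenvector_phi j by blast
qed

lemma riesz_basis_phi: "riesz_basis V nm UNIV \<phi>"
  unfolding riesz_basis_def
  by (intro conjI exI[of _ m] exI[of _ M] ballI allI impI riesz_lower riesz_upper m_pos M_pos)
    (auto intro: phi_dense)

lemma is_riesz_spectral_operator:
  assumes "inj ev" "closed (range ev)"
  shows "riesz_spectral_operator V nm D A"
proof -
  have "totally_disconnected (range ev)"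
    unfolding totally_disconnected_def
  proof (intro allI impI)
    fix T assume T: "T \<subseteq> range ev \<and> connected T"
    then have "countable T" using countable_subset[of T "range ev"] by simp
    \<comment> \<open>A connected set with two distinct points would be uncountable.\<close>
    then have "x = y" if "x \<in> T" "y \<in> T" for x y
      using connected_uncountable[OF conjunct2[OF T] that] by blast
    then show "\<exists>x. T \<subseteq> {x}" by (cases "T = {}") blast+
  qed
  then have "totally_disconnected (closure (eigenvalues nm D A))"
    using assms(2) by (simp add: eigenvalues_eq)
  then show ?thesis
    unfolding riesz_spectral_operator_def
    using closed simple_eigenvalues[OF assms(1)] riesz_basis_phi eigenvalues_eq eigenvector_phi
    by (intro conjI ballI exI[of _ ev] exI[of _ \<phi>]) auto
qed

definition semigroup :: "real \<Rightarrow> 'a \<Rightarrow> 'a"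
  where "semigroup t = multiplier (\<lambda>i. exp (of_real t * ev i))"

lemma exp_ev_bound:
  assumes "\<And>i. Re (ev i) \<le> \<omega>" "0 \<le> t"
  shows "cmod (exp (of_real t * ev i)) \<le> exp (\<omega> * t)"
  using mult_left_mono[OF assms(1)[of i] assms(2)] by (simp add: norm_exp_eq_Re mult.commute)

lemma has_coeffs_semigroup:
  assumes "\<And>i. Re (ev i) \<le> \<omega>" "0 \<le> t" "has_coeffs a u"
  shows "has_coeffs (\<lambda>i. exp (of_real t * ev i) * a i) (semigroup t u)"
  unfolding semigroup_def
  by (rule has_coeffs_multiplier[OF assms(3) exp_ev_bound[OF assms(1,2)]])

text \<open>The first bound dominates difference quotients on the domain of \<open>A\<close>; the
  second is free of \<open>ev i\<close> and dominates the orbit of an arbitrary vector.\<close>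

lemma exp_ev_minus_one_bound:
  assumes "\<And>i. Re (ev i) \<le> \<omega>" "0 \<le> t" "t \<le> 1"
  shows "cmod (exp (of_real t * ev i) - 1) \<le> exp \<bar>\<omega>\<bar> * (t * cmod (ev i))"
    "cmod (exp (of_real t * ev i) - 1) \<le> exp \<bar>\<omega>\<bar> + 1"
proof -
  have "t * Re (ev i) \<le> t * \<bar>\<omega>\<bar>"
    using assms(2) order_trans[OF assms(1)[of i] abs_ge_self] by (intro mult_left_mono) auto
  also have "\<dots> \<le> \<bar>\<omega>\<bar>" using mult_right_mono[OF assms(3), of "\<bar>\<omega>\<bar>"] by simp
  finally have le: "t * Re (ev i) \<le> \<bar>\<omega>\<bar>" .
  then show "cmod (exp (of_real t * ev i) - 1) \<le> exp \<bar>\<omega>\<bar> * (t * cmod (ev i))"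
    using norm_exp_minus_one_le[of "of_real t * ev i" "\<bar>\<omega>\<bar>"] assms(2) by (simp add: norm_mult)
  have "cmod (exp (of_real t * ev i)) \<le> exp \<bar>\<omega>\<bar>" using le by (simp add: norm_exp_eq_Re)
  then show "cmod (exp (of_real t * ev i) - 1) \<le> exp \<bar>\<omega>\<bar> + 1"
    using norm_triangle_ineq4[of "exp (of_real t * ev i)" 1] unfolding norm_one by linarith
qed

lemma at_right_unit: "\<forall>\<^sub>F t in at_right (0::real). t \<in> {0<..1}"
  using eventually_at_right_less[of 0] eventually_at_right[of 0 1]
  by (metis (mono_tags, lifting) eventually_at_right_field greaterThanAtMost_iff less_imp_le zero_less_one)

lemma semigroup_C0:
  assumes \<omega>: "\<And>i. Re (ev i) \<le> \<omega>"
  shows "C0_semigroup V nm semigroup"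
  unfolding C0_semigroup_def
proof (intro conjI allI impI ballI)
  note S = has_coeffs_semigroup[OF \<omega>]
  have mem: "semigroup t u \<in> V" if "u \<in> V" "0 \<le> t" for t u
    using S[OF that(2) has_coeffs_coeffs[OF that(1)]] has_coeffsD(1) by blast
  fix t :: real assume t: "0 \<le> t"
  show "linear_operator V nm V (semigroup t)"
    unfolding linear_operator_def
  proof (intro conjI ballI allI impI)
    show "csubspace V" by (rule subspace)
    show "semigroup t ` V \<subseteq> V" using mem t by blast
    fix u assume "u \<in> V"
    note u = has_coeffs_coeffs[OF this]
    show "nm (semigroup t (a *\<^sub>C u) - a *\<^sub>C semigroup t u) = 0" for a
      using has_coeffs_same[OF S[OF t has_coeffs_scale[OF u, of a]]] has_coeffs_scale[OF S[OF t u], of a]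
      by (simp add: mult.left_commute)
    fix v assume v': "v \<in> V"
    note v = has_coeffs_coeffs[OF v']
    show "nm (semigroup t (u + v) - (semigroup t u + semigroup t v)) = 0"
      using has_coeffs_same[OF S[OF t has_coeffs_add[OF u v]]] has_coeffs_add[OF S[OF t u] S[OF t v]]
      by (simp add: distrib_left)
    assume "nm (u - v) = 0"
    then have "has_coeffs (coeffs u) v" using has_coeffs_null[OF u v'] by blast
    then show "nm (semigroup t u - semigroup t v) = 0"
      using has_coeffs_same[OF S[OF t u]] S[OF t] by blast
  qed auto
  show "\<exists>K. \<forall>u\<in>V. nm (semigroup t u) \<le> K * nm u"
  proof (intro exI ballI)
    fix u assume "u \<in> V"
    note u = has_coeffs_coeffs[OF this]
    show "nm (semigroup t u) \<le> sqrt (M / m) * exp (\<omega> * t) * nm u"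
    proof (rule has_coeffs_nm_le[OF u S[OF t u]])
      show "cmod (exp (of_real t * ev i) * coeffs u i) \<le> exp (\<omega> * t) * cmod (coeffs u i)" for i
        unfolding norm_mult by (intro mult_right_mono exp_ev_bound[OF \<omega> t] norm_ge_zero)
    qed simp
  qed
next
  note S = has_coeffs_semigroup[OF \<omega>]
  fix u assume "u \<in> V"
  note u = has_coeffs_coeffs[OF this]
  show "nm (semigroup 0 u - u) = 0" 
    by (rule has_coeffs_same[OF _ u]) (use S[OF order_refl u] in simp)
  show "((\<lambda>t. nm (semigroup t u - u)) \<longlongrightarrow> 0) (at_right 0)"
  proof (rule has_coeffs_tendsto_zero[OF _ at_right_unit])
    show "has_coeffs (\<lambda>i. (exp (of_real t * ev i) - 1) * coeffs u i) (semigroup t u - u)"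
      if "t \<in> {0<..1}" for t :: real
      using has_coeffs_diff[OF S[OF _ u] u] that by (simp add: left_diff_distrib)
    have "((\<lambda>t. (exp (complex_of_real t * ev i) - 1) * coeffs u i)
        \<longlongrightarrow> (exp (complex_of_real 0 * ev i) - 1) * coeffs u i) (at_right 0)" for i
      by (intro tendsto_intros)
    then show "((\<lambda>t. (exp (complex_of_real t * ev i) - 1) * coeffs u i) \<longlongrightarrow> 0) (at_right 0)" for i
      by simp
    show "cmod ((exp (of_real t * ev i) - 1) * coeffs u i) \<le> (exp \<bar>\<omega>\<bar> + 1) * cmod (coeffs u i)"
      if "t \<in> {0<..1}" for t :: real and i
      using exp_ev_minus_one_bound(2)[OF \<omega>, of t i] that by (simp add: norm_mult mult_right_mono)
  qed (use has_coeffsD(2)[OF u] in auto)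
next
  note S = has_coeffs_semigroup[OF \<omega>]
  fix s t :: real and u assume st: "0 \<le> s" "0 \<le> t" and "u \<in> V"
  note u = has_coeffs_coeffs[OF \<open>u \<in> V\<close>]
  show "nm (semigroup (s + t) u - semigroup s (semigroup t u)) = 0"
    using has_coeffs_same[OF S[OF add_nonneg_nonneg[OF st] u]] S[OF st(1) S[OF st(2) u]]
    by (simp add: exp_add distrib_right mult.assoc)
qed

lemma exp_quotient_tendsto:
  "((\<lambda>t. complex_of_real (1 / t) * (exp (of_real t * z) - 1)) \<longlongrightarrow> z) (at_right 0)"
proof (cases "z = 0")
  case False
  have "((\<lambda>w::complex. (exp w - exp 0) / (w - 0)) \<longlongrightarrow> exp 0) (at 0)"
    using DERIV_exp[of "0::complex"] unfolding has_field_derivative_iff .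
  moreover have "filterlim (\<lambda>t. complex_of_real t * z) (at 0) (at_right 0)"
    unfolding filterlim_at
  proof
    have "((\<lambda>t. complex_of_real t * z) \<longlongrightarrow> complex_of_real 0 * z) (at_right 0)"
      by (intro tendsto_intros)
    then show "((\<lambda>t. complex_of_real t * z) \<longlongrightarrow> 0) (at_right 0)" by simp
    show "\<forall>\<^sub>F t in at_right 0. complex_of_real t * z \<in> UNIV \<and> complex_of_real t * z \<noteq> 0"
      using at_right_unit by (rule eventually_mono) (use False in auto)
  qed
  ultimately have "((\<lambda>t. (exp (of_real t * z) - exp 0) / (of_real t * z - 0)) \<longlongrightarrow> exp 0) (at_right 0)"
    by (rule filterlim_compose)
  from tendsto_mult[OF this tendsto_const[of z]] show ?thesis using False by simp
qed simp

lemma semigroup_generator: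
  assumes \<omega>: "\<And>i. Re (ev i) \<le> \<omega>"
  shows "generator_of V nm D A semigroup"
proof -
  note S = has_coeffs_semigroup[OF \<omega>]
  let ?q = "\<lambda>t z. complex_of_real (1 / t) * (exp (of_real t * z) - 1)"
  have Q: "has_coeffs (\<lambda>i. ?q t (ev i) * a i) (complex_of_real (1 / t) *\<^sub>C (semigroup t u - u))"
    if "0 < t" "has_coeffs a u" for t a u
    using has_coeffs_scale[OF has_coeffs_diff[OF S[OF less_imp_le[OF that(1)] that(2)] that(2)], of "complex_of_real (1 / t)"]
    by (simp only: mult.assoc left_diff_distrib mult_1)
  have lim: "((\<lambda>t. nm (complex_of_real (1 / t) *\<^sub>C (semigroup t u - u) - A u)) \<longlongrightarrow> 0) (at_right 0)"
    if uD: "u \<in> D" for u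
  proof -
    note u = has_coeffs_coeffs[OF dom_V[OF uD]]
    note Au = dom_analysis[OF u uD]
    show ?thesis
    proof (rule has_coeffs_tendsto_zero[OF _ at_right_unit _ _ Au(1)])
      show "has_coeffs (\<lambda>i. (?q t (ev i) - ev i) * coeffs u i) (complex_of_real (1 / t) *\<^sub>C (semigroup t u - u) - A u)"
        if "t \<in> {0<..1}" for t
        using has_coeffs_diff[OF Q[OF _ u] Au(2), of t] that by (simp only: left_diff_distrib greaterThanAtMost_iff)
      have "((\<lambda>t. (?q t (ev i) - ev i) * coeffs u i) \<longlongrightarrow> (ev i - ev i) * coeffs u i) (at_right 0)" for i
        by (intro tendsto_mult tendsto_diff exp_quotient_tendsto tendsto_const)
      then show "((\<lambda>t. (?q t (ev i) - ev i) * coeffs u i) \<longlongrightarrow> 0) (at_right 0)" for i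
        by simp
      \<comment> \<open>The factor \<open>1 / t\<close> of the quotient cancels against the
        \<open>t\<close> in \<open>exp_ev_minus_one_bound\<close>. The dominating sequence is square
        summable because \<open>u\<close> lies in \<open>D\<close>.\<close>
      show "cmod ((?q t (ev i) - ev i) * coeffs u i) \<le> (exp \<bar>\<omega>\<bar> + 1) * cmod (ev i * coeffs u i)"
        if t: "t \<in> {0<..1}" for t i
      proof -
        have "cmod (?q t (ev i)) \<le> 1 / t * (exp \<bar>\<omega>\<bar> * (t * cmod (ev i)))"
          unfolding norm_mult using exp_ev_minus_one_bound(1)[OF \<omega>, of t i] t
          by (intro mult_mono) (auto simp: norm_divide)
        then have "cmod (?q t (ev i)) \<le> exp \<bar>\<omega>\<bar> * cmod (ev i)" using t by simp
        then have "cmod (?q t (ev i) - ev i) \<le> (exp \<bar>\<omega>\<bar> + 1) * cmod (ev i)"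
          using norm_triangle_ineq4[of "?q t (ev i)" "ev i"] unfolding distrib_right by linarith
        then show ?thesis
          unfolding norm_mult mult.assoc[symmetric] by (intro mult_right_mono) auto
      qed
    qed simp
  qed
  \<comment> \<open>Conversely, if the difference quotients converge to \<open>w\<close>, comparing
    coordinates gives \<open>w\<close> the coefficients \<open>ev i * coeffs u i\<close>. These are
    then square summable, which is the description of \<open>D\<close> in
    \<open>dom_iff\<close>.\<close>
  have sub: "u \<in> D" if uV: "u \<in> V" and wV: "w \<in> V"
    and w: "((\<lambda>t. nm (complex_of_real (1 / t) *\<^sub>C (semigroup t u - u) - w)) \<longlongrightarrow> 0) (at_right 0)" for u w
  proof -
    note u = has_coeffs_coeffs[OF uV] and w' = has_coeffs_coeffs[OF wV]
    have "coeffs w i = ev i * coeffs u i" for i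
    proof -
      have "((\<lambda>t. ?q t (ev i) * coeffs u i - coeffs w i) \<longlongrightarrow> 0) (at_right 0)"
      proof (rule Lim_null_comparison)
        show "\<forall>\<^sub>F t in at_right 0. norm (?q t (ev i) * coeffs u i - coeffs w i)
            \<le> nm (complex_of_real (1 / t) *\<^sub>C (semigroup t u - u) - w) / sqrt m"
          using at_right_unit
          by (rule eventually_mono) (rule has_coeffs_coeff_le[OF has_coeffs_diff[OF Q[OF _ u] w']], simp)
        show "((\<lambda>t. nm (complex_of_real (1 / t) *\<^sub>C (semigroup t u - u) - w) / sqrt m) \<longlongrightarrow> 0) (at_right 0)"
          using tendsto_divide[OF w tendsto_const[of "sqrt m"]] m_pos by simp
      qed
      moreover have "((\<lambda>t. ?q t (ev i) * coeffs u i - coeffs w i) \<longlongrightarrow> ev i * coeffs u i - coeffs w i) (at_right 0)"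
        by (intro tendsto_mult tendsto_diff exp_quotient_tendsto tendsto_const)
      ultimately show ?thesis
        using tendsto_unique[OF trivial_limit_at_right_real] by fastforce
    qed
    then have "coeffs w = (\<lambda>i. ev i * coeffs u i)" by auto
    then show ?thesis using has_coeffsD(2)[OF w'] dom_iff[OF u] by simp
  qed
  show ?thesis
    unfolding generator_of_def using lim sub dom_V A_mem by blast
qed

lemma is_generator:
  assumes "\<And>i. Re (ev i) \<le> \<omega>"
  shows "generates_C0_semigroup V nm D A"
  unfolding generates_C0_semigroup_def using semigroup_C0[OF assms] semigroup_generator[OF assms] by blast

text \<open>Division of the coefficients by \<open>ev i - z\<close>. The bound is stated for every
  solution and not for a constructed inverse, so that it also applies to a solution picked
  elsewhere, such as \<open>phi2_fst\<close>.\<close>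

lemma resolvent:
  assumes "v \<in> V" "\<And>i. K \<le> cmod (ev i - z)" "0 < K"
  shows "\<exists>u\<in>D. nm (A u - z *\<^sub>C u - v) = 0"
    and "\<And>u. u \<in> D \<Longrightarrow> nm (A u - z *\<^sub>C u - v) = 0 \<Longrightarrow> nm u \<le> sqrt (M / m) * (1 / K) * nm v"
proof -
  note v = has_coeffs_coeffs[OF assms(1)]
  have nz: "ev i - z \<noteq> 0" for i using assms(2)[of i] assms(3) by auto
  have bd: "cmod (1 / (ev i - z)) \<le> 1 / K" for i
    using assms(2)[of i] assms(3) by (simp add: norm_divide frac_le)
  show "nm u \<le> sqrt (M / m) * (1 / K) * nm v" if u: "u \<in> D" "nm (A u - z *\<^sub>C u - v) = 0" for u
  proof -
    note c = has_coeffs_coeffs[OF dom_V[OF u(1)]]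
    have "coeffs v i = (ev i - z) * coeffs u i" for i
      using has_coeffs_unique[OF shifted_has_coeffs[OF c u(1)] v u(2)] by (metis (mono_tags))
    then have "coeffs u i = 1 / (ev i - z) * coeffs v i" for i using nz[of i] by simp
    then have "cmod (coeffs u i) \<le> 1 / K * cmod (coeffs v i)" for i
      using bd[of i] by (simp only: norm_mult mult_right_mono norm_ge_zero)
    then show ?thesis by (rule has_coeffs_nm_le[OF v c]) (use assms(3) in simp)
  qed
  have s1: "summable (\<lambda>i. (cmod (1 / (ev i - z) * coeffs v i))\<^sup>2)"
    by (rule summable_norm_sq_mult[OF has_coeffsD(2)[OF v] bd])
  then obtain u where u: "has_coeffs (\<lambda>i. 1 / (ev i - z) * coeffs v i) u" using synthesis[OF s1] by blast
  have e: "(ev i - z) * (1 / (ev i - z) * coeffs v i) = coeffs v i" for i using nz[of i] by simp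
  have "ev i * (1 / (ev i - z) * coeffs v i) = coeffs v i + z * (1 / (ev i - z) * coeffs v i)" for i
    using e[of i] by (simp only: left_diff_distrib diff_eq_eq)
  then have "summable (\<lambda>i. (cmod (ev i * (1 / (ev i - z) * coeffs v i)))\<^sup>2)"
    using summable_norm_sq_add[OF has_coeffsD(2)[OF v] summable_norm_sq_mult[OF s1, of "\<lambda>_. z" "cmod z"]] by simp
  then have "u \<in> D" by (rule dom_synthesis(1)[OF u])
  moreover have "nm (A u - z *\<^sub>C u - v) = 0"
    using has_coeffs_same[OF shifted_has_coeffs[OF u \<open>u \<in> D\<close>, of z]] v unfolding e by blast
  ultimately show "\<exists>u\<in>D. nm (A u - z *\<^sub>C u - v) = 0" by blast
qed

end

text \<open>Brings index sets such as \<open>{1..}\<close> and \<open>Phi_index\<close> to the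
  sequences of the locale. The Riesz bounds concern finite sets of indices, so the order of the
  enumeration is immaterial.\<close>

lemma riesz_basis_sequence:
  assumes "complete_seminormed_space V nm" "riesz_basis V nm I \<phi>" "bij_betw e (UNIV :: nat set) I"
  shows "\<exists>m M. riesz_sequence_space V nm (\<phi> \<circ> e) m M"
proof -
  interpret complete_seminormed_space V nm by fact
  from assms(2) obtain m M where mem: "\<phi> ` I \<subseteq> V"
    and dense: "\<forall>v\<in>V. \<forall>\<epsilon>>0. \<exists>w\<in>cspan (\<phi> ` I). nm (v - w) < \<epsilon>"
    and mM: "0 < m" "0 < M"
    and b: "\<forall>F a. finite F \<and> F \<subseteq> I \<longrightarrow>
        m * (\<Sum>i\<in>F. (cmod (a i))\<^sup>2) \<le> (nm (\<Sum>i\<in>F. a i *\<^sub>C \<phi> i))\<^sup>2 \<and>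
        (nm (\<Sum>i\<in>F. a i *\<^sub>C \<phi> i))\<^sup>2 \<le> M * (\<Sum>i\<in>F. (cmod (a i))\<^sup>2)"
    unfolding riesz_basis_def by (elim conjE exE) (rule that)
  have e: "inj e" "range e = I" using assms(3) by (auto simp: bij_betw_def)
  have inj: "inj_on e F" for F using e(1) inj_on_subset by blast
  have tr: "(\<Sum>i\<in>F. (cmod (a i))\<^sup>2) = (\<Sum>j\<in>e ` F. (cmod ((a \<circ> inv e) j))\<^sup>2)"
    "(\<Sum>i\<in>F. a i *\<^sub>C (\<phi> \<circ> e) i) = (\<Sum>j\<in>e ` F. (a \<circ> inv e) j *\<^sub>C \<phi> j)" for F a
    by (simp_all add: sum.reindex[OF inj] inv_f_f[OF e(1)])
  have "riesz_sequence_space V nm (\<phi> \<circ> e) m M"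
  proof unfold_locales
    show "(\<phi> \<circ> e) i \<in> V" for i using mem e(2) by auto
    have "range (\<phi> \<circ> e) = \<phi> ` I" using e(2) by auto
    then show "\<exists>w\<in>cspan (range (\<phi> \<circ> e)). nm (v - w) < \<epsilon>" if "v \<in> V" "\<epsilon> > 0" for v \<epsilon>
      using that dense by simp
    fix F :: "nat set" and a assume "finite F"
    then show "m * (\<Sum>i\<in>F. (cmod (a i))\<^sup>2) \<le> (nm (\<Sum>i\<in>F. a i *\<^sub>C (\<phi> \<circ> e) i))\<^sup>2"
      "(nm (\<Sum>i\<in>F. a i *\<^sub>C (\<phi> \<circ> e) i))\<^sup>2 \<le> M * (\<Sum>i\<in>F. (cmod (a i))\<^sup>2)"
      unfolding tr using b[rule_format, of "e ` F" "a \<circ> inv e"] e(2) by auto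
  qed (use mM in auto)
  then show ?thesis by blast
qed

section \<open>The seminormed space of square integrable functions\<close>

definition l2_norm :: "real \<Rightarrow> (real \<Rightarrow> complex) \<Rightarrow> real"
  where "l2_norm L f = sqrt (LINT x|leb L. (cmod (f x))\<^sup>2)"

lemma scaleC_fun_apply [simp]: "(a *\<^sub>C f) x = a * (f x :: complex)"
  by (simp add: scaleC_fun_def scaleC_complex_def)

lemma sum_fun_apply: "(\<Sum>i\<in>F. f i) x = (\<Sum>i\<in>F. f i x)"
  by (induction F rule: infinite_finite_induct) auto

lemma L2_measurable [measurable_dest]: "f \<in> L2 L \<Longrightarrow> f \<in> borel_measurable (leb L)"
  and L2_integrable_sq: "f \<in> L2 L \<Longrightarrow> integrable (leb L) (\<lambda>x. (cmod (f x))\<^sup>2)"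
  by (auto simp: L2_def)

lemma L2_I: "f \<in> borel_measurable (leb L) \<Longrightarrow> integrable (leb L) (\<lambda>x. (cmod (f x))\<^sup>2) \<Longrightarrow> f \<in> L2 L"
  by (auto simp: L2_def)

lemma emeasure_leb_finite: "emeasure (leb L) (space (leb L)) < \<infinity>"
proof -
  have "emeasure lebesgue {0<..<L} \<le> emeasure lebesgue {0..L}" by (intro emeasure_mono) auto
  also have "\<dots> < \<infinity>" by (cases "0 \<le> L") auto
  finally show ?thesis by (simp add: emeasure_restrict_space)
qed

lemma finite_measure_leb: "finite_measure (leb L)"
  by (rule finite_measureI) (use emeasure_leb_finite[of L] in simp)

lemma measure_leb: "0 \<le> L \<Longrightarrow> measure (leb L) (space (leb L)) = L"
  by (simp add: measure_restrict_space)

lemma measure_leb' [simp]: "0 \<le> L \<Longrightarrow> measure (leb L) {0<..<L} = L"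
  using measure_leb[of L] by simp

lemma l2_norm_nonneg [simp]: "0 \<le> l2_norm L f"
  by (simp add: l2_norm_def)

lemma l2_norm_sq: "(l2_norm L f)\<^sup>2 = (LINT x|leb L. (cmod (f x))\<^sup>2)"
  by (simp add: l2_norm_def)

lemma L2_bounded_comparison:
  assumes "f \<in> L2 L" "g \<in> borel_measurable (leb L)" "AE x in leb L. cmod (g x) \<le> K * cmod (f x)"
  shows "g \<in> L2 L" "0 \<le> K \<Longrightarrow> l2_norm L g \<le> K * l2_norm L f"
proof -
  have i: "integrable (leb L) (\<lambda>x. K\<^sup>2 * (cmod (f x))\<^sup>2)"
    using L2_integrable_sq[OF assms(1)] by simp
  have le: "AE x in leb L. (cmod (g x))\<^sup>2 \<le> K\<^sup>2 * (cmod (f x))\<^sup>2"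
    using assms(3)
    by (rule AE_mp) (auto simp: power_mult_distrib[symmetric] intro!: AE_I2 power_mono)
  show g: "g \<in> L2 L"
  proof (rule L2_I[OF assms(2)])
    show "integrable (leb L) (\<lambda>x. (cmod (g x))\<^sup>2)"
      by (rule Bochner_Integration.integrable_bound[OF i]) (use assms(2) le in auto)
  qed
  assume K: "0 \<le> K"
  have "(l2_norm L g)\<^sup>2 \<le> (LINT x|leb L. K\<^sup>2 * (cmod (f x))\<^sup>2)"
    unfolding l2_norm_sq by (rule integral_mono_AE[OF L2_integrable_sq[OF g] i le])
  also have "\<dots> = (K * l2_norm L f)\<^sup>2" by (simp add: power_mult_distrib l2_norm_sq)
  finally show "l2_norm L g \<le> K * l2_norm L f"
    by (rule power2_le_imp_le) (use K in simp)
qed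

lemma L2_AE_cong:
  assumes "f \<in> L2 L" "g \<in> borel_measurable (leb L)" "AE x in leb L. f x = g x"
  shows "g \<in> L2 L" "l2_norm L g = l2_norm L f"
proof -
  have "AE x in leb L. cmod (g x) \<le> 1 * cmod (f x)" using assms(3) by auto
  note 1 = L2_bounded_comparison[OF assms(1,2) this]
  show g: "g \<in> L2 L" by (rule 1)
  have "AE x in leb L. cmod (f x) \<le> 1 * cmod (g x)" using assms(3) by auto
  note 2 = L2_bounded_comparison[OF g _ this]
  show "l2_norm L g = l2_norm L f" using 1(2) 2(2) L2_measurable[OF assms(1)] by simp
qed

text \<open>Completeness of Lebesgue measure, transferred to the interval by extending both
  functions by zero.\<close>

lemma leb_measurable_AE:
  assumes "f \<in> borel_measurable (leb L)" "AE x in leb L. f x = (g x :: complex)"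
  shows "g \<in> borel_measurable (leb L)"
proof -
  have "(\<lambda>x. if x \<in> {0<..<L} then f x else 0) \<in> borel_measurable lebesgue"
    by (subst borel_measurable_if) (use assms(1) in auto)
  moreover have "AE x in lebesgue. (if x \<in> {0<..<L} then f x else 0) = (if x \<in> {0<..<L} then g x else 0)"
    using assms(2) by (simp add: AE_restrict_space_iff)
  ultimately have "(\<lambda>x. if x \<in> {0<..<L} then g x else 0) \<in> borel_measurable lebesgue"
    by (rule borel_measurable_AE)
  moreover have "{0<..<L} \<in> sets lebesgue" by simp
  ultimately show ?thesis using borel_measurable_if[of "{0<..<L}" g] by blast
qed

lemma L2_AE: "f \<in> L2 L \<Longrightarrow> AE x in leb L. f x = g x \<Longrightarrow> g \<in> L2 L"
  using L2_AE_cong(1)[of f L g] leb_measurable_AE[of f L g] L2_measurable by blast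

lemma L2_add:
  assumes "f \<in> L2 L" "g \<in> L2 L"
  shows "(\<lambda>x. f x + g x) \<in> L2 L"
proof (rule L2_I)
  show "integrable (leb L) (\<lambda>x. (cmod (f x + g x))\<^sup>2)"
  proof (rule Bochner_Integration.integrable_bound)
    show "integrable (leb L) (\<lambda>x. 2 * (cmod (f x))\<^sup>2 + 2 * (cmod (g x))\<^sup>2)"
      using assms[THEN L2_integrable_sq] by simp
    show "AE x in leb L. norm ((cmod (f x + g x))\<^sup>2) \<le> norm (2 * (cmod (f x))\<^sup>2 + 2 * (cmod (g x))\<^sup>2)"
      using norm_add_sq_le[of "f _" "g _"] by auto
  qed (use assms[THEN L2_measurable] in measurable)
qed (use assms[THEN L2_measurable] in measurable)

lemma L2_mult_bounded:
  assumes "f \<in> L2 L" "b \<in> borel_measurable (leb L)" "AE x in leb L. cmod (b x) \<le> K"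
  shows "(\<lambda>x. b x * f x) \<in> L2 L" "0 \<le> K \<Longrightarrow> l2_norm L (\<lambda>x. b x * f x) \<le> K * l2_norm L f"
proof -
  have "AE x in leb L. cmod (b x * f x) \<le> K * cmod (f x)"
    using assms(3) by (rule AE_mp) (auto simp: norm_mult intro!: AE_I2 mult_right_mono)
  note * = L2_bounded_comparison[OF assms(1) _ this]
  show "(\<lambda>x. b x * f x) \<in> L2 L" "0 \<le> K \<Longrightarrow> l2_norm L (\<lambda>x. b x * f x) \<le> K * l2_norm L f"
    using * assms(2) L2_measurable[OF assms(1)] by auto
qed

lemma L2_cmult: "f \<in> L2 L \<Longrightarrow> (\<lambda>x. c * f x) \<in> L2 L"
  by (rule L2_mult_bounded(1)[where K = "cmod c"]) auto

lemma L2_zero: "(\<lambda>x. 0) \<in> L2 L"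
  by (rule L2_I) auto

lemma L2_diff: "f \<in> L2 L \<Longrightarrow> g \<in> L2 L \<Longrightarrow> (\<lambda>x. f x - g x) \<in> L2 L"
  using L2_add[of f L "\<lambda>x. -1 * g x"] L2_cmult[of g L "-1"] by simp

lemma L2_cnj: "f \<in> L2 L \<Longrightarrow> (\<lambda>x. cnj (f x)) \<in> L2 L"
  by (rule L2_bounded_comparison(1)[where K = 1])
    (auto intro: measurable_compose[OF L2_measurable borel_measurable_continuous_onI] continuous_intros)

lemma L2_subspace: "csubspace (L2 L)"
proof (rule complex_vector.subspaceI)
  show "0 \<in> L2 L" using L2_zero by (simp add: zero_fun_def)
  show "f + g \<in> L2 L" if "f \<in> L2 L" "g \<in> L2 L" for f g
    using L2_add[OF that] by (simp add: plus_fun_def)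
  show "c *\<^sub>C f \<in> L2 L" if "f \<in> L2 L" for c f
    using L2_cmult[OF that, of c] by (simp add: scaleC_fun_def scaleC_complex_def)
qed

lemma L2_sum: "(\<And>i. i \<in> F \<Longrightarrow> f i \<in> L2 L) \<Longrightarrow> (\<lambda>x. \<Sum>i\<in>F. f i x) \<in> L2 L"
  by (induction F rule: infinite_finite_induct) (auto intro: L2_zero L2_add)

lemma l2_norm_eq_0_iff: "f \<in> L2 L \<Longrightarrow> l2_norm L f = 0 \<longleftrightarrow> (AE x in leb L. f x = 0)"
  using integral_nonneg_eq_0_iff_AE[OF L2_integrable_sq[of f L]] by (simp add: l2_norm_def)

lemma L2_integrable_mult:
  assumes "f \<in> L2 L" "g \<in> L2 L"
  shows "integrable (leb L) (\<lambda>x. f x * g x)"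
proof (rule Bochner_Integration.integrable_bound)
  show "integrable (leb L) (\<lambda>x. (cmod (f x))\<^sup>2 + (cmod (g x))\<^sup>2)"
    using assms[THEN L2_integrable_sq] by simp
  have "2 * (cmod (f x) * cmod (g x)) \<le> (cmod (f x))\<^sup>2 + (cmod (g x))\<^sup>2" for x
    using sum_squares_bound[of "cmod (f x)" "cmod (g x)"] by simp
  then have "cmod (f x) * cmod (g x) \<le> (cmod (f x))\<^sup>2 + (cmod (g x))\<^sup>2" for x
    by (smt (verit) mult_nonneg_nonneg norm_ge_zero)
  then show "AE x in leb L. norm (f x * g x) \<le> norm ((cmod (f x))\<^sup>2 + (cmod (g x))\<^sup>2)"
    by (auto simp: norm_mult)
qed (use assms[THEN L2_measurable] in measurable)

lemma L2_cauchy_schwarz_abs: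
  assumes "f \<in> L2 L" "g \<in> L2 L"
  shows "(LINT x|leb L. cmod (f x) * cmod (g x)) \<le> l2_norm L f * l2_norm L g"
proof (cases "l2_norm L f = 0 \<or> l2_norm L g = 0")
  case True
  then have "AE x in leb L. cmod (f x) * cmod (g x) = 0"
    using assms by (auto simp: l2_norm_eq_0_iff elim: AE_mp)
  then show ?thesis by (simp add: integral_eq_zero_AE)
next
  case False
  define a b where "a = l2_norm L f" and "b = l2_norm L g"
  have ab: "0 < a" "0 < b" using False l2_norm_nonneg[of L f] l2_norm_nonneg[of L g]
    unfolding a_def b_def by (simp_all add: order_less_le del: l2_norm_nonneg)
  note i = assms[THEN L2_integrable_sq]
  \<comment> \<open>The inequality of Young, weighted so that each of the two terms integrates to
    \<open>a * b / 2\<close>.\<close>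
  have "(LINT x|leb L. cmod (f x) * cmod (g x))
      \<le> (LINT x|leb L. b / (2 * a) * (cmod (f x))\<^sup>2 + a / (2 * b) * (cmod (g x))\<^sup>2)"
  proof (rule integral_mono)
    show "integrable (leb L) (\<lambda>x. cmod (f x) * cmod (g x))"
      using integrable_norm[OF L2_integrable_mult[OF assms]] by (simp add: norm_mult)
    fix x
    have "0 \<le> (b * cmod (f x) - a * cmod (g x))\<^sup>2" by simp
    then show "cmod (f x) * cmod (g x) \<le> b / (2 * a) * (cmod (f x))\<^sup>2 + a / (2 * b) * (cmod (g x))\<^sup>2"
      using ab by (simp add: field_simps power2_eq_square)
  qed (use i in simp)
  also have "\<dots> = b / (2 * a) * a\<^sup>2 + a / (2 * b) * b\<^sup>2"
    using i by (simp add: a_def b_def l2_norm_sq)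
  also have "\<dots> = a * b" using ab by (simp add: field_simps power2_eq_square)
  finally show ?thesis by (simp add: a_def b_def)
qed

lemma L2_cauchy_schwarz:
  assumes "f \<in> L2 L" "g \<in> L2 L"
  shows "cmod (LINT x|leb L. f x * g x) \<le> l2_norm L f * l2_norm L g"
proof -
  have "cmod (LINT x|leb L. f x * g x) \<le> (LINT x|leb L. cmod (f x * g x))"
    by (rule integral_norm_bound)
  then show ?thesis using L2_cauchy_schwarz_abs[OF assms] by (simp add: norm_mult)
qed

lemma l2_norm_triangle:
  assumes "f \<in> L2 L" "g \<in> L2 L"
  shows "l2_norm L (\<lambda>x. f x + g x) \<le> l2_norm L f + l2_norm L g"
proof (rule power2_le_imp_le)
  note i = assms[THEN L2_integrable_sq]
  have i2: "integrable (leb L) (\<lambda>x. cmod (f x) * cmod (g x))"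
    using integrable_norm[OF L2_integrable_mult[OF assms]] by (simp add: norm_mult)
  have "(l2_norm L (\<lambda>x. f x + g x))\<^sup>2
      \<le> (LINT x|leb L. (cmod (f x))\<^sup>2 + 2 * (cmod (f x) * cmod (g x)) + (cmod (g x))\<^sup>2)"
    unfolding l2_norm_sq
  proof (rule integral_mono)
    show "integrable (leb L) (\<lambda>x. (cmod (f x + g x))\<^sup>2)" using L2_add[OF assms] by (rule L2_integrable_sq)
    fix x
    have "(cmod (f x + g x))\<^sup>2 \<le> (cmod (f x) + cmod (g x))\<^sup>2" by (intro power_mono norm_triangle_ineq) simp
    then show "(cmod (f x + g x))\<^sup>2 \<le> (cmod (f x))\<^sup>2 + 2 * (cmod (f x) * cmod (g x)) + (cmod (g x))\<^sup>2"
      by (simp add: power2_sum)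
  qed (use i i2 in simp)
  also have "\<dots> = (l2_norm L f)\<^sup>2 + 2 * (LINT x|leb L. cmod (f x) * cmod (g x)) + (l2_norm L g)\<^sup>2"
    using i i2 by (simp add: l2_norm_sq)
  also have "\<dots> \<le> (l2_norm L f + l2_norm L g)\<^sup>2"
    using L2_cauchy_schwarz_abs[OF assms] by (simp add: power2_sum)
  finally show "(l2_norm L (\<lambda>x. f x + g x))\<^sup>2 \<le> (l2_norm L f + l2_norm L g)\<^sup>2" .
qed simp

lemma l2_norm_cmult: "l2_norm L (\<lambda>x. c * f x) = cmod c * l2_norm L f"
  by (simp add: l2_norm_def norm_mult power_mult_distrib real_sqrt_mult)

lemma l2_norm_bounded:
  assumes "0 \<le> L" "f \<in> borel_measurable (leb L)" "\<And>x. x \<in> {0<..<L} \<Longrightarrow> cmod (f x) \<le> B"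
  shows "f \<in> L2 L" "l2_norm L f \<le> \<bar>B\<bar> * sqrt L"
proof -
  interpret finite_measure "leb L" by (rule finite_measure_leb)
  have 1: "(\<lambda>x. 1) \<in> L2 L" by (rule L2_I) auto
  have B: "AE x in leb L. cmod (f x) \<le> \<bar>B\<bar>"
    by (rule AE_I2) (use assms(3) abs_ge_self[of B] in \<open>fastforce intro: order_trans\<close>)
  have *: "l2_norm L (\<lambda>x. 1) = sqrt L" by (simp add: l2_norm_def assms(1))
  show "f \<in> L2 L" "l2_norm L f \<le> \<bar>B\<bar> * sqrt L"
    using L2_mult_bounded[OF 1 assms(2) B] * by auto
qed

lemma L2_integrable: "f \<in> L2 L \<Longrightarrow> integrable (leb L) f"
proof -
  interpret finite_measure "leb L" by (rule finite_measure_leb)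
  have 1: "(\<lambda>x. 1) \<in> L2 L" by (rule L2_I) auto
  show "integrable (leb L) f" if "f \<in> L2 L" using L2_integrable_mult[OF that 1] by simp
qed

lemma L2_norm_integral_le:
  assumes "0 \<le> L" "f \<in> L2 L"
  shows "(LINT x|leb L. cmod (f x)) \<le> sqrt L * l2_norm L f"
proof -
  interpret finite_measure "leb L" by (rule finite_measure_leb)
  have 1: "(\<lambda>x. 1) \<in> L2 L" by (rule L2_I) auto
  have *: "l2_norm L (\<lambda>x. 1) = sqrt L" by (simp add: l2_norm_def assms(1))
  show ?thesis using L2_cauchy_schwarz_abs[OF assms(2) 1] * by (simp add: mult.commute)
qed

lemma seminormed_space_L2: "seminormed_space (L2 L) (l2_norm L)"
proof
  show "csubspace (L2 L)" by (rule L2_subspace)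
  show "l2_norm L (u + v) \<le> l2_norm L u + l2_norm L v" if "u \<in> L2 L" "v \<in> L2 L" for u v
    using l2_norm_triangle[OF that] by (simp add: plus_fun_def)
  show "l2_norm L (a *\<^sub>C u) = cmod a * l2_norm L u" for a u
    using l2_norm_cmult[of L a u] by (simp add: scaleC_fun_def scaleC_complex_def)
qed

lemma l2_norm_tendsto_dominated:
  assumes "\<And>n. f n \<in> borel_measurable (leb L)" "integrable (leb L) w"
    and "AE x in leb L. (\<lambda>n. f n x) \<longlonglongrightarrow> 0" "\<And>n. AE x in leb L. (cmod (f n x))\<^sup>2 \<le> w x"
  shows "(\<lambda>n. l2_norm L (f n)) \<longlonglongrightarrow> 0"
proof -
  have "(\<lambda>n. LINT x|leb L. (cmod (f n x))\<^sup>2) \<longlonglongrightarrow> (LINT x|leb L. 0)"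
  proof (rule integral_dominated_convergence[where w = w])
    show "AE x in leb L. (\<lambda>n. (cmod (f n x))\<^sup>2) \<longlonglongrightarrow> 0"
      using assms(3)
      by (rule AE_mp) (auto intro!: AE_I2 tendsto_eq_intros)
  qed (use assms in auto)
  then have "(\<lambda>n. sqrt (LINT x|leb L. (cmod (f n x))\<^sup>2)) \<longlonglongrightarrow> sqrt (LINT x|leb L. 0)"
    by (rule tendsto_real_sqrt)
  then show ?thesis by (simp add: l2_norm_def)
qed

text \<open>The Riesz-Fischer argument: a subsequence with geometrically small steps has, almost
  everywhere, an absolutely convergent telescoping series, and the lemma of Fatou bounds the
  distance to its limit.\<close>

lemma L2_complete:
  assumes mem: "\<And>n::nat. x n \<in> L2 L" and L: "0 \<le> L"
    and cauchy: "\<And>e::real. e > 0 \<Longrightarrow> \<exists>N. \<forall>m\<ge>N. \<forall>n\<ge>N. l2_norm L (x m - x n) < e"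
  shows "\<exists>u\<in>L2 L. (\<lambda>n. l2_norm L (x n - u)) \<longlonglongrightarrow> 0"
proof -
  have "\<exists>N. \<forall>m\<ge>N. \<forall>n\<ge>N. l2_norm L (x m - x n) < (1 / 2) ^ k" for k :: nat
    by (rule cauchy) simp
  then obtain r where r: "\<And>k m n. m \<ge> r k \<Longrightarrow> n \<ge> r k \<Longrightarrow> l2_norm L (x m - x n) < (1 / 2) ^ k"
    by metis
  \<comment> \<open>Cumulative sums turn \<open>r\<close> into a sequence whose value at
    \<open>l\<close> dominates \<open>r k\<close> for every \<open>k\<close> up to
    \<open>l\<close>.\<close>
  define s where "s k = (\<Sum>i\<le>k. r i)" for k
  define y where "y k = x (s k)" for k
  have s: "r k \<le> s l" if "k \<le> l" for k l
    unfolding s_def by (rule member_le_sum) (use that in auto)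
  have ymem: "y k \<in> L2 L" for k by (simp add: y_def mem)
  have ym [measurable]: "y k \<in> borel_measurable (leb L)" for k using ymem by (rule L2_measurable)
  have yy: "l2_norm L (\<lambda>t. y l t - y k t) < (1 / 2) ^ k" if "k \<le> l" for k l
    using r[of k "s l" "s k"] s[OF that] s[OF order_refl, of k] by (simp add: y_def fun_diff_def)
  define d where "d k t = cmod (y (Suc k) t - y k t)" for k t
  have dm [measurable]: "d k \<in> borel_measurable (leb L)" for k unfolding d_def by measurable
  have dI: "(\<integral>\<^sup>+ t. ennreal (d k t) \<partial>leb L) \<le> ennreal (sqrt L * (1 / 2) ^ k)" for k
  proof -
    have D: "(\<lambda>t. y (Suc k) t - y k t) \<in> L2 L" by (intro L2_diff ymem)
    have "(\<integral>\<^sup>+ t. ennreal (d k t) \<partial>leb L) = ennreal (LINT t|leb L. d k t)"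
      unfolding d_def by (intro nn_integral_eq_integral integrable_norm L2_integrable D) auto
    moreover have "(LINT t|leb L. d k t) \<le> sqrt L * l2_norm L (\<lambda>t. y (Suc k) t - y k t)"
      unfolding d_def by (rule L2_norm_integral_le[OF L D])
    moreover have "\<dots> \<le> sqrt L * (1 / 2) ^ k"
      using yy[of k "Suc k"] L by (intro mult_left_mono) auto
    ultimately show ?thesis by (metis ennreal_leI order_trans)
  qed
  have "(\<integral>\<^sup>+ t. (\<Sum>k. ennreal (d k t)) \<partial>leb L) = (\<Sum>k. \<integral>\<^sup>+ t. ennreal (d k t) \<partial>leb L)"
    by (rule nn_integral_suminf) simp
  also have "\<dots> \<le> (\<Sum>k. ennreal (sqrt L * (1 / 2) ^ k))"
    by (intro suminf_le dI) auto
  also have "\<dots> = ennreal (\<Sum>k. sqrt L * (1 / 2) ^ k)"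
    by (rule suminf_ennreal2) (use L in \<open>auto intro!: summable_mult summable_geometric\<close>)
  finally have "(\<integral>\<^sup>+ t. (\<Sum>k. ennreal (d k t)) \<partial>leb L) \<noteq> \<infinity>"
    by (metis ennreal_less_top infinity_ennreal_def not_le top.extremum_uniqueI)
  then have fin: "AE t in leb L. (\<Sum>k. ennreal (d k t)) \<noteq> \<infinity>"
    by (intro nn_integral_PInf_AE) auto
  have conv: "AE t in leb L. convergent (\<lambda>k. y k t)"
    using fin
  proof (rule AE_mp, intro AE_I2 impI)
    fix t assume "(\<Sum>k. ennreal (d k t)) \<noteq> \<infinity>"
    then have "summable (\<lambda>k. d k t)" by (intro summable_suminf_not_top) (auto simp: d_def)
    then have "summable (\<lambda>k. y (Suc k) t - y k t)" unfolding d_def by (rule summable_norm_cancel)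
    then have "convergent (\<lambda>n. \<Sum>k<n. y (Suc k) t - y k t)" by (simp add: summable_iff_convergent)
    moreover have "(\<Sum>k<n. y (Suc k) t - y k t) = y n t - y 0 t" for n by (induction n) auto
    ultimately have "convergent (\<lambda>n. y n t - y 0 t)" by simp
    then show "convergent (\<lambda>k. y k t)"
      using convergent_add[OF _ convergent_const[of "y 0 t"], of "\<lambda>n. y n t - y 0 t"] by simp
  qed
  define u where "u t = lim (\<lambda>k. y k t)" for t
  have um [measurable]: "u \<in> borel_measurable (leb L)" unfolding u_def by measurable
  have lim: "AE t in leb L. (\<lambda>k. y k t) \<longlonglongrightarrow> u t"
    using conv by (rule AE_mp) (auto simp: u_def convergent_LIMSEQ_iff)
  have uy: "(\<integral>\<^sup>+ t. ennreal ((cmod (u t - y k t))\<^sup>2) \<partial>leb L) \<le> ennreal (((1 / 2) ^ k)\<^sup>2)" for k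
  proof -
    have "(\<integral>\<^sup>+ t. ennreal ((cmod (u t - y k t))\<^sup>2) \<partial>leb L)
        = (\<integral>\<^sup>+ t. liminf (\<lambda>l. ennreal ((cmod (y l t - y k t))\<^sup>2)) \<partial>leb L)"
    proof (rule nn_integral_cong_AE, use lim in \<open>rule AE_mp\<close>, intro AE_I2 impI)
      fix t assume "(\<lambda>l. y l t) \<longlonglongrightarrow> u t"
      then have "(\<lambda>l. ennreal ((cmod (y l t - y k t))\<^sup>2)) \<longlonglongrightarrow> ennreal ((cmod (u t - y k t))\<^sup>2)"
        by (intro tendsto_intros)
      then show "ennreal ((cmod (u t - y k t))\<^sup>2) = liminf (\<lambda>l. ennreal ((cmod (y l t - y k t))\<^sup>2))"
        by (intro lim_imp_Liminf[symmetric]) auto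
    qed
    also have "\<dots> \<le> liminf (\<lambda>l. \<integral>\<^sup>+ t. ennreal ((cmod (y l t - y k t))\<^sup>2) \<partial>leb L)"
      by (rule nn_integral_liminf) measurable
    also have "\<dots> \<le> limsup (\<lambda>l. \<integral>\<^sup>+ t. ennreal ((cmod (y l t - y k t))\<^sup>2) \<partial>leb L)"
      by (rule Liminf_le_Limsup) simp
    also have "\<dots> \<le> ennreal (((1 / 2) ^ k)\<^sup>2)"
    proof (rule Limsup_bounded, rule eventually_sequentiallyI[of k])
      fix l assume "k \<le> l"
      have D: "(\<lambda>t. y l t - y k t) \<in> L2 L" by (intro L2_diff ymem)
      have "(\<integral>\<^sup>+ t. ennreal ((cmod (y l t - y k t))\<^sup>2) \<partial>leb L) = ennreal ((l2_norm L (\<lambda>t. y l t - y k t))\<^sup>2)"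
        unfolding l2_norm_sq by (intro nn_integral_eq_integral L2_integrable_sq D) auto
      also have "\<dots> \<le> ennreal (((1 / 2) ^ k)\<^sup>2)"
        using yy[OF \<open>k \<le> l\<close>] by (intro ennreal_leI power_mono) auto
      finally show "(\<integral>\<^sup>+ t. ennreal ((cmod (y l t - y k t))\<^sup>2) \<partial>leb L) \<le> ennreal (((1 / 2) ^ k)\<^sup>2)" .
    qed
    finally show ?thesis .
  qed
  have uyL: "(\<lambda>t. u t - y k t) \<in> L2 L" for k
  proof (rule L2_I)
    show "integrable (leb L) (\<lambda>t. (cmod (u t - y k t))\<^sup>2)"
      unfolding integrable_iff_bounded using uy[of k] by (auto simp: le_less_trans[OF _ ennreal_less_top])
  qed measurable
  have uL: "u \<in> L2 L" using L2_add[OF uyL[of 0] ymem[of 0]] by simp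
  have uy': "l2_norm L (y k - u) \<le> (1 / 2) ^ k" for k
  proof (rule power2_le_imp_le)
    have "ennreal ((l2_norm L (\<lambda>t. u t - y k t))\<^sup>2) = (\<integral>\<^sup>+ t. ennreal ((cmod (u t - y k t))\<^sup>2) \<partial>leb L)"
      unfolding l2_norm_sq by (intro nn_integral_eq_integral[symmetric] L2_integrable_sq uyL) auto
    then have "ennreal ((l2_norm L (\<lambda>t. u t - y k t))\<^sup>2) \<le> ennreal (((1 / 2) ^ k)\<^sup>2)"
      using uy[of k] by (simp only:)
    then have "(l2_norm L (\<lambda>t. u t - y k t))\<^sup>2 \<le> ((1 / 2) ^ k)\<^sup>2"
      by (subst (asm) ennreal_le_iff) auto
    then show "(l2_norm L (y k - u))\<^sup>2 \<le> ((1 / 2) ^ k)\<^sup>2"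
      by (simp add: l2_norm_def norm_minus_commute)
  qed simp
  interpret seminormed_space "L2 L" "l2_norm L" by (rule seminormed_space_L2)
  have "(\<lambda>n. l2_norm L (x n - u)) \<longlonglongrightarrow> 0"
  proof (rule LIMSEQ_I)
    fix e :: real assume "e > 0"
    obtain k where k: "(1 / 2 :: real) ^ k < e / 2"
      using real_arch_pow_inv[of "e / 2" "1 / 2"] \<open>e > 0\<close> by auto
    have "l2_norm L (x n - u) < e" if "n \<ge> r k" for n
    proof -
      have "l2_norm L (x n - u) \<le> l2_norm L (x n - y k) + l2_norm L (y k - u)"
        by (rule nm_triangle[OF mem ymem uL])
      moreover have "l2_norm L (x n - y k) < (1 / 2) ^ k"
        unfolding y_def by (rule r[OF that s[OF order_refl]])
      ultimately show ?thesis using uy'[of k] k by linarith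
    qed
    then show "\<exists>N. \<forall>n\<ge>N. norm (l2_norm L (x n - u) - 0) < e" by auto
  qed
  then show ?thesis using uL by blast
qed

lemma complete_seminormed_space_L2:
  assumes "0 \<le> L"
  shows "complete_seminormed_space (L2 L) (l2_norm L)"
proof -
  interpret seminormed_space "L2 L" "l2_norm L" by (rule seminormed_space_L2)
  show ?thesis by unfold_locales (rule L2_complete[OF _ assms])
qed

text \<open>Radial truncation at modulus \<open>k\<close>. For \<open>k > 0\<close> it is a
  continuous function of the value of \<open>f\<close>, so \<open>L2_approx_continuous\<close> can
  apply it to continuous approximations as well.\<close>

lemma L2_clip_tendsto:
  assumes "f \<in> L2 L"
  shows "(\<lambda>k. l2_norm L (\<lambda>x. f x - (real k / max (real k) (cmod (f x))) *\<^sub>R f x)) \<longlonglongrightarrow> 0"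
proof (rule l2_norm_tendsto_dominated[where w = "\<lambda>x. (cmod (f x))\<^sup>2"])
  have [measurable]: "f \<in> borel_measurable (leb L)" using assms by (rule L2_measurable)
  show "(\<lambda>x. f x - (real k / max (real k) (cmod (f x))) *\<^sub>R f x) \<in> borel_measurable (leb L)" for k
    by measurable
  show "AE x in leb L. (\<lambda>k. f x - (real k / max (real k) (cmod (f x))) *\<^sub>R f x) \<longlonglongrightarrow> 0"
  proof (rule AE_I2)
    fix x
    obtain K where K: "cmod (f x) < real K" using reals_Archimedean2 by blast
    have "f x - (real k / max (real k) (cmod (f x))) *\<^sub>R f x = 0" if "k \<ge> K" for k
    proof -
      have "max (real k) (cmod (f x)) = real k" "real k > 0"
        using K that norm_ge_zero[of "f x"] by linarith+
      then show ?thesis by simp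
    qed
    then show "(\<lambda>k. f x - (real k / max (real k) (cmod (f x))) *\<^sub>R f x) \<longlonglongrightarrow> 0"
      by (intro tendsto_eventually eventually_sequentiallyI)
  qed
  show "AE x in leb L. (cmod (f x - (real k / max (real k) (cmod (f x))) *\<^sub>R f x))\<^sup>2 \<le> (cmod (f x))\<^sup>2" for k
  proof (rule AE_I2, rule power_mono)
    fix x
    define q where "q = real k / max (real k) (cmod (f x))"
    have q: "0 \<le> q" "q \<le> 1" unfolding q_def by (auto simp: divide_le_eq_1)
    have "f x - q *\<^sub>R f x = (1 - q) *\<^sub>R f x" by (simp add: scaleR_left_diff_distrib)
    then have "cmod (f x - q *\<^sub>R f x) = (1 - q) * cmod (f x)" using q by simp
    also have "\<dots> \<le> cmod (f x)" using q by (simp add: mult_left_le_one_le)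
    finally show "cmod (f x - (real k / max (real k) (cmod (f x))) *\<^sub>R f x) \<le> cmod (f x)"
      by (simp add: q_def)
  qed simp
qed (rule L2_integrable_sq[OF assms])

text \<open>Truncation makes dominated convergence available. After \<open>f\<close> is truncated at
  \<open>k\<close>, continuous functions that converge to it almost everywhere are truncated at the
  same level and multiplied by a cutoff, and all differences stay below
  \<open>2 * k\<close>.\<close>

lemma L2_approx_continuous:
  assumes L: "0 < L" and f: "f \<in> L2 L" and e: "0 < e"
  obtains g a b where "continuous_on UNIV g" "0 < a" "a < b" "b < L" "\<And>x. x \<notin> {a..b} \<Longrightarrow> g x = 0"
    "l2_norm L (\<lambda>x. f x - g x) < e"
proof -
  have [measurable]: "f \<in> borel_measurable (leb L)" using f by (rule L2_measurable)
  define cl where "cl k z = (real k / max (real k) (cmod z)) *\<^sub>R z" for k z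
  have cl_le: "cmod (cl k z) \<le> real k" for k z
  proof -
    have "cmod (cl k z) = real k * (cmod z / max (real k) (cmod z))" by (simp add: cl_def)
    also have "\<dots> \<le> real k * 1" by (intro mult_left_mono) (auto simp: divide_le_eq_1)
    finally show ?thesis by simp
  qed
  have cl_cont: "continuous_on UNIV (cl k)" if "k > 0" for k
    unfolding cl_def using that by (intro continuous_intros) (auto simp: max_def)
  from order_tendstoD(2)[OF L2_clip_tendsto[OF f], of "e / 2"] e
  have "\<forall>\<^sub>F k in sequentially. l2_norm L (\<lambda>x. f x - cl k (f x)) < e / 2 \<and> 0 < k"
    unfolding cl_def by (intro eventually_conj eventually_gt_at_top) auto
  then obtain k where k: "l2_norm L (\<lambda>x. f x - cl k (f x)) < e / 2" "0 < k"
    using eventually_happens by force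
  have clm: "cl k \<in> borel_measurable borel"
    using cl_cont[OF k(2)] by (rule borel_measurable_continuous_onI)
  define f0 where "f0 x = (if x \<in> {0<..<L} then f x else 0)" for x
  have "f0 \<in> borel_measurable lebesgue"
    unfolding f0_def by (subst borel_measurable_if) auto
  then have "f0 measurable_on UNIV" by (rule lebesgue_measurable_imp_measurable_on) simp
  then obtain N g where N: "negligible N" and gc: "\<And>n. continuous_on UNIV (g n)"
    and gl: "\<And>x. x \<notin> N \<Longrightarrow> (\<lambda>n. g n x) \<longlonglongrightarrow> f0 x"
    unfolding measurable_on_def by auto
  \<comment> \<open>A trapezoid: zero within distance \<open>1 / n\<close> of the end points and one
    beyond distance \<open>2 / n\<close>.\<close>
  define cut where "cut n x = max 0 (min 1 (real n * min x (L - x) - 1))" for n :: nat and x :: real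
  have cutc: "continuous_on UNIV (cut n)" for n unfolding cut_def by (intro continuous_intros)
  have cut01: "0 \<le> cut n x" "cut n x \<le> 1" for n x by (auto simp: cut_def)
  define h where "h n x = cut n x *\<^sub>R cl k (g n x)" for n x
  have hc: "continuous_on UNIV (h n)" for n
    unfolding h_def
    by (intro continuous_on_scaleR cutc continuous_on_compose2[OF cl_cont[OF k(2)] gc]) simp
  have hm: "h n \<in> borel_measurable (leb L)" for n
    by (rule continuous_imp_measurable_on_sets_lebesgue[OF continuous_on_subset[OF hc]]) auto
  have cfm: "(\<lambda>x. cl k (f x)) \<in> borel_measurable (leb L)"
    by (rule measurable_compose[OF _ clm]) measurable
  have clim: "(\<lambda>n. l2_norm L (\<lambda>x. cl k (f x) - h n x)) \<longlonglongrightarrow> 0"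
  proof (rule l2_norm_tendsto_dominated[where w = "\<lambda>x. (2 * real k)\<^sup>2"])
    interpret finite_measure "leb L" by (rule finite_measure_leb)
    show "integrable (leb L) (\<lambda>x. (2 * real k)\<^sup>2)" by simp
    show "(\<lambda>x. cl k (f x) - h n x) \<in> borel_measurable (leb L)" for n
      using hm cfm by (intro borel_measurable_diff)
    have "AE x in lebesgue. x \<notin> N"
      using N by (auto simp: negligible_iff_null_sets intro: AE_not_in)
    then have "AE x in leb L. x \<notin> N"
      by (auto simp: AE_restrict_space_iff elim: AE_mp)
    then show "AE x in leb L. (\<lambda>n. cl k (f x) - h n x) \<longlonglongrightarrow> 0"
    proof (rule AE_mp, intro AE_I2 impI)
      fix x assume x: "x \<in> space (leb L)" "x \<notin> N"
      have x': "0 < x" "x < L" using x by auto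
      have "(\<lambda>n. cl k (g n x)) \<longlonglongrightarrow> cl k (f0 x)"
        by (rule continuous_on_tendsto_compose[OF cl_cont[OF k(2)] gl[OF x(2)]]) auto
      moreover obtain n0 where n0: "2 / min x (L - x) < real n0" using reals_Archimedean2 by blast
      have "cut n x = 1" if "n \<ge> n0" for n
      proof -
        have "2 < real n0 * min x (L - x)" using n0 x' by (simp add: divide_less_eq split: if_splits)
        also have "\<dots> \<le> real n * min x (L - x)" using that x' by (intro mult_right_mono) auto
        finally show ?thesis by (simp add: cut_def)
      qed
      then have "(\<lambda>n. cut n x) \<longlonglongrightarrow> 1"
        by (intro tendsto_eventually eventually_sequentiallyI)
      ultimately have "(\<lambda>n. cl k (f x) - h n x) \<longlonglongrightarrow> cl k (f x) - 1 *\<^sub>R cl k (f0 x)"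
        unfolding h_def by (intro tendsto_intros)
      then show "(\<lambda>n. cl k (f x) - h n x) \<longlonglongrightarrow> 0" using x' by (simp add: f0_def)
    qed
    show "AE x in leb L. (cmod (cl k (f x) - h n x))\<^sup>2 \<le> (2 * real k)\<^sup>2" for n
    proof (rule AE_I2, rule power_mono)
      fix x
      have "cmod (h n x) \<le> 1 * real k"
        unfolding h_def norm_scaleR using cut01[of n x] cl_le by (intro mult_mono) auto
      then show "cmod (cl k (f x) - h n x) \<le> 2 * real k"
        using norm_triangle_ineq4[of "cl k (f x)" "h n x"] cl_le[of k "f x"] by linarith
    qed simp
  qed
  \<comment> \<open>\<open>3 / L < n\<close> makes the support \<open>{1 / n..L - 1 / n}\<close> a
    nondegenerate interval.\<close>
  obtain n1 where n1: "3 / L < real n1" using reals_Archimedean2 by blast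
  from order_tendstoD(2)[OF clim, of "e / 2"] e
  have "\<forall>\<^sub>F n in sequentially. l2_norm L (\<lambda>x. cl k (f x) - h n x) < e / 2 \<and> n1 < n"
    by (intro eventually_conj eventually_gt_at_top) auto
  then obtain n where n: "l2_norm L (\<lambda>x. cl k (f x) - h n x) < e / 2" "n1 < n"
    using eventually_happens by force
  have n3: "3 / L < real n" using n1 n(2) by simp
  then have npos: "0 < real n" using L by (meson divide_pos_pos less_trans zero_less_numeral)
  show ?thesis
  proof (rule that[of "h n" "1 / real n" "L - 1 / real n"])
    show "continuous_on UNIV (h n)" by (rule hc)
    show "0 < 1 / real n" "L - 1 / real n < L" using npos by auto
    show "1 / real n < L - 1 / real n" using n3 npos L by (simp add: field_simps)
    show "h n x = 0" if "x \<notin> {1 / real n..L - 1 / real n}" for x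
    proof -
      have "min x (L - x) < 1 / real n" using that by auto
      then have "real n * min x (L - x) < 1" using npos by (simp add: field_simps)
      then show ?thesis by (simp add: h_def cut_def)
    qed
    have "l2_norm L (\<lambda>x. (f x - cl k (f x)) + (cl k (f x) - h n x))
        \<le> l2_norm L (\<lambda>x. f x - cl k (f x)) + l2_norm L (\<lambda>x. cl k (f x) - h n x)"
    proof (rule l2_norm_triangle)
      have 1: "(\<lambda>x. cl k (f x)) \<in> L2 L"
        using l2_norm_bounded(1)[OF _ cfm] L cl_le by force
      have 2: "h n \<in> L2 L"
      proof (rule l2_norm_bounded(1)[OF _ hm])
        show "cmod (h n x) \<le> 1 * real k" for x
          unfolding h_def norm_scaleR using cut01[of n x] cl_le by (intro mult_mono) auto
      qed (use L in simp)
      show "(\<lambda>x. f x - cl k (f x)) \<in> L2 L" "(\<lambda>x. cl k (f x) - h n x) \<in> L2 L"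
        using 1 2 f by (auto intro: L2_diff)
    qed
    then show "l2_norm L (\<lambda>x. f x - h n x) < e" using k n by simp
  qed
qed

section \<open>Weak derivatives and absolutely continuous representatives\<close>

lemma continuous_leb_measurable:
  "continuous_on {0..L} f \<Longrightarrow> f \<in> borel_measurable (leb L)"
  by (rule continuous_imp_measurable_on_sets_lebesgue[OF continuous_on_subset[of "{0..L}"]]) auto

lemma continuous_L2:
  assumes "0 \<le> L" "continuous_on {0..L} f"
  shows "f \<in> L2 L"
proof -
  have "bounded (f ` {0..L})"
    using assms by (intro compact_imp_bounded compact_continuous_image) auto
  then obtain B where "\<forall>y\<in>f ` {0..L}. cmod y \<le> B"
    unfolding bounded_iff by blast
  then have "cmod (f x) \<le> B" if "x \<in> {0<..<L}" for x using that by simp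
  then show ?thesis
    using l2_norm_bounded(1)[OF assms(1) continuous_leb_measurable[OF assms(2)]] by blast
qed

lemma AE_leb_negligible:
  assumes "AE x in leb L. P x"
  obtains N where "negligible N" "\<And>x. x \<in> {0..L} - N \<Longrightarrow> P x"
proof -
  have "AE x in lebesgue. x \<in> {0<..<L} \<longrightarrow> P x"
    using assms by (subst (asm) AE_restrict_space_iff) auto
  then obtain N where N: "N \<in> null_sets lebesgue" "{x \<in> space lebesgue. \<not> (x \<in> {0<..<L} \<longrightarrow> P x)} \<subseteq> N"
    by (rule AE_E3) auto
  \<comment> \<open>The measure \<open>leb L\<close> lives on the open interval, so the end points
    are added to the exceptional set.\<close>
  show ?thesis
  proof (rule that[of "N \<union> {0, L}"])
    show "negligible (N \<union> {0, L})" using N(1) by (simp add: negligible_iff_null_sets[symmetric])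
    show "P x" if "x \<in> {0..L} - (N \<union> {0, L})" for x
    proof (rule ccontr)
      assume "\<not> P x"
      then have "x \<in> {x \<in> space lebesgue. \<not> (x \<in> {0<..<L} \<longrightarrow> P x)}" using that by simp
      then show False using N(2) that by blast
    qed
  qed
qed

lemma negligible_AE_leb:
  assumes "negligible N" "\<And>x. x \<in> {0<..<L} - N \<Longrightarrow> P x"
  shows "AE x in leb L. P x"
proof -
  have "AE x in lebesgue. x \<notin> N"
    using assms(1) by (auto simp: negligible_iff_null_sets intro: AE_not_in)
  then have "AE x in lebesgue. x \<in> {0<..<L} \<longrightarrow> P x"
    by (rule AE_mp) (use assms(2) in auto)
  then show ?thesis by (subst AE_restrict_space_iff) auto
qed

lemma L2_abs_integrable:
  assumes "f \<in> L2 L"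
  shows "f absolutely_integrable_on {0..L}"
proof -
  have "f absolutely_integrable_on {0<..<L}"
    using L2_integrable[OF assms] unfolding set_integrable_def
    by (subst (asm) integrable_restrict_space) auto
  then show ?thesis using absolutely_integrable_on_open_interval[where f = f and a = 0 and b = L] by simp
qed

lemma L2_integrable_on:
  assumes "f \<in> L2 L" "x \<le> L"
  shows "f integrable_on {0..x}"
proof -
  have "f absolutely_integrable_on {0..x}"
    by (rule absolutely_integrable_on_subinterval[OF L2_abs_integrable[OF assms(1)]]) (use assms in auto)
  then show ?thesis by (rule set_lebesgue_integral_eq_integral(1))
qed

lemma leb_integral_eq:
  fixes f :: "real \<Rightarrow> 'a::euclidean_space"
  assumes "integrable (leb L) f"
  shows "(LINT x|leb L. f x) = integral {0..L} f"
  using lebesgue_integral_eq_integral[OF assms] by (simp add: integral_open_interval_real)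

lemma L2_integral_le:
  assumes "f \<in> L2 L" "x \<in> {0..L}"
  shows "cmod (integral {0..x} f) \<le> sqrt L * l2_norm L f"
proof -
  have n: "(\<lambda>t. cmod (f t)) integrable_on {0..L}"
    using L2_abs_integrable[OF assms(1)] by (rule absolutely_integrable_on_def[THEN iffD1, THEN conjunct2])
  have n': "(\<lambda>t. cmod (f t)) integrable_on {0..x}"
    by (rule integrable_on_subinterval[OF n]) (use assms in auto)
  have "cmod (integral {0..x} f) \<le> integral {0..x} (\<lambda>t. cmod (f t))"
    using L2_integrable_on[OF assms(1), of x] n' assms(2) by (intro integral_norm_bound_integral) auto
  also have "\<dots> \<le> integral {0..L} (\<lambda>t. cmod (f t))"
    using n n' assms(2) by (intro integral_subset_le) auto
  also have "\<dots> = (LINT t|leb L. cmod (f t))"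
    using L2_integrable[OF assms(1)] by (intro leb_integral_eq[symmetric]) auto
  also have "\<dots> \<le> sqrt L * l2_norm L f" by (rule L2_norm_integral_le) (use assms in auto)
  finally show ?thesis .
qed

lemma integral_AE_cong:
  assumes "AE t in leb L. f t = g t" "x \<le> L"
  shows "integral {0..x} f = integral {0..x} (g :: real \<Rightarrow> complex)"
proof -
  obtain N where N: "negligible N" "\<And>x. x \<in> {0..L} - N \<Longrightarrow> f x = g x"
    using AE_leb_negligible[OF assms(1)] by blast
  show ?thesis by (rule integral_spike[OF N(1)]) (use N(2) assms(2) in auto)
qed

text \<open>An open null set is empty, which settles the open interval; continuity then reaches the
  end points.\<close>

lemma continuous_AE_eq:
  assumes L: "0 < L" and c: "continuous_on {0..L} F" "continuous_on {0..L} G"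
    and e: "AE x in leb L. F x = (G x :: complex)" and x: "x \<in> {0..L}"
  shows "F x = G x"
proof -
  obtain N where N: "negligible N" "\<And>x. x \<in> {0..L} - N \<Longrightarrow> F x = G x"
    using AE_leb_negligible[OF e] by blast
  let ?U = "{0<..<L} \<inter> (\<lambda>x. F x - G x) -` (- {0})"
  have "open ?U"
    by (rule continuous_open_preimage) (auto intro!: continuous_intros continuous_on_subset[OF c(1)] continuous_on_subset[OF c(2)])
  moreover have "negligible ?U" by (rule negligible_subset[OF N(1)]) (use N(2) in force)
  ultimately have "?U = {}" using open_not_negligible by blast
  then have "F y - G y = 0" if "y \<in> {0<..<L}" for y using that by auto
  moreover have "closure {0<..<L} = {0..L}" using L by simp
  ultimately have "F x - G x = 0"
    using continuous_constant_on_closure[of "{0<..<L}" "\<lambda>x. F x - G x" 0 x] x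
    by (auto intro: continuous_intros c)
  then show ?thesis by simp
qed

text \<open>\<open>F\<close> is absolutely continuous on [0, L] with derivative \<open>w\<close> in
  L2, in integrated form. The equation holds at every point and not just almost everywhere, so
  boundary values are the plain values \<open>F 0\<close> and \<open>F L\<close>.\<close>

definition is_prim :: "real \<Rightarrow> (real \<Rightarrow> complex) \<Rightarrow> (real \<Rightarrow> complex) \<Rightarrow> bool"
  where "is_prim L F w \<longleftrightarrow> w \<in> L2 L \<and> (\<forall>x\<in>{0..L}. F x = F 0 + integral {0..x} w)"

lemma is_primD: "is_prim L F w \<Longrightarrow> w \<in> L2 L" "is_prim L F w \<Longrightarrow> x \<in> {0..L} \<Longrightarrow> F x = F 0 + integral {0..x} w"
  unfolding is_prim_def by blast+

lemma is_prim_integral: "w \<in> L2 L \<Longrightarrow> is_prim L (\<lambda>x. k + integral {0..x} w) w"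
  by (simp add: is_prim_def)

lemma is_prim_continuous:
  assumes "is_prim L F w"
  shows "continuous_on {0..L} F"
proof -
  have "continuous_on {0..L} (\<lambda>x. F 0 + integral {0..x} w)"
    by (intro continuous_intros indefinite_integral_continuous_1
        L2_integrable_on[OF is_primD(1)[OF assms] order_refl])
  then show ?thesis by (rule continuous_on_eq) (simp add: is_primD(2)[OF assms, symmetric])
qed

lemma is_prim_L2: "0 \<le> L \<Longrightarrow> is_prim L F w \<Longrightarrow> F \<in> L2 L"
  by (intro continuous_L2 is_prim_continuous)

lemma is_prim_AE_cong:
  assumes "is_prim L F w" "AE x in leb L. w x = w' x"
  shows "is_prim L F w'"
  unfolding is_prim_def
proof (intro conjI ballI)
  show "w' \<in> L2 L" by (rule L2_AE[OF is_primD(1)[OF assms(1)] assms(2)])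
  fix x assume x: "x \<in> {0..L}"
  show "F x = F 0 + integral {0..x} w'"
    using is_primD(2)[OF assms(1) x] integral_AE_cong[OF assms(2), of x] x by simp
qed

lemma is_prim_add:
  assumes "is_prim L F w" "is_prim L G v"
  shows "is_prim L (\<lambda>x. F x + G x) (\<lambda>x. w x + v x)"
  unfolding is_prim_def
proof (intro conjI ballI)
  show "(\<lambda>x. w x + v x) \<in> L2 L" by (rule L2_add[OF is_primD(1)[OF assms(1)] is_primD(1)[OF assms(2)]])
  fix x assume x: "x \<in> {0..L}"
  have "integral {0..x} (\<lambda>x. w x + v x) = integral {0..x} w + integral {0..x} v"
    using x L2_integrable_on[OF is_primD(1)[OF assms(1)], of x] L2_integrable_on[OF is_primD(1)[OF assms(2)], of x]
    by (simp add: Henstock_Kurzweil_Integration.integral_add)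
  then show "F x + G x = F 0 + G 0 + integral {0..x} (\<lambda>x. w x + v x)"
    using is_primD(2)[OF assms(1) x] is_primD(2)[OF assms(2) x] by simp
qed

lemma is_prim_cmult:
  assumes "is_prim L F w"
  shows "is_prim L (\<lambda>x. c * F x) (\<lambda>x. c * w x)"
  unfolding is_prim_def
proof (intro conjI ballI)
  show "(\<lambda>x. c * w x) \<in> L2 L" by (rule L2_cmult[OF is_primD(1)[OF assms]])
  fix x assume x: "x \<in> {0..L}"
  show "c * F x = c * F 0 + integral {0..x} (\<lambda>x. c * w x)"
    using is_primD(2)[OF assms x] by (simp add: distrib_left)
qed

lemma is_prim_diff:
  assumes "is_prim L F w" "is_prim L G v"
  shows "is_prim L (\<lambda>x. F x - G x) (\<lambda>x. w x - v x)"
  using is_prim_add[OF assms(1) is_prim_cmult[OF assms(2), of "-1"]] by simp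

lemma is_prim_const: "is_prim L (\<lambda>x. k) (\<lambda>x. 0)"
  by (simp add: is_prim_def L2_zero)

lemma is_prim_sum:
  "(\<And>i. i \<in> I \<Longrightarrow> is_prim L (F i) (w i)) \<Longrightarrow> is_prim L (\<lambda>x. \<Sum>i\<in>I. F i x) (\<lambda>x. \<Sum>i\<in>I. w i x)"
proof (induction I rule: infinite_finite_induct)
  case (insert j I)
  then have "is_prim L (F j) (w j)" "is_prim L (\<lambda>x. \<Sum>i\<in>I. F i x) (\<lambda>x. \<Sum>i\<in>I. w i x)" by auto
  from is_prim_add[OF this] show ?case using insert.hyps by simp
qed (simp_all add: is_prim_const)

lemma is_prim_bound: "is_prim L F w \<Longrightarrow> x \<in> {0..L} \<Longrightarrow> cmod (F x - F 0) \<le> sqrt L * l2_norm L w"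
  using is_primD(2)[of L F w x] L2_integral_le[of w L x] is_primD(1)[of L F w] by simp

lemma is_prim_C1:
  assumes "0 \<le> L" "\<And>x. (F has_vector_derivative w x) (at x)" "continuous_on {0..L} w"
  shows "is_prim L F w"
  unfolding is_prim_def
proof (intro conjI ballI)
  show "w \<in> L2 L" by (rule continuous_L2[OF assms(1,3)])
  fix x assume x: "x \<in> {0..L}"
  have "(w has_integral F x - F 0) {0..x}"
    by (rule fundamental_theorem_of_calculus)
      (use x assms(2) in \<open>auto intro: has_vector_derivative_at_within\<close>)
  then show "F x = F 0 + integral {0..x} w" by (simp add: integral_unique)
qed

lemma is_prim_has_derivative:
  assumes "is_prim L F w" "continuous_on {0..L} w" "x \<in> {0..L}"
  shows "(F has_vector_derivative w x) (at x within {0..L})"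
proof -
  have "((\<lambda>u. F 0 + integral {0..u} w) has_vector_derivative w x) (at x within {0..L})"
    using has_vector_derivative_add[OF has_vector_derivative_const integral_has_vector_derivative[OF assms(2,3)]]
    by simp
  then show ?thesis
    by (rule has_vector_derivative_transform[OF assms(3) is_primD(2)[OF assms(1)], rotated -1])
qed

text \<open>Lebesgue differentiation: almost every value of \<open>w\<close> is a limit of means
  over short intervals to the right, and all these means vanish for constant
  \<open>F\<close>.\<close>

lemma is_prim_zero_AE:
  assumes "is_prim L F w" "\<And>x. x \<in> {0..L} \<Longrightarrow> F x = F 0"
  shows "AE x in leb L. w x = 0"
proof -
  \<comment> \<open>Extension by zero, because the differentiation theorem asks for integrability on
    every interval.\<close>
  define v where "v x = (if x \<in> {0..L} then w x else 0)" for x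
  note w = L2_abs_integrable[OF is_primD(1)[OF assms(1)]]
  have "v absolutely_integrable_on UNIV"
    unfolding v_def using w by (simp only: absolutely_integrable_restrict_UNIV)
  then have vi: "v integrable_on cbox a b" for a b
    by (meson absolutely_integrable_on_subcbox subset_UNIV set_lebesgue_integral_eq_integral(1))
  have z: "integral {0..x} w = 0" if "x \<in> {0..L}" for x
    using is_primD(2)[OF assms(1) that] assms(2)[OF that] by simp
  have z': "integral {x..y} v = 0" if "0 \<le> x" "x \<le> y" "y \<le> L" for x y
  proof -
    have "integral {x..y} v = integral {x..y} w"
      by (rule Henstock_Kurzweil_Integration.integral_cong) (use that in \<open>auto simp: v_def\<close>)
    moreover have "integral {0..x} w + integral {x..y} w = integral {0..y} w"
      using that by (intro Henstock_Kurzweil_Integration.integral_combine L2_integrable_on[OF is_primD(1)[OF assms(1)]]) auto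
    ultimately show ?thesis using z[of x] z[of y] that by simp
  qed
  from integrable_ccontinuous_explicit[OF vi] obtain N where N: "negligible N"
    "\<And>x e. \<lbrakk>x \<notin> N; 0 < e\<rbrakk> \<Longrightarrow> \<exists>d>0. \<forall>h. 0 < h \<and> h < d \<longrightarrow>
        norm (integral (cbox x (x + h *\<^sub>R One)) v /\<^sub>R h ^ DIM(real) - v x) < e" by blast
  show ?thesis
  proof (rule negligible_AE_leb[OF N(1)])
    fix x assume x: "x \<in> {0<..<L} - N"
    have "norm (w x) \<le> e" if e: "e > 0" for e
    proof -
      obtain d where d: "d > 0" "\<And>h. 0 < h \<Longrightarrow> h < d \<Longrightarrow>
          norm (integral {x..x + h} v /\<^sub>R h - v x) < e"
        using N(2)[of x e] x e by auto
      \<comment> \<open>Keeps the window inside [0, L], where the integrals of \<open>v\<close> are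
        known to vanish.\<close>
      define h where "h = min (d / 2) (L - x)"
      have h: "0 < h" "h < d" "x + h \<le> L" using d(1) x by (auto simp: h_def)
      show ?thesis using d(2)[OF h(1,2)] z'[of x "x + h"] h x by (simp add: v_def)
    qed
    then have "norm (w x) \<le> 0" by (rule field_le_epsilon[of _ 0, simplified]) 
    then show "w x = 0" by simp
  qed
qed

section \<open>Weak derivatives and the lemma of du Bois-Reymond\<close>

lemma nonneg_zero_if_le_eps:
  fixes a C :: real
  assumes "0 \<le> a" "\<And>e. e > 0 \<Longrightarrow> a \<le> C * e"
  shows "a = 0"
proof -
  have "((\<lambda>e. C * e) \<longlongrightarrow> C * 0) (at_right 0)"
    by (intro tendsto_intros)
  moreover have "\<forall>\<^sub>F e in at_right 0. a \<le> C * e"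
    using eventually_at_right_less[of 0] by (rule eventually_mono) (rule assms(2))
  ultimately have "a \<le> C * 0"
    by (rule tendsto_lowerbound) simp
  then show ?thesis using assms(1) by simp
qed

text \<open>With a continuous \<open>g\<close> near \<open>w\<close> in L2, the primitive
  \<open>G\<close> of \<open>g\<close> is continuously differentiable and classical integration by
  parts applies to it. Both the change from \<open>F\<close> to \<open>G\<close> and that from
  \<open>w\<close> to \<open>g\<close> cost a multiple of \<open>e\<close>.\<close>

lemma is_prim_weak_deriv:
  assumes L: "0 < L" and F: "is_prim L F w"
  shows "weak_deriv L F w"
  unfolding weak_deriv_def
proof (intro allI impI, elim conjE exE)
  fix \<psi> \<psi>' :: "real \<Rightarrow> real" and a b
  assume d: "\<forall>x. (\<psi> has_real_derivative \<psi>' x) (at x)" and c: "continuous_on UNIV \<psi>'"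
    and ab: "0 < a" "b < L" and z: "\<forall>x. x \<notin> {a..b} \<longrightarrow> \<psi> x = 0"
  have c\<psi>: "continuous_on S \<psi>" for S
    using d by (meson DERIV_isCont continuous_at_imp_continuous_on)
  define p where "p x = complex_of_real (\<psi> x)" for x
  define p' where "p' x = complex_of_real (\<psi>' x)" for x
  have cp: "continuous_on {0..L} p" "continuous_on {0..L} p'"
    unfolding p_def p'_def by (intro continuous_intros c\<psi> continuous_on_subset[OF c] subset_UNIV)+
  have pL2: "p \<in> L2 L" "p' \<in> L2 L" using cp L by (auto intro: continuous_L2)
  have dp: "(p has_vector_derivative p' x) (at x)" for x
    unfolding p_def p'_def
    using d by (intro has_vector_derivative_of_real) (simp add: has_real_derivative_iff_has_vector_derivative)
  have FL2: "F \<in> L2 L" using is_prim_L2[OF _ F] L by simp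
  have wL2: "w \<in> L2 L" by (rule is_primD(1)[OF F])
  have "cmod ((LINT x|leb L. F x * p' x) + (LINT x|leb L. w x * p x))
      \<le> (L * l2_norm L p' + l2_norm L p) * e" if e: "e > 0" for e
  proof -
    obtain g where g: "continuous_on UNIV g" "l2_norm L (\<lambda>x. w x - g x) < e"
      using L2_approx_continuous[OF L wL2 e] by metis
    have cg: "continuous_on {0..L} g" using g(1) by (rule continuous_on_subset) simp
    have gL2: "g \<in> L2 L" using continuous_L2[OF _ cg] L by simp
    define G where "G x = F 0 + integral {0..x} g" for x
    have G: "is_prim L G g" unfolding G_def by (rule is_prim_integral[OF gL2])
    have GL2: "G \<in> L2 L" using is_prim_L2[OF _ G] L by simp
    have "((\<lambda>x. G x * p' x + g x * p x) has_integral G L * p L - G 0 * p 0) {0..L}"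
    proof (rule fundamental_theorem_of_calculus)
      show "((\<lambda>x. G x * p x) has_vector_derivative G x * p' x + g x * p x) (at x within {0..L})"
        if "x \<in> {0..L}" for x
        by (rule has_vector_derivative_mult[OF is_prim_has_derivative[OF G cg that]
              has_vector_derivative_at_within[OF dp]])
    qed (use L in simp)
    moreover have "p L = 0" "p 0 = 0" using z ab by (auto simp: p_def)
    ultimately have "integral {0..L} (\<lambda>x. G x * p' x + g x * p x) = 0" by (simp add: integral_unique)
    moreover have "integrable (leb L) (\<lambda>x. G x * p' x + g x * p x)"
      by (intro Bochner_Integration.integrable_add L2_integrable_mult GL2 gL2 pL2)
    ultimately have "(LINT x|leb L. G x * p' x + g x * p x) = 0" by (simp add: leb_integral_eq)
    then have Gz: "(LINT x|leb L. G x * p' x) + (LINT x|leb L. g x * p x) = 0"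
      using L2_integrable_mult[OF GL2 pL2(2)] L2_integrable_mult[OF gL2 pL2(1)] by simp
    have FG: "l2_norm L (\<lambda>x. F x - G x) \<le> L * e"
    proof -
      have pr: "is_prim L (\<lambda>x. F x - G x) (\<lambda>x. w x - g x)" by (rule is_prim_diff[OF F G])
      have "cmod (F x - G x) \<le> sqrt L * e" if x: "x \<in> {0<..<L}" for x
      proof -
        have "cmod (F x - G x) \<le> sqrt L * l2_norm L (\<lambda>x. w x - g x)"
          using is_prim_bound[OF pr, of x] x by (simp add: G_def)
        also have "\<dots> \<le> sqrt L * e" using g(2) L by (intro mult_left_mono) auto
        finally show ?thesis .
      qed
      then have "l2_norm L (\<lambda>x. F x - G x) \<le> \<bar>sqrt L * e\<bar> * sqrt L"
        using L L2_measurable[OF L2_diff[OF FL2 GL2]] by (intro l2_norm_bounded(2)) auto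
      moreover have "\<bar>sqrt L * e\<bar> * sqrt L = (sqrt L * sqrt L) * e" using L e by (simp add: abs_mult)
      ultimately show ?thesis using L by simp
    qed
    have "(LINT x|leb L. F x * p' x) + (LINT x|leb L. w x * p x)
        = ((LINT x|leb L. F x * p' x) - (LINT x|leb L. G x * p' x)) + ((LINT x|leb L. w x * p x) - (LINT x|leb L. g x * p x))"
      using Gz by (simp add: algebra_simps)
    also have "\<dots> = (LINT x|leb L. (F x - G x) * p' x) + (LINT x|leb L. (w x - g x) * p x)"
      using L2_integrable_mult[OF FL2 pL2(2)] L2_integrable_mult[OF GL2 pL2(2)]
        L2_integrable_mult[OF wL2 pL2(1)] L2_integrable_mult[OF gL2 pL2(1)]
      by (simp add: left_diff_distrib)
    also have "cmod \<dots> \<le> l2_norm L (\<lambda>x. F x - G x) * l2_norm L p' + l2_norm L (\<lambda>x. w x - g x) * l2_norm L p"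
      by (intro order_trans[OF norm_triangle_ineq] add_mono L2_cauchy_schwarz L2_diff FL2 GL2 wL2 gL2 pL2)
    also have "\<dots> \<le> (L * e) * l2_norm L p' + e * l2_norm L p"
      using FG g(2) by (intro add_mono mult_right_mono) auto
    finally show ?thesis by (simp add: algebra_simps)
  qed
  then have "cmod ((LINT x|leb L. F x * p' x) + (LINT x|leb L. w x * p x)) = 0"
    by (rule nonneg_zero_if_le_eps[OF norm_ge_zero])
  then show "(LINT x|leb L. F x * complex_of_real (\<psi>' x)) = - (LINT x|leb L. w x * complex_of_real (\<psi> x))"
    by (simp add: p_def p'_def eq_neg_iff_add_eq_0)
qed

text \<open>For \<open>g\<close> close to the conjugate of \<open>u\<close>, the squared norm of
  \<open>u\<close> is the integral of u (cnj u - g), hence arbitrarily small. Real and imaginary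
  part of \<open>g\<close> enter separately because the test functions are real.\<close>

lemma L2_orthogonal_zero:
  assumes L: "0 < L" and u: "u \<in> L2 L"
    and z: "\<And>g a b. continuous_on UNIV g \<Longrightarrow> 0 < a \<Longrightarrow> a < b \<Longrightarrow> b < L \<Longrightarrow> (\<And>x. x \<notin> {a..b} \<Longrightarrow> g x = 0) \<Longrightarrow>
      (LINT x|leb L. u x * complex_of_real (g x)) = 0"
  shows "AE x in leb L. u x = 0"
proof -
  have "(l2_norm L u)\<^sup>2 \<le> l2_norm L u * e" if e: "e > 0" for e
  proof -
    obtain g a b where g: "continuous_on UNIV g" "0 < a" "a < b" "b < L" "\<And>x. x \<notin> {a..b} \<Longrightarrow> g x = 0"
      and ge: "l2_norm L (\<lambda>x. cnj (u x) - g x) < e"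
      using L2_approx_continuous[OF L L2_cnj[OF u] e] by metis
    have gL2: "g \<in> L2 L" using L continuous_on_subset[OF g(1)] by (intro continuous_L2) auto
    have re: "(\<lambda>x. complex_of_real (Re (g x))) \<in> L2 L" "(\<lambda>x. complex_of_real (Im (g x))) \<in> L2 L"
      using L continuous_on_subset[OF g(1)] by (auto intro!: continuous_L2 continuous_intros)
    have 1: "(LINT x|leb L. u x * complex_of_real (Re (g x))) = 0"
      by (rule z[OF _ g(2-4)]) (use g(1,5) in \<open>auto intro: continuous_intros\<close>)
    have 2: "(LINT x|leb L. u x * complex_of_real (Im (g x))) = 0"
      by (rule z[OF _ g(2-4)]) (use g(1,5) in \<open>auto intro: continuous_intros\<close>)
    have "(LINT x|leb L. u x * g x) = (LINT x|leb L. u x * complex_of_real (Re (g x)) + \<i> * (u x * complex_of_real (Im (g x))))"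
      by (rule Bochner_Integration.integral_cong) (auto simp: complex_eq_iff algebra_simps)
    also have "\<dots> = 0"
      using L2_integrable_mult[OF u re(1)] L2_integrable_mult[OF u re(2)] 1 2 by simp
    finally have g0: "(LINT x|leb L. u x * g x) = 0" .
    have "complex_of_real ((l2_norm L u)\<^sup>2) = (LINT x|leb L. u x * cnj (u x))"
      unfolding l2_norm_sq complex_norm_square[symmetric] by (rule integral_complex_of_real[symmetric])
    also have "\<dots> = (LINT x|leb L. u x * (cnj (u x) - g x))"
      using L2_integrable_mult[OF u L2_cnj[OF u]] L2_integrable_mult[OF u gL2] g0
      by (simp add: right_diff_distrib)
    finally have "(l2_norm L u)\<^sup>2 = cmod (LINT x|leb L. u x * (cnj (u x) - g x))"
      by (metis norm_of_real abs_power2)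
    also have "\<dots> \<le> l2_norm L u * l2_norm L (\<lambda>x. cnj (u x) - g x)"
      by (intro L2_cauchy_schwarz L2_diff L2_cnj u gL2)
    also have "\<dots> \<le> l2_norm L u * e" using ge by (intro mult_left_mono) auto
    finally show ?thesis .
  qed
  then have "(l2_norm L u)\<^sup>2 = 0" by (rule nonneg_zero_if_le_eps[OF zero_le_power2])
  then show ?thesis using l2_norm_eq_0_iff[OF u] by simp
qed

text \<open>The integral from \<open>0\<close> vanishes to the left of the support anyway; mean zero
  makes it vanish to the right as well.\<close>

lemma mean_zero_has_test_primitive:
  fixes \<theta> :: "real \<Rightarrow> real"
  assumes "0 < L" "continuous_on UNIV \<theta>" "0 < a" "a \<le> b" "b < L" "\<And>x. x \<notin> {a..b} \<Longrightarrow> \<theta> x = 0"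
    and int: "integral {0..L} \<theta> = 0"
  obtains \<psi> where "\<And>x. (\<psi> has_real_derivative \<theta> x) (at x)" "\<And>x. x \<notin> {a..b} \<Longrightarrow> \<psi> x = 0"
proof
  let ?\<psi> = "\<lambda>x. integral {0..x} \<theta>"
  have c: "continuous_on S \<theta>" for S using assms(2) continuous_on_subset by blast
  have left: "?\<psi> x = 0" if "x < a" for x
  proof -
    have "?\<psi> x = integral {0..x} (\<lambda>x. 0)"
      using that assms(6) by (intro Henstock_Kurzweil_Integration.integral_cong) auto
    then show ?thesis by simp
  qed
  have right: "?\<psi> x = ?\<psi> b" if "x \<ge> b" for x
  proof -
    have "integral {b..x} \<theta> = integral {b..x} (\<lambda>x. 0)"
      by (rule integral_spike[of "{b}"]) (use assms(6) in auto)
    moreover have "?\<psi> b + integral {b..x} \<theta> = ?\<psi> x"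
      using that assms by (intro Henstock_Kurzweil_Integration.integral_combine integrable_continuous_real c) auto
    ultimately show ?thesis by simp
  qed
  show "?\<psi> x = 0" if "x \<notin> {a..b}" for x
    using that left[of x] right[of x] right[of L] int assms(5) by force
  show "(?\<psi> has_real_derivative \<theta> x) (at x)" for x
  proof (cases "x < a")
    case True
    have "((\<lambda>x. 0) has_real_derivative 0) (at x)" by simp
    then have "(?\<psi> has_real_derivative 0) (at x)"
      by (rule has_field_derivative_transform_within_open[of _ _ _ "{..<a}"]) (use True left in auto)
    then show ?thesis using assms(6)[of x] True by simp
  next
    case False
    then have x: "x \<in> {0<..<x + 1}" using assms(3) by simp
    have "(?\<psi> has_vector_derivative \<theta> x) (at x within {0..x + 1})"
      by (rule integral_has_vector_derivative[OF c]) (use x in auto)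
    then show ?thesis
      using x by (simp add: has_real_derivative_iff_has_vector_derivative at_within_Icc_at)
  qed
qed

text \<open>Fix one test function \<open>\<eta>0\<close> of nonzero mean. Subtracting a multiple of
  it from any \<open>\<eta>\<close> leaves mean zero, hence the derivative of a test function, on
  which \<open>v\<close> vanishes. So \<open>v\<close> acts on \<open>\<eta>\<close> as the constant
  \<open>k\<close>.\<close>

lemma weak_deriv_zero_constant:
  assumes L: "0 < L" and v: "v \<in> L2 L" and d: "weak_deriv L v (\<lambda>x. 0)"
  shows "\<exists>k. AE x in leb L. v x = k"
proof -
  have one: "(\<lambda>x. 1) \<in> L2 L" using L by (intro continuous_L2) auto
  \<comment> \<open>An error below \<open>sqrt L / 2\<close> keeps the integral of \<open>g0\<close>
    within \<open>L / 2\<close> of \<open>L\<close>, so \<open>\<eta>0\<close> has nonzero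
    mean.\<close>
  have sL: "0 < sqrt L / 2" using L by simp
  obtain g0 a0 b0 where g0: "continuous_on UNIV g0" "0 < a0" "a0 < b0" "b0 < L" "\<And>x. x \<notin> {a0..b0} \<Longrightarrow> g0 x = 0"
      and g0e: "l2_norm L (\<lambda>x. 1 - g0 x) < sqrt L / 2"
    using L2_approx_continuous[OF L one sL] by metis
  define \<eta>0 where "\<eta>0 x = Re (g0 x)" for x
  have \<eta>0: "continuous_on UNIV \<eta>0" "\<And>x. x \<notin> {a0..b0} \<Longrightarrow> \<eta>0 x = 0"
    using g0 unfolding \<eta>0_def by (auto intro: continuous_intros)
  have cL2: "(\<lambda>x. complex_of_real (h x)) \<in> L2 L" if "continuous_on UNIV h" for h
    using L continuous_on_subset[OF that] by (auto intro!: continuous_L2 continuous_intros)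
  have ci: "integrable (leb L) h" if "continuous_on UNIV h" for h :: "real \<Rightarrow> real"
    using integrable_Re[OF L2_integrable[OF cL2[OF that]]] by simp
  have g0L2: "g0 \<in> L2 L" using L continuous_on_subset[OF g0(1)] by (intro continuous_L2) auto
  define I where "I = (LINT x|leb L. \<eta>0 x)"
  have "cmod (LINT x|leb L. 1 - g0 x) \<le> (LINT x|leb L. cmod (1 - g0 x))" by (rule integral_norm_bound)
  also have "\<dots> \<le> sqrt L * l2_norm L (\<lambda>x. 1 - g0 x)"
    using L by (intro L2_norm_integral_le L2_diff one g0L2) auto
  also have "\<dots> < sqrt L * (sqrt L / 2)" using g0e L by (intro mult_strict_left_mono) auto
  also have "\<dots> = L / 2" using L by simp
  finally have "cmod (LINT x|leb L. 1 - g0 x) < L / 2" .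
  moreover have "(LINT x|leb L. 1 - g0 x) = complex_of_real L - (LINT x|leb L. g0 x)"
    using L2_integrable[OF g0L2] L2_integrable[OF one] L
    by (simp add: scaleR_conv_of_real)
  moreover have "Re (LINT x|leb L. g0 x) = I"
    using L2_integrable[OF g0L2] by (simp add: I_def \<eta>0_def)
  ultimately have I: "I \<noteq> 0"
    using abs_Re_le_cmod[of "complex_of_real L - (LINT x|leb L. g0 x)"] L by auto
  define k where "k = (LINT x|leb L. v x * complex_of_real (\<eta>0 x)) / complex_of_real I"
  have key: "(LINT x|leb L. v x * complex_of_real (\<eta> x)) = k * complex_of_real (LINT x|leb L. \<eta> x)"
    if \<eta>: "continuous_on UNIV \<eta>" "0 < a" "a < b" "b < L" "\<And>x. x \<notin> {a..b} \<Longrightarrow> \<eta> x = 0" for \<eta> a b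
  proof -
    define J where "J = (LINT x|leb L. \<eta> x)"
    define \<theta> where "\<theta> x = \<eta> x - J / I * \<eta>0 x" for x
    have \<theta>c: "continuous_on UNIV \<theta>"
      unfolding \<theta>_def by (intro continuous_intros \<eta>(1) \<eta>0(1))
    have "(LINT x|leb L. \<theta> x) = J - J / I * I"
      unfolding \<theta>_def using ci[OF \<eta>(1)] ci[OF \<eta>0(1)] by (simp add: J_def I_def)
    then have \<theta>0: "integral {0..L} \<theta> = 0" using leb_integral_eq[OF ci[OF \<theta>c]] I by simp
    have \<theta>s: "\<theta> x = 0" if "x \<notin> {min a a0..max b b0}" for x
    proof -
      have "x \<notin> {a..b}" "x \<notin> {a0..b0}" using that by auto
      then show ?thesis using \<eta>(5) \<eta>0(2) by (simp add: \<theta>_def)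
    qed
    have ab: "0 < min a a0" "min a a0 \<le> max b b0" "max b b0 < L" using \<eta> g0 by auto
    obtain \<psi> where \<psi>: "\<And>x. (\<psi> has_real_derivative \<theta> x) (at x)"
      "\<And>x. x \<notin> {min a a0..max b b0} \<Longrightarrow> \<psi> x = 0"
      using mean_zero_has_test_primitive[OF L \<theta>c ab \<theta>s \<theta>0] by blast
    have "\<exists>a b. 0 < a \<and> b < L \<and> (\<forall>x. x \<notin> {a..b} \<longrightarrow> \<psi> x = 0)"
      using \<psi>(2) \<eta>(2-4) g0(2-4) by (intro exI[of _ "min a a0"] exI[of _ "max b b0"]) auto
    then have "(LINT x|leb L. v x * complex_of_real (\<theta> x)) = - (LINT x|leb L. 0 * complex_of_real (\<psi> x))"
      using d[unfolded weak_deriv_def, rule_format, of \<psi> \<theta>] \<psi>(1) \<theta>c by blast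
    moreover have "(LINT x|leb L. v x * complex_of_real (\<theta> x))
      = (LINT x|leb L. v x * complex_of_real (\<eta> x)) - complex_of_real (J / I) * (LINT x|leb L. v x * complex_of_real (\<eta>0 x))"
    proof -
      have "(LINT x|leb L. v x * complex_of_real (\<theta> x))
        = (LINT x|leb L. v x * complex_of_real (\<eta> x) - complex_of_real (J / I) * (v x * complex_of_real (\<eta>0 x)))"
        by (rule Bochner_Integration.integral_cong) (auto simp: \<theta>_def algebra_simps)
      then show ?thesis
        using L2_integrable_mult[OF v cL2[OF \<eta>(1)]] L2_integrable_mult[OF v cL2[OF \<eta>0(1)]] by simp
    qed
    ultimately show ?thesis by (simp add: k_def J_def)
  qed
  have vk: "(\<lambda>x. v x - k * 1) \<in> L2 L" by (intro L2_diff v L2_cmult one)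
  have "AE x in leb L. v x - k * 1 = 0"
  proof (rule L2_orthogonal_zero[OF L vk])
    fix \<eta> :: "real \<Rightarrow> real" and a b
    assume \<eta>: "continuous_on UNIV \<eta>" "0 < a" "a < b" "b < L" "\<And>x. x \<notin> {a..b} \<Longrightarrow> \<eta> x = 0"
    have "(LINT x|leb L. (v x - k * 1) * complex_of_real (\<eta> x))
      = (LINT x|leb L. v x * complex_of_real (\<eta> x)) - k * complex_of_real (LINT x|leb L. \<eta> x)"
      using L2_integrable_mult[OF v cL2[OF \<eta>(1)]] L2_integrable[OF cL2[OF \<eta>(1)]]
      by (simp add: left_diff_distrib)
    then show "(LINT x|leb L. (v x - k * 1) * complex_of_real (\<eta> x)) = 0"
      using key[OF \<eta>] by simp
  qed
  then show ?thesis by auto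
qed

lemma weak_deriv_diff:
  assumes "f \<in> L2 L" "g \<in> L2 L" "f' \<in> L2 L" "g' \<in> L2 L" "0 < L" "weak_deriv L f f'" "weak_deriv L g g'"
  shows "weak_deriv L (\<lambda>x. f x - g x) (\<lambda>x. f' x - g' x)"
  unfolding weak_deriv_def
proof (intro allI impI)
  fix \<psi> \<psi>' :: "real \<Rightarrow> real"
  assume t: "(\<forall>x. (\<psi> has_real_derivative \<psi>' x) (at x)) \<and> continuous_on UNIV \<psi>' \<and>
    (\<exists>a b. 0 < a \<and> b < L \<and> (\<forall>x. x \<notin> {a..b} \<longrightarrow> \<psi> x = 0))"
  have "continuous_on {0..L} \<psi>"
    using t by (meson DERIV_isCont continuous_at_imp_continuous_on)
  then have p: "(\<lambda>x. complex_of_real (\<psi> x)) \<in> L2 L" "(\<lambda>x. complex_of_real (\<psi>' x)) \<in> L2 L"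
    using t assms(5) continuous_on_subset[of UNIV \<psi>' "{0..L}"]
    by (auto intro!: continuous_L2 continuous_intros)
  show "(LINT x|leb L. (f x - g x) * complex_of_real (\<psi>' x)) = - (LINT x|leb L. (f' x - g' x) * complex_of_real (\<psi> x))"
    using assms(6)[unfolded weak_deriv_def, rule_format, OF t] assms(7)[unfolded weak_deriv_def, rule_format, OF t]
      L2_integrable_mult[OF assms(1) p(2)] L2_integrable_mult[OF assms(2) p(2)]
      L2_integrable_mult[OF assms(3) p(1)] L2_integrable_mult[OF assms(4) p(1)]
    by (simp add: left_diff_distrib)
qed

lemma weak_deriv_is_prim:
  assumes L: "0 < L" and f: "f \<in> L2 L" and w: "w \<in> L2 L" and d: "weak_deriv L f w"
  shows "\<exists>F. is_prim L F w \<and> (AE x in leb L. f x = F x)"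
proof -
  define W where "W x = 0 + integral {0..x} w" for x
  have W: "is_prim L W w" unfolding W_def by (rule is_prim_integral[OF w])
  have WL2: "W \<in> L2 L" using is_prim_L2[OF _ W] L by simp
  have "weak_deriv L (\<lambda>x. f x - W x) (\<lambda>x. w x - w x)"
    by (rule weak_deriv_diff[OF f WL2 w w L d is_prim_weak_deriv[OF L W]])
  then obtain k where k: "AE x in leb L. f x - W x = k"
    using weak_deriv_zero_constant[OF L L2_diff[OF f WL2]] by auto
  have "is_prim L (\<lambda>x. W x + k) (\<lambda>x. w x + 0)" by (rule is_prim_add[OF W is_prim_const])
  moreover have "AE x in leb L. f x = W x + k" using k by (rule AE_mp) (auto simp: algebra_simps)
  ultimately show ?thesis by auto
qed

lemma weak_deriv_AE_cong:
  assumes "AE x in leb L. f x = g x" "f \<in> borel_measurable (leb L)" "weak_deriv L f w"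
  shows "weak_deriv L g w"
  unfolding weak_deriv_def
proof (intro allI impI)
  fix \<psi> \<psi>' :: "real \<Rightarrow> real"
  assume t: "(\<forall>x. (\<psi> has_real_derivative \<psi>' x) (at x)) \<and> continuous_on UNIV \<psi>' \<and>
    (\<exists>a b. 0 < a \<and> b < L \<and> (\<forall>x. x \<notin> {a..b} \<longrightarrow> \<psi> x = 0))"
  have c: "(\<lambda>x. complex_of_real (\<psi>' x)) \<in> borel_measurable (leb L)"
    using t continuous_on_subset[of UNIV \<psi>' "{0..L}"] by (auto intro!: continuous_leb_measurable continuous_intros)
  have "(LINT x|leb L. g x * complex_of_real (\<psi>' x)) = (LINT x|leb L. f x * complex_of_real (\<psi>' x))"
    by (rule integral_cong_AE)
      (use assms(1,2) leb_measurable_AE[OF assms(2,1)] c in \<open>auto intro!: borel_measurable_times elim: AE_mp\<close>)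
  then show "(LINT x|leb L. g x * complex_of_real (\<psi>' x)) = - (LINT x|leb L. w x * complex_of_real (\<psi> x))"
    using assms(3)[unfolded weak_deriv_def, rule_format, OF t] by simp
qed

lemma H1_wderiv:
  assumes "f \<in> H1 L"
  shows "f \<in> L2 L" "wderiv L f \<in> L2 L" "weak_deriv L f (wderiv L f)"
proof -
  have "\<exists>f'. f' \<in> L2 L \<and> weak_deriv L f f'" using assms unfolding H1_def by blast
  from someI_ex[OF this] show "wderiv L f \<in> L2 L" "weak_deriv L f (wderiv L f)"
    unfolding wderiv_def by blast+
  show "f \<in> L2 L" using assms unfolding H1_def by blast
qed

lemma H1_is_prim:
  assumes "0 < L" "f \<in> H1 L"
  obtains F where "is_prim L F (wderiv L f)" "AE x in leb L. f x = F x"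
  using weak_deriv_is_prim[OF assms(1) H1_wderiv[OF assms(2)]] by blast

lemma is_prim_unique_AE:
  assumes "0 < L" "is_prim L F v" "is_prim L G w" "AE x in leb L. F x = G x"
  shows "AE x in leb L. v x = w x" "x \<in> {0..L} \<Longrightarrow> F x = G x"
proof -
  have eq: "F x = G x" if "x \<in> {0..L}" for x
    by (rule continuous_AE_eq[OF assms(1) is_prim_continuous[OF assms(2)] is_prim_continuous[OF assms(3)] assms(4) that])
  show "x \<in> {0..L} \<Longrightarrow> F x = G x" by (rule eq)
  have "AE x in leb L. v x - w x = 0"
    by (rule is_prim_zero_AE[OF is_prim_diff[OF assms(2,3)]]) (use eq assms(1) in auto)
  then show "AE x in leb L. v x = w x" by auto
qed

text \<open>Evaluates the choices hidden in \<open>wderiv\<close> and \<open>pt_value\<close> from a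
  single absolutely continuous representative. Later proofs construct primitives and read membership
  and boundary values off from here.\<close>

lemma is_prim_H1:
  assumes L: "0 < L" and F: "is_prim L F w" and f: "AE x in leb L. f x = F x"
  shows "f \<in> H1 L" "AE x in leb L. wderiv L f x = w x" "x \<in> {0..L} \<Longrightarrow> pt_value L f x = F x"
proof -
  have FL2: "F \<in> L2 L" using is_prim_L2[OF _ F] L by simp
  have f': "AE x in leb L. F x = f x" using f by auto
  have fL2: "f \<in> L2 L" by (rule L2_AE[OF FL2 f'])
  have "weak_deriv L f w"
    by (rule weak_deriv_AE_cong[OF f' L2_measurable[OF FL2] is_prim_weak_deriv[OF L F]])
  then show H1: "f \<in> H1 L" using fL2 is_primD(1)[OF F] unfolding H1_def by blast
  obtain G where G: "is_prim L G (wderiv L f)" "AE x in leb L. f x = G x"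
    by (rule H1_is_prim[OF L H1])
  have "AE x in leb L. G x = F x" using G(2) f by (rule AE_mp[OF _ AE_mp]) auto
  then show "AE x in leb L. wderiv L f x = w x" by (rule is_prim_unique_AE(1)[OF L G(1) F])
  assume x: "x \<in> {0..L}"
  show "pt_value L f x = F x"
    unfolding pt_value_def
  proof (rule the_equality)
    show "\<exists>G. continuous_on {0..L} G \<and> (AE t in leb L. G t = f t) \<and> G x = F x"
      using is_prim_continuous[OF F] f' by blast
    fix y assume "\<exists>G. continuous_on {0..L} G \<and> (AE t in leb L. G t = f t) \<and> G x = y"
    then obtain G where G: "continuous_on {0..L} G" "AE t in leb L. G t = f t" "G x = y" by blast
    have "AE x in leb L. G x = F x" using G(2) f by (rule AE_mp[OF _ AE_mp]) auto
    from continuous_AE_eq[OF L G(1) is_prim_continuous[OF F] this x] show "y = F x" using G(3) by simp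
  qed
qed

lemma H2_is_prim:
  assumes L: "0 < L" and f: "f \<in> H2 L"
  obtains F G w where "is_prim L F G" "is_prim L G w" "AE x in leb L. f x = F x"
    "AE x in leb L. wderiv L f x = G x" "AE x in leb L. wderiv L (wderiv L f) x = w x"
proof -
  have H: "f \<in> H1 L" "wderiv L f \<in> H1 L" using f unfolding H2_def by auto
  obtain F where F: "is_prim L F (wderiv L f)" "AE x in leb L. f x = F x" by (rule H1_is_prim[OF L H(1)])
  obtain G where G: "is_prim L G (wderiv L (wderiv L f))" "AE x in leb L. wderiv L f x = G x"
    by (rule H1_is_prim[OF L H(2)])
  show ?thesis
    by (rule that[OF is_prim_AE_cong[OF F(1) G(2)] G(1) F(2) G(2)]) simp
qed

lemma is_prim_H2:
  assumes L: "0 < L" and F: "is_prim L F G" and G: "is_prim L G w" and f: "AE x in leb L. f x = F x"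
  shows "f \<in> H2 L" "AE x in leb L. wderiv L f x = G x" "AE x in leb L. wderiv L (wderiv L f) x = w x"
    "x \<in> {0..L} \<Longrightarrow> pt_value L f x = F x" "x \<in> {0..L} \<Longrightarrow> pt_value L (wderiv L f) x = G x"
proof -
  note 1 = is_prim_H1[OF L F f]
  note 2 = is_prim_H1[OF L G 1(2)]
  show "f \<in> H2 L" using 1(1) 2(1) unfolding H2_def by simp
  show "AE x in leb L. wderiv L f x = G x" "AE x in leb L. wderiv L (wderiv L f) x = w x"
    "x \<in> {0..L} \<Longrightarrow> pt_value L f x = F x" "x \<in> {0..L} \<Longrightarrow> pt_value L (wderiv L f) x = G x"
    using 1 2 by blast+
qed

section \<open>Density of trigonometric systems\<close>

definition cosf :: "real \<Rightarrow> nat \<Rightarrow> real \<Rightarrow> complex"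
  where "cosf L k x = complex_of_real (cos (real k * pi / L * x))"

definition sinf :: "real \<Rightarrow> nat \<Rightarrow> real \<Rightarrow> complex"
  where "sinf L k x = complex_of_real (sin (real k * pi / L * x))"

text \<open>Stated for a generic system \<open>E\<close>, since it serves the cosines and the sines
  alike.\<close>

lemma cos_mult_span:
  assumes "u \<in> cspan (range (E L))" "\<And>k. (\<lambda>x. cosf L 1 x * E L k x) \<in> cspan (range (E L))"
  shows "(\<lambda>x. cosf L 1 x * u x) \<in> cspan (range (E L))"
  using assms(1)
proof (induction rule: complex_vector.span_induct_alt)
  case base
  have "(\<lambda>x. cosf L 1 x * 0 x) = 0" by (simp add: fun_eq_iff)
  then show ?case by (simp add: complex_vector.span_zero)
next
  case (step c v w)
  then obtain k where v: "v = E L k" by blast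
  have "(\<lambda>x. cosf L 1 x * (c *\<^sub>C v + w) x) = c *\<^sub>C (\<lambda>x. cosf L 1 x * E L k x) + (\<lambda>x. cosf L 1 x * w x)"
    by (simp add: v fun_eq_iff algebra_simps)
  then show ?case
    using complex_vector.span_add[OF complex_vector.span_scale[OF assms(2)] step(2)] by simp
qed

lemma cos_power_mult_span:
  assumes "\<And>k. (\<lambda>x. cosf L 1 x * E L k x) \<in> cspan (range (E L))"
  shows "(\<lambda>x. cosf L 1 x ^ i * E L k x) \<in> cspan (range (E L))"
proof (induction i)
  case 0
  have "E L k \<in> cspan (range (E L))" by (intro complex_vector.span_base) simp
  then show ?case by simp
next
  case (Suc i)
  from cos_mult_span[of _ E L, OF this assms] show ?case by (simp add: mult.assoc)
qed

lemma cos_mult_cosf: "(\<lambda>x. cosf L 1 x * cosf L k x) \<in> cspan (range (cosf L))"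
proof (cases k)
  case 0
  have "(\<lambda>x. cosf L 1 x * cosf L k x) = cosf L 1" by (simp add: 0 cosf_def fun_eq_iff)
  then show ?thesis by (auto intro!: complex_vector.span_base)
next
  case (Suc j)
  have "cosf L 1 x * cosf L k x = (1/2) * cosf L (Suc k) x + (1/2) * cosf L j x" for x
  proof -
    have "cos (real (Suc k) * pi / L * x) = cos (real k * pi / L * x + pi / L * x)"
      by (simp add: algebra_simps add_divide_distrib)
    moreover have "cos (real j * pi / L * x) = cos (real k * pi / L * x - pi / L * x)"
      by (simp add: Suc algebra_simps add_divide_distrib)
    ultimately show ?thesis
      unfolding cosf_def cos_add cos_diff
      by (simp add: complex_eq_iff add_divide_distrib diff_divide_distrib)
  qed
  then have "(\<lambda>x. cosf L 1 x * cosf L k x) = (1/2) *\<^sub>C cosf L (Suc k) + (1/2) *\<^sub>C cosf L j"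
    by (simp add: fun_eq_iff)
  then show ?thesis
    by (simp only:) (intro complex_vector.span_add complex_vector.span_scale complex_vector.span_base rangeI)
qed

lemma cos_mult_sinf: "(\<lambda>x. cosf L 1 x * sinf L k x) \<in> cspan (range (sinf L))"
proof (cases k)
  case 0
  have "(\<lambda>x. cosf L 1 x * sinf L k x) = 0" by (simp add: 0 sinf_def fun_eq_iff)
  then show ?thesis by (simp add: complex_vector.span_zero)
next
  case (Suc j)
  have "cosf L 1 x * sinf L k x = (1/2) * sinf L (Suc k) x + (1/2) * sinf L j x" for x
  proof -
    have "sin (real (Suc k) * pi / L * x) = sin (real k * pi / L * x + pi / L * x)"
      by (simp add: algebra_simps add_divide_distrib)
    moreover have "sin (real j * pi / L * x) = sin (real k * pi / L * x - pi / L * x)"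
      by (simp add: Suc algebra_simps add_divide_distrib)
    ultimately show ?thesis
      unfolding cosf_def sinf_def sin_add sin_diff
      by (simp add: complex_eq_iff add_divide_distrib diff_divide_distrib)
  qed
  then have "(\<lambda>x. cosf L 1 x * sinf L k x) = (1/2) *\<^sub>C sinf L (Suc k) + (1/2) *\<^sub>C sinf L j"
    by (simp add: fun_eq_iff)
  then show ?thesis
    by (simp only:) (intro complex_vector.span_add complex_vector.span_scale complex_vector.span_base rangeI)
qed

text \<open>The substitution y = cos (\<pi> x / L) maps [0, L] homeomorphically onto [-1, 1] and
  turns the Weierstrass theorem into approximation by polynomials in the first cosine.\<close>

lemma cosine_polynomial_approx:
  assumes L: "0 < L" and g: "continuous_on {0..L} g" and e: "0 < e"
  obtains c :: "nat \<Rightarrow> complex" and n where "\<And>x. x \<in> {0..L} \<Longrightarrow> cmod (g x - (\<Sum>i\<le>n. c i * cosf L 1 x ^ i)) < e"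
proof -
  have real: "\<exists>a n. \<forall>x\<in>{0..L}. \<bar>h x - (\<Sum>i\<le>n. a i * cos (pi / L * x) ^ i)\<bar> < e / 2"
    if h: "continuous_on {0..L} h" for h :: "real \<Rightarrow> real"
  proof -
    have "continuous_on {-1..1} (\<lambda>y. h (L / pi * arccos y))"
    proof (rule continuous_on_compose2[OF h])
      show "continuous_on {-1..1} (\<lambda>y. L / pi * arccos y)" by (intro continuous_intros) auto
      show "(\<lambda>y. L / pi * arccos y) ` {-1..1} \<subseteq> {0..L}"
      proof clarsimp
        fix y :: real assume y: "-1 \<le> y" "y \<le> 1"
        have "L * arccos y \<le> L * pi" using arccos_ubound[OF y] L by simp
        then show "0 \<le> L * arccos y / pi \<and> L * arccos y / pi \<le> L"
          using arccos_lbound[OF y] L by (simp add: divide_le_eq)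
      qed
    qed
    then obtain p where p: "real_polynomial_function p"
      "\<And>y. y \<in> {-1..1} \<Longrightarrow> \<bar>h (L / pi * arccos y) - p y\<bar> < e / 2"
      using Stone_Weierstrass_real_polynomial_function[of "{-1..1}" "\<lambda>y. h (L / pi * arccos y)" "e / 2"] e
      by auto
    obtain a n where an: "p = (\<lambda>y. \<Sum>i\<le>n. a i * y ^ i)"
      using p(1) real_polynomial_function_iff_sum by auto
    have "\<bar>h x - (\<Sum>i\<le>n. a i * cos (pi / L * x) ^ i)\<bar> < e / 2" if x: "x \<in> {0..L}" for x
    proof -
      have "0 \<le> pi / L * x" "pi / L * x \<le> pi" using x L by (auto simp: divide_le_eq)
      then have "arccos (cos (pi / L * x)) = pi / L * x" by (rule arccos_cos)
      then have "L / pi * arccos (cos (pi / L * x)) = x" using L by simp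
      then show ?thesis using p(2)[of "cos (pi / L * x)"] by (simp add: an)
    qed
    then show ?thesis by blast
  qed
  obtain a n where a: "\<And>x. x \<in> {0..L} \<Longrightarrow> \<bar>Re (g x) - (\<Sum>i\<le>n. a i * cos (pi / L * x) ^ i)\<bar> < e / 2"
    using real[OF continuous_on_Re[OF g]] by blast
  obtain b k where b: "\<And>x. x \<in> {0..L} \<Longrightarrow> \<bar>Im (g x) - (\<Sum>i\<le>k. b i * cos (pi / L * x) ^ i)\<bar> < e / 2"
    using real[OF continuous_on_Im[OF g]] by blast
  define N where "N = max n k"
  define c where "c i = Complex (if i \<le> n then a i else 0) (if i \<le> k then b i else 0)" for i
  have "(\<Sum>i\<le>n. a i * cos (pi / L * x) ^ i) = (\<Sum>i\<le>N. (if i \<le> n then a i else 0) * cos (pi / L * x) ^ i)" for x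
    by (rule sum.mono_neutral_cong_left) (auto simp: N_def)
  moreover have "(\<Sum>i\<le>k. b i * cos (pi / L * x) ^ i) = (\<Sum>i\<le>N. (if i \<le> k then b i else 0) * cos (pi / L * x) ^ i)" for x
    by (rule sum.mono_neutral_cong_left) (auto simp: N_def)
  ultimately have re: "Re (\<Sum>i\<le>N. c i * cosf L 1 x ^ i) = (\<Sum>i\<le>n. a i * cos (pi / L * x) ^ i)"
    and im: "Im (\<Sum>i\<le>N. c i * cosf L 1 x ^ i) = (\<Sum>i\<le>k. b i * cos (pi / L * x) ^ i)" for x
    by (simp_all add: c_def cosf_def flip: of_real_power)
  show ?thesis
  proof (rule that[of c N])
    fix x assume x: "x \<in> {0..L}"
    have "cmod (g x - (\<Sum>i\<le>N. c i * cosf L 1 x ^ i)) \<le>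
        \<bar>Re (g x - (\<Sum>i\<le>N. c i * cosf L 1 x ^ i))\<bar> + \<bar>Im (g x - (\<Sum>i\<le>N. c i * cosf L 1 x ^ i))\<bar>"
      by (rule cmod_le)
    then show "cmod (g x - (\<Sum>i\<le>N. c i * cosf L 1 x ^ i)) < e"
      using a[OF x] b[OF x] by (simp only: minus_complex.simps re im)
  qed
qed

lemma cosf_continuous: "continuous_on S (cosf L k)"
  unfolding cosf_def by (intro continuous_intros)

lemma sinf_continuous: "continuous_on S (sinf L k)"
  unfolding sinf_def by (intro continuous_intros)

lemma cosf_le_one: "cmod (cosf L k x) \<le> 1"
  by (simp add: cosf_def)

lemma sinf_le_one: "cmod (sinf L k x) \<le> 1"
  by (simp add: sinf_def)

lemma cosf_L2: "0 \<le> L \<Longrightarrow> cosf L k \<in> L2 L"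
  by (intro continuous_L2 cosf_continuous)

lemma sinf_L2: "0 \<le> L \<Longrightarrow> sinf L k \<in> L2 L"
  by (intro continuous_L2 sinf_continuous)

lemma span_L2:
  assumes "S \<subseteq> L2 L" "w \<in> cspan S"
  shows "w \<in> L2 L"
  using complex_vector.span_minimal[OF assms(1) L2_subspace] assms(2) by blast

text \<open>Polynomials in the first cosine times \<open>E L k\<close> stay in the span. For the
  cosines \<open>k = 0\<close> gives the constant function one, so \<open>q\<close> can be any
  continuous function; for the sines the factor \<open>E L 1\<close> must first be divided
  out.\<close>

lemma trig_dense_step:
  assumes L: "0 < L" and E: "continuous_on {0..L} (E L k)" "\<And>x. x \<in> {0..L} \<Longrightarrow> cmod (E L k x) \<le> 1"
    and q: "continuous_on {0..L} q" and e: "0 < e"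
    and span: "\<And>k. (\<lambda>x. cosf L 1 x * E L k x) \<in> cspan (range (E L))"
  shows "\<exists>w\<in>cspan (range (E L)). l2_norm L (\<lambda>x. E L k x * q x - w x) < e"
proof -
  \<comment> \<open>A uniform error \<open>d\<close> costs at most \<open>d * sqrt L = e / 2\<close>
    in the L2 norm.\<close>
  define d where "d = e / (2 * sqrt L)"
  have d: "d > 0" using L e by (simp add: d_def)
  obtain c n where c: "\<And>x. x \<in> {0..L} \<Longrightarrow> cmod (q x - (\<Sum>i\<le>n. c i * cosf L 1 x ^ i)) < d"
    using cosine_polynomial_approx[OF L q d] by blast
  define w where "w = (\<Sum>i\<le>n. c i *\<^sub>C (\<lambda>x. cosf L 1 x ^ i * E L k x))"
  have w: "w \<in> cspan (range (E L))"
    unfolding w_def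
    by (intro complex_vector.span_sum complex_vector.span_scale cos_power_mult_span[of L E, OF span])
  have wx: "w x = E L k x * (\<Sum>i\<le>n. c i * cosf L 1 x ^ i)" for x
    by (simp add: w_def sum_fun_apply sum_distrib_left mult_ac)
  have "l2_norm L (\<lambda>x. E L k x * q x - w x) \<le> \<bar>d\<bar> * sqrt L"
  proof (rule l2_norm_bounded(2))
    show "(\<lambda>x. E L k x * q x - w x) \<in> borel_measurable (leb L)"
      unfolding wx cosf_def
      by (intro continuous_leb_measurable continuous_intros E(1) q)
    fix x assume x: "x \<in> {0<..<L}"
    have "cmod (E L k x * q x - w x) = cmod (E L k x) * cmod (q x - (\<Sum>i\<le>n. c i * cosf L 1 x ^ i))"
      by (simp add: wx norm_mult[symmetric] right_diff_distrib)
    also have "\<dots> \<le> 1 * d" using E(2)[of x] c[of x] x by (intro mult_mono) auto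
    finally show "cmod (E L k x * q x - w x) \<le> d" by simp
  qed (use L in simp)
  also have "\<dots> < e" using d L e by (simp add: d_def)
  finally show ?thesis by (rule bexI[OF _ w])
qed

lemma cosf_dense:
  assumes L: "0 < L" and f: "f \<in> L2 L" and e: "0 < e"
  shows "\<exists>w\<in>cspan (range (cosf L)). l2_norm L (\<lambda>x. f x - w x) < e"
proof -
  obtain g a b where g: "continuous_on UNIV g" "l2_norm L (\<lambda>x. f x - g x) < e / 2"
    using L2_approx_continuous[OF L f half_gt_zero[OF e]] by metis
  have c: "continuous_on {0..L} g" using g(1) by (rule continuous_on_subset) simp
  obtain w where w: "w \<in> cspan (range (cosf L))" "l2_norm L (\<lambda>x. cosf L 0 x * g x - w x) < e / 2"
    using trig_dense_step[where E = cosf and k = 0, OF L cosf_continuous cosf_le_one c half_gt_zero[OF e] cos_mult_cosf]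
    by blast
  have wL2: "w \<in> L2 L"
    by (rule span_L2[OF _ w(1)]) (use L in \<open>auto intro: cosf_L2\<close>)
  have gL2: "g \<in> L2 L" using continuous_L2[OF _ c] L by simp
  have "l2_norm L (\<lambda>x. f x - w x) \<le> l2_norm L (\<lambda>x. f x - g x) + l2_norm L (\<lambda>x. g x - w x)"
    using l2_norm_triangle[OF L2_diff[OF f gL2] L2_diff[OF gL2 wL2]] by simp
  moreover have "cosf L 0 x = 1" for x by (simp add: cosf_def)
  with w(2) have "l2_norm L (\<lambda>x. g x - w x) < e / 2" by (simp only: mult_1)
  ultimately have "l2_norm L (\<lambda>x. f x - w x) < e" using g(2) by linarith
  then show ?thesis by (rule bexI[OF _ w(1)])
qed

text \<open>A function supported inside (0, L) can be divided by the first sine, which is bounded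
  below on its support. This makes up for the missing constant function.\<close>

lemma sinf_dense:
  assumes L: "0 < L" and f: "f \<in> L2 L" and e: "0 < e"
  shows "\<exists>w\<in>cspan (range (sinf L)). l2_norm L (\<lambda>x. f x - w x) < e"
proof -
  obtain g a b where g: "continuous_on UNIV g" "0 < a" "a < b" "b < L" "\<And>x. x \<notin> {a..b} \<Longrightarrow> g x = 0"
    and ge: "l2_norm L (\<lambda>x. f x - g x) < e / 2"
    using L2_approx_continuous[OF L f half_gt_zero[OF e]] by metis
  have c: "continuous_on {0..L} g" using g(1) by (rule continuous_on_subset) simp
  have "\<exists>x\<in>{a..b}. \<forall>y\<in>{a..b}. sin (pi / L * x) \<le> sin (pi / L * y)"
    by (rule continuous_attains_inf) (use g in \<open>auto intro!: continuous_intros\<close>)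
  then obtain x0 where x0: "x0 \<in> {a..b}" "\<And>y. y \<in> {a..b} \<Longrightarrow> sin (pi / L * x0) \<le> sin (pi / L * y)"
    by blast
  define \<sigma> where "\<sigma> = sin (pi / L * x0)"
  have "0 < pi / L * x0" "pi / L * x0 < pi" using x0(1) g L by (auto simp: divide_less_eq)
  then have \<sigma>: "\<sigma> > 0" unfolding \<sigma>_def by (rule sin_gt_zero)
  \<comment> \<open>The maximum with \<open>\<sigma>\<close> changes nothing on the support of
    \<open>g\<close> and keeps the denominator away from zero elsewhere.\<close>
  define q where "q x = g x / complex_of_real (max (sin (pi / L * x)) \<sigma>)" for x
  have qc: "continuous_on {0..L} q"
    unfolding q_def using \<sigma> by (intro continuous_intros c) (auto simp: max_def)
  have sq: "sinf L 1 x * q x = g x" for x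
  proof (cases "x \<in> {a..b}")
    case True
    then have "\<sigma> \<le> sin (pi / L * x)" using x0(2) by (simp add: \<sigma>_def)
    then show ?thesis using \<sigma> by (simp add: q_def sinf_def max_def)
  qed (simp add: q_def g(5))
  obtain w where w: "w \<in> cspan (range (sinf L))" "l2_norm L (\<lambda>x. sinf L 1 x * q x - w x) < e / 2"
    using trig_dense_step[where E = sinf and k = 1, OF L sinf_continuous sinf_le_one qc half_gt_zero[OF e] cos_mult_sinf]
    by blast
  have wL2: "w \<in> L2 L"
    by (rule span_L2[OF _ w(1)]) (use L in \<open>auto intro: sinf_L2\<close>)
  have gL2: "g \<in> L2 L" using continuous_L2[OF _ c] L by simp
  have "l2_norm L (\<lambda>x. f x - w x) \<le> l2_norm L (\<lambda>x. f x - g x) + l2_norm L (\<lambda>x. g x - w x)"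
    using l2_norm_triangle[OF L2_diff[OF f gL2] L2_diff[OF gL2 wL2]] by simp
  moreover have "l2_norm L (\<lambda>x. g x - w x) < e / 2" using w(2) by (simp only: sq)
  ultimately have "l2_norm L (\<lambda>x. f x - w x) < e" using ge by linarith
  then show ?thesis by (rule bexI[OF _ w(1)])
qed

lemma integral_cos_int:
  assumes L: "0 < L"
  shows "(LINT x|leb L. cos (of_int j * pi / L * x)) = (if j = 0 then L else 0)"
proof -
  have c: "continuous_on {0..L} (\<lambda>x. complex_of_real (cos (of_int j * pi / L * x)))"
    by (intro continuous_intros)
  have i: "integrable (leb L) (\<lambda>x. cos (of_int j * pi / L * x))"
    using integrable_Re[OF L2_integrable[OF continuous_L2[OF less_imp_le[OF L] c]]]
    by (simp only: Re_complex_of_real)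
  have "integral {0..L} (\<lambda>x. cos (of_int j * pi / L * x)) = 0" if j: "j \<noteq> 0"
  proof -
    define k where "k = of_int j * pi / L"
    have k: "k \<noteq> 0" using j L by (simp add: k_def)
    have "((\<lambda>x. cos (k * x)) has_integral sin (k * L) / k - sin (k * 0) / k) {0..L}"
      by (rule fundamental_theorem_of_calculus)
        (use L k in \<open>auto intro!: derivative_eq_intros simp: has_real_derivative_iff_has_vector_derivative[symmetric]\<close>)
    moreover have "k * L = of_int j * pi" using L by (simp add: k_def)
    moreover have "sin (of_int j * pi) = 0" using sin_zero_iff_int2 by blast
    ultimately show ?thesis by (simp add: k_def[symmetric] integral_unique)
  qed
  then show ?thesis using leb_integral_eq[OF i] L by auto
qed

lemma l2_norm_sq_sum:
  assumes "finite F" "\<And>i. i \<in> F \<Longrightarrow> e i \<in> L2 L"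
  shows "complex_of_real ((l2_norm L (\<lambda>x. \<Sum>i\<in>F. a i * e i x))\<^sup>2)
    = (\<Sum>i\<in>F. \<Sum>j\<in>F. a i * cnj (a j) * (LINT x|leb L. e i x * cnj (e j x)))"
proof -
  have i: "integrable (leb L) (\<lambda>x. e i x * cnj (e j x))" if "i \<in> F" "j \<in> F" for i j
    using that by (intro L2_integrable_mult L2_cnj assms)
  have "complex_of_real ((l2_norm L (\<lambda>x. \<Sum>i\<in>F. a i * e i x))\<^sup>2)
      = (LINT x|leb L. (\<Sum>i\<in>F. a i * e i x) * cnj (\<Sum>i\<in>F. a i * e i x))"
    unfolding l2_norm_sq complex_norm_square[symmetric] by (rule integral_complex_of_real[symmetric])
  also have "\<dots> = (LINT x|leb L. (\<Sum>i\<in>F. \<Sum>j\<in>F. a i * cnj (a j) * (e i x * cnj (e j x))))"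
    by (rule Bochner_Integration.integral_cong) (auto simp: sum_product cnj_sum mult_ac)
  also have "\<dots> = (\<Sum>i\<in>F. LINT x|leb L. (\<Sum>j\<in>F. a i * cnj (a j) * (e i x * cnj (e j x))))"
    by (intro Bochner_Integration.integral_sum Bochner_Integration.integrable_sum integrable_mult_right i)
  also have "\<dots> = (\<Sum>i\<in>F. \<Sum>j\<in>F. LINT x|leb L. a i * cnj (a j) * (e i x * cnj (e j x)))"
    by (intro sum.cong refl Bochner_Integration.integral_sum integrable_mult_right i)
  also have "\<dots> = (\<Sum>i\<in>F. \<Sum>j\<in>F. a i * cnj (a j) * (LINT x|leb L. e i x * cnj (e j x)))"
    by simp
  finally show ?thesis .
qed

section \<open>The Dirichlet Laplacian\<close>

definition sine_basis :: "real \<Rightarrow> nat \<Rightarrow> real \<Rightarrow> complex"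
  where "sine_basis L n x = complex_of_real (sqrt (2 / L) * sin (of_nat n * pi / L * x))"

lemma sine_basis_sinf: "sine_basis L n = complex_of_real (sqrt (2 / L)) *\<^sub>C sinf L n"
  by (simp add: fun_eq_iff sine_basis_def sinf_def)

lemma sine_basis_L2: "0 \<le> L \<Longrightarrow> sine_basis L n \<in> L2 L"
  unfolding sine_basis_sinf by (intro complex_vector.subspace_scale[OF L2_subspace] sinf_L2)

lemma sine_basis_gram:
  assumes L: "0 < L" and jk: "1 \<le> j" "1 \<le> k"
  shows "(LINT x|leb L. sine_basis L j x * cnj (sine_basis L k x)) = (if j = k then 1 else 0)"
proof -
  let ?c = "\<lambda>i::int. \<lambda>x. cos (of_int i * pi / L * x)"
  have c: "continuous_on {0..L} (\<lambda>x. complex_of_real (?c i x))" for i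
    by (intro continuous_intros)
  have i: "integrable (leb L) (?c i)" for i
    using integrable_Re[OF L2_integrable[OF continuous_L2[OF less_imp_le[OF L] c]]]
    by (simp only: Re_complex_of_real)
  have e: "sine_basis L j x * cnj (sine_basis L k x)
      = complex_of_real (1 / L * (?c (int j - int k) x - ?c (int j + int k) x))" for x
  proof -
    have 1: "of_int (int j - int k) * pi / L * x = of_nat j * pi / L * x - of_nat k * pi / L * x"
      "of_int (int j + int k) * pi / L * x = of_nat j * pi / L * x + of_nat k * pi / L * x"
      by (simp_all add: algebra_simps diff_divide_distrib add_divide_distrib)
    have "sqrt (2 / L) * sin (of_nat j * pi / L * x) * (sqrt (2 / L) * sin (of_nat k * pi / L * x))
        = (sqrt (2 / L) * sqrt (2 / L)) * (sin (of_nat j * pi / L * x) * sin (of_nat k * pi / L * x))"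
      by (simp only: mult_ac)
    also have "\<dots> = 1 / L * (?c (int j - int k) x - ?c (int j + int k) x)"
    proof -
      have "2 / L * ((a - b) / 2) = 1 / L * (a - b)" for a b using L by (simp add: field_simps)
      moreover have "sqrt (2 / L) * sqrt (2 / L) = 2 / L" using L by simp
      ultimately show ?thesis unfolding 1 sin_times_sin by simp
    qed
    finally show ?thesis by (simp add: sine_basis_def flip: of_real_mult)
  qed
  have "(LINT x|leb L. sine_basis L j x * cnj (sine_basis L k x))
      = complex_of_real (LINT x|leb L. 1 / L * (?c (int j - int k) x - ?c (int j + int k) x))"
    unfolding e by (rule integral_complex_of_real)
  \<comment> \<open>The frequency \<open>j + k\<close> is positive and its cosine integrates to
    zero, so only \<open>j - k\<close> can contribute.\<close>
  also have "(LINT x|leb L. 1 / L * (?c (int j - int k) x - ?c (int j + int k) x)) = (if j = k then 1 else 0)"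
    using i[of "int j - int k"] i[of "int j + int k"] integral_cos_int[OF L, of "int j - int k"]
      integral_cos_int[OF L, of "int j + int k"] L jk by simp
  finally show ?thesis by simp
qed

lemma sine_basis_norm_sum:
  assumes L: "0 < L" and F: "finite F" "F \<subseteq> {1..}"
  shows "(l2_norm L (\<lambda>x. \<Sum>i\<in>F. a i * sine_basis L i x))\<^sup>2 = (\<Sum>i\<in>F. (cmod (a i))\<^sup>2)"
proof -
  have "complex_of_real ((l2_norm L (\<lambda>x. \<Sum>i\<in>F. a i * sine_basis L i x))\<^sup>2)
      = (\<Sum>i\<in>F. \<Sum>j\<in>F. a i * cnj (a j) * (LINT x|leb L. sine_basis L i x * cnj (sine_basis L j x)))"
    by (rule l2_norm_sq_sum[OF F(1)]) (use L in \<open>auto intro: sine_basis_L2\<close>)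
  also have "\<dots> = (\<Sum>i\<in>F. \<Sum>j\<in>F. if i = j then a i * cnj (a j) else 0)"
    using F(2) by (intro sum.cong refl) (auto simp: subset_iff sine_basis_gram[OF L])
  also have "\<dots> = (\<Sum>i\<in>F. a i * cnj (a i))" using F(1) by simp
  also have "\<dots> = complex_of_real (\<Sum>i\<in>F. (cmod (a i))\<^sup>2)"
    by (simp only: complex_norm_square of_real_sum)
  finally show ?thesis by (simp only: of_real_eq_iff)
qed

lemma sine_basis_dense:
  assumes L: "0 < L" and f: "f \<in> L2 L" and e: "0 < e"
  shows "\<exists>w\<in>cspan (sine_basis L ` {1..}). l2_norm L (\<lambda>x. f x - w x) < e"
proof -
  have "sinf L k \<in> cspan (sine_basis L ` {1..})" for k
  proof (cases "k = 0")
    case True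
    then have "sinf L k = 0" by (simp add: sinf_def fun_eq_iff)
    then show ?thesis by (simp add: complex_vector.span_zero)
  next
    case False
    have "complex_of_real (sqrt (2 / L)) * (1 / complex_of_real (sqrt (2 / L))) = 1" using L by simp
    then have "sinf L k = (1 / complex_of_real (sqrt (2 / L))) *\<^sub>C sine_basis L k"
      unfolding sine_basis_sinf scaleC_scaleC by (simp add: mult.commute scaleC_one)
    then show ?thesis using False
      by (simp only:) (intro complex_vector.span_scale complex_vector.span_base imageI, simp)
  qed
  then have "cspan (range (sinf L)) \<subseteq> cspan (sine_basis L ` {1..})"
    by (intro complex_vector.span_minimal complex_vector.subspace_span) auto
  moreover obtain w where "w \<in> cspan (range (sinf L))" "l2_norm L (\<lambda>x. f x - w x) < e"
    using sinf_dense[OF L f e] by (rule bexE)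
  ultimately show ?thesis by (intro bexI[of _ w]) auto
qed

lemma sine_riesz_basis:
  assumes L: "0 < L"
  shows "riesz_basis (L2 L) (l2_norm L) {1..} (sine_basis L)"
  unfolding riesz_basis_def
proof (intro conjI ballI allI impI exI[of _ "1::real"])
  show "sine_basis L ` {1..} \<subseteq> L2 L" using sine_basis_L2 L by auto
  show "\<exists>w\<in>cspan (sine_basis L ` {1..}). l2_norm L (v - w) < \<epsilon>" if "v \<in> L2 L" "0 < \<epsilon>" for v \<epsilon>
    using sine_basis_dense[OF L that] by (simp only: fun_diff_def)
  fix F :: "nat set" and a :: "nat \<Rightarrow> complex" assume F: "finite F \<and> F \<subseteq> {1..}"
  have "(\<Sum>i\<in>F. a i *\<^sub>C sine_basis L i) = (\<lambda>x. \<Sum>i\<in>F. a i * sine_basis L i x)"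
    by (simp add: fun_eq_iff sum_fun_apply)
  then show "1 * (\<Sum>i\<in>F. (cmod (a i))\<^sup>2) \<le> (l2_norm L (\<Sum>i\<in>F. a i *\<^sub>C sine_basis L i))\<^sup>2"
    "(l2_norm L (\<Sum>i\<in>F. a i *\<^sub>C sine_basis L i))\<^sup>2 \<le> 1 * (\<Sum>i\<in>F. (cmod (a i))\<^sup>2)"
    using sine_basis_norm_sum[OF L, of F a] F by simp_all
qed auto

text \<open>Describing an operator by a relation keeps the arbitrary choice in \<open>wderiv\<close>
  out of the algebra and of the limits. It is used for the Laplacian and for the full
  operator.\<close>

lemma closed_operator_graph:
  fixes R :: "'v::complex_vector \<Rightarrow> 'v \<Rightarrow> bool"
  assumes "seminormed_space V nm"
    and dom: "\<And>u. u \<in> D \<Longrightarrow> R u (A u)" "\<And>u w. R u w \<Longrightarrow> u \<in> D"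
    and mem: "\<And>u w. R u w \<Longrightarrow> u \<in> V \<and> w \<in> V"
    and uniq: "\<And>u w w'. R u w \<Longrightarrow> R u w' \<Longrightarrow> nm (w - w') = 0"
    and zero: "R 0 0"
    and add: "\<And>u w u' w'. R u w \<Longrightarrow> R u' w' \<Longrightarrow> R (u + u') (w + w')"
    and scale: "\<And>a u w. R u w \<Longrightarrow> R (a *\<^sub>C u) (a *\<^sub>C w)"
    and null: "\<And>u w v. R u w \<Longrightarrow> v \<in> V \<Longrightarrow> nm (u - v) = 0 \<Longrightarrow> R v w"
    and lim: "\<And>u w x y. (\<And>n::nat. R (u n) (w n)) \<Longrightarrow> x \<in> V \<Longrightarrow> y \<in> V \<Longrightarrow>
      (\<lambda>n. nm (u n - x)) \<longlonglongrightarrow> 0 \<Longrightarrow> (\<lambda>n. nm (w n - y)) \<longlonglongrightarrow> 0 \<Longrightarrow> R x y"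
  shows "closed_operator V nm D A"
  unfolding closed_operator_def linear_operator_def
proof (intro conjI ballI allI impI)
  interpret seminormed_space V nm by fact
  show "csubspace D"
  proof (rule complex_vector.subspaceI)
    show "0 \<in> D" by (rule dom(2)[OF zero])
    show "u + v \<in> D" if "u \<in> D" "v \<in> D" for u v
      by (rule dom(2)[OF add[OF dom(1)[OF that(1)] dom(1)[OF that(2)]]])
    show "c *\<^sub>C u \<in> D" if "u \<in> D" for c u by (rule dom(2)[OF scale[OF dom(1)[OF that]]])
  qed
  show "D \<subseteq> V" using mem dom(1) by blast
  show "A ` D \<subseteq> V" using mem dom(1) by blast
  fix u assume u: "u \<in> D"
  show "nm (A (a *\<^sub>C u) - a *\<^sub>C A u) = 0" for a
    by (rule uniq[OF dom(1)[OF dom(2)] scale[OF dom(1)[OF u]]]) (rule scale[OF dom(1)[OF u]])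
  show "nm (A (u + v) - (A u + A v)) = 0" if "v \<in> D" for v
    by (rule uniq[OF dom(1)[OF dom(2)] add[OF dom(1)[OF u] dom(1)[OF that]]])
      (rule add[OF dom(1)[OF u] dom(1)[OF that]])
  fix v assume v: "v \<in> V" "nm (u - v) = 0"
  note R = null[OF dom(1)[OF u] v]
  show "v \<in> D" by (rule dom(2)[OF R])
  show "nm (A u - A v) = 0" by (rule uniq[OF _ dom(1)[OF dom(2)[OF R]], of "A u"]) (rule R)
next
  fix u x y
  assume *: "(\<forall>n::nat. u n \<in> D) \<and> x \<in> V \<and> y \<in> V \<and>
       (\<lambda>n. nm (u n - x)) \<longlonglongrightarrow> 0 \<and> (\<lambda>n. nm (A (u n) - y)) \<longlonglongrightarrow> 0"
  have R: "R x y"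
    by (rule lim[of u "\<lambda>n. A (u n)"]) (use * dom(1) in auto)
  show "x \<in> D" by (rule dom(2)[OF R])
  show "nm (A x - y) = 0" by (rule uniq[OF dom(1)[OF dom(2)[OF R]] R])
qed

text \<open>Reads as \<open>w = f''\<close> with Dirichlet conditions. \<open>F\<close> and
  \<open>G\<close> represent \<open>f\<close> and its derivative and have genuine values at the end
  points.\<close>

definition dirichlet_graph :: "real \<Rightarrow> (real \<Rightarrow> complex) \<Rightarrow> (real \<Rightarrow> complex) \<Rightarrow> bool"
  where "dirichlet_graph L f w \<longleftrightarrow> (\<exists>F G. is_prim L F G \<and> is_prim L G w \<and>
    (AE x in leb L. f x = F x) \<and> F 0 = 0 \<and> F L = 0)"

definition dirichlet_dom :: "real \<Rightarrow> (real \<Rightarrow> complex) set"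
  where "dirichlet_dom L = {f \<in> H2 L. pt_value L f 0 = 0 \<and> pt_value L f L = 0}"

lemma dirichlet_dom_graph:
  assumes L: "0 < L" and f: "f \<in> dirichlet_dom L"
  shows "dirichlet_graph L f (wderiv L (wderiv L f))"
proof -
  have H: "f \<in> H2 L" "pt_value L f 0 = 0" "pt_value L f L = 0"
    using f by (auto simp: dirichlet_dom_def)
  obtain F G w where P: "is_prim L F G" "is_prim L G w" "AE x in leb L. f x = F x"
    "AE x in leb L. wderiv L f x = G x" "AE x in leb L. wderiv L (wderiv L f) x = w x"
    by (rule H2_is_prim[OF L H(1)])
  have "AE x in leb L. w x = wderiv L (wderiv L f) x" using P(5) by auto
  then have "is_prim L G (wderiv L (wderiv L f))" by (rule is_prim_AE_cong[OF P(2)])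
  moreover have "F 0 = 0" "F L = 0"
    using is_prim_H2(4)[OF L P(1-3), of 0] is_prim_H2(4)[OF L P(1-3), of L] H L by auto
  ultimately show ?thesis unfolding dirichlet_graph_def using P(1,3) by blast
qed

lemma dirichlet_graph_dom:
  assumes L: "0 < L" and "dirichlet_graph L f w"
  shows "f \<in> dirichlet_dom L" "AE x in leb L. wderiv L (wderiv L f) x = w x" "f \<in> L2 L" "w \<in> L2 L"
proof -
  obtain F G where P: "is_prim L F G" "is_prim L G w" "AE x in leb L. f x = F x" "F 0 = 0" "F L = 0"
    using assms(2) unfolding dirichlet_graph_def by blast
  note 1 = is_prim_H2[OF L P(1-3)]
  show "f \<in> dirichlet_dom L" using 1(1) 1(4)[of 0] 1(4)[of L] P(4,5) L by (simp add: dirichlet_dom_def)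
  show "AE x in leb L. wderiv L (wderiv L f) x = w x" by (rule 1(3))
  show "w \<in> L2 L" by (rule is_primD(1)[OF P(2)])
  show "f \<in> L2 L" using is_prim_H1(1)[OF L P(1,3)] by (rule H1_wderiv(1))
qed

lemma dirichlet_graph_unique:
  assumes L: "0 < L" and "dirichlet_graph L f w" "dirichlet_graph L f w'"
  shows "AE x in leb L. w x = w' x"
  using dirichlet_graph_dom(2)[OF L assms(2)] dirichlet_graph_dom(2)[OF L assms(3)]
  by (rule AE_mp[OF _ AE_mp]) auto

lemma dirichlet_graph_add:
  assumes "dirichlet_graph L f w" "dirichlet_graph L f' w'"
  shows "dirichlet_graph L (\<lambda>x. f x + f' x) (\<lambda>x. w x + w' x)"
proof -
  obtain F G where P: "is_prim L F G" "is_prim L G w" "AE x in leb L. f x = F x" "F 0 = 0" "F L = 0"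
    using assms(1) unfolding dirichlet_graph_def by blast
  obtain F' G' where P': "is_prim L F' G'" "is_prim L G' w'" "AE x in leb L. f' x = F' x" "F' 0 = 0" "F' L = 0"
    using assms(2) unfolding dirichlet_graph_def by blast
  have "AE x in leb L. f x + f' x = F x + F' x" using P(3) P'(3) by (rule AE_mp[OF _ AE_mp]) auto
  then show ?thesis
    unfolding dirichlet_graph_def using is_prim_add[OF P(1) P'(1)] is_prim_add[OF P(2) P'(2)] P(4,5) P'(4,5)
    by (intro exI[of _ "\<lambda>x. F x + F' x"] exI[of _ "\<lambda>x. G x + G' x"]) simp
qed

lemma dirichlet_graph_scale:
  assumes "dirichlet_graph L f w"
  shows "dirichlet_graph L (\<lambda>x. a * f x) (\<lambda>x. a * w x)"
proof -
  obtain F G where P: "is_prim L F G" "is_prim L G w" "AE x in leb L. f x = F x" "F 0 = 0" "F L = 0"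
    using assms(1) unfolding dirichlet_graph_def by blast
  have "AE x in leb L. a * f x = a * F x" using P(3) by auto
  then show ?thesis
    unfolding dirichlet_graph_def using is_prim_cmult[OF P(1), of a] is_prim_cmult[OF P(2), of a] P(4,5)
    by (intro exI[of _ "\<lambda>x. a * F x"] exI[of _ "\<lambda>x. a * G x"]) simp
qed

lemma dirichlet_graph_zero: "dirichlet_graph L (\<lambda>x. 0) (\<lambda>x. 0)"
  unfolding dirichlet_graph_def using is_prim_const[of L 0]
  by (intro exI[of _ "\<lambda>x. 0"]) simp

lemma dirichlet_graph_AE:
  assumes "dirichlet_graph L f w" "AE x in leb L. f x = f' x" "AE x in leb L. w x = w' x"
  shows "dirichlet_graph L f' w'"
proof -
  obtain F G where P: "is_prim L F G" "is_prim L G w" "AE x in leb L. f x = F x" "F 0 = 0" "F L = 0"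
    using assms(1) unfolding dirichlet_graph_def by blast
  have "AE x in leb L. f' x = F x" using P(3) assms(2) by (rule AE_mp[OF _ AE_mp]) auto
  then show ?thesis
    unfolding dirichlet_graph_def using P(1,4,5) is_prim_AE_cong[OF P(2) assms(3)] by blast
qed

lemma l2_norm_AE_eq_zero:
  assumes "f \<in> L2 L" "g \<in> L2 L"
  shows "l2_norm L (\<lambda>x. f x - g x) = 0 \<longleftrightarrow> (AE x in leb L. f x = g x)"
  using l2_norm_eq_0_iff[OF L2_diff[OF assms]] by simp

lemma is_prim_sup_bound:
  assumes "0 < L" "is_prim L F w" "F 0 = 0"
  shows "F \<in> L2 L" "l2_norm L F \<le> L * l2_norm L w"
proof -
  show F: "F \<in> L2 L" using is_prim_L2[OF _ assms(2)] assms(1) by simp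
  have "l2_norm L F \<le> \<bar>sqrt L * l2_norm L w\<bar> * sqrt L"
    by (rule l2_norm_bounded(2)[OF _ L2_measurable[OF F]])
      (use is_prim_bound[OF assms(2)] assms(1,3) in auto)
  also have "\<dots> = (sqrt L * sqrt L) * l2_norm L w" using assms(1) by (simp add: abs_mult)
  finally show "l2_norm L F \<le> L * l2_norm L w" using assms(1) by simp
qed

lemma is_prim_linear: "0 \<le> L \<Longrightarrow> is_prim L (\<lambda>x. c * of_real x) (\<lambda>x. c)"
  by (simp add: is_prim_def continuous_L2 scaleR_conv_of_real mult.commute)

text \<open>Each of the two integrations contributes a factor \<open>L\<close>. The unknown slope
  \<open>G 0\<close> is controlled by the second boundary condition, as \<open>F L = 0\<close>
  bounds it by the norm of \<open>G - G 0\<close>; this is the factor 2.\<close>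

lemma dirichlet_bound:
  assumes L: "0 < L" and F: "is_prim L F G" "is_prim L G w" "F 0 = 0" "F L = 0"
  shows "l2_norm L F \<le> 2 * L\<^sup>2 * l2_norm L w"
proof -
  define E where "E x = G x - G 0" for x
  have E: "is_prim L E w" using is_prim_diff[OF F(2) is_prim_const[of L "G 0"]] by (simp add: E_def[abs_def])
  have E2: "E \<in> L2 L" "l2_norm L E \<le> L * l2_norm L w"
    using is_prim_sup_bound[OF L E] by (auto simp: E_def)
  have EP: "is_prim L (\<lambda>x. F x - G 0 * of_real x) E"
  proof -
    from is_prim_diff[OF F(1) is_prim_linear[OF less_imp_le[OF L], of "G 0"]]
    show ?thesis by (simp add: E_def[abs_def])
  qed
  have "cmod (G 0 * of_real L) \<le> sqrt L * l2_norm L E"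
    using is_prim_bound[OF EP, of L] F(3,4) L by simp
  then have "L * cmod (G 0) \<le> sqrt L * l2_norm L E" using L by (simp add: norm_mult mult.commute)
  then have G0: "sqrt L * cmod (G 0) \<le> l2_norm L E"
  proof -
    assume "L * cmod (G 0) \<le> sqrt L * l2_norm L E"
    moreover have "L * cmod (G 0) = sqrt L * (sqrt L * cmod (G 0))" using L by simp
    ultimately show ?thesis using L by simp
  qed
  have "(\<lambda>x. G 0) \<in> L2 L" using L by (intro continuous_L2) auto
  then have "l2_norm L (\<lambda>x. E x + G 0) \<le> l2_norm L E + l2_norm L (\<lambda>x. G 0)"
    by (rule l2_norm_triangle[OF E2(1)])
  also have "l2_norm L (\<lambda>x. G 0) = sqrt L * cmod (G 0)"
    using L by (simp add: l2_norm_def real_sqrt_mult)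
  also have "l2_norm L E + sqrt L * cmod (G 0) \<le> 2 * (L * l2_norm L w)" using G0 E2(2) by linarith
  finally have "l2_norm L G \<le> 2 * (L * l2_norm L w)" by (simp add: E_def)
  then have "L * l2_norm L G \<le> L * (2 * (L * l2_norm L w))" using L by simp
  then show ?thesis using is_prim_sup_bound(2)[OF L F(1,3)] by (simp add: power2_eq_square)
qed

text \<open>No limit of derivatives is taken. Instead F'' = y is solved with Dirichlet conditions by
  two integrations, and \<open>dirichlet_bound\<close> forces \<open>u n\<close> to converge to this
  \<open>F\<close>.\<close>

lemma dirichlet_graph_limit:
  assumes L: "0 < L" and u: "\<And>n::nat. dirichlet_graph L (u n) (w n)" and xy: "x \<in> L2 L" "y \<in> L2 L"
    and lu: "(\<lambda>n. l2_norm L (\<lambda>t. u n t - x t)) \<longlonglongrightarrow> 0"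
    and lw: "(\<lambda>n. l2_norm L (\<lambda>t. w n t - y t)) \<longlonglongrightarrow> 0"
  shows "dirichlet_graph L x y"
proof -
  define Y1 where "Y1 t = 0 + integral {0..t} y" for t
  have Y1: "is_prim L Y1 y" unfolding Y1_def by (rule is_prim_integral[OF xy(2)])
  have Y1L: "Y1 \<in> L2 L" using is_prim_L2[OF _ Y1] L by simp
  define Y2 where "Y2 t = 0 + integral {0..t} Y1" for t
  have Y2: "is_prim L Y2 Y1" unfolding Y2_def by (rule is_prim_integral[OF Y1L])
  \<comment> \<open>Slope of the linear correction that brings the twofold primitive to zero at
    \<open>L\<close>.\<close>
  define c where "c = - (Y2 L / of_real L)"
  define F where "F t = Y2 t + c * of_real t" for t
  define G where "G t = Y1 t + c" for t
  have lin: "is_prim L (\<lambda>x. c * of_real x) (\<lambda>x. c)" by (rule is_prim_linear) (use L in simp)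
  have FG: "is_prim L F G" unfolding F_def[abs_def] G_def[abs_def] by (rule is_prim_add[OF Y2 lin])
  have Gy: "is_prim L G y" using is_prim_add[OF Y1 is_prim_const[of L c]] by (simp add: G_def[abs_def])
  have F0: "F 0 = 0" by (simp add: F_def Y2_def)
  have FL: "F L = 0" using L by (simp add: F_def c_def)
  have FL2: "F \<in> L2 L" using is_prim_L2[OF _ FG] L by simp
  have uL: "u n \<in> L2 L" "w n \<in> L2 L" for n using dirichlet_graph_dom[OF L u] by auto
  have "l2_norm L (\<lambda>t. u n t - F t) \<le> 2 * L\<^sup>2 * l2_norm L (\<lambda>t. w n t - y t)" for n
  proof -
    obtain Fn Gn where P: "is_prim L Fn Gn" "is_prim L Gn (w n)" "AE t in leb L. u n t = Fn t" "Fn 0 = 0" "Fn L = 0"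
      using u[of n] unfolding dirichlet_graph_def by blast
    have FnL: "Fn \<in> L2 L" using is_prim_L2[OF _ P(1)] L by simp
    have "l2_norm L (\<lambda>t. u n t - F t) = l2_norm L (\<lambda>t. Fn t - F t)"
      by (rule L2_AE_cong(2)[OF L2_diff[OF FnL FL2]])
        (use P(3) L2_measurable[OF L2_diff[OF uL(1) FL2]] in auto)
    then show ?thesis
      using dirichlet_bound[OF L is_prim_diff[OF P(1) FG] is_prim_diff[OF P(2) Gy]] P(4,5) F0 FL by simp
  qed
  moreover have "l2_norm L (\<lambda>t. x t - F t) \<le> l2_norm L (\<lambda>t. u n t - x t) + l2_norm L (\<lambda>t. u n t - F t)" for n
    using l2_norm_triangle[OF L2_diff[OF xy(1) uL(1)[of n]] L2_diff[OF uL(1)[of n] FL2]]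
      l2_norm_cmult[of L "-1" "\<lambda>t. u n t - x t"] by simp
  ultimately have le: "l2_norm L (\<lambda>t. x t - F t) \<le>
      l2_norm L (\<lambda>t. u n t - x t) + 2 * L\<^sup>2 * l2_norm L (\<lambda>t. w n t - y t)" for n
    by (meson add_left_mono order_trans)
  have "l2_norm L (\<lambda>t. x t - F t) \<le> 0 + 2 * L\<^sup>2 * 0"
    by (rule LIMSEQ_le_const[OF tendsto_add[OF lu tendsto_mult[OF tendsto_const lw]]]) (use le in blast)
  then have "l2_norm L (\<lambda>t. x t - F t) = 0" using l2_norm_nonneg[of L "\<lambda>t. x t - F t"] by linarith
  then have "AE t in leb L. x t = F t" using l2_norm_AE_eq_zero[OF xy(1) FL2] by simp
  then show ?thesis unfolding dirichlet_graph_def using FG Gy F0 FL by blast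
qed

lemma dirichlet_closed:
  assumes L: "0 < L"
  shows "closed_operator (L2 L) (l2_norm L) (dirichlet_dom L) (\<lambda>f. wderiv L (wderiv L f))"
proof (rule closed_operator_graph[where R = "dirichlet_graph L"])
  show "seminormed_space (L2 L) (l2_norm L)" by (rule seminormed_space_L2)
  show "dirichlet_graph L 0 0" using dirichlet_graph_zero by (simp add: zero_fun_def)
  show "dirichlet_graph L (u + u') (w + w')" if "dirichlet_graph L u w" "dirichlet_graph L u' w'" for u w u' w'
    using dirichlet_graph_add[OF that] by (simp add: plus_fun_def)
  show "dirichlet_graph L (a *\<^sub>C u) (a *\<^sub>C w)" if "dirichlet_graph L u w" for a u w
    using dirichlet_graph_scale[OF that, of a] by (simp add: scaleC_fun_def scaleC_complex_def)
  show "l2_norm L (w - w') = 0" if "dirichlet_graph L u w" "dirichlet_graph L u w'" for u w w'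
    using dirichlet_graph_unique[OF L that] l2_norm_AE_eq_zero[of w L w'] dirichlet_graph_dom(4)[OF L] that
    by (simp add: fun_diff_def)
  show "dirichlet_graph L v w" if "dirichlet_graph L u w" "v \<in> L2 L" "l2_norm L (u - v) = 0" for u v w
    using that l2_norm_AE_eq_zero[of u L v] dirichlet_graph_dom(3)[OF L that(1)]
    by (intro dirichlet_graph_AE[OF that(1)]) (auto simp: fun_diff_def)
  show "dirichlet_graph L x y"
    if "\<And>n::nat. dirichlet_graph L (u n) (w n)" "x \<in> L2 L" "y \<in> L2 L"
      "(\<lambda>n. l2_norm L (u n - x)) \<longlonglongrightarrow> 0" "(\<lambda>n. l2_norm L (w n - y)) \<longlonglongrightarrow> 0" for u w x y
    using dirichlet_graph_limit[OF L that(1,2,3)] that(4,5) by (simp add: fun_diff_def)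
qed (use dirichlet_dom_graph[OF L] dirichlet_graph_dom[OF L] in blast)+

text \<open>The two first order factors of \<open>F'' = k\<^sup>2 F\<close>, namely \<open>(F' \<plusminus> k F) exp (\<mp>k x)\<close>, are constant.\<close>

lemma second_order_solution:
  assumes L: "0 < L" and F: "is_prim L F G" "is_prim L G w" "F 0 = 0"
    and w: "AE x in leb L. w x = (of_real k)\<^sup>2 * F x" and x: "x \<in> {0..L}"
  shows "G x = G 0 * of_real (cosh (k * x))" "of_real k * F x = G 0 * of_real (sinh (k * x))"
proof -
  have cF: "continuous_on {0..L} (\<lambda>x. (of_real k)\<^sup>2 * F x)"
    by (intro continuous_intros is_prim_continuous[OF F(1)])
  have dF: "(F has_vector_derivative G x) (at x within {0..L})" if "x \<in> {0..L}" for x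
    by (rule is_prim_has_derivative[OF F(1) is_prim_continuous[OF F(2)] that])
  have dG: "(G has_vector_derivative (of_real k)\<^sup>2 * F x) (at x within {0..L})" if "x \<in> {0..L}" for x
    by (rule is_prim_has_derivative[OF is_prim_AE_cong[OF F(2) w] cF that])
  \<comment> \<open>Used with \<open>s = k\<close> and with \<open>s = - k\<close>; the two
    constants give the sum and the difference of exponentials below.\<close>
  have const: "(G x + of_real s * F x) * of_real (exp (- s * x)) = G 0" if s: "s\<^sup>2 = k\<^sup>2" for s
  proof -
    have s': "complex_of_real s * complex_of_real s = (of_real k)\<^sup>2"
      using s by (simp add: power2_eq_square flip: of_real_mult)
    have hz: "((\<lambda>x. (G x + of_real s * F x) * of_real (exp (- s * x))) has_vector_derivative 0) (at x within {0..L})"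
      if x: "x \<in> {0..L}" for x
    proof -
      have "((\<lambda>x. of_real (exp (- s * x))) has_vector_derivative complex_of_real (- s * exp (- s * x))) (at x within {0..L})"
        by (rule has_vector_derivative_of_real)
          (auto intro!: derivative_eq_intros simp: has_real_derivative_iff_has_vector_derivative[symmetric])
      from has_vector_derivative_mult[OF has_vector_derivative_add[OF dG[OF x]
            has_vector_derivative_mult_right[OF dF[OF x], of "of_real s"]] this]
      have "((\<lambda>x. (G x + of_real s * F x) * of_real (exp (- s * x))) has_vector_derivative
          ((G x + of_real s * F x) * complex_of_real (- s * exp (- s * x))
            + ((of_real k)\<^sup>2 * F x + of_real s * G x) * of_real (exp (- s * x)))) (at x within {0..L})" .
      also have "(G x + of_real s * F x) * complex_of_real (- s * exp (- s * x))
            + ((of_real k)\<^sup>2 * F x + of_real s * G x) * of_real (exp (- s * x)) = 0"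
        unfolding s'[symmetric] by (simp add: algebra_simps)
      finally show ?thesis .
    qed
    obtain C where C: "\<And>x. x \<in> {0..L} \<Longrightarrow> (G x + of_real s * F x) * of_real (exp (- s * x)) = C"
      by (rule has_vector_derivative_zero_constant[OF convex_real_interval(5) hz]) (assumption, rule that, blast)
    show ?thesis using C[OF x] C[of 0] F(3) L by simp
  qed
  have e: "of_real (exp (- s * x)) * of_real (exp (s * x)) = (1::complex)" for s
    by (simp flip: of_real_mult exp_add)
  have 1: "G x + of_real k * F x = G 0 * of_real (exp (k * x))"
  proof -
    have "(G x + of_real k * F x) * (of_real (exp (- k * x)) * of_real (exp (k * x))) = G 0 * of_real (exp (k * x))"
      using const[of k] by (simp only: mult.assoc[symmetric])
    then show ?thesis unfolding e by simp
  qed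
  have 2: "G x - of_real k * F x = G 0 * of_real (exp (- k * x))"
  proof -
    have "(G x + of_real (- k) * F x) * (of_real (exp (- (- k) * x)) * of_real (exp (- k * x))) = G 0 * of_real (exp (- k * x))"
      using const[of "- k"] by (simp only: mult.assoc[symmetric] power2_minus)
    then show ?thesis unfolding e by simp
  qed
  have "2 * G x = G 0 * of_real (exp (k * x) + exp (- k * x))" using 1 2 by (simp add: algebra_simps)
  then show "G x = G 0 * of_real (cosh (k * x))" by (simp add: cosh_def field_simps)
  have "2 * (of_real k * F x) = G 0 * of_real (exp (k * x) - exp (- k * x))" using 1 2 by (simp add: algebra_simps)
  then show "of_real k * F x = G 0 * of_real (sinh (k * x))" by (simp add: sinh_def field_simps)
qed

text \<open>By \<open>second_order_solution\<close> a solution that vanishes at \<open>0\<close> is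
  a multiple of sinh (k x), which does not vanish at \<open>L\<close>.\<close>

lemma dirichlet_injective:
  assumes L: "0 < L" and f: "dirichlet_graph L f w" and k: "0 < k"
    and w: "AE x in leb L. w x = (of_real k)\<^sup>2 * f x"
  shows "AE x in leb L. f x = 0"
proof -
  obtain F G where P: "is_prim L F G" "is_prim L G w" "AE x in leb L. f x = F x" "F 0 = 0" "F L = 0"
    using f unfolding dirichlet_graph_def by blast
  have w': "AE x in leb L. w x = (of_real k)\<^sup>2 * F x" using w P(3) by (rule AE_mp[OF _ AE_mp]) auto
  note sol = second_order_solution(2)[OF L P(1,2,4) w']
  have "G 0 * of_real (sinh (k * L)) = 0" using sol[of L] P(5) L by simp
  moreover have "sinh (k * L) > 0" using k L by simp
  ultimately have "G 0 = 0" using k L by simp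
  then have "F x = 0" if "x \<in> {0..L}" for x using sol[OF that] k by simp
  then have "AE x in leb L. F x = 0" by (auto intro!: AE_I2)
  then show ?thesis using P(3) by (rule AE_mp[OF _ AE_mp]) auto
qed

lemma sine_basis_dirichlet:
  assumes L: "0 < L"
  shows "dirichlet_graph L (sine_basis L n) (\<lambda>x. - (of_real ((real n * pi / L)\<^sup>2)) * sine_basis L n x)"
proof -
  define k where "k = real n * pi / L"
  define s where "s = sqrt (2 / L)"
  have sb: "sine_basis L n = (\<lambda>x. of_real (s * sin (k * x)))"
    by (simp add: sine_basis_def k_def s_def fun_eq_iff)
  have 1: "is_prim L (sine_basis L n) (\<lambda>x. of_real (s * k * cos (k * x)))"
    unfolding sb
    by (rule is_prim_C1)
      (use L in \<open>auto intro!: derivative_eq_intros continuous_intros has_vector_derivative_of_real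
        simp: has_real_derivative_iff_has_vector_derivative[symmetric]\<close>)
  have 2: "is_prim L (\<lambda>x. of_real (s * k * cos (k * x))) (\<lambda>x. of_real (- (s * k\<^sup>2 * sin (k * x))))"
    by (rule is_prim_C1)
      (use L in \<open>auto intro!: derivative_eq_intros continuous_intros has_vector_derivative_of_real
        simp: has_real_derivative_iff_has_vector_derivative[symmetric] power2_eq_square\<close>)
  have "(\<lambda>x. of_real (- (s * k\<^sup>2 * sin (k * x)))) = (\<lambda>x. - (of_real ((real n * pi / L)\<^sup>2)) * sine_basis L n x)"
    by (simp add: sine_basis_def k_def s_def fun_eq_iff)
  moreover have "sine_basis L n 0 = 0" "sine_basis L n L = 0"
    using L sin_npi by (auto simp: sine_basis_def)
  ultimately show ?thesis
    unfolding dirichlet_graph_def using 1 2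
    by (intro exI[of _ "sine_basis L n"] exI[of _ "\<lambda>x. of_real (s * k * cos (k * x))"]) simp
qed

text \<open>One \<open>C\<close> serves all \<open>z\<close> and \<open>K\<close>: the estimate is
  needed at the infinitely many points \<open>ev2 m - c\<close>, with a single gap
  \<open>K\<close>.\<close>

lemma dirichlet_resolvent:
  assumes L: "0 < L"
  shows "\<exists>C\<ge>0. \<forall>v\<in>L2 L. \<forall>z K. 0 < K \<and> (\<forall>n::nat. n \<ge> 1 \<longrightarrow> K \<le> cmod (- of_real ((real n * pi / L)\<^sup>2) - z)) \<longrightarrow>
      (\<exists>f w. dirichlet_graph L f w \<and> (AE x in leb L. w x - z * f x = v x)) \<and>
      (\<forall>f w. dirichlet_graph L f w \<and> (AE x in leb L. w x - z * f x = v x) \<longrightarrow> l2_norm L f \<le> C / K * l2_norm L v)"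
proof -
  let ?A = "\<lambda>f. wderiv L (wderiv L f)"
  have "bij_betw Suc UNIV {1..}" 
    by (auto simp: bij_betw_def image_iff Suc_le_eq gr0_conv_Suc)
  from riesz_basis_sequence[OF complete_seminormed_space_L2 sine_riesz_basis[OF L] this] L
  obtain m M where rs: "riesz_sequence_space (L2 L) (l2_norm L) (sine_basis L \<circ> Suc) m M" by auto
  define ev where "ev i = - complex_of_real ((real (Suc i) * pi / L)\<^sup>2)" for i
  interpret R: riesz_sequence_space "L2 L" "l2_norm L" "sine_basis L \<circ> Suc" m M by (rule rs)
  have op: "l2_norm L (?A f - z *\<^sub>C f - v) = 0 \<longleftrightarrow> (AE x in leb L. w x - z * f x = v x)"
    if "dirichlet_graph L f w" "v \<in> L2 L" for f w z v
  proof -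
    note 1 = dirichlet_graph_dom[OF L that(1)]
    have w: "?A f \<in> L2 L"
      by (rule L2_AE[OF 1(4)]) (use 1(2) in auto)
    have "?A f - z *\<^sub>C f - v = (\<lambda>x. (?A f x - z * f x) - v x)" by (simp add: fun_eq_iff)
    then have "l2_norm L (?A f - z *\<^sub>C f - v) = 0 \<longleftrightarrow> (AE x in leb L. ?A f x - z * f x = v x)"
      using l2_norm_AE_eq_zero[OF L2_diff[OF w L2_cmult[OF 1(3)]] that(2), of z] by simp
    also have "\<dots> \<longleftrightarrow> (AE x in leb L. w x - z * f x = v x)"
      by (rule eventually_subst) (use 1(2) in auto)
    finally show ?thesis .
  qed
  \<comment> \<open>The eigenvalues lie on the negative axis, so the point 1 has distance at least 1
    from all of them, and injectivity there is elementary.\<close>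
  have "diagonal_operator (L2 L) (l2_norm L) (sine_basis L \<circ> Suc) m M (dirichlet_dom L) ?A ev 1 1"
  proof unfold_locales
    show "closed_operator (L2 L) (l2_norm L) (dirichlet_dom L) ?A" by (rule dirichlet_closed[OF L])
    show "(sine_basis L \<circ> Suc) i \<in> dirichlet_dom L" for i
      using dirichlet_graph_dom(1)[OF L sine_basis_dirichlet[OF L]] by simp
    show "l2_norm L (?A ((sine_basis L \<circ> Suc) i) - ev i *\<^sub>C (sine_basis L \<circ> Suc) i) = 0" for i
      using op[OF sine_basis_dirichlet[OF L, of "Suc i"] L2_zero, of "ev i"] by (simp add: ev_def zero_fun_def[symmetric])
    show "1 \<le> cmod (ev i - 1)" for i
    proof -
      have "ev i - 1 = - complex_of_real ((real (Suc i) * pi / L)\<^sup>2 + 1)" by (simp add: ev_def)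
      then have "cmod (ev i - 1) = \<bar>(real (Suc i) * pi / L)\<^sup>2 + 1\<bar>" by (simp only: norm_minus_cancel norm_of_real)
      then show ?thesis by simp
    qed
    fix u assume u: "u \<in> dirichlet_dom L" "l2_norm L (?A u - 1 *\<^sub>C u) = 0"
    note g = dirichlet_dom_graph[OF L u(1)]
    have "AE x in leb L. ?A u x - 1 * u x = 0"
      using op[OF g L2_zero, of 1] u(2) by (simp add: zero_fun_def[symmetric])
    then have "AE x in leb L. u x = 0"
      by (intro dirichlet_injective[OF L g, of 1]) auto
    then show "l2_norm L u = 0" using l2_norm_eq_0_iff dirichlet_graph_dom(3)[OF L g] by blast
  qed simp
  then interpret diagonal_operator "L2 L" "l2_norm L" "sine_basis L \<circ> Suc" m M "dirichlet_dom L" ?A ev 1 1 .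
  have gap': "K \<le> cmod (ev i - z)" if "\<forall>n::nat. n \<ge> 1 \<longrightarrow> K \<le> cmod (- of_real ((real n * pi / L)\<^sup>2) - z)" for K z i
    using that[rule_format, of "Suc i"] by (simp add: ev_def)
  show ?thesis
  proof (rule exI[of _ "sqrt (M / m)"], intro conjI ballI allI impI; (elim conjE)?)
    show "0 \<le> sqrt (M / m)" using R.m_pos R.M_pos by simp
    fix v z K
    assume v: "v \<in> L2 L" "0 < K" "\<forall>n::nat. n \<ge> 1 \<longrightarrow> K \<le> cmod (- of_real ((real n * pi / L)\<^sup>2) - z)"
    obtain f where f: "f \<in> dirichlet_dom L" "l2_norm L (?A f - z *\<^sub>C f - v) = 0"
      using resolvent(1)[OF v(1) gap'[OF v(3)] v(2)] by blast
    show "\<exists>f w. dirichlet_graph L f w \<and> (AE x in leb L. w x - z * f x = v x)"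
      using dirichlet_dom_graph[OF L f(1)] op[OF dirichlet_dom_graph[OF L f(1)] v(1)] f(2) by blast
  next
    fix v z K f w
    assume v: "v \<in> L2 L" "0 < K" "\<forall>n::nat. n \<ge> 1 \<longrightarrow> K \<le> cmod (- of_real ((real n * pi / L)\<^sup>2) - z)"
      and f: "dirichlet_graph L f w" "AE x in leb L. w x - z * f x = v x"
    show "l2_norm L f \<le> sqrt (M / m) / K * l2_norm L v"
      using resolvent(2)[OF v(1) gap'[OF v(3)] v(2) dirichlet_graph_dom(1)[OF L f(1)]] op[OF f(1) v(1)] f(2)
      by simp
  qed
qed

section \<open>The state space\<close>

text \<open>Reads as \<open>w = g'\<close> with \<open>g\<close> vanishing at \<open>0\<close>.
  Carrying \<open>w\<close> along lets the norm of the state space be computed from any version of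
  the derivative.\<close>

definition h1_graph :: "real \<Rightarrow> (real \<Rightarrow> complex) \<Rightarrow> (real \<Rightarrow> complex) \<Rightarrow> bool"
  where "h1_graph L g w \<longleftrightarrow> (\<exists>G. is_prim L G w \<and> (AE x in leb L. g x = G x) \<and> G 0 = 0)"

lemma H1_left_graph:
  assumes L: "0 < L" and g: "g \<in> H1_left L"
  shows "h1_graph L g (wderiv L g)"
proof -
  have g': "g \<in> H1 L" "pt_value L g 0 = 0" using g by (auto simp: H1_left_def)
  obtain G where G: "is_prim L G (wderiv L g)" "AE x in leb L. g x = G x" by (rule H1_is_prim[OF L g'(1)])
  have "G 0 = 0" using is_prim_H1(3)[OF L G, of 0] g'(2) L by simp
  then show ?thesis unfolding h1_graph_def using G by blast
qed

lemma h1_graphD: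
  assumes L: "0 < L" and "h1_graph L g w"
  shows "g \<in> H1_left L" "AE x in leb L. wderiv L g x = w x" "g \<in> L2 L" "w \<in> L2 L"
    "l2_norm L g \<le> L * l2_norm L w"
proof -
  obtain G where G: "is_prim L G w" "AE x in leb L. g x = G x" "G 0 = 0"
    using assms(2) unfolding h1_graph_def by blast
  note 1 = is_prim_H1[OF L G(1,2)]
  show "g \<in> H1_left L" using 1(1) 1(3)[of 0] G(3) L by (simp add: H1_left_def)
  show "AE x in leb L. wderiv L g x = w x" by (rule 1(2))
  show g: "g \<in> L2 L" by (rule H1_wderiv(1)[OF 1(1)])
  show "w \<in> L2 L" by (rule is_primD(1)[OF G(1)])
  have "AE x in leb L. G x = g x" using G(2) by auto
  then show "l2_norm L g \<le> L * l2_norm L w"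
    using L2_AE_cong(2)[of G L g] is_prim_sup_bound[OF L G(1,3)] L2_measurable[OF g] by simp
qed

lemma h1_graph_add:
  assumes "h1_graph L g w" "h1_graph L g' w'"
  shows "h1_graph L (\<lambda>x. g x + g' x) (\<lambda>x. w x + w' x)"
proof -
  obtain G where G: "is_prim L G w" "AE x in leb L. g x = G x" "G 0 = 0"
    using assms(1) unfolding h1_graph_def by blast
  obtain G' where G': "is_prim L G' w'" "AE x in leb L. g' x = G' x" "G' 0 = 0"
    using assms(2) unfolding h1_graph_def by blast
  have "AE x in leb L. g x + g' x = G x + G' x" using G(2) G'(2) by (rule AE_mp[OF _ AE_mp]) auto
  then show ?thesis
    unfolding h1_graph_def using is_prim_add[OF G(1) G'(1)] G(3) G'(3)
    by (intro exI[of _ "\<lambda>x. G x + G' x"]) simp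
qed

lemma h1_graph_scale:
  assumes "h1_graph L g w"
  shows "h1_graph L (\<lambda>x. a * g x) (\<lambda>x. a * w x)"
proof -
  obtain G where G: "is_prim L G w" "AE x in leb L. g x = G x" "G 0 = 0"
    using assms(1) unfolding h1_graph_def by blast
  have "AE x in leb L. a * g x = a * G x" using G(2) by auto
  then show ?thesis
    unfolding h1_graph_def using is_prim_cmult[OF G(1), of a] G(3)
    by (intro exI[of _ "\<lambda>x. a * G x"]) simp
qed

lemma h1_graph_diff:
  assumes "h1_graph L g w" "h1_graph L g' w'"
  shows "h1_graph L (\<lambda>x. g x - g' x) (\<lambda>x. w x - w' x)"
  using h1_graph_add[OF assms(1) h1_graph_scale[OF assms(2), of "-1"]] by simp

lemma h1_graph_zero: "h1_graph L (\<lambda>x. 0) (\<lambda>x. 0)"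
  unfolding h1_graph_def using is_prim_const[of L 0] by (intro exI[of _ "\<lambda>x. 0"]) simp

lemma h1_graph_integral: "w \<in> L2 L \<Longrightarrow> h1_graph L (\<lambda>x. integral {0..x} w) w"
  unfolding h1_graph_def using is_prim_integral[of w L 0] by (intro exI[of _ "\<lambda>x. integral {0..x} w"]) simp

lemma H0_norm_eq:
  assumes L: "0 < L" and f: "f \<in> L2 L" and g: "h1_graph L g w" and h: "h \<in> L2 L"
  shows "H0_norm L (f, g, h) = sqrt ((l2_norm L f)\<^sup>2 + (l2_norm L w)\<^sup>2 + (l2_norm L h)\<^sup>2)"
proof -
  let ?d = "wderiv L g"
  note 1 = h1_graphD[OF L g]
  have w: "AE x in leb L. w x = ?d x" using 1(2) by auto
  have d: "?d \<in> L2 L" by (rule L2_AE[OF 1(4) w])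
  have dn: "l2_norm L ?d = l2_norm L w" by (rule L2_AE_cong(2)[OF 1(4) L2_measurable[OF d] w])
  note i = L2_integrable_sq[OF f] L2_integrable_sq[OF d] L2_integrable_sq[OF h]
  have "H0_inner L (f, g, h) (f, g, h)
      = (LINT x|leb L. complex_of_real ((cmod (f x))\<^sup>2 + (cmod (?d x))\<^sup>2 + (cmod (h x))\<^sup>2))"
    unfolding H0_inner_def by (simp only: prod.case complex_norm_square of_real_add)
  also have "\<dots> = complex_of_real (LINT x|leb L. (cmod (f x))\<^sup>2 + (cmod (?d x))\<^sup>2 + (cmod (h x))\<^sup>2)"
    by (rule integral_complex_of_real)
  also have "(LINT x|leb L. (cmod (f x))\<^sup>2 + (cmod (?d x))\<^sup>2 + (cmod (h x))\<^sup>2)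
      = (l2_norm L f)\<^sup>2 + (l2_norm L w)\<^sup>2 + (l2_norm L h)\<^sup>2"
    using i by (simp add: l2_norm_sq dn[symmetric])
  finally show ?thesis by (simp add: H0_norm_def)
qed

lemma H0_cases:
  assumes L: "0 < L" and u: "u \<in> H0 L"
  obtains f g h w where "u = (f, g, h)" "f \<in> L2 L" "h1_graph L g w" "h \<in> L2 L"
proof (cases u)
  case (fields f g h)
  then have "f \<in> L2 L" "g \<in> H1_left L" "h \<in> L2 L" using u by (auto simp: H0_def)
  then show ?thesis using that[OF fields _ H1_left_graph[OF L]] by blast
qed

lemma H0_I:
  assumes "0 < L" "f \<in> L2 L" "h1_graph L g w" "h \<in> L2 L"
  shows "(f, g, h) \<in> H0 L"
  using assms h1_graphD(1)[OF assms(1,3)] by (simp add: H0_def)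

lemma seminormed_space_H0:
  assumes L: "0 < L"
  shows "seminormed_space (H0 L) (H0_norm L)"
proof
  show "csubspace (H0 L)"
  proof (rule complex_vector.subspaceI)
    have "(\<lambda>x. 0, \<lambda>x. 0, \<lambda>x. 0) \<in> H0 L" by (rule H0_I[OF L L2_zero h1_graph_zero L2_zero])
    then show "0 \<in> H0 L" by (simp add: zero_prod_def zero_fun_def)
    fix u assume "u \<in> H0 L"
    then obtain f g h w where u: "u = (f, g, h)" "f \<in> L2 L" "h1_graph L g w" "h \<in> L2 L"
      by (rule H0_cases[OF L])
    show "c *\<^sub>C u \<in> H0 L" for c
      using H0_I[OF L L2_cmult[OF u(2), of c] h1_graph_scale[OF u(3), of c] L2_cmult[OF u(4), of c]]
      by (simp add: u(1) scaleC_prod_def scaleC_fun_def scaleC_complex_def)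
    fix v assume "v \<in> H0 L"
    then obtain f' g' h' w' where v: "v = (f', g', h')" "f' \<in> L2 L" "h1_graph L g' w'" "h' \<in> L2 L"
      by (rule H0_cases[OF L])
    show "u + v \<in> H0 L"
      using H0_I[OF L L2_add[OF u(2) v(2)] h1_graph_add[OF u(3) v(3)] L2_add[OF u(4) v(4)]]
      by (simp add: u(1) v(1) plus_fun_def)
  qed
next
  fix u assume "u \<in> H0 L"
  then obtain f g h w where u: "u = (f, g, h)" "f \<in> L2 L" "h1_graph L g w" "h \<in> L2 L"
    by (rule H0_cases[OF L])
  note nu = H0_norm_eq[OF L u(2-4)]
  show "H0_norm L (a *\<^sub>C u) = cmod a * H0_norm L u" for a
  proof -
    have "a *\<^sub>C u = (\<lambda>x. a * f x, \<lambda>x. a * g x, \<lambda>x. a * h x)"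
      by (simp add: u(1) scaleC_prod_def scaleC_fun_def scaleC_complex_def)
    then have "H0_norm L (a *\<^sub>C u) = sqrt ((cmod a)\<^sup>2 * ((l2_norm L f)\<^sup>2 + (l2_norm L w)\<^sup>2 + (l2_norm L h)\<^sup>2))"
      using H0_norm_eq[OF L L2_cmult[OF u(2), of a] h1_graph_scale[OF u(3), of a] L2_cmult[OF u(4), of a]]
      by (simp add: l2_norm_cmult power_mult_distrib distrib_left)
    then show ?thesis by (simp add: u(1) nu real_sqrt_mult)
  qed
  fix v assume "v \<in> H0 L"
  then obtain f' g' h' w' where v: "v = (f', g', h')" "f' \<in> L2 L" "h1_graph L g' w'" "h' \<in> L2 L"
    by (rule H0_cases[OF L])
  note nv = H0_norm_eq[OF L v(2-4)]
  have w: "w \<in> L2 L" "w' \<in> L2 L" using h1_graphD(4)[OF L] u(3) v(3) by blast+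
  have norm3: "norm (a, b, c) = sqrt (a\<^sup>2 + b\<^sup>2 + c\<^sup>2)" for a b c :: real
    by (simp add: norm_Pair)
  have "u + v = (\<lambda>x. f x + f' x, \<lambda>x. g x + g' x, \<lambda>x. h x + h' x)"
    by (simp add: u(1) v(1) plus_fun_def)
  then have "H0_norm L (u + v) = sqrt ((l2_norm L (\<lambda>x. f x + f' x))\<^sup>2
      + (l2_norm L (\<lambda>x. w x + w' x))\<^sup>2 + (l2_norm L (\<lambda>x. h x + h' x))\<^sup>2)"
    using H0_norm_eq[OF L L2_add[OF u(2) v(2)] h1_graph_add[OF u(3) v(3)] L2_add[OF u(4) v(4)]] by simp
  also have "\<dots> \<le> sqrt ((l2_norm L f + l2_norm L f')\<^sup>2 + (l2_norm L w + l2_norm L w')\<^sup>2 + (l2_norm L h + l2_norm L h')\<^sup>2)"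
    by (intro real_sqrt_le_mono add_mono power_mono l2_norm_triangle l2_norm_nonneg u v w)
  \<comment> \<open>The three component norms are read as a vector of a Euclidean space, whose
    triangle inequality finishes the proof.\<close>
  also have "\<dots> = norm ((l2_norm L f, l2_norm L w, l2_norm L h) + (l2_norm L f', l2_norm L w', l2_norm L h'))"
    by (simp add: norm3)
  also have "\<dots> \<le> norm (l2_norm L f, l2_norm L w, l2_norm L h) + norm (l2_norm L f', l2_norm L w', l2_norm L h')"
    by (rule norm_triangle_ineq)
  also have "\<dots> = H0_norm L u + H0_norm L v" by (simp only: norm3 u(1) v(1) nu nv)
  finally show "H0_norm L (u + v) \<le> H0_norm L u + H0_norm L v" .
qed

lemma H0_norm_diff_eq:
  assumes L: "0 < L" and "f \<in> L2 L" "h1_graph L g w" "h \<in> L2 L"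
    and "f' \<in> L2 L" "h1_graph L g' w'" "h' \<in> L2 L"
  shows "H0_norm L ((f, g, h) - (f', g', h')) = sqrt ((l2_norm L (\<lambda>x. f x - f' x))\<^sup>2
      + (l2_norm L (\<lambda>x. w x - w' x))\<^sup>2 + (l2_norm L (\<lambda>x. h x - h' x))\<^sup>2)"
  using H0_norm_eq[OF L L2_diff[OF assms(2,5)] h1_graph_diff[OF assms(3,6)] L2_diff[OF assms(4,7)]]
  by (simp add: fun_diff_def)

lemma H0_norm_diff_bounds:
  assumes L: "0 < L" and "f \<in> L2 L" "h1_graph L g w" "h \<in> L2 L"
    and "f' \<in> L2 L" "h1_graph L g' w'" "h' \<in> L2 L"
  shows "l2_norm L (\<lambda>x. f x - f' x) \<le> H0_norm L ((f, g, h) - (f', g', h'))"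
    "l2_norm L (\<lambda>x. w x - w' x) \<le> H0_norm L ((f, g, h) - (f', g', h'))"
    "l2_norm L (\<lambda>x. h x - h' x) \<le> H0_norm L ((f, g, h) - (f', g', h'))"
  unfolding H0_norm_diff_eq[OF assms] by (auto intro!: real_le_rsqrt)

lemma H0_null_iff:
  assumes L: "0 < L" and "f \<in> L2 L" "h1_graph L g w" "h \<in> L2 L"
    and "f' \<in> L2 L" "h1_graph L g' w'" "h' \<in> L2 L"
  shows "H0_norm L ((f, g, h) - (f', g', h')) = 0 \<longleftrightarrow>
    (AE x in leb L. f x = f' x) \<and> (AE x in leb L. w x = w' x) \<and> (AE x in leb L. h x = h' x)"
  unfolding H0_norm_diff_eq[OF assms]
  using l2_norm_AE_eq_zero[OF assms(2,5)] l2_norm_AE_eq_zero[OF assms(4,7)]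
    l2_norm_AE_eq_zero[OF h1_graphD(4)[OF L assms(3)] h1_graphD(4)[OF L assms(6)]]
  by (simp add: add_nonneg_eq_0_iff)

text \<open>The Poincare inequality for functions vanishing at \<open>0\<close>: the derivative
  controls the function.\<close>

lemma h1_graph_eq_AE:
  assumes L: "0 < L" and g: "h1_graph L g w" "h1_graph L g' w'" and w: "AE x in leb L. w x = w' x"
  shows "AE x in leb L. g x = g' x"
proof -
  note d = h1_graph_diff[OF g]
  note W = h1_graphD(4)[OF L g(1)] h1_graphD(4)[OF L g(2)]
  have "l2_norm L (\<lambda>x. g x - g' x) \<le> 0"
    using h1_graphD(5)[OF L d] l2_norm_AE_eq_zero[OF W] w by simp
  then have "l2_norm L (\<lambda>x. g x - g' x) = 0"
    using l2_norm_nonneg[of L "\<lambda>x. g x - g' x"] by linarith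
  then show ?thesis using l2_norm_AE_eq_zero h1_graphD(3)[OF L] g by blast
qed

lemma complete_seminormed_space_H0:
  assumes L: "0 < L"
  shows "complete_seminormed_space (H0 L) (H0_norm L)"
proof -
  interpret seminormed_space "H0 L" "H0_norm L" by (rule seminormed_space_H0[OF L])
  show ?thesis
  proof
    fix x :: "nat \<Rightarrow> state"
    assume x: "\<And>n. x n \<in> H0 L"
      and cauchy: "\<And>e::real. e > 0 \<Longrightarrow> \<exists>N. \<forall>m\<ge>N. \<forall>n\<ge>N. H0_norm L (x m - x n) < e"
    have "\<exists>f g h w. x n = (f, g, h) \<and> f \<in> L2 L \<and> h1_graph L g w \<and> h \<in> L2 L" for n
      using H0_cases[OF L x[of n]] by metis
    then obtain f g h w where xn: "\<And>n. x n = (f n, g n, h n)" and f: "\<And>n. f n \<in> L2 L"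
      and g: "\<And>n. h1_graph L (g n) (w n)" and h: "\<And>n. h n \<in> L2 L"
      by metis
    have w: "w n \<in> L2 L" for n by (rule h1_graphD(4)[OF L g])
    have bd: "l2_norm L (f m - f n) \<le> H0_norm L (x m - x n)"
      "l2_norm L (w m - w n) \<le> H0_norm L (x m - x n)"
      "l2_norm L (h m - h n) \<le> H0_norm L (x m - x n)" for m n
      unfolding xn using H0_norm_diff_bounds[OF L f g h f g h] by (simp_all add: fun_diff_def)
    have lim: "\<exists>u\<in>L2 L. (\<lambda>n. l2_norm L (y n - u)) \<longlonglongrightarrow> 0"
      if "\<And>n. y n \<in> L2 L" "\<And>m n. l2_norm L (y m - y n) \<le> H0_norm L (x m - x n)" for y :: "nat \<Rightarrow> real \<Rightarrow> complex"
    proof (rule L2_complete[OF that(1)])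
      show "\<exists>N. \<forall>m\<ge>N. \<forall>n\<ge>N. l2_norm L (y m - y n) < e" if "e > 0" for e
        using cauchy[OF that] \<open>\<And>m n. l2_norm L (y m - y n) \<le> H0_norm L (x m - x n)\<close>
        by (meson le_less_trans)
    qed (use L in simp)
    obtain f' where f': "f' \<in> L2 L" "(\<lambda>n. l2_norm L (f n - f')) \<longlonglongrightarrow> 0"
      using lim[of f, OF f bd(1)] by (rule bexE)
    obtain w' where w': "w' \<in> L2 L" "(\<lambda>n. l2_norm L (w n - w')) \<longlonglongrightarrow> 0"
      using lim[of w, OF w bd(2)] by (rule bexE)
    obtain h' where h': "h' \<in> L2 L" "(\<lambda>n. l2_norm L (h n - h')) \<longlonglongrightarrow> 0"
      using lim[of h, OF h bd(3)] by (rule bexE)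
    \<comment> \<open>The middle component is recovered by integrating the limit of the derivatives,
      which builds in the condition at \<open>0\<close>.\<close>
    note g' = h1_graph_integral[OF w'(1)]
    have "(\<lambda>n. sqrt ((l2_norm L (f n - f'))\<^sup>2 + (l2_norm L (w n - w'))\<^sup>2 + (l2_norm L (h n - h'))\<^sup>2)) \<longlonglongrightarrow> sqrt (0\<^sup>2 + 0\<^sup>2 + 0\<^sup>2)"
      by (intro tendsto_real_sqrt tendsto_add tendsto_power f' w' h')
    then have "(\<lambda>n. H0_norm L (x n - (f', \<lambda>t. integral {0..t} w', h'))) \<longlonglongrightarrow> 0"
      unfolding xn H0_norm_diff_eq[OF L f g h f'(1) g' h'(1)] by (simp add: fun_diff_def)
    then show "\<exists>u\<in>H0 L. (\<lambda>n. H0_norm L (x n - u)) \<longlonglongrightarrow> 0"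
      by (intro bexI[OF _ H0_I[OF L f'(1) g' h'(1)]])
  qed
qed

section \<open>The eigenvectors\<close>

lemma l2_norm_sq_add_le:
  assumes "f \<in> L2 L" "g \<in> L2 L"
  shows "(l2_norm L (\<lambda>x. f x + g x))\<^sup>2 \<le> 2 * (l2_norm L f)\<^sup>2 + 2 * (l2_norm L g)\<^sup>2"
proof -
  have "(l2_norm L (\<lambda>x. f x + g x))\<^sup>2 \<le> (l2_norm L f + l2_norm L g)\<^sup>2"
    by (intro power_mono l2_norm_triangle assms l2_norm_nonneg)
  also have "\<dots> \<le> 2 * (l2_norm L f)\<^sup>2 + 2 * (l2_norm L g)\<^sup>2"
    using sum_squares_bound[of "l2_norm L f" "l2_norm L g"] by (simp add: power2_sum)
  finally show ?thesis .
qed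

lemma l2_norm_sum_sq_le:
  assumes "finite F" "\<And>i. i \<in> F \<Longrightarrow> e i \<in> L2 L"
  shows "(l2_norm L (\<lambda>x. \<Sum>i\<in>F. b i * e i x))\<^sup>2 \<le> (\<Sum>i\<in>F. (cmod (b i))\<^sup>2) * (\<Sum>i\<in>F. (l2_norm L (e i))\<^sup>2)"
proof -
  have "l2_norm L (\<lambda>x. \<Sum>i\<in>F. b i * e i x) \<le> (\<Sum>i\<in>F. cmod (b i) * l2_norm L (e i))"
    using assms
  proof (induction F rule: finite_induct)
    case empty
    then show ?case by (simp add: l2_norm_def)
  next
    case (insert j F)
    have "l2_norm L (\<lambda>x. b j * e j x + (\<Sum>i\<in>F. b i * e i x))
        \<le> l2_norm L (\<lambda>x. b j * e j x) + l2_norm L (\<lambda>x. \<Sum>i\<in>F. b i * e i x)"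
      using insert.prems by (intro l2_norm_triangle L2_cmult L2_sum) auto
    also have "\<dots> \<le> cmod (b j) * l2_norm L (e j) + (\<Sum>i\<in>F. cmod (b i) * l2_norm L (e i))"
      using insert.IH insert.prems by (simp add: l2_norm_cmult)
    finally show ?case using insert.hyps by simp
  qed
  then have "(l2_norm L (\<lambda>x. \<Sum>i\<in>F. b i * e i x))\<^sup>2 \<le> (\<Sum>i\<in>F. cmod (b i) * l2_norm L (e i))\<^sup>2"
    by (intro power_mono) auto
  also have "\<dots> \<le> (\<Sum>i\<in>F. (cmod (b i))\<^sup>2) * (\<Sum>i\<in>F. (l2_norm L (e i))\<^sup>2)"
    by (rule Cauchy_Schwarz_ineq_sum)
  finally show ?thesis .
qed

lemma l2_norm_combination_le:
  assumes "0 \<le> L" "E \<in> L2 L" "O' \<in> L2 L" "continuous_on {0..L} a" "continuous_on {0..L} b"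
    and "\<And>x. x \<in> {0..L} \<Longrightarrow> cmod (a x) \<le> k" "\<And>x. x \<in> {0..L} \<Longrightarrow> cmod (b x) \<le> k"
  shows "(\<lambda>x. a x * E x + b x * O' x) \<in> L2 L"
    "(l2_norm L (\<lambda>x. a x * E x + b x * O' x))\<^sup>2 \<le> 2 * k\<^sup>2 * ((l2_norm L E)\<^sup>2 + (l2_norm L O')\<^sup>2)"
proof -
  have k: "0 \<le> k" using assms(1) order_trans[OF norm_ge_zero assms(6)[of 0]] by simp
  have A: "AE x in leb L. cmod (a x) \<le> k" "AE x in leb L. cmod (b x) \<le> k"
    using assms(6,7) by (auto intro!: AE_I2)
  note 1 = L2_mult_bounded[OF assms(2) continuous_leb_measurable[OF assms(4)] A(1)]
  note 2 = L2_mult_bounded[OF assms(3) continuous_leb_measurable[OF assms(5)] A(2)]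
  show "(\<lambda>x. a x * E x + b x * O' x) \<in> L2 L" by (rule L2_add[OF 1(1) 2(1)])
  have "(l2_norm L (\<lambda>x. a x * E x + b x * O' x))\<^sup>2
      \<le> 2 * (l2_norm L (\<lambda>x. a x * E x))\<^sup>2 + 2 * (l2_norm L (\<lambda>x. b x * O' x))\<^sup>2"
    by (rule l2_norm_sq_add_le[OF 1(1) 2(1)])
  also have "\<dots> \<le> 2 * (k * l2_norm L E)\<^sup>2 + 2 * (k * l2_norm L O')\<^sup>2"
    by (intro add_mono mult_left_mono power_mono 1(2)[OF k] 2(2)[OF k]) auto
  finally show "(l2_norm L (\<lambda>x. a x * E x + b x * O' x))\<^sup>2 \<le> 2 * k\<^sup>2 * ((l2_norm L E)\<^sup>2 + (l2_norm L O')\<^sup>2)"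
    by (simp add: power_mult_distrib algebra_simps)
qed

text \<open>With \<open>fourier_sin\<close>, the even and odd parts of exp (\<i> m \<pi> x / L).
  Pairs of functions on (0, L) thereby stand for functions on (-L, L).\<close>

definition fourier_cos :: "real \<Rightarrow> int \<Rightarrow> real \<Rightarrow> complex"
  where "fourier_cos L m x = complex_of_real (cos (of_int m * pi / L * x))"

definition fourier_sin :: "real \<Rightarrow> int \<Rightarrow> real \<Rightarrow> complex"
  where "fourier_sin L m x = \<i> * complex_of_real (sin (of_int m * pi / L * x))"

lemma fourier_continuous: "continuous_on S (fourier_cos L m)" "continuous_on S (fourier_sin L m)"
  unfolding fourier_cos_def fourier_sin_def by (intro continuous_intros)+

lemma fourier_L2: "0 \<le> L \<Longrightarrow> fourier_cos L m \<in> L2 L" "0 \<le> L \<Longrightarrow> fourier_sin L m \<in> L2 L"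
  by (intro continuous_L2 fourier_continuous; assumption)+

text \<open>Neither component is orthogonal over all integers, but the two Gram matrices add up to
  \<open>L\<close> times the identity, because cos cos + sin sin is the cosine of the difference of
  frequencies.\<close>

lemma fourier_norm_sum:
  assumes L: "0 < L" and F: "finite F"
  shows "(l2_norm L (\<lambda>x. \<Sum>m\<in>F. a m * fourier_cos L m x))\<^sup>2 + (l2_norm L (\<lambda>x. \<Sum>m\<in>F. a m * fourier_sin L m x))\<^sup>2
    = L * (\<Sum>m\<in>F. (cmod (a m))\<^sup>2)"
proof -
  note [simp] = fourier_L2[OF less_imp_le[OF L]]
  let ?C = "\<lambda>i j. LINT x|leb L. fourier_cos L i x * cnj (fourier_cos L j x)"
  let ?S = "\<lambda>i j. LINT x|leb L. fourier_sin L i x * cnj (fourier_sin L j x)"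
  have gram: "?C i j + ?S i j = (if i = j then of_real L else 0)" for i j
  proof -
    have "?C i j + ?S i j = (LINT x|leb L. fourier_cos L i x * cnj (fourier_cos L j x)
        + fourier_sin L i x * cnj (fourier_sin L j x))"
      by (intro Bochner_Integration.integral_add[symmetric] L2_integrable_mult L2_cnj) simp_all
    also have "\<dots> = (LINT x|leb L. complex_of_real (cos (of_int (i - j) * pi / L * x)))"
    proof (rule Bochner_Integration.integral_cong[OF refl])
      fix x
      have "of_int (i - j) * pi / L * x = of_int i * pi / L * x - of_int j * pi / L * x"
        by (simp add: algebra_simps diff_divide_distrib)
      then show "fourier_cos L i x * cnj (fourier_cos L j x) + fourier_sin L i x * cnj (fourier_sin L j x)
          = complex_of_real (cos (of_int (i - j) * pi / L * x))"
        by (simp only: cos_diff) (simp add: fourier_cos_def fourier_sin_def complex_eq_iff)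
    qed
    also have "\<dots> = complex_of_real (LINT x|leb L. cos (of_int (i - j) * pi / L * x))"
      by (rule integral_complex_of_real)
    also have "\<dots> = (if i = j then of_real L else 0)" unfolding integral_cos_int[OF L] by simp
    finally show ?thesis .
  qed
  have "complex_of_real ((l2_norm L (\<lambda>x. \<Sum>m\<in>F. a m * fourier_cos L m x))\<^sup>2 + (l2_norm L (\<lambda>x. \<Sum>m\<in>F. a m * fourier_sin L m x))\<^sup>2)
      = (\<Sum>i\<in>F. \<Sum>j\<in>F. a i * cnj (a j) * (?C i j + ?S i j))"
    unfolding of_real_add l2_norm_sq_sum[OF F, of "fourier_cos L", OF fourier_L2(1)[OF less_imp_le[OF L]]]
      l2_norm_sq_sum[OF F, of "fourier_sin L", OF fourier_L2(2)[OF less_imp_le[OF L]]]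
    by (simp add: sum.distrib distrib_left)
  also have "\<dots> = (\<Sum>i\<in>F. \<Sum>j\<in>F. if i = j then of_real L * (a i * cnj (a j)) else 0)"
    unfolding gram by (intro sum.cong) auto
  also have "\<dots> = of_real L * (\<Sum>i\<in>F. a i * cnj (a i))" using F by (simp add: sum_distrib_left)
  also have "\<dots> = complex_of_real (L * (\<Sum>i\<in>F. (cmod (a i))\<^sup>2))"
    by (simp only: complex_norm_square of_real_sum of_real_mult)
  finally show ?thesis by (simp only: of_real_eq_iff)
qed

text \<open>The pairs for \<open>m\<close> and \<open>- m\<close> combine to (cos, 0) and (0, sin),
  so the components can be approximated independently.\<close>

lemma fourier_dense:
  assumes L: "0 < L" and E: "E \<in> L2 L" "O' \<in> L2 L" and e: "0 < e"
  obtains p q where "(p, q) \<in> cspan (range (\<lambda>m. (fourier_cos L m, fourier_sin L m)))"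
    "l2_norm L (\<lambda>x. E x - p x) < e" "l2_norm L (\<lambda>x. O' x - q x) < e"
proof -
  let ?S = "cspan (range (\<lambda>m. (fourier_cos L m, fourier_sin L m)))"
  have base: "(fourier_cos L m, fourier_sin L m) \<in> ?S" for m
    by (rule complex_vector.span_base) simp
  have c: "(cosf L k, 0) \<in> ?S" for k
  proof -
    have "(cosf L k, 0) = (1 / 2) *\<^sub>C (fourier_cos L (int k), fourier_sin L (int k))
        + (1 / 2) *\<^sub>C (fourier_cos L (- int k), fourier_sin L (- int k))"
      by (simp add: scaleC_prod_def fun_eq_iff cosf_def fourier_cos_def fourier_sin_def)
    then show ?thesis
      by (simp only:) (intro complex_vector.span_add complex_vector.span_scale base)
  qed
  have s: "(0, sinf L k) \<in> ?S" for k
  proof -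
    have "(0, sinf L k) = (- \<i> / 2) *\<^sub>C (fourier_cos L (int k), fourier_sin L (int k))
        + (\<i> / 2) *\<^sub>C (fourier_cos L (- int k), fourier_sin L (- int k))"
      by (simp add: scaleC_prod_def fun_eq_iff sinf_def fourier_cos_def fourier_sin_def)
    then show ?thesis
      by (simp only:) (intro complex_vector.span_add complex_vector.span_scale base)
  qed
  have "csubspace {p. (p, 0) \<in> ?S}"
  proof (rule complex_vector.subspaceI)
    show "0 \<in> {p. (p, 0) \<in> ?S}" using complex_vector.span_zero by (simp add: zero_prod_def[symmetric])
    show "x + y \<in> {p. (p, 0) \<in> ?S}" if "x \<in> {p. (p, 0) \<in> ?S}" "y \<in> {p. (p, 0) \<in> ?S}" for x y
      using complex_vector.span_add[of "(x, 0)" _ "(y, 0)"] that by simp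
    show "a *\<^sub>C x \<in> {p. (p, 0) \<in> ?S}" if "x \<in> {p. (p, 0) \<in> ?S}" for a x
      using complex_vector.span_scale[of "(x, 0)" _ a] that by (simp add: scaleC_prod_def)
  qed
  then have C: "cspan (range (cosf L)) \<subseteq> {p. (p, 0) \<in> ?S}"
    by (rule complex_vector.span_minimal[rotated]) (use c in auto)
  have "csubspace {p. (0, p) \<in> ?S}"
  proof (rule complex_vector.subspaceI)
    show "0 \<in> {p. (0, p) \<in> ?S}" using complex_vector.span_zero by (simp add: zero_prod_def[symmetric])
    show "x + y \<in> {p. (0, p) \<in> ?S}" if "x \<in> {p. (0, p) \<in> ?S}" "y \<in> {p. (0, p) \<in> ?S}" for x y
      using complex_vector.span_add[of "(0, x)" _ "(0, y)"] that by simp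
    show "a *\<^sub>C x \<in> {p. (0, p) \<in> ?S}" if "x \<in> {p. (0, p) \<in> ?S}" for a x
      using complex_vector.span_scale[of "(0, x)" _ a] that by (simp add: scaleC_prod_def)
  qed
  then have S: "cspan (range (sinf L)) \<subseteq> {p. (0, p) \<in> ?S}"
    by (rule complex_vector.span_minimal[rotated]) (use s in auto)
  obtain p where p: "p \<in> cspan (range (cosf L))" "l2_norm L (\<lambda>x. E x - p x) < e"
    using cosf_dense[OF L E(1) e] by (rule bexE)
  obtain q where q: "q \<in> cspan (range (sinf L))" "l2_norm L (\<lambda>x. O' x - q x) < e"
    using sinf_dense[OF L E(2) e] by (rule bexE)
  have "(p, 0) + (0, q) \<in> ?S" by (rule complex_vector.span_add) (use p(1) q(1) C S in auto)
  then show ?thesis using that[of p q] p(2) q(2) by simp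
qed

section \<open>The wave part and its eigenvectors\<close>

locale coupled_system =
  fixes L c \<alpha> :: real and \<beta> :: "real \<Rightarrow> real"
  assumes L_pos: "0 < L" and beta: "\<beta> \<in> Linf_real L" and alpha: "1 < \<alpha>"
    and nonresonance: "\<And>n::nat. n \<ge> 1 \<Longrightarrow> c \<noteq> 1 / (2 * L) * ln ((\<alpha> - 1) / (\<alpha> + 1)) + (real n)\<^sup>2 * pi\<^sup>2 / L\<^sup>2"
begin

abbreviation "\<mu> \<equiv> mu L \<alpha>"
abbreviation "ev2 \<equiv> lambda2 L \<alpha>"

text \<open>Common amplitude of the derivative of \<open>phi2_snd\<close> and of
  \<open>phi2_thd\<close>. The normalisation \<open>A_coef\<close> is made so that its modulus does
  not depend on \<open>m\<close>.\<close>

definition kappa :: "int \<Rightarrow> complex"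
  where "kappa m = ev2 m / complex_of_real (A_coef L \<alpha> m)"

definition wave_deriv :: "int \<Rightarrow> real \<Rightarrow> complex"
  where "wave_deriv m x = kappa m * cosh (ev2 m * complex_of_real x)"

lemma mu_pos: "0 < \<mu>"
proof -
  have "ln ((\<alpha> - 1) / (\<alpha> + 1)) < 0" using alpha by (simp add: ln_less_zero)
  then show ?thesis using L_pos by (simp add: mu_def field_simps mult_pos_neg)
qed

lemma mu_exp: "exp (- 2 * \<mu> * L) = (\<alpha> - 1) / (\<alpha> + 1)"
  using L_pos alpha by (simp add: mu_def)

lemma ev2_eq: "ev2 m = - complex_of_real \<mu> + \<i> * complex_of_real (of_int m * pi / L)"
  by (simp add: lambda2_def mu_def)

lemma ev2_nonzero: "ev2 m \<noteq> 0"
  using mu_pos by (simp add: ev2_eq complex_eq_iff)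

lemma cmod_ev2_sq: "(cmod (ev2 m))\<^sup>2 = \<mu>\<^sup>2 + (of_int m * pi / L)\<^sup>2"
  by (simp add: ev2_eq cmod_power2)

lemma A_coef_sq: "(A_coef L \<alpha> m)\<^sup>2 = (\<mu>\<^sup>2 + (of_int m * pi / L)\<^sup>2) * sinh (2 * \<mu> * L) / (2 * \<mu>)"
  and A_coef_pos: "0 < A_coef L \<alpha> m"
proof -
  have s: "sinh (2 * \<mu> * L) > 0" using mu_pos L_pos by simp
  have p: "0 < (\<mu>\<^sup>2 * L\<^sup>2 + (of_int m)\<^sup>2 * pi\<^sup>2) * sinh (2 * \<mu> * L)"
    using s mu_pos L_pos by (intro mult_pos_pos add_pos_nonneg) auto
  then show "0 < A_coef L \<alpha> m"
    unfolding A_coef_def using L_pos mu_pos by simp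
  have "(A_coef L \<alpha> m)\<^sup>2 = (\<mu>\<^sup>2 * L\<^sup>2 + (of_int m)\<^sup>2 * pi\<^sup>2) * sinh (2 * \<mu> * L) / (L\<^sup>2 * (2 * \<mu>))"
    unfolding A_coef_def using p mu_pos by (simp add: power_mult_distrib power_divide)
  also have "\<dots> = (\<mu>\<^sup>2 + (of_int m * pi / L)\<^sup>2) * sinh (2 * \<mu> * L) / (2 * \<mu>)"
    using L_pos by (simp add: field_simps power_mult_distrib power_divide)
  finally show "(A_coef L \<alpha> m)\<^sup>2 = (\<mu>\<^sup>2 + (of_int m * pi / L)\<^sup>2) * sinh (2 * \<mu> * L) / (2 * \<mu>)" .
qed

text \<open>The squared modulus of every \<open>kappa m\<close>.\<close>

definition rho :: real where "rho = 2 * \<mu> / sinh (2 * \<mu> * L)"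

lemma rho_pos: "0 < rho"
  unfolding rho_def using mu_pos L_pos by simp

lemma cmod_kappa_sq: "(cmod (kappa m))\<^sup>2 = rho"
proof -
  have s: "sinh (2 * \<mu> * L) > 0" using mu_pos L_pos by simp
  have "0 < \<mu>\<^sup>2 + (of_int m * pi / L)\<^sup>2" using mu_pos by (intro add_pos_nonneg) auto
  then show ?thesis
    unfolding kappa_def norm_divide power_divide norm_of_real power2_abs cmod_ev2_sq A_coef_sq
    using s mu_pos by (simp add: rho_def)
qed

lemma kappa_nonzero: "kappa m \<noteq> 0"
  using ev2_nonzero less_imp_neq[OF A_coef_pos[of m]] by (simp add: kappa_def)

lemma phi2_thd_eq: "phi2_thd L \<alpha> m x = kappa m * sinh (ev2 m * complex_of_real x)"
  by (simp add: phi2_thd_def kappa_def)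

lemma phi2_thd_snd: "phi2_thd L \<alpha> m x = ev2 m * phi2_snd L \<alpha> m x"
  by (simp add: phi2_thd_def phi2_snd_def)

lemma phi2_snd_is_prim: "is_prim L (phi2_snd L \<alpha> m) (wave_deriv m)"
proof (rule is_prim_C1)
  show "(phi2_snd L \<alpha> m has_vector_derivative wave_deriv m x) (at x)" for x
    unfolding phi2_snd_def[abs_def] wave_deriv_def kappa_def
    by (rule has_vector_derivative_real_field[where f = "\<lambda>z. 1 / complex_of_real (A_coef L \<alpha> m) * sinh (ev2 m * z)"])
      (use A_coef_pos[of m] in \<open>auto intro!: derivative_eq_intros\<close>)
  show "continuous_on {0..L} (wave_deriv m)"
    unfolding wave_deriv_def by (intro continuous_intros)
qed (use L_pos in simp)

lemma wave_deriv_is_prim: "is_prim L (wave_deriv m) (\<lambda>x. ev2 m * phi2_thd L \<alpha> m x)"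
proof (rule is_prim_C1)
  show "(wave_deriv m has_vector_derivative ev2 m * phi2_thd L \<alpha> m x) (at x)" for x
    unfolding wave_deriv_def[abs_def] phi2_thd_eq
    by (rule has_vector_derivative_real_field[where f = "\<lambda>z. kappa m * cosh (ev2 m * z)"])
      (auto intro!: derivative_eq_intros)
  show "continuous_on {0..L} (\<lambda>x. ev2 m * phi2_thd L \<alpha> m x)"
    unfolding phi2_thd_eq by (intro continuous_intros)
qed (use L_pos in simp)

lemma phi2_thd_is_prim: "is_prim L (phi2_thd L \<alpha> m) (\<lambda>x. ev2 m * wave_deriv m x)"
  using is_prim_cmult[OF phi2_snd_is_prim, of "ev2 m" m] by (simp add: phi2_thd_snd[abs_def])

lemma phi2_snd_h1: "h1_graph L (phi2_snd L \<alpha> m) (wave_deriv m)"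
  unfolding h1_graph_def using phi2_snd_is_prim
  by (intro exI[of _ "phi2_snd L \<alpha> m"]) (simp add: phi2_snd_def)

lemma phi2_thd_L2: "phi2_thd L \<alpha> m \<in> L2 L" and phi2_snd_L2: "phi2_snd L \<alpha> m \<in> L2 L"
  and wave_deriv_L2: "wave_deriv m \<in> L2 L"
  using is_prim_L2[OF less_imp_le[OF L_pos] phi2_thd_is_prim] is_prim_L2[OF less_imp_le[OF L_pos] phi2_snd_is_prim]
    is_prim_L2[OF less_imp_le[OF L_pos] wave_deriv_is_prim] by blast+

lemma exp_ev2_L: "exp (ev2 m * complex_of_real L) = complex_of_real (exp (- \<mu> * L) * cos (of_int m * pi))"
proof -
  have "ev2 m * complex_of_real L = complex_of_real (- \<mu> * L) + \<i> * complex_of_real (of_int m * pi)"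
    using L_pos by (simp add: ev2_eq algebra_simps)
  moreover have "sin (of_int m * pi) = 0" using sin_zero_iff_int2 by blast
  then have "cis (of_int m * pi) = complex_of_real (cos (of_int m * pi))"
    by (simp add: complex_eq_iff)
  ultimately show ?thesis
    by (simp only: exp_add exp_of_real cis_conv_exp[symmetric])
      (simp add: cis_conv_exp exp_of_real)
qed

text \<open>With z = exp (ev2 m L), the quantity cosh + \<alpha> sinh at \<open>L\<close> equals
  ((\<alpha> + 1) z^2 - (\<alpha> - 1)) / (2 z), and the eigenvalue is exactly such that z^2 =
  (\<alpha> - 1) / (\<alpha> + 1).\<close>

lemma boundary_condition: "wave_deriv m L + complex_of_real \<alpha> * phi2_thd L \<alpha> m L = 0"
proof -
  define z where "z = exp (ev2 m * complex_of_real L)"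
  have "z * z = complex_of_real ((exp (- \<mu> * L) * exp (- \<mu> * L)) * (cos (of_int m * pi))\<^sup>2)"
    unfolding z_def exp_ev2_L by (simp add: power2_eq_square)
  moreover have "(cos (of_int m * pi))\<^sup>2 = 1"
  proof -
    have "sin (of_int m * pi) = 0" using sin_zero_iff_int2 by blast
    then show ?thesis by (simp add: cos_squared_eq)
  qed
  moreover have "exp (- \<mu> * L) * exp (- \<mu> * L) = (\<alpha> - 1) / (\<alpha> + 1)"
    unfolding mu_exp[symmetric] by (simp flip: exp_add)
  ultimately have "z * z = complex_of_real ((\<alpha> - 1) / (\<alpha> + 1))" by (simp only: mult_1_right)
  then have "z * z * complex_of_real (\<alpha> + 1) = complex_of_real ((\<alpha> - 1) / (\<alpha> + 1) * (\<alpha> + 1))"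
    by (simp only: of_real_mult)
  then have zz: "z * z * complex_of_real (\<alpha> + 1) = complex_of_real (\<alpha> - 1)" using alpha by simp
  have z: "z \<noteq> 0" by (simp add: z_def)
  have cs: "cosh (ev2 m * complex_of_real L) = (z + inverse z) / 2" "sinh (ev2 m * complex_of_real L) = (z - inverse z) / 2"
    by (simp_all add: cosh_field_def sinh_field_def exp_minus z_def)
  have "cosh (ev2 m * complex_of_real L) + complex_of_real \<alpha> * sinh (ev2 m * complex_of_real L)
      = (z * z * complex_of_real (\<alpha> + 1) - complex_of_real (\<alpha> - 1)) / (2 * z)"
    unfolding cs using z by (simp add: field_simps)
  also have "\<dots> = 0" using zz by simp
  finally have "kappa m * (cosh (ev2 m * complex_of_real L) + complex_of_real \<alpha> * sinh (ev2 m * complex_of_real L)) = 0"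
    by simp
  then show ?thesis by (simp add: wave_deriv_def phi2_thd_eq algebra_simps)
qed

text \<open>In the unknowns \<open>E = cosh (\<mu> x) g' + sinh (\<mu> x) h\<close>, \<open>O = sinh (\<mu> x) g' + cosh (\<mu> x) h\<close>
  the eigenvectors of the wave part become a Fourier basis, because \<open>ev2 m + \<mu> = \<i> m \<pi> / L\<close>.\<close>

definition mcosh :: "real \<Rightarrow> complex" where "mcosh x = complex_of_real (cosh (\<mu> * x))"
definition msinh :: "real \<Rightarrow> complex" where "msinh x = complex_of_real (sinh (\<mu> * x))"

lemma m_continuous: "continuous_on S mcosh" "continuous_on S msinh" "continuous_on S (\<lambda>x. - msinh x)"
  unfolding mcosh_def msinh_def by (intro continuous_intros)+

lemma m_bounds:
  assumes "x \<in> {0..L}"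
  shows "cmod (mcosh x) \<le> cosh (\<mu> * L)" "cmod (msinh x) \<le> cosh (\<mu> * L)" "cmod (- msinh x) \<le> cosh (\<mu> * L)"
proof -
  have x: "0 \<le> \<mu> * x" "\<mu> * x \<le> \<mu> * L" using assms mu_pos by auto
  then have "cosh (\<mu> * x) \<le> cosh (\<mu> * L)" by (simp add: cosh_real_nonneg_le_iff)
  moreover have "\<bar>sinh (\<mu> * x)\<bar> \<le> cosh (\<mu> * x)"
    using x sinh_le_cosh_real[of "\<mu> * x"] by simp
  ultimately show "cmod (mcosh x) \<le> cosh (\<mu> * L)" "cmod (msinh x) \<le> cosh (\<mu> * L)" "cmod (- msinh x) \<le> cosh (\<mu> * L)"
    unfolding mcosh_def msinh_def norm_minus_cancel norm_of_real by auto
qed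

lemma m_pythagoras: "mcosh x * mcosh x - msinh x * msinh x = 1"
proof -
  have "cosh (\<mu> * x) * cosh (\<mu> * x) - sinh (\<mu> * x) * sinh (\<mu> * x) = 1"
    using hyperbolic_pythagoras[of "\<mu> * x"] by (simp add: power2_eq_square)
  then show ?thesis unfolding mcosh_def msinh_def by (metis of_real_1 of_real_diff of_real_mult)
qed

definition rotE :: "(real \<Rightarrow> complex) \<Rightarrow> (real \<Rightarrow> complex) \<Rightarrow> real \<Rightarrow> complex"
  where "rotE w h x = mcosh x * w x + msinh x * h x"

definition rotO :: "(real \<Rightarrow> complex) \<Rightarrow> (real \<Rightarrow> complex) \<Rightarrow> real \<Rightarrow> complex"
  where "rotO w h x = msinh x * w x + mcosh x * h x"

lemma rot_inverse:
  "w x = mcosh x * rotE w h x + - msinh x * rotO w h x"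
  "h x = - msinh x * rotE w h x + mcosh x * rotO w h x"
proof -
  have "mcosh x * rotE w h x + - msinh x * rotO w h x = (mcosh x * mcosh x - msinh x * msinh x) * w x"
    by (simp add: rotE_def rotO_def algebra_simps)
  then show "w x = mcosh x * rotE w h x + - msinh x * rotO w h x" unfolding m_pythagoras by simp
  have "- msinh x * rotE w h x + mcosh x * rotO w h x = (mcosh x * mcosh x - msinh x * msinh x) * h x"
    by (simp add: rotE_def rotO_def algebra_simps)
  then show "h x = - msinh x * rotE w h x + mcosh x * rotO w h x" unfolding m_pythagoras by simp
qed

text \<open>By \<open>l2_norm_combination_le\<close> each of the two components contributes twice
  the square of the bound cosh (\<mu> L) on the coefficients.\<close>

abbreviation "Kr \<equiv> 4 * (cosh (\<mu> * L))\<^sup>2"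

lemma rot_bounds:
  assumes "w \<in> L2 L" "h \<in> L2 L"
  shows "rotE w h \<in> L2 L" "rotO w h \<in> L2 L"
    "(l2_norm L (rotE w h))\<^sup>2 + (l2_norm L (rotO w h))\<^sup>2 \<le> Kr * ((l2_norm L w)\<^sup>2 + (l2_norm L h)\<^sup>2)"
    "(l2_norm L w)\<^sup>2 + (l2_norm L h)\<^sup>2 \<le> Kr * ((l2_norm L (rotE w h))\<^sup>2 + (l2_norm L (rotO w h))\<^sup>2)"
proof -
  note comb = l2_norm_combination_le[OF less_imp_le[OF L_pos]]
  note E = comb[OF assms m_continuous(1,2) m_bounds(1,2), folded rotE_def]
  note O = comb[OF assms m_continuous(2,1) m_bounds(2,1), folded rotO_def]
  show EL: "rotE w h \<in> L2 L" and OL: "rotO w h \<in> L2 L" using E(1) O(1) by (simp_all add: rotE_def[abs_def] rotO_def[abs_def])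
  show "(l2_norm L (rotE w h))\<^sup>2 + (l2_norm L (rotO w h))\<^sup>2 \<le> Kr * ((l2_norm L w)\<^sup>2 + (l2_norm L h)\<^sup>2)"
    using E(2) O(2) by simp
  note W = comb[OF EL OL m_continuous(1,3) m_bounds(1,3), folded rot_inverse]
  note H = comb[OF EL OL m_continuous(3,1) m_bounds(3,1), folded rot_inverse]
  show "(l2_norm L w)\<^sup>2 + (l2_norm L h)\<^sup>2 \<le> Kr * ((l2_norm L (rotE w h))\<^sup>2 + (l2_norm L (rotO w h))\<^sup>2)"
    using W(2) H(2) by simp
qed

lemma rot_linear:
  "rotE (\<lambda>x. w x + w' x) (\<lambda>x. h x + h' x) x = rotE w h x + rotE w' h' x"
  "rotO (\<lambda>x. w x + w' x) (\<lambda>x. h x + h' x) x = rotO w h x + rotO w' h' x"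
  "rotE (\<lambda>x. w x - w' x) (\<lambda>x. h x - h' x) x = rotE w h x - rotE w' h' x"
  "rotO (\<lambda>x. w x - w' x) (\<lambda>x. h x - h' x) x = rotO w h x - rotO w' h' x"
  "rotE (\<lambda>x. a * w x) (\<lambda>x. a * h x) x = a * rotE w h x"
  "rotO (\<lambda>x. a * w x) (\<lambda>x. a * h x) x = a * rotO w h x"
  by (simp_all add: rotE_def rotO_def algebra_simps)

lemma rot_wave:
  "rotE (wave_deriv m) (phi2_thd L \<alpha> m) x = kappa m * fourier_cos L m x"
  "rotO (wave_deriv m) (phi2_thd L \<alpha> m) x = kappa m * fourier_sin L m x"
proof -
  let ?y = "of_int m * pi / L * x"
  have s: "ev2 m * complex_of_real x + complex_of_real (\<mu> * x) = \<i> * complex_of_real ?y"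
    by (simp add: ev2_eq algebra_simps)
  have m: "mcosh x = cosh (complex_of_real (\<mu> * x))" "msinh x = sinh (complex_of_real (\<mu> * x))"
    unfolding mcosh_def msinh_def
    by (simp_all add: cosh_field_def sinh_field_def exp_of_real[symmetric])
  have e: "exp (\<i> * complex_of_real y) = cis y" "exp (- (\<i> * complex_of_real y)) = cis (- y)" for y
    by (simp_all add: cis_conv_exp)
  have ch: "cosh (\<i> * complex_of_real y) = complex_of_real (cos y)" for y
    unfolding cosh_field_def e by (simp add: complex_eq_iff)
  have sh: "sinh (\<i> * complex_of_real y) = \<i> * complex_of_real (sin y)" for y
    unfolding sinh_field_def e by (simp add: complex_eq_iff)
  have "rotE (wave_deriv m) (phi2_thd L \<alpha> m) x = kappa m * cosh (ev2 m * complex_of_real x + complex_of_real (\<mu> * x))"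
    unfolding cosh_add rotE_def m wave_deriv_def phi2_thd_eq by (simp add: algebra_simps)
  then show "rotE (wave_deriv m) (phi2_thd L \<alpha> m) x = kappa m * fourier_cos L m x"
    unfolding s ch fourier_cos_def .
  have "rotO (wave_deriv m) (phi2_thd L \<alpha> m) x = kappa m * sinh (ev2 m * complex_of_real x + complex_of_real (\<mu> * x))"
    unfolding sinh_add rotO_def m wave_deriv_def phi2_thd_eq by (simp add: algebra_simps)
  then show "rotO (wave_deriv m) (phi2_thd L \<alpha> m) x = kappa m * fourier_sin L m x"
    unfolding s sh fourier_sin_def .
qed

lemma rot_wave_sum:
  "rotE (\<lambda>x. \<Sum>m\<in>F. b m * wave_deriv m x) (\<lambda>x. \<Sum>m\<in>F. b m * phi2_thd L \<alpha> m x)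
    = (\<lambda>x. \<Sum>m\<in>F. (b m * kappa m) * fourier_cos L m x)"
  "rotO (\<lambda>x. \<Sum>m\<in>F. b m * wave_deriv m x) (\<lambda>x. \<Sum>m\<in>F. b m * phi2_thd L \<alpha> m x)
    = (\<lambda>x. \<Sum>m\<in>F. (b m * kappa m) * fourier_sin L m x)"
proof -
  have "rotE (\<lambda>x. \<Sum>m\<in>F. b m * wave_deriv m x) (\<lambda>x. \<Sum>m\<in>F. b m * phi2_thd L \<alpha> m x) x
      = (\<Sum>m\<in>F. b m * rotE (wave_deriv m) (phi2_thd L \<alpha> m) x)" for x
    by (simp add: rotE_def sum_distrib_left sum.distrib[symmetric] algebra_simps)
  then show "rotE (\<lambda>x. \<Sum>m\<in>F. b m * wave_deriv m x) (\<lambda>x. \<Sum>m\<in>F. b m * phi2_thd L \<alpha> m x)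
    = (\<lambda>x. \<Sum>m\<in>F. (b m * kappa m) * fourier_cos L m x)" by (simp add: rot_wave mult.assoc fun_eq_iff)
  have "rotO (\<lambda>x. \<Sum>m\<in>F. b m * wave_deriv m x) (\<lambda>x. \<Sum>m\<in>F. b m * phi2_thd L \<alpha> m x) x
      = (\<Sum>m\<in>F. b m * rotO (wave_deriv m) (phi2_thd L \<alpha> m) x)" for x
    by (simp add: rotO_def sum_distrib_left sum.distrib[symmetric] algebra_simps)
  then show "rotO (\<lambda>x. \<Sum>m\<in>F. b m * wave_deriv m x) (\<lambda>x. \<Sum>m\<in>F. b m * phi2_thd L \<alpha> m x)
    = (\<lambda>x. \<Sum>m\<in>F. (b m * kappa m) * fourier_sin L m x)" by (simp add: rot_wave mult.assoc fun_eq_iff)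
qed

text \<open>The rotation turns the combination into one of Fourier pairs with coefficients
  \<open>b m * kappa m\<close>. The common modulus of the \<open>kappa m\<close> leaves the factor
  \<open>L * rho\<close>, and each direction of the rotation costs \<open>Kr\<close>.\<close>

lemma wave_riesz:
  fixes F :: "int set" and b :: "int \<Rightarrow> complex"
  assumes F: "finite F"
  defines "w \<equiv> \<lambda>x. \<Sum>m\<in>F. b m * wave_deriv m x" and "h \<equiv> \<lambda>x. \<Sum>m\<in>F. b m * phi2_thd L \<alpha> m x"
  shows "L * rho / Kr * (\<Sum>m\<in>F. (cmod (b m))\<^sup>2) \<le> (l2_norm L w)\<^sup>2 + (l2_norm L h)\<^sup>2"
    "(l2_norm L w)\<^sup>2 + (l2_norm L h)\<^sup>2 \<le> Kr * (L * rho) * (\<Sum>m\<in>F. (cmod (b m))\<^sup>2)"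
proof -
  have w: "w \<in> L2 L" unfolding w_def by (intro L2_sum L2_cmult wave_deriv_L2)
  have h: "h \<in> L2 L" unfolding h_def by (intro L2_sum L2_cmult phi2_thd_L2)
  have "(l2_norm L (rotE w h))\<^sup>2 + (l2_norm L (rotO w h))\<^sup>2 = L * (\<Sum>m\<in>F. (cmod (b m * kappa m))\<^sup>2)"
    unfolding w_def h_def rot_wave_sum by (rule fourier_norm_sum[OF L_pos F])
  also have "\<dots> = L * rho * (\<Sum>m\<in>F. (cmod (b m))\<^sup>2)"
    by (simp add: norm_mult power_mult_distrib cmod_kappa_sq sum_distrib_left mult_ac)
  finally have eq: "(l2_norm L (rotE w h))\<^sup>2 + (l2_norm L (rotO w h))\<^sup>2 = L * rho * (\<Sum>m\<in>F. (cmod (b m))\<^sup>2)" .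
  have K: "Kr > 0" by simp
  show "L * rho / Kr * (\<Sum>m\<in>F. (cmod (b m))\<^sup>2) \<le> (l2_norm L w)\<^sup>2 + (l2_norm L h)\<^sup>2"
    using rot_bounds(3)[OF w h] K unfolding eq by (simp add: field_simps)
  show "(l2_norm L w)\<^sup>2 + (l2_norm L h)\<^sup>2 \<le> Kr * (L * rho) * (\<Sum>m\<in>F. (cmod (b m))\<^sup>2)"
    using rot_bounds(4)[OF w h] unfolding eq by (simp add: mult.assoc)
qed

end

lemma phi1_eq: "phi1 L n = (sine_basis L n, \<lambda>x. 0, \<lambda>x. 0)"
  by (simp add: phi1_def sine_basis_def[abs_def] zero_fun_def)

section \<open>The heat components of the eigenvectors\<close>

context coupled_system
begin

lemma nonneg_L: "0 \<le> L" using L_pos by simp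

lemma beta_measurable: "(\<lambda>x. complex_of_real (\<beta> x)) \<in> borel_measurable (leb L)"
proof -
  have [measurable]: "\<beta> \<in> borel_measurable (leb L)" using beta by (simp add: Linf_real_def)
  show ?thesis by measurable
qed

lemma beta_bounded: obtains B where "0 \<le> B" "AE x in leb L. cmod (complex_of_real (\<beta> x)) \<le> B"
proof -
  obtain B where "AE x in leb L. \<bar>\<beta> x\<bar> \<le> B" using beta by (auto simp: Linf_real_def)
  then have "AE x in leb L. cmod (complex_of_real (\<beta> x)) \<le> \<bar>B\<bar>" by auto
  then show ?thesis using that[of "\<bar>B\<bar>"] by simp
qed

text \<open>For nonzero \<open>m\<close> the imaginary part alone gives \<pi> / L. For
  \<open>m = 0\<close> everything is real: the numbers \<open>a n\<close> are nonzero by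
  \<open>nonresonance\<close>, and all but finitely many have modulus at least 1, so they have a
  positive lower bound.\<close>

lemma spectral_gap:
  "\<exists>K>0. \<forall>m. \<forall>n::nat. n \<ge> 1 \<longrightarrow> K \<le> cmod (- of_real ((real n * pi / L)\<^sup>2) - (ev2 m - complex_of_real c))"
proof -
  define a where "a n = c + \<mu> - (real n * pi / L)\<^sup>2" for n
  have a0: "a n \<noteq> 0" if "n \<ge> 1" for n
    using nonresonance[OF that] by (simp add: a_def mu_def power_mult_distrib power_divide)
  \<comment> \<open>Beyond \<open>N\<close> the square of \<open>n * pi / L\<close> exceeds
    \<open>1 + \<bar>c + \<mu>\<bar>\<close>.\<close>
  obtain N :: nat where N: "(1 + \<bar>c + \<mu>\<bar>) * (L / pi)\<^sup>2 + 1 < real N" using reals_Archimedean2 by blast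
  have big: "1 \<le> \<bar>a n\<bar>" if "n \<ge> N" for n
  proof -
    have n: "(1 + \<bar>c + \<mu>\<bar>) * (L / pi)\<^sup>2 + 1 < real n" using N that by simp
    have "0 \<le> (1 + \<bar>c + \<mu>\<bar>) * (L / pi)\<^sup>2" by simp
    then have "1 \<le> real n" using n by linarith
    then have "real n \<le> (real n)\<^sup>2" by (simp add: power2_eq_square)
    then have "(1 + \<bar>c + \<mu>\<bar>) * (L / pi)\<^sup>2 \<le> (real n)\<^sup>2" using n by linarith
    then have "(1 + \<bar>c + \<mu>\<bar>) * (L / pi)\<^sup>2 * (pi / L)\<^sup>2 \<le> (real n)\<^sup>2 * (pi / L)\<^sup>2"
      by (rule mult_right_mono) simp
    moreover have "(L / pi)\<^sup>2 * (pi / L)\<^sup>2 = 1"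
      using L_pos by (simp add: power_mult_distrib[symmetric])
    ultimately have "1 + \<bar>c + \<mu>\<bar> \<le> (real n * pi / L)\<^sup>2"
      using L_pos by (simp add: power_mult_distrib power_divide mult.assoc)
    then show ?thesis by (simp add: a_def)
  qed
  define K0 where "K0 = Min (insert 1 ((\<lambda>n. \<bar>a n\<bar>) ` {1..N}))"
  have K0: "0 < K0" unfolding K0_def using a0 by (subst Min_gr_iff) auto
  have K0le: "K0 \<le> \<bar>a n\<bar>" if "n \<ge> 1" for n
  proof (cases "n \<le> N")
    case True
    then show ?thesis unfolding K0_def using that by (intro Min_le) auto
  next
    case False
    have "K0 \<le> 1" unfolding K0_def by (intro Min_le) auto
    then show ?thesis using big[of n] False by simp
  qed
  show ?thesis
  proof (rule exI[of _ "min K0 (pi / L)"], intro conjI allI impI)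
    show "0 < min K0 (pi / L)" using K0 L_pos by simp
  next
    fix m and n :: nat assume n: "n \<ge> 1"
    let ?d = "- of_real ((real n * pi / L)\<^sup>2) - (ev2 m - complex_of_real c)"
    have re: "Re ?d = a n" and im: "Im ?d = - (of_int m * pi / L)"
      by (simp_all add: a_def ev2_eq flip: of_real_power)
    show "min K0 (pi / L) \<le> cmod ?d"
    proof (cases "m = 0")
      case True
      have "K0 \<le> \<bar>Re ?d\<bar>" unfolding re by (rule K0le[OF n])
      also have "\<dots> \<le> cmod ?d" by (rule abs_Re_le_cmod)
      finally show ?thesis by simp
    next
      case False
      then have "1 * pi / L \<le> \<bar>of_int m\<bar> * pi / L"
        using L_pos by (intro divide_right_mono mult_right_mono) (auto simp flip: of_int_abs)
      also have "\<dots> = \<bar>Im ?d\<bar>" unfolding im using L_pos by (simp add: abs_mult)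
      also have "\<dots> \<le> cmod ?d" by (rule abs_Im_le_cmod)
      finally show ?thesis by simp
    qed
  qed
qed

abbreviation "\<phi>1 m \<equiv> phi2_fst L c \<beta> \<alpha> m"
abbreviation "\<phi>2 m \<equiv> phi2_snd L \<alpha> m"
abbreviation "\<phi>3 m \<equiv> phi2_thd L \<alpha> m"

lemma beta_mult_L2:
  assumes "f \<in> L2 L"
  shows "(\<lambda>x. complex_of_real (\<beta> x) * f x) \<in> L2 L"
proof -
  obtain B where "0 \<le> B" "AE x in leb L. cmod (complex_of_real (\<beta> x)) \<le> B" by (rule beta_bounded)
  then show ?thesis using L2_mult_bounded(1)[OF assms beta_measurable] by blast
qed

text \<open>The resolvent of the Laplacian at \<open>ev2 m - c\<close> supplies a solution, so the
  choice by \<open>SOME\<close> is meaningful; the chosen function is then translated to the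
  relational form.\<close>

lemma phi2_fst_graph:
  "\<exists>w. dirichlet_graph L (\<phi>1 m) w \<and>
    (AE x in leb L. w x - (ev2 m - complex_of_real c) * \<phi>1 m x = - complex_of_real (\<beta> x) * \<phi>2 m x)"
proof -
  obtain C where C0: "0 \<le> C" and C: "\<forall>v\<in>L2 L. \<forall>z K. 0 < K \<and> (\<forall>n::nat. n \<ge> 1 \<longrightarrow> K \<le> cmod (- of_real ((real n * pi / L)\<^sup>2) - z)) \<longrightarrow>
      (\<exists>f w. dirichlet_graph L f w \<and> (AE x in leb L. w x - z * f x = v x)) \<and>
      (\<forall>f w. dirichlet_graph L f w \<and> (AE x in leb L. w x - z * f x = v x) \<longrightarrow> l2_norm L f \<le> C / K * l2_norm L v)"
    using dirichlet_resolvent[OF L_pos] by (elim exE conjE) (rule that)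
  obtain K where K: "0 < K"
    "\<forall>m. \<forall>n::nat. n \<ge> 1 \<longrightarrow> K \<le> cmod (- of_real ((real n * pi / L)\<^sup>2) - (ev2 m - complex_of_real c))"
    using spectral_gap by (elim exE conjE) (rule that)
  have v: "(\<lambda>x. - complex_of_real (\<beta> x) * \<phi>2 m x) \<in> L2 L"
    using L2_cmult[OF beta_mult_L2[OF phi2_snd_L2], of "-1" m] by simp
  obtain f w where f: "dirichlet_graph L f w"
    "AE x in leb L. w x - (ev2 m - complex_of_real c) * f x = - complex_of_real (\<beta> x) * \<phi>2 m x"
    
    using C[rule_format, OF v conjI[OF K(1) spec[OF K(2)]], THEN conjunct1] by blast
  have d: "f \<in> dirichlet_dom L" "AE x in leb L. wderiv L (wderiv L f) x = w x"
    using dirichlet_graph_dom[OF L_pos f(1)] by blast+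
  have "AE x in leb L. wderiv L (wderiv L f) x + (complex_of_real c - ev2 m) * f x = - complex_of_real (\<beta> x) * \<phi>2 m x"
    using d(2) f(2) by (rule AE_mp[OF _ AE_mp]) (auto simp: algebra_simps)
  then have "\<exists>f. f \<in> H2 L \<and>
    (AE x in leb L. wderiv L (wderiv L f) x + (complex_of_real c - ev2 m) * f x = - complex_of_real (\<beta> x) * \<phi>2 m x) \<and>
    pt_value L f 0 = 0 \<and> pt_value L f L = 0"
    using d(1) by (auto simp: dirichlet_dom_def)
  from someI_ex[OF this, folded phi2_fst_def]
  have s: "\<phi>1 m \<in> dirichlet_dom L"
    "AE x in leb L. wderiv L (wderiv L (\<phi>1 m)) x + (complex_of_real c - ev2 m) * \<phi>1 m x = - complex_of_real (\<beta> x) * \<phi>2 m x"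
    by (auto simp: dirichlet_dom_def)
  have "AE x in leb L. wderiv L (wderiv L (\<phi>1 m)) x - (ev2 m - complex_of_real c) * \<phi>1 m x = - complex_of_real (\<beta> x) * \<phi>2 m x"
    using s(2) by (rule AE_mp) (auto simp: algebra_simps)
  then show ?thesis using dirichlet_dom_graph[OF L_pos s(1)] by blast
qed

lemma phi2_fst_L2: "\<phi>1 m \<in> L2 L"
  using phi2_fst_graph[of m] dirichlet_graph_dom(3)[OF L_pos] by blast

text \<open>The last factor is the inverse square of the modulus of \<open>ev2 m\<close>:
  \<open>phi2_thd\<close> has amplitude \<open>kappa m\<close> of constant modulus, and
  \<open>phi2_snd\<close> is \<open>phi2_thd\<close> divided by \<open>ev2 m\<close>.\<close>

lemma phi2_snd_norm: "(l2_norm L (\<phi>2 m))\<^sup>2 \<le> (cosh (\<mu> * L))\<^sup>2 * rho * L * (1 / (\<mu>\<^sup>2 + (of_int m * pi / L)\<^sup>2))"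
proof -
  have s: "cmod (sinh (ev2 m * complex_of_real x)) \<le> cosh (\<mu> * L)" if x: "x \<in> {0<..<L}" for x
  proof -
    let ?z = "ev2 m * complex_of_real x"
    have "cmod (sinh ?z) \<le> (cmod (exp ?z) + cmod (exp (- ?z))) / 2"
      unfolding sinh_field_def norm_divide using norm_triangle_ineq4[of "exp ?z" "exp (- ?z)"] by simp
    also have "\<dots> = cosh (\<mu> * x)"
      by (simp add: norm_exp_eq_Re ev2_eq cosh_field_def)
    also have "\<dots> \<le> cosh (\<mu> * L)" using x mu_pos by (simp add: cosh_real_nonneg_le_iff)
    finally show ?thesis .
  qed
  define k where "k = cmod (kappa m) / cmod (ev2 m)"
  have k: "0 \<le> k" by (simp add: k_def)
  have "\<phi>2 m x = kappa m / ev2 m * sinh (ev2 m * complex_of_real x)" for x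
    using ev2_nonzero by (simp add: phi2_snd_def kappa_def)
  then have "cmod (\<phi>2 m x) \<le> k * cosh (\<mu> * L)" if "x \<in> {0<..<L}" for x
    using mult_left_mono[OF s[OF that] k] by (simp add: norm_mult norm_divide k_def)
  then have "l2_norm L (\<phi>2 m) \<le> \<bar>k * cosh (\<mu> * L)\<bar> * sqrt L"
    by (rule l2_norm_bounded(2)[OF nonneg_L L2_measurable[OF phi2_snd_L2]])
  then have "(l2_norm L (\<phi>2 m))\<^sup>2 \<le> (\<bar>k * cosh (\<mu> * L)\<bar> * sqrt L)\<^sup>2" by (intro power_mono) auto
  also have "\<dots> = (cosh (\<mu> * L))\<^sup>2 * k\<^sup>2 * L" using L_pos by (simp add: power_mult_distrib)
  also have "k\<^sup>2 = rho * (1 / (\<mu>\<^sup>2 + (of_int m * pi / L)\<^sup>2))"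
    by (simp add: k_def power_divide cmod_kappa_sq cmod_ev2_sq)
  finally show ?thesis by (simp add: mult_ac)
qed

lemma inverse_square_sums:
  "\<exists>S. \<forall>F :: int set. finite F \<longrightarrow> (\<Sum>m\<in>F. 1 / (\<mu>\<^sup>2 + (of_int m * pi / L)\<^sup>2)) \<le> S"
proof -
  define q where "q k = 1 / (\<mu>\<^sup>2 + (real k * pi / L)\<^sup>2)" for k :: nat
  have q0: "0 \<le> q k" for k by (simp add: q_def)
  have s: "summable q"
  proof (rule summable_comparison_test')
    show "summable (\<lambda>k. (L / pi)\<^sup>2 * (1 / (real k)\<^sup>2))"
      by (intro summable_mult) (use inverse_power_summable[of 2] in \<open>simp add: inverse_eq_divide\<close>)
    show "norm (q k) \<le> (L / pi)\<^sup>2 * (1 / (real k)\<^sup>2)" if k: "k \<ge> 1" for k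
    proof -
      have "q k \<le> 1 / (real k * pi / L)\<^sup>2"
        unfolding q_def using k L_pos by (intro frac_le) auto
      also have "\<dots> = (L / pi)\<^sup>2 * (1 / (real k)\<^sup>2)" by (simp add: power_divide power_mult_distrib)
      finally show ?thesis using q0 by simp
    qed
  qed
  show ?thesis
  proof (rule exI[of _ "2 * suminf q"], intro allI impI)
    fix F :: "int set" assume F: "finite F"
    \<comment> \<open>A crude bound for the modulus of every element of \<open>F\<close>; it reduces
      the sum to two sums over natural numbers, one for each sign.\<close>
    let ?N = "\<Sum>m\<in>F. nat \<bar>m\<bar>"
    let ?t = "\<lambda>m::int. 1 / (\<mu>\<^sup>2 + (of_int m * pi / L)\<^sup>2)"
    have sub: "F \<subseteq> int ` {..?N} \<union> (\<lambda>k. - int k) ` {..?N}"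
    proof
      fix m assume m: "m \<in> F"
      have "nat \<bar>m\<bar> \<le> ?N" by (rule member_le_sum) (use m F in auto)
      then show "m \<in> int ` {..?N} \<union> (\<lambda>k. - int k) ` {..?N}"
        by (cases "0 \<le> m") (auto intro!: image_eqI[of _ _ "nat \<bar>m\<bar>"])
    qed
    have "sum ?t F \<le> sum ?t (int ` {..?N} \<union> (\<lambda>k. - int k) ` {..?N})"
      by (rule sum_mono2[OF _ sub]) auto
    also have "\<dots> \<le> sum ?t (int ` {..?N}) + sum ?t ((\<lambda>k. - int k) ` {..?N})"
    proof -
      have "0 \<le> sum ?t (int ` {..?N} \<inter> (\<lambda>k. - int k) ` {..?N})" by (intro sum_nonneg) auto
      then show ?thesis
        using sum.union_inter[of "int ` {..?N}" "(\<lambda>k. - int k) ` {..?N}" ?t] by simp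
    qed
    also have "\<dots> = (\<Sum>k\<le>?N. q k) + (\<Sum>k\<le>?N. q k)"
      by (subst sum.reindex, simp add: inj_on_def)+ (simp add: q_def)
    also have "\<dots> \<le> 2 * suminf q"
      using sum_le_suminf[OF s, of "{..?N}"] q0 by simp
    finally show "sum ?t F \<le> 2 * suminf q" .
  qed
qed

lemma phi2_fst_square_sums:
  "\<exists>S\<ge>0. \<forall>F :: int set. finite F \<longrightarrow> (\<Sum>m\<in>F. (l2_norm L (\<phi>1 m))\<^sup>2) \<le> S"
proof -
  obtain C where C0: "0 \<le> C" and C: "\<forall>v\<in>L2 L. \<forall>z K. 0 < K \<and> (\<forall>n::nat. n \<ge> 1 \<longrightarrow> K \<le> cmod (- of_real ((real n * pi / L)\<^sup>2) - z)) \<longrightarrow>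
      (\<exists>f w. dirichlet_graph L f w \<and> (AE x in leb L. w x - z * f x = v x)) \<and>
      (\<forall>f w. dirichlet_graph L f w \<and> (AE x in leb L. w x - z * f x = v x) \<longrightarrow> l2_norm L f \<le> C / K * l2_norm L v)"
    using dirichlet_resolvent[OF L_pos] by (elim exE conjE) (rule that)
  obtain K where K: "0 < K"
    "\<forall>m. \<forall>n::nat. n \<ge> 1 \<longrightarrow> K \<le> cmod (- of_real ((real n * pi / L)\<^sup>2) - (ev2 m - complex_of_real c))"
    using spectral_gap by (elim exE conjE) (rule that)
  obtain B where B: "0 \<le> B" "AE x in leb L. cmod (complex_of_real (\<beta> x)) \<le> B" by (rule beta_bounded)
  obtain S where S': "\<forall>F :: int set. finite F \<longrightarrow> (\<Sum>m\<in>F. 1 / (\<mu>\<^sup>2 + (of_int m * pi / L)\<^sup>2)) \<le> S"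
    using inverse_square_sums by (rule exE)
  note S = S'[rule_format]
  \<comment> \<open>Square of the resolvent constant times the bound on \<open>\<beta>\<close>,
    multiplied by the constant of \<open>phi2_snd_norm\<close>; none of them depends on
    \<open>m\<close>.\<close>
  define T where "T = (C / K * B)\<^sup>2 * ((cosh (\<mu> * L))\<^sup>2 * rho * L)"
  have T: "0 \<le> T" unfolding T_def using rho_pos L_pos by simp
  have bd: "(l2_norm L (\<phi>1 m))\<^sup>2 \<le> T * (1 / (\<mu>\<^sup>2 + (of_int m * pi / L)\<^sup>2))" for m
  proof -
    obtain w where w: "dirichlet_graph L (\<phi>1 m) w"
      "AE x in leb L. w x - (ev2 m - complex_of_real c) * \<phi>1 m x = - complex_of_real (\<beta> x) * \<phi>2 m x"
      using phi2_fst_graph by blast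
    have AE: "AE x in leb L. cmod (- complex_of_real (\<beta> x)) \<le> B" using B(2) by simp
    have ms: "(\<lambda>x. - complex_of_real (\<beta> x)) \<in> borel_measurable (leb L)"
      using beta_measurable by simp
    note v = L2_mult_bounded[OF phi2_snd_L2 ms AE, of m]
    have "l2_norm L (\<phi>1 m) \<le> C / K * l2_norm L (\<lambda>x. - complex_of_real (\<beta> x) * \<phi>2 m x)"
      using C[rule_format, OF v(1) conjI[OF K(1) spec[OF K(2)]], THEN conjunct2] w by blast
    also have "\<dots> \<le> C / K * (B * l2_norm L (\<phi>2 m))"
      using v(2)[OF B(1)] C0 K(1) by (intro mult_left_mono) auto
    finally have "(l2_norm L (\<phi>1 m))\<^sup>2 \<le> (C / K * (B * l2_norm L (\<phi>2 m)))\<^sup>2" by (intro power_mono) auto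
    also have "\<dots> = (C / K * B)\<^sup>2 * (l2_norm L (\<phi>2 m))\<^sup>2" by (simp only: power_mult_distrib mult.assoc)
    also have "\<dots> \<le> (C / K * B)\<^sup>2 * ((cosh (\<mu> * L))\<^sup>2 * rho * L * (1 / (\<mu>\<^sup>2 + (of_int m * pi / L)\<^sup>2)))"
      by (intro mult_left_mono phi2_snd_norm) simp
    finally show ?thesis by (simp only: T_def mult.assoc)
  qed
  show ?thesis
  proof (rule exI[of _ "T * S"], intro conjI allI impI)
    show "0 \<le> T * S" using T S[of "{}"] by simp
  next
    fix F :: "int set" assume F: "finite F"
    have "(\<Sum>m\<in>F. (l2_norm L (\<phi>1 m))\<^sup>2) \<le> (\<Sum>m\<in>F. T * (1 / (\<mu>\<^sup>2 + (of_int m * pi / L)\<^sup>2)))"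
      by (intro sum_mono bd)
    also have "\<dots> = T * (\<Sum>m\<in>F. 1 / (\<mu>\<^sup>2 + (of_int m * pi / L)\<^sup>2))" by (simp only: sum_distrib_left)
    also have "\<dots> \<le> T * S" by (intro mult_left_mono S F T)
    finally show "(\<Sum>m\<in>F. (l2_norm L (\<phi>1 m))\<^sup>2) \<le> T * S" .
  qed
qed

section \<open>The Riesz basis of the coupled system\<close>

lemma phi2_H0: "phi2 L c \<beta> \<alpha> m \<in> H0 L"
  unfolding phi2_def by (rule H0_I[OF L_pos phi2_fst_L2 phi2_snd_h1 phi2_thd_L2])

lemma phi1_H0: "phi1 L n \<in> H0 L"
  unfolding phi1_eq by (rule H0_I[OF L_pos sine_basis_L2[OF nonneg_L] h1_graph_zero L2_zero])

lemma Phi_sum: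
  assumes "finite F1" "finite F2"
  shows "(\<Sum>i\<in>F1 <+> F2. a i *\<^sub>C Phi L c \<beta> \<alpha> i) =
    (\<lambda>x. (\<Sum>n\<in>F1. a (Inl n) * sine_basis L n x) + (\<Sum>m\<in>F2. a (Inr m) * \<phi>1 m x),
     \<lambda>x. \<Sum>m\<in>F2. a (Inr m) * \<phi>2 m x, \<lambda>x. \<Sum>m\<in>F2. a (Inr m) * \<phi>3 m x)"
proof -
  have "(\<Sum>i\<in>F1 <+> F2. a i *\<^sub>C Phi L c \<beta> \<alpha> i)
      = (\<Sum>n\<in>F1. a (Inl n) *\<^sub>C phi1 L n) + (\<Sum>m\<in>F2. a (Inr m) *\<^sub>C phi2 L c \<beta> \<alpha> m)"
    using assms by (simp add: sum.Plus Phi_def comp_def)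
  then show ?thesis
    by (simp add: prod_eq_iff fst_sum snd_sum phi1_eq phi2_def scaleC_prod_def fun_eq_iff sum_fun_apply)
qed

lemma Phi_finite_split:
  assumes "finite F" "F \<subseteq> Phi_index"
  obtains F1 F2 where "F = F1 <+> F2" "finite F1" "F1 \<subseteq> {1..}" "finite F2"
proof (rule that[of "Inl -` F" "Inr -` F"])
  show "F = Inl -` F <+> Inr -` F"
  proof (intro set_eqI)
    fix i show "i \<in> F \<longleftrightarrow> i \<in> Inl -` F <+> Inr -` F" by (cases i) auto
  qed
  show "finite (Inl -` F)" "finite (Inr -` F)" using assms(1) by (auto intro: finite_vimageI)
  show "Inl -` F \<subseteq> {1..}" using assms(2) by (auto simp: Phi_index_def)
qed

text \<open>The family is triangular: the heat component of a combination of the \<open>phi2\<close> is controlled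
  by its wave component because the norms of the \<open>phi2_fst\<close> are square summable.\<close>

lemma Phi_riesz_bounds:
  "\<exists>k K. 0 < k \<and> 0 < K \<and> (\<forall>F a. finite F \<and> F \<subseteq> Phi_index \<longrightarrow>
      k * (\<Sum>i\<in>F. (cmod (a i))\<^sup>2) \<le> (H0_norm L (\<Sum>i\<in>F. a i *\<^sub>C Phi L c \<beta> \<alpha> i))\<^sup>2 \<and>
      (H0_norm L (\<Sum>i\<in>F. a i *\<^sub>C Phi L c \<beta> \<alpha> i))\<^sup>2 \<le> K * (\<Sum>i\<in>F. (cmod (a i))\<^sup>2))"
proof -
  obtain S where S': "0 \<le> S" "\<forall>F :: int set. finite F \<longrightarrow> (\<Sum>m\<in>F. (l2_norm L (\<phi>1 m))\<^sup>2) \<le> S"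
    using phi2_fst_square_sums by (elim exE conjE) (rule that)
  note S = S'(1) S'(2)[rule_format]
  define m2 where "m2 = L * rho / Kr"
  define M2 where "M2 = Kr * (L * rho)"
  have m2: "0 < m2" and M2: "0 < M2" unfolding m2_def M2_def using L_pos rho_pos by simp_all
  \<comment> \<open>With \<open>A1\<close>, \<open>A2\<close> the heat and wave coefficient sums, A1
    is at most 2 |f|^2 + 2 S A2, and m2 A2 is at most |w|^2 + |h|^2. So A1 + A2 is bounded with
    weight 2 on the heat norm and (2 S + 1) / m2 on the wave norm; \<open>Q\<close> is the sum of
    the weights.\<close>
  define Q where "Q = 2 + (2 * S + 1) / m2"
  have Q: "0 < Q" unfolding Q_def using S(1) m2 by (intro add_pos_nonneg) auto
  have main: "(\<Sum>i\<in>F. (cmod (a i))\<^sup>2) \<le> Q * (H0_norm L (\<Sum>i\<in>F. a i *\<^sub>C Phi L c \<beta> \<alpha> i))\<^sup>2"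
      "(H0_norm L (\<Sum>i\<in>F. a i *\<^sub>C Phi L c \<beta> \<alpha> i))\<^sup>2 \<le> (2 + 2 * S + M2) * (\<Sum>i\<in>F. (cmod (a i))\<^sup>2)"
    if F: "finite F" "F \<subseteq> Phi_index" for F a
  proof -
    obtain F1 F2 where F12: "F = F1 <+> F2" "finite F1" "F1 \<subseteq> {1..}" "finite F2"
      by (rule Phi_finite_split[OF F])
    define f1 where "f1 x = (\<Sum>n\<in>F1. a (Inl n) * sine_basis L n x)" for x
    define f2 where "f2 x = (\<Sum>m\<in>F2. a (Inr m) * \<phi>1 m x)" for x
    define w where "w x = (\<Sum>m\<in>F2. a (Inr m) * wave_deriv m x)" for x
    define g where "g x = (\<Sum>m\<in>F2. a (Inr m) * \<phi>2 m x)" for x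
    define h where "h x = (\<Sum>m\<in>F2. a (Inr m) * \<phi>3 m x)" for x
    have f1: "f1 \<in> L2 L" unfolding f1_def[abs_def] by (intro L2_sum L2_cmult sine_basis_L2 nonneg_L)
    have f2: "f2 \<in> L2 L" unfolding f2_def[abs_def] by (intro L2_sum L2_cmult phi2_fst_L2)
    have h: "h \<in> L2 L" unfolding h_def[abs_def] by (intro L2_sum L2_cmult phi2_thd_L2)
    have g: "h1_graph L g w"
    proof -
      have "is_prim L g w" unfolding g_def[abs_def] w_def[abs_def]
        by (intro is_prim_sum is_prim_cmult phi2_snd_is_prim)
      moreover have "g 0 = 0" by (simp add: g_def phi2_snd_def)
      ultimately show ?thesis unfolding h1_graph_def by (intro exI[of _ g]) simp
    qed
    define A1 where "A1 = (\<Sum>n\<in>F1. (cmod (a (Inl n)))\<^sup>2)"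
    define A2 where "A2 = (\<Sum>m\<in>F2. (cmod (a (Inr m)))\<^sup>2)"
    have A: "(\<Sum>i\<in>F. (cmod (a i))\<^sup>2) = A1 + A2"
      unfolding F12(1) A1_def A2_def using F12(2,4) by (simp add: sum.Plus comp_def)
    have A0: "0 \<le> A1" "0 \<le> A2" unfolding A1_def A2_def by (simp_all add: sum_nonneg)
    have n1: "(l2_norm L f1)\<^sup>2 = A1"
      unfolding f1_def[abs_def] A1_def by (rule sine_basis_norm_sum[OF L_pos F12(2,3)])
    have n2: "(l2_norm L f2)\<^sup>2 \<le> S * A2"
    proof -
      have "(l2_norm L f2)\<^sup>2 \<le> A2 * (\<Sum>m\<in>F2. (l2_norm L (\<phi>1 m))\<^sup>2)"
        unfolding f2_def[abs_def] A2_def by (rule l2_norm_sum_sq_le[OF F12(4) phi2_fst_L2])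
      also have "\<dots> \<le> A2 * S" by (intro mult_left_mono S(2) F12(4) A0)
      finally show ?thesis by (simp add: mult.commute)
    qed
    have n3: "m2 * A2 \<le> (l2_norm L w)\<^sup>2 + (l2_norm L h)\<^sup>2" "(l2_norm L w)\<^sup>2 + (l2_norm L h)\<^sup>2 \<le> M2 * A2"
      using wave_riesz[OF F12(4), of "\<lambda>m. a (Inr m)"]
      unfolding m2_def M2_def A2_def w_def[abs_def] h_def[abs_def] by auto
    define f where "f x = f1 x + f2 x" for x
    have f: "f \<in> L2 L" unfolding f_def[abs_def] by (rule L2_add[OF f1 f2])
    have "(\<Sum>i\<in>F. a i *\<^sub>C Phi L c \<beta> \<alpha> i) = (f, g, h)"
      unfolding F12(1) Phi_sum[OF F12(2,4)] f_def[abs_def] f1_def f2_def g_def[abs_def] h_def[abs_def] ..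
    then have N: "(H0_norm L (\<Sum>i\<in>F. a i *\<^sub>C Phi L c \<beta> \<alpha> i))\<^sup>2 = (l2_norm L f)\<^sup>2 + ((l2_norm L w)\<^sup>2 + (l2_norm L h)\<^sup>2)"
      using H0_norm_eq[OF L_pos f g h] by simp
    have "(l2_norm L f)\<^sup>2 \<le> 2 * A1 + 2 * (S * A2)"
      using l2_norm_sq_add_le[OF f1 f2] n1 n2 unfolding f_def[abs_def] by linarith
    then have "(H0_norm L (\<Sum>i\<in>F. a i *\<^sub>C Phi L c \<beta> \<alpha> i))\<^sup>2 \<le> 2 * A1 + 2 * (S * A2) + M2 * A2"
      unfolding N using n3(2) by linarith
    also have "\<dots> \<le> (2 + 2 * S + M2) * (A1 + A2)"
      using A0 S(1) M2 by (simp add: algebra_simps add_nonneg_nonneg)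
    finally show "(H0_norm L (\<Sum>i\<in>F. a i *\<^sub>C Phi L c \<beta> \<alpha> i))\<^sup>2 \<le> (2 + 2 * S + M2) * (\<Sum>i\<in>F. (cmod (a i))\<^sup>2)"
      unfolding A .
    let ?W = "(l2_norm L w)\<^sup>2 + (l2_norm L h)\<^sup>2"
    \<comment> \<open>The sine combination is recovered as \<open>f1 = f - f2\<close>, the
      contribution of the wave eigenvectors being already under control.\<close>
    have "(l2_norm L (\<lambda>x. f x + (-1) * f2 x))\<^sup>2 \<le> 2 * (l2_norm L f)\<^sup>2 + 2 * (l2_norm L (\<lambda>x. (-1) * f2 x))\<^sup>2"
      by (rule l2_norm_sq_add_le[OF f L2_cmult[OF f2]])
    then have "A1 \<le> 2 * (l2_norm L f)\<^sup>2 + 2 * (l2_norm L f2)\<^sup>2"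
      unfolding l2_norm_cmult n1[symmetric] f_def by simp
    then have "A1 + A2 \<le> 2 * (l2_norm L f)\<^sup>2 + (2 * S + 1) * A2" using n2 by (simp add: algebra_simps)
    also have "\<dots> \<le> 2 * (l2_norm L f)\<^sup>2 + (2 * S + 1) * (?W / m2)"
      using n3(1) m2 S(1) by (intro add_left_mono mult_left_mono) (auto simp: field_simps)
    also have "\<dots> = 2 * (l2_norm L f)\<^sup>2 + (2 * S + 1) / m2 * ?W" by simp
    also have "\<dots> \<le> Q * (l2_norm L f)\<^sup>2 + Q * ?W"
      unfolding Q_def using S(1) m2 by (intro add_mono mult_right_mono) auto
    finally show "(\<Sum>i\<in>F. (cmod (a i))\<^sup>2) \<le> Q * (H0_norm L (\<Sum>i\<in>F. a i *\<^sub>C Phi L c \<beta> \<alpha> i))\<^sup>2"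
      unfolding A N by (simp add: distrib_left)
  qed
  show ?thesis
  proof (rule exI[of _ "1 / Q"], rule exI[of _ "2 + 2 * S + M2"], intro conjI allI impI; (elim conjE)?)
    show "0 < 1 / Q" "0 < 2 + 2 * S + M2" using Q S(1) M2 by auto
  next
    fix F a assume F: "finite F" "F \<subseteq> Phi_index"
    show "1 / Q * (\<Sum>i\<in>F. (cmod (a i))\<^sup>2) \<le> (H0_norm L (\<Sum>i\<in>F. a i *\<^sub>C Phi L c \<beta> \<alpha> i))\<^sup>2"
      "(H0_norm L (\<Sum>i\<in>F. a i *\<^sub>C Phi L c \<beta> \<alpha> i))\<^sup>2 \<le> (2 + 2 * S + M2) * (\<Sum>i\<in>F. (cmod (a i))\<^sup>2)"
      using main[OF F, of a] Q by (simp_all add: divide_le_eq mult.commute)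
  qed
qed

text \<open>Every combination of Fourier pairs is the rotated wave part of a combination of the
  \<open>phi2\<close>. The heat component \<open>f\<close> that comes along is not controlled;
  \<open>Phi_dense\<close> corrects it afterwards.\<close>

lemma fourier_span_lift:
  assumes "(p, q) \<in> cspan (range (\<lambda>m. (fourier_cos L m, fourier_sin L m)))"
  shows "\<exists>f g h w. (f, g, h) \<in> cspan (range (phi2 L c \<beta> \<alpha>)) \<and> f \<in> L2 L \<and> h1_graph L g w \<and> h \<in> L2 L \<and>
    p = rotE w h \<and> q = rotO w h"
proof -
  let ?P = "\<lambda>p q. \<exists>f g h w. (f, g, h) \<in> cspan (range (phi2 L c \<beta> \<alpha>)) \<and> f \<in> L2 L \<and> h1_graph L g w \<and> h \<in> L2 L \<and>
    p = rotE w h \<and> q = rotO w h"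
  have "csubspace {z. ?P (fst z) (snd z)}"
  proof (rule complex_vector.subspaceI)
    have "(\<lambda>x. 0, \<lambda>x. 0, \<lambda>x. 0) \<in> cspan (range (phi2 L c \<beta> \<alpha>))"
      using complex_vector.span_zero[of "range (phi2 L c \<beta> \<alpha>)"] by (simp add: zero_prod_def zero_fun_def)
    moreover have "(0 :: real \<Rightarrow> complex) = rotE (\<lambda>x. 0) (\<lambda>x. 0)" "(0 :: real \<Rightarrow> complex) = rotO (\<lambda>x. 0) (\<lambda>x. 0)"
      by (simp_all add: rotE_def rotO_def fun_eq_iff)
    ultimately show "0 \<in> {z. ?P (fst z) (snd z)}"
      using L2_zero h1_graph_zero by (simp add: zero_prod_def) blast
  next
    fix z z' assume "z \<in> {z. ?P (fst z) (snd z)}" "z' \<in> {z. ?P (fst z) (snd z)}"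
    then obtain f g h w f' g' h' w' where
      1: "(f, g, h) \<in> cspan (range (phi2 L c \<beta> \<alpha>))" "f \<in> L2 L" "h1_graph L g w" "h \<in> L2 L" "z = (rotE w h, rotO w h)"
      and 2: "(f', g', h') \<in> cspan (range (phi2 L c \<beta> \<alpha>))" "f' \<in> L2 L" "h1_graph L g' w'" "h' \<in> L2 L" "z' = (rotE w' h', rotO w' h')"
      by (auto simp: prod_eq_iff)
    have "(\<lambda>x. f x + f' x, \<lambda>x. g x + g' x, \<lambda>x. h x + h' x) \<in> cspan (range (phi2 L c \<beta> \<alpha>))"
      using complex_vector.span_add[OF 1(1) 2(1)] by (simp add: plus_fun_def)
    moreover have "fst (z + z') = rotE (\<lambda>x. w x + w' x) (\<lambda>x. h x + h' x)"
      "snd (z + z') = rotO (\<lambda>x. w x + w' x) (\<lambda>x. h x + h' x)"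
      by (simp_all add: 1(5) 2(5) fun_eq_iff rot_linear)
    ultimately show "z + z' \<in> {z. ?P (fst z) (snd z)}"
      using L2_add[OF 1(2) 2(2)] h1_graph_add[OF 1(3) 2(3)] L2_add[OF 1(4) 2(4)] unfolding mem_Collect_eq by blast
  next
    fix z a assume "z \<in> {z. ?P (fst z) (snd z)}"
    then obtain f g h w where
      1: "(f, g, h) \<in> cspan (range (phi2 L c \<beta> \<alpha>))" "f \<in> L2 L" "h1_graph L g w" "h \<in> L2 L" "z = (rotE w h, rotO w h)"
      by (auto simp: prod_eq_iff)
    have "(\<lambda>x. a * f x, \<lambda>x. a * g x, \<lambda>x. a * h x) \<in> cspan (range (phi2 L c \<beta> \<alpha>))"
      using complex_vector.span_scale[OF 1(1), of a] by (simp add: scaleC_prod_def scaleC_fun_def scaleC_complex_def)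
    moreover have "fst (a *\<^sub>C z) = rotE (\<lambda>x. a * w x) (\<lambda>x. a * h x)" "snd (a *\<^sub>C z) = rotO (\<lambda>x. a * w x) (\<lambda>x. a * h x)"
      by (simp_all add: 1(5) fun_eq_iff rot_linear scaleC_prod_def)
    ultimately show "a *\<^sub>C z \<in> {z. ?P (fst z) (snd z)}"
      using L2_cmult[OF 1(2)] h1_graph_scale[OF 1(3)] L2_cmult[OF 1(4)] unfolding mem_Collect_eq by blast
  qed
  moreover have "range (\<lambda>m. (fourier_cos L m, fourier_sin L m)) \<subseteq> {z. ?P (fst z) (snd z)}"
  proof clarify
    fix m
    let ?k = "1 / kappa m"
    have "?k *\<^sub>C phi2 L c \<beta> \<alpha> m \<in> cspan (range (phi2 L c \<beta> \<alpha>))"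
      by (intro complex_vector.span_scale complex_vector.span_base rangeI)
    then have "(\<lambda>x. ?k * \<phi>1 m x, \<lambda>x. ?k * \<phi>2 m x, \<lambda>x. ?k * \<phi>3 m x) \<in> cspan (range (phi2 L c \<beta> \<alpha>))"
      by (simp add: phi2_def scaleC_prod_def scaleC_fun_def scaleC_complex_def)
    moreover have "fourier_cos L m = rotE (\<lambda>x. ?k * wave_deriv m x) (\<lambda>x. ?k * \<phi>3 m x)"
      "fourier_sin L m = rotO (\<lambda>x. ?k * wave_deriv m x) (\<lambda>x. ?k * \<phi>3 m x)"
      unfolding fun_eq_iff rot_linear rot_wave using kappa_nonzero by simp_all
    ultimately have "?P (fourier_cos L m) (fourier_sin L m)"
      using L2_cmult[OF phi2_fst_L2] h1_graph_scale[OF phi2_snd_h1] L2_cmult[OF phi2_thd_L2] by blast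
    then show "?P (fst (fourier_cos L m, fourier_sin L m)) (snd (fourier_cos L m, fourier_sin L m))" by simp
  qed
  ultimately have "cspan (range (\<lambda>m. (fourier_cos L m, fourier_sin L m))) \<subseteq> {z. ?P (fst z) (snd z)}"
    by (rule complex_vector.span_minimal[rotated])
  from subsetD[OF this assms] show ?thesis by simp
qed

lemma Phi_image: "Phi L c \<beta> \<alpha> ` Phi_index = phi1 L ` {1..} \<union> range (phi2 L c \<beta> \<alpha>)"
  unfolding Phi_index_def Phi_def Plus_def by (auto simp: image_Un image_image)

text \<open>Triangularity again: the wave part is approximated first, whatever heat component
  results, and the remaining heat error is then reduced by sines, which leave the wave part
  untouched.\<close>

lemma Phi_dense:
  assumes v: "v \<in> H0 L" and e: "0 < e"
  shows "\<exists>u\<in>cspan (Phi L c \<beta> \<alpha> ` Phi_index). H0_norm L (v - u) < e"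
proof -
  obtain f g h w where vv: "v = (f, g, h)" "f \<in> L2 L" "h1_graph L g w" "h \<in> L2 L"
    by (rule H0_cases[OF L_pos v])
  have w: "w \<in> L2 L" by (rule h1_graphD(4)[OF L_pos vv(3)])
  \<comment> \<open>Chosen so that the distortion \<open>Kr\<close> of the rotation gives
    \<open>Kr * (d\<^sup>2 + d\<^sup>2) = e\<^sup>2 / 2\<close>.\<close>
  define d where "d = e / (4 * cosh (\<mu> * L))"
  have d: "0 < d" unfolding d_def using e by simp
  obtain p q where pq: "(p, q) \<in> cspan (range (\<lambda>m. (fourier_cos L m, fourier_sin L m)))"
    "l2_norm L (\<lambda>x. rotE w h x - p x) < d" "l2_norm L (\<lambda>x. rotO w h x - q x) < d"
    by (rule fourier_dense[OF L_pos rot_bounds(1,2)[OF w vv(4)] d])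
  obtain f1 g1 h1 w1 where 1: "(f1, g1, h1) \<in> cspan (range (phi2 L c \<beta> \<alpha>))" "f1 \<in> L2 L" "h1_graph L g1 w1" "h1 \<in> L2 L"
    "p = rotE w1 h1" "q = rotO w1 h1"
    using fourier_span_lift[OF pq(1)] by blast
  have w1: "w1 \<in> L2 L" by (rule h1_graphD(4)[OF L_pos 1(3)])
  have "(l2_norm L (\<lambda>x. w x - w1 x))\<^sup>2 + (l2_norm L (\<lambda>x. h x - h1 x))\<^sup>2
      \<le> Kr * ((l2_norm L (rotE (\<lambda>x. w x - w1 x) (\<lambda>x. h x - h1 x)))\<^sup>2 + (l2_norm L (rotO (\<lambda>x. w x - w1 x) (\<lambda>x. h x - h1 x)))\<^sup>2)"
    by (rule rot_bounds(4)[OF L2_diff[OF w w1] L2_diff[OF vv(4) 1(4)]])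
  also have "\<dots> = Kr * ((l2_norm L (\<lambda>x. rotE w h x - p x))\<^sup>2 + (l2_norm L (\<lambda>x. rotO w h x - q x))\<^sup>2)"
  proof -
    have "rotE (\<lambda>x. w x - w1 x) (\<lambda>x. h x - h1 x) = (\<lambda>x. rotE w h x - p x)"
      "rotO (\<lambda>x. w x - w1 x) (\<lambda>x. h x - h1 x) = (\<lambda>x. rotO w h x - q x)"
      by (simp_all add: fun_eq_iff rot_linear 1(5,6))
    then show ?thesis by simp
  qed
  also have "\<dots> \<le> Kr * (d\<^sup>2 + d\<^sup>2)"
    using pq(2,3) by (intro mult_left_mono add_mono power_mono) auto
  also have "\<dots> = e\<^sup>2 / 2"
    unfolding d_def by (simp add: power_divide power_mult_distrib field_simps cosh_real_nonzero)
  finally have wave: "(l2_norm L (\<lambda>x. w x - w1 x))\<^sup>2 + (l2_norm L (\<lambda>x. h x - h1 x))\<^sup>2 \<le> e\<^sup>2 / 2" .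
  obtain r where r: "r \<in> cspan (sine_basis L ` {1..})" "l2_norm L (\<lambda>x. (f x - f1 x) - r x) < e / 2"
    using sine_basis_dense[OF L_pos L2_diff[OF vv(2) 1(2)] half_gt_zero[OF e]] by (rule bexE)
  have rL2: "r \<in> L2 L" by (rule span_L2[OF _ r(1)]) (use sine_basis_L2[OF nonneg_L] in auto)
  have "csubspace {r. (r, \<lambda>x. 0, \<lambda>x. 0) \<in> cspan (phi1 L ` {1..})}"
  proof (rule complex_vector.subspaceI)
    show "0 \<in> {r. (r, \<lambda>x. 0, \<lambda>x. 0) \<in> cspan (phi1 L ` {1..})}"
      using complex_vector.span_zero[of "phi1 L ` {1..}"] by (simp add: zero_prod_def zero_fun_def)
    show "r + s \<in> {r. (r, \<lambda>x. 0, \<lambda>x. 0) \<in> cspan (phi1 L ` {1..})}"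
      if "r \<in> {r. (r, \<lambda>x. 0, \<lambda>x. 0) \<in> cspan (phi1 L ` {1..})}" "s \<in> {r. (r, \<lambda>x. 0, \<lambda>x. 0) \<in> cspan (phi1 L ` {1..})}" for r s
      using complex_vector.span_add[of "(r, \<lambda>x. 0, \<lambda>x. 0)" _ "(s, \<lambda>x. 0, \<lambda>x. 0)"] that by (simp add: plus_fun_def)
    show "a *\<^sub>C r \<in> {r. (r, \<lambda>x. 0, \<lambda>x. 0) \<in> cspan (phi1 L ` {1..})}"
      if "r \<in> {r. (r, \<lambda>x. 0, \<lambda>x. 0) \<in> cspan (phi1 L ` {1..})}" for r a
      using complex_vector.span_scale[of "(r, \<lambda>x. 0, \<lambda>x. 0)" _ a] that
      by (simp add: scaleC_prod_def scaleC_fun_def scaleC_complex_def)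
  qed
  then have "cspan (sine_basis L ` {1..}) \<subseteq> {r. (r, \<lambda>x. 0, \<lambda>x. 0) \<in> cspan (phi1 L ` {1..})}"
    by (rule complex_vector.span_minimal[rotated]) (auto simp: phi1_eq[symmetric] intro: complex_vector.span_base)
  then have "(r, \<lambda>x. 0, \<lambda>x. 0) \<in> cspan (phi1 L ` {1..})" using r(1) by blast
  then have u1: "(r, \<lambda>x. 0, \<lambda>x. 0) \<in> cspan (Phi L c \<beta> \<alpha> ` Phi_index)"
    using complex_vector.span_mono[of "phi1 L ` {1..}" "Phi L c \<beta> \<alpha> ` Phi_index"] by (auto simp: Phi_image)
  have u2: "(f1, g1, h1) \<in> cspan (Phi L c \<beta> \<alpha> ` Phi_index)"
    using complex_vector.span_mono[of "range (phi2 L c \<beta> \<alpha>)" "Phi L c \<beta> \<alpha> ` Phi_index"] 1(1) by (auto simp: Phi_image)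
  have u: "(\<lambda>x. f1 x + r x, g1, h1) \<in> cspan (Phi L c \<beta> \<alpha> ` Phi_index)"
    using complex_vector.span_add[OF u2 u1] by (simp add: plus_fun_def)
  have "H0_norm L (v - (\<lambda>x. f1 x + r x, g1, h1)) = sqrt ((l2_norm L (\<lambda>x. f x - (f1 x + r x)))\<^sup>2
      + (l2_norm L (\<lambda>x. w x - w1 x))\<^sup>2 + (l2_norm L (\<lambda>x. h x - h1 x))\<^sup>2)"
    unfolding vv(1) by (rule H0_norm_diff_eq[OF L_pos vv(2-4) L2_add[OF 1(2) rL2] 1(3,4)])
  also have "\<dots> < e"
  proof (rule real_less_lsqrt)
    have "(l2_norm L (\<lambda>x. f x - (f1 x + r x)))\<^sup>2 < (e / 2)\<^sup>2"
      using r(2) by (intro power_strict_mono) (auto simp: diff_diff_eq)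
    also have "(e / 2)\<^sup>2 \<le> e\<^sup>2 / 2" by (simp add: power_divide)
    finally show "(l2_norm L (\<lambda>x. f x - (f1 x + r x)))\<^sup>2
      + (l2_norm L (\<lambda>x. w x - w1 x))\<^sup>2 + (l2_norm L (\<lambda>x. h x - h1 x))\<^sup>2 < e\<^sup>2" using wave by linarith
  qed (use e in auto)
  finally show ?thesis using u by (rule bexI)
qed

lemma Phi_riesz_basis: "riesz_basis (H0 L) (H0_norm L) Phi_index (Phi L c \<beta> \<alpha>)"
  unfolding riesz_basis_def
proof (intro conjI ballI allI impI)
  show "Phi L c \<beta> \<alpha> ` Phi_index \<subseteq> H0 L" unfolding Phi_image using phi1_H0 phi2_H0 by auto
  show "\<exists>w\<in>cspan (Phi L c \<beta> \<alpha> ` Phi_index). H0_norm L (v - w) < \<epsilon>" if "v \<in> H0 L" "0 < \<epsilon>" for v \<epsilon>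
    by (rule Phi_dense[OF that])
qed (rule Phi_riesz_bounds)

end

section \<open>The operator\<close>

lemma h1_graph_unique:
  assumes L: "0 < L" and "h1_graph L g w" "h1_graph L g' w'" "AE x in leb L. g x = g' x"
  shows "AE x in leb L. w x = w' x"
proof -
  obtain G where G: "is_prim L G w" "AE x in leb L. g x = G x" using assms(2) unfolding h1_graph_def by blast
  obtain G' where G': "is_prim L G' w'" "AE x in leb L. g' x = G' x" using assms(3) unfolding h1_graph_def by blast
  have "AE x in leb L. G x = g' x" using G(2) assms(4) by (rule AE_mp[OF _ AE_mp]) auto
  then have "AE x in leb L. G x = G' x" using G'(2) by (rule AE_mp[OF _ AE_mp]) auto
  then show ?thesis by (rule is_prim_unique_AE(1)[OF L G(1) G'(1)])
qed

text \<open>Controls a primitive from its value at \<open>L\<close> instead of \<open>0\<close>,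
  because the damping condition prescribes the derivative at \<open>L\<close>.\<close>

lemma is_prim_end_bound:
  assumes L: "0 < L" and D: "is_prim L D d"
  shows "l2_norm L D \<le> sqrt L * (cmod (D L) + 2 * (sqrt L * l2_norm L d))"
proof -
  have D0: "cmod (D 0) \<le> cmod (D L) + sqrt L * l2_norm L d"
    using is_prim_bound[OF D, of L] norm_triangle_ineq4[of "D L" "D L - D 0"] L by simp
  have "cmod (D x) \<le> cmod (D L) + 2 * (sqrt L * l2_norm L d)" if "x \<in> {0<..<L}" for x
    using is_prim_bound[OF D, of x] norm_triangle_ineq[of "D x - D 0" "D 0"] D0 that by simp
  then have "l2_norm L D \<le> \<bar>cmod (D L) + 2 * (sqrt L * l2_norm L d)\<bar> * sqrt L"
    using L by (intro l2_norm_bounded(2) L2_measurable is_prim_L2[OF _ D]) auto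
  then show ?thesis using L by (simp add: mult.commute)
qed

section \<open>The graph of the operator\<close>

context coupled_system
begin

text \<open>One \<open>H\<close> represents both \<open>h\<close> and its image \<open>q\<close>,
  which are the same element of the space but possibly different functions. Its derivative
  \<open>v\<close> records that \<open>h\<close> lies in \<open>H1\<close>.\<close>

definition wave_graph :: "(real \<Rightarrow> complex) \<Rightarrow> (real \<Rightarrow> complex) \<Rightarrow> (real \<Rightarrow> complex) \<Rightarrow> (real \<Rightarrow> complex) \<Rightarrow> bool"
  where "wave_graph g h q r \<longleftrightarrow> (\<exists>G G' H v. is_prim L G G' \<and> is_prim L G' r \<and> (AE x in leb L. g x = G x) \<and> G 0 = 0 \<and>
    is_prim L H v \<and> (AE x in leb L. h x = H x) \<and> (AE x in leb L. q x = H x) \<and> H 0 = 0 \<and>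
    G' L + complex_of_real \<alpha> * H L = 0)"

definition heat_graph :: "(real \<Rightarrow> complex) \<Rightarrow> (real \<Rightarrow> complex) \<Rightarrow> (real \<Rightarrow> complex) \<Rightarrow> bool"
  where "heat_graph f g p \<longleftrightarrow> (\<exists>w. dirichlet_graph L f w \<and>
    (AE x in leb L. p x = w x + complex_of_real c * f x + complex_of_real (\<beta> x) * g x))"

definition op_graph :: "state \<Rightarrow> state \<Rightarrow> bool"
  where "op_graph = (\<lambda>(f, g, h) (p, q, r). heat_graph f g p \<and> wave_graph g h q r)"

lemma op_graph_simp [simp]: "op_graph (f, g, h) (p, q, r) \<longleftrightarrow> heat_graph f g p \<and> wave_graph g h q r"
  by (simp add: op_graph_def)

lemma wave_graph_h1:
  assumes "wave_graph g h q r"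
  obtains w v where "h1_graph L g w" "h1_graph L h v" "h1_graph L q v" "AE x in leb L. q x = h x" "r \<in> L2 L"
proof -
  obtain G G' H v where P: "is_prim L G G'" "is_prim L G' r" "AE x in leb L. g x = G x" "G 0 = 0"
    "is_prim L H v" "AE x in leb L. h x = H x" "AE x in leb L. q x = H x" "H 0 = 0"
    using assms unfolding wave_graph_def by blast
  have "AE x in leb L. q x = h x" using P(6,7) by (rule AE_mp[OF _ AE_mp]) auto
  moreover have "h1_graph L g G'" "h1_graph L h v" "h1_graph L q v"
    unfolding h1_graph_def using P by blast+
  ultimately show ?thesis using that is_primD(1)[OF P(2)] by blast
qed

lemma heat_graph_L2:
  assumes "heat_graph f g p" "g \<in> L2 L"
  shows "f \<in> L2 L" "p \<in> L2 L"
proof -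
  obtain w where w: "dirichlet_graph L f w"
    "AE x in leb L. p x = w x + complex_of_real c * f x + complex_of_real (\<beta> x) * g x"
    using assms(1) unfolding heat_graph_def by blast
  show f: "f \<in> L2 L" by (rule dirichlet_graph_dom(3)[OF L_pos w(1)])
  have "(\<lambda>x. w x + complex_of_real c * f x + complex_of_real (\<beta> x) * g x) \<in> L2 L"
    by (rule L2_add[OF L2_add[OF dirichlet_graph_dom(4)[OF L_pos w(1)] L2_cmult[OF f]] beta_mult_L2[OF assms(2)]])
  then show "p \<in> L2 L" by (rule L2_AE) (use w(2) in auto)
qed

lemma op_graph_mem:
  assumes "op_graph u z"
  obtains f g h p q r w v where "u = (f, g, h)" "z = (p, q, r)" "heat_graph f g p" "wave_graph g h q r"
    "f \<in> L2 L" "h1_graph L g w" "h \<in> L2 L" "p \<in> L2 L" "h1_graph L q v" "r \<in> L2 L" "AE x in leb L. q x = h x"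
proof -
  obtain f g h where u: "u = (f, g, h)" by (cases u)
  obtain p q r where z: "z = (p, q, r)" by (cases z)
  have hw: "heat_graph f g p" "wave_graph g h q r" using assms by (simp_all add: u z)
  obtain w v where wv: "h1_graph L g w" "h1_graph L h v" "h1_graph L q v" "AE x in leb L. q x = h x" "r \<in> L2 L"
    by (rule wave_graph_h1[OF hw(2)])
  have "g \<in> L2 L" "h \<in> L2 L" using h1_graphD(3)[OF L_pos] wv(1,2) by blast+
  then show ?thesis using that[OF u z hw _ wv(1) _ _ wv(3,5,4)] heat_graph_L2[OF hw(1)] by blast
qed

lemma heat_graph_add:
  assumes "heat_graph f g p" "heat_graph f' g' p'"
  shows "heat_graph (\<lambda>x. f x + f' x) (\<lambda>x. g x + g' x) (\<lambda>x. p x + p' x)"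
proof -
  obtain w where w: "dirichlet_graph L f w"
    "AE x in leb L. p x = w x + complex_of_real c * f x + complex_of_real (\<beta> x) * g x"
    using assms(1) unfolding heat_graph_def by blast
  obtain w' where w': "dirichlet_graph L f' w'"
    "AE x in leb L. p' x = w' x + complex_of_real c * f' x + complex_of_real (\<beta> x) * g' x"
    using assms(2) unfolding heat_graph_def by blast
  have "AE x in leb L. p x + p' x = (w x + w' x) + complex_of_real c * (f x + f' x) + complex_of_real (\<beta> x) * (g x + g' x)"
    using w(2) w'(2) by (rule AE_mp[OF _ AE_mp]) (auto simp: algebra_simps)
  then show ?thesis unfolding heat_graph_def using dirichlet_graph_add[OF w(1) w'(1)] by blast
qed

lemma heat_graph_scale:
  assumes "heat_graph f g p"
  shows "heat_graph (\<lambda>x. a * f x) (\<lambda>x. a * g x) (\<lambda>x. a * p x)"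
proof -
  obtain w where w: "dirichlet_graph L f w"
    "AE x in leb L. p x = w x + complex_of_real c * f x + complex_of_real (\<beta> x) * g x"
    using assms(1) unfolding heat_graph_def by blast
  have "AE x in leb L. a * p x = a * w x + complex_of_real c * (a * f x) + complex_of_real (\<beta> x) * (a * g x)"
    using w(2) by (rule AE_mp) (auto simp: algebra_simps)
  then show ?thesis unfolding heat_graph_def using dirichlet_graph_scale[OF w(1), of a] by blast
qed

lemma wave_graph_add:
  assumes "wave_graph g h q r" "wave_graph g' h' q' r'"
  shows "wave_graph (\<lambda>x. g x + g' x) (\<lambda>x. h x + h' x) (\<lambda>x. q x + q' x) (\<lambda>x. r x + r' x)"
proof -
  obtain G G' H v where P: "is_prim L G G'" "is_prim L G' r" "AE x in leb L. g x = G x" "G 0 = 0"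
    "is_prim L H v" "AE x in leb L. h x = H x" "AE x in leb L. q x = H x" "H 0 = 0"
    "G' L + complex_of_real \<alpha> * H L = 0"
    using assms(1) unfolding wave_graph_def by blast
  obtain K K' J u where Q: "is_prim L K K'" "is_prim L K' r'" "AE x in leb L. g' x = K x" "K 0 = 0"
    "is_prim L J u" "AE x in leb L. h' x = J x" "AE x in leb L. q' x = J x" "J 0 = 0"
    "K' L + complex_of_real \<alpha> * J L = 0"
    using assms(2) unfolding wave_graph_def by blast
  have "(G' L + K' L) + complex_of_real \<alpha> * (H L + J L)
      = (G' L + complex_of_real \<alpha> * H L) + (K' L + complex_of_real \<alpha> * J L)"
    by (simp add: algebra_simps)
  then have "(G' L + K' L) + complex_of_real \<alpha> * (H L + J L) = 0" using P(9) Q(9) by simp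
  moreover have "AE x in leb L. g x + g' x = G x + K x" using P(3) Q(3) by (rule AE_mp[OF _ AE_mp]) auto
  moreover have "AE x in leb L. h x + h' x = H x + J x" using P(6) Q(6) by (rule AE_mp[OF _ AE_mp]) auto
  moreover have "AE x in leb L. q x + q' x = H x + J x" using P(7) Q(7) by (rule AE_mp[OF _ AE_mp]) auto
  ultimately show ?thesis
    unfolding wave_graph_def using is_prim_add[OF P(1) Q(1)] is_prim_add[OF P(2) Q(2)] is_prim_add[OF P(5) Q(5)] P(4,8) Q(4,8)
    by (intro exI[of _ "\<lambda>x. G x + K x"] exI[of _ "\<lambda>x. G' x + K' x"] exI[of _ "\<lambda>x. H x + J x"] exI[of _ "\<lambda>x. v x + u x"]) simp
qed

lemma wave_graph_scale:
  assumes "wave_graph g h q r"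
  shows "wave_graph (\<lambda>x. a * g x) (\<lambda>x. a * h x) (\<lambda>x. a * q x) (\<lambda>x. a * r x)"
proof -
  obtain G G' H v where P: "is_prim L G G'" "is_prim L G' r" "AE x in leb L. g x = G x" "G 0 = 0"
    "is_prim L H v" "AE x in leb L. h x = H x" "AE x in leb L. q x = H x" "H 0 = 0"
    "G' L + complex_of_real \<alpha> * H L = 0"
    using assms(1) unfolding wave_graph_def by blast
  have "a * G' L + complex_of_real \<alpha> * (a * H L) = a * (G' L + complex_of_real \<alpha> * H L)"
    by (simp add: algebra_simps)
  then have "a * G' L + complex_of_real \<alpha> * (a * H L) = 0" using P(9) by simp
  moreover have "AE x in leb L. a * g x = a * G x" "AE x in leb L. a * h x = a * H x" "AE x in leb L. a * q x = a * H x"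
    using P(3,6,7) by auto
  ultimately show ?thesis
    unfolding wave_graph_def using is_prim_cmult[OF P(1), of a] is_prim_cmult[OF P(2), of a] is_prim_cmult[OF P(5), of a] P(4,8)
    by (intro exI[of _ "\<lambda>x. a * G x"] exI[of _ "\<lambda>x. a * G' x"] exI[of _ "\<lambda>x. a * H x"] exI[of _ "\<lambda>x. a * v x"]) simp
qed

lemma wave_graph_zero: "wave_graph (\<lambda>x. 0) (\<lambda>x. 0) (\<lambda>x. 0) (\<lambda>x. 0)"
  unfolding wave_graph_def using is_prim_const[of L 0]
  by (intro exI[of _ "\<lambda>x. 0"]) simp

lemma heat_graph_zero: "heat_graph (\<lambda>x. 0) (\<lambda>x. 0) (\<lambda>x. 0)"
  unfolding heat_graph_def using dirichlet_graph_zero[of L] by (intro exI[of _ "\<lambda>x. 0"]) simp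

text \<open>The third component converges only in L2, which says nothing about its value at
  \<open>L\<close>. But it equals the second component of the image, which converges together with
  its derivative, so the boundary value passes to the limit. A primitive \<open>\<Gamma>\<close> of
  \<open>r'\<close> obeying the damping condition is then compared with the derivatives
  \<open>\<gamma> n\<close> from the end point \<open>L\<close>.\<close>

lemma wave_graph_limit:
  assumes wg: "\<And>n::nat. wave_graph (g n) (h n) (q n) (r n)"
    and \<gamma>: "\<And>n. h1_graph L (g n) (\<gamma> n)" and \<theta>: "\<And>n. h1_graph L (q n) (\<theta> n)"
    and lim: "h1_graph L g' \<gamma>'" "h' \<in> L2 L" "h1_graph L q' \<theta>'" "r' \<in> L2 L"
    and l\<gamma>: "(\<lambda>n. l2_norm L (\<lambda>x. \<gamma> n x - \<gamma>' x)) \<longlonglongrightarrow> 0" and lh: "(\<lambda>n. l2_norm L (\<lambda>x. h n x - h' x)) \<longlonglongrightarrow> 0"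
    and l\<theta>: "(\<lambda>n. l2_norm L (\<lambda>x. \<theta> n x - \<theta>' x)) \<longlonglongrightarrow> 0" and lr: "(\<lambda>n. l2_norm L (\<lambda>x. r n x - r' x)) \<longlonglongrightarrow> 0"
  shows "wave_graph g' h' q' r'"
proof -
  have limit_zero: "a = 0" if "0 \<le> a" "\<And>n. a \<le> b n" "b \<longlonglongrightarrow> 0" for a :: real and b
    using LIMSEQ_le_const[OF that(3), of a] that(1,2) by force
  obtain H where H: "is_prim L H \<theta>'" "AE x in leb L. q' x = H x" "H 0 = 0"
    using lim(3) unfolding h1_graph_def by blast
  obtain G where G: "is_prim L G \<gamma>'" "AE x in leb L. g' x = G x" "G 0 = 0"
    using lim(1) unfolding h1_graph_def by blast
  have q'L: "q' \<in> L2 L" by (rule h1_graphD(3)[OF L_pos lim(3)])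
  have \<gamma>'L: "\<gamma>' \<in> L2 L" by (rule h1_graphD(4)[OF L_pos lim(1)])
  have hL: "h n \<in> L2 L" and qL: "q n \<in> L2 L" and rL: "r n \<in> L2 L" and qh: "AE x in leb L. q n x = h n x" for n
  proof -
    obtain w v where "h1_graph L (h n) v" "AE x in leb L. q n x = h n x" "r n \<in> L2 L"
      by (rule wave_graph_h1[OF wg[of n]])
    then show "h n \<in> L2 L" "q n \<in> L2 L" "r n \<in> L2 L" "AE x in leb L. q n x = h n x"
      using h1_graphD(3)[OF L_pos] \<theta>[of n] by blast+
  qed
  have \<gamma>L: "\<gamma> n \<in> L2 L" and \<theta>L: "\<theta> n \<in> L2 L" for n
    using h1_graphD(4)[OF L_pos] \<gamma> \<theta> by blast+
  have "l2_norm L (\<lambda>x. h' x - q' x) = 0"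
  proof (rule limit_zero)
    show "(\<lambda>n. l2_norm L (\<lambda>x. h n x - h' x) + L * l2_norm L (\<lambda>x. \<theta> n x - \<theta>' x)) \<longlonglongrightarrow> 0"
      using tendsto_add[OF lh tendsto_mult_right_zero[OF l\<theta>, of L]] by simp
    fix n
    have "l2_norm L (\<lambda>x. h' x - q' x) \<le> l2_norm L (\<lambda>x. h' x - h n x) + l2_norm L (\<lambda>x. h n x - q' x)"
      using l2_norm_triangle[OF L2_diff[OF lim(2) hL[of n]] L2_diff[OF hL[of n] q'L]] by simp
    also have "l2_norm L (\<lambda>x. h' x - h n x) = l2_norm L (\<lambda>x. h n x - h' x)"
      using l2_norm_cmult[of L "-1" "\<lambda>x. h n x - h' x"] by simp
    also have "l2_norm L (\<lambda>x. h n x - q' x) = l2_norm L (\<lambda>x. q n x - q' x)"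
      by (rule L2_AE_cong(2)[OF L2_diff[OF qL q'L] L2_measurable[OF L2_diff[OF hL q'L]]])
        (use qh[of n] in auto)
    also have "\<dots> \<le> L * l2_norm L (\<lambda>x. \<theta> n x - \<theta>' x)"
      by (rule h1_graphD(5)[OF L_pos h1_graph_diff[OF \<theta> lim(3)]])
    finally show "l2_norm L (\<lambda>x. h' x - q' x) \<le> l2_norm L (\<lambda>x. h n x - h' x) + L * l2_norm L (\<lambda>x. \<theta> n x - \<theta>' x)"
      by simp
  qed simp
  then have "AE x in leb L. h' x = q' x" using l2_norm_AE_eq_zero[OF lim(2) q'L] by simp
  then have hH: "AE x in leb L. h' x = H x" using H(2) by (rule AE_mp[OF _ AE_mp]) auto
  \<comment> \<open>The constant of integration for which \<open>\<Gamma>\<close> satisfies the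
    damping condition at \<open>L\<close>.\<close>
  define k where "k = - integral {0..L} r' - complex_of_real \<alpha> * H L"
  define \<Gamma> where "\<Gamma> x = k + integral {0..x} r'" for x
  have \<Gamma>: "is_prim L \<Gamma> r'" unfolding \<Gamma>_def by (rule is_prim_integral[OF lim(4)])
  have \<Gamma>L: "\<Gamma> \<in> L2 L" by (rule is_prim_L2[OF nonneg_L \<Gamma>])
  have bc: "\<Gamma> L + complex_of_real \<alpha> * H L = 0" by (simp add: \<Gamma>_def k_def)
  have "l2_norm L (\<lambda>x. \<gamma>' x - \<Gamma> x) = 0"
  proof (rule limit_zero)
    let ?b = "\<lambda>n. l2_norm L (\<lambda>x. \<gamma> n x - \<gamma>' x) + sqrt L * (\<alpha> * (sqrt L * l2_norm L (\<lambda>x. \<theta> n x - \<theta>' x))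
        + 2 * (sqrt L * l2_norm L (\<lambda>x. r n x - r' x)))"
    have "?b \<longlonglongrightarrow> 0 + sqrt L * (\<alpha> * (sqrt L * 0) + 2 * (sqrt L * 0))"
      by (intro tendsto_intros l\<gamma> l\<theta> lr)
    then show "?b \<longlonglongrightarrow> 0" by simp
    fix n
    obtain Gn Gn' Hn vn where P: "is_prim L Gn Gn'" "is_prim L Gn' (r n)" "AE x in leb L. g n x = Gn x" "Gn 0 = 0"
      "is_prim L Hn vn" "AE x in leb L. h n x = Hn x" "AE x in leb L. q n x = Hn x" "Hn 0 = 0"
      "Gn' L + complex_of_real \<alpha> * Hn L = 0"
      using wg[of n] unfolding wave_graph_def by blast
    have gn: "AE x in leb L. \<gamma> n x = Gn' x"
      by (rule h1_graph_unique[OF L_pos \<gamma>[of n], of Gn Gn']) (use P(1,3,4) in \<open>auto simp: h1_graph_def\<close>)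
    have vn: "AE x in leb L. vn x = \<theta> n x"
      by (rule h1_graph_unique[OF L_pos _ \<theta>[of n], of Hn]) (use P(5,7,8) in \<open>auto simp: h1_graph_def\<close>)
    have "is_prim L (\<lambda>x. Hn x - H x) (\<lambda>x. \<theta> n x - \<theta>' x)"
      by (rule is_prim_diff[OF is_prim_AE_cong[OF P(5) vn] H(1)])
    from is_prim_bound[OF this, of L] have HL: "cmod (Hn L - H L) \<le> sqrt L * l2_norm L (\<lambda>x. \<theta> n x - \<theta>' x)"
      using P(8) H(3) L_pos by simp
    have "Gn' L - \<Gamma> L = (Gn' L + complex_of_real \<alpha> * Hn L) - (\<Gamma> L + complex_of_real \<alpha> * H L) - complex_of_real \<alpha> * (Hn L - H L)"
      by (simp add: algebra_simps)
    then have "Gn' L - \<Gamma> L = - (complex_of_real \<alpha> * (Hn L - H L))" unfolding P(9) bc by simp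
    then have "cmod (Gn' L - \<Gamma> L) = \<alpha> * cmod (Hn L - H L)" using alpha by (simp add: norm_mult)
    then have GL: "cmod (Gn' L - \<Gamma> L) \<le> \<alpha> * (sqrt L * l2_norm L (\<lambda>x. \<theta> n x - \<theta>' x))" using HL alpha by simp
    have "l2_norm L (\<lambda>x. \<gamma>' x - \<Gamma> x) \<le> l2_norm L (\<lambda>x. \<gamma>' x - \<gamma> n x) + l2_norm L (\<lambda>x. \<gamma> n x - \<Gamma> x)"
      using l2_norm_triangle[OF L2_diff[OF \<gamma>'L \<gamma>L[of n]] L2_diff[OF \<gamma>L[of n] \<Gamma>L]] by simp
    also have "l2_norm L (\<lambda>x. \<gamma>' x - \<gamma> n x) = l2_norm L (\<lambda>x. \<gamma> n x - \<gamma>' x)"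
      using l2_norm_cmult[of L "-1" "\<lambda>x. \<gamma> n x - \<gamma>' x"] by simp
    also have "l2_norm L (\<lambda>x. \<gamma> n x - \<Gamma> x) = l2_norm L (\<lambda>x. Gn' x - \<Gamma> x)"
      by (rule L2_AE_cong(2)[OF L2_diff[OF is_prim_L2[OF nonneg_L P(2)] \<Gamma>L] L2_measurable[OF L2_diff[OF \<gamma>L \<Gamma>L]]])
        (use gn in auto)
    also have "\<dots> \<le> sqrt L * (cmod (Gn' L - \<Gamma> L) + 2 * (sqrt L * l2_norm L (\<lambda>x. r n x - r' x)))"
      by (rule is_prim_end_bound[OF L_pos is_prim_diff[OF P(2) \<Gamma>]])
    also have "\<dots> \<le> sqrt L * (\<alpha> * (sqrt L * l2_norm L (\<lambda>x. \<theta> n x - \<theta>' x)) + 2 * (sqrt L * l2_norm L (\<lambda>x. r n x - r' x)))"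
      using GL nonneg_L by (intro mult_left_mono add_right_mono) auto
    finally show "l2_norm L (\<lambda>x. \<gamma>' x - \<Gamma> x) \<le> ?b n" by simp
  qed simp
  then have "AE x in leb L. \<gamma>' x = \<Gamma> x" using l2_norm_AE_eq_zero[OF \<gamma>'L \<Gamma>L] by simp
  then have "is_prim L G \<Gamma>" by (rule is_prim_AE_cong[OF G(1)])
  then show ?thesis unfolding wave_graph_def using \<Gamma> G(2,3) H hH bc by blast
qed

text \<open>The terms with \<open>c\<close> and \<open>\<beta>\<close> are bounded operators, so
  subtracting them leaves a convergent sequence of second derivatives and the claim for the
  Dirichlet Laplacian.\<close>

lemma heat_graph_limit:
  assumes hg: "\<And>n::nat. heat_graph (f n) (g n) (p n)" and gL: "\<And>n. g n \<in> L2 L"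
    and lim: "f' \<in> L2 L" "g' \<in> L2 L" "p' \<in> L2 L"
    and lf: "(\<lambda>n. l2_norm L (\<lambda>x. f n x - f' x)) \<longlonglongrightarrow> 0" and lg: "(\<lambda>n. l2_norm L (\<lambda>x. g n x - g' x)) \<longlonglongrightarrow> 0"
    and lp: "(\<lambda>n. l2_norm L (\<lambda>x. p n x - p' x)) \<longlonglongrightarrow> 0"
  shows "heat_graph f' g' p'"
proof -
  obtain B where B: "0 \<le> B" "AE x in leb L. cmod (complex_of_real (\<beta> x)) \<le> B" by (rule beta_bounded)
  have fL: "f n \<in> L2 L" and pL: "p n \<in> L2 L" for n using heat_graph_L2[OF hg gL] by auto
  define y where "y x = p' x - complex_of_real c * f' x - complex_of_real (\<beta> x) * g' x" for x
  have yL: "y \<in> L2 L" unfolding y_def[abs_def] by (intro L2_diff L2_cmult beta_mult_L2 lim)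
  have "\<exists>w. dirichlet_graph L (f n) w \<and>
    (AE x in leb L. p n x = w x + complex_of_real c * f n x + complex_of_real (\<beta> x) * g n x)" for n
    using hg[of n] unfolding heat_graph_def .
  then obtain w where w: "\<And>n. dirichlet_graph L (f n) (w n)"
    "\<And>n. AE x in leb L. p n x = w n x + complex_of_real c * f n x + complex_of_real (\<beta> x) * g n x"
    by metis
  have wL: "w n \<in> L2 L" for n by (rule dirichlet_graph_dom(4)[OF L_pos w(1)])
  have le: "l2_norm L (\<lambda>x. w n x - y x) \<le> l2_norm L (\<lambda>x. p n x - p' x) + \<bar>c\<bar> * l2_norm L (\<lambda>x. f n x - f' x)
      + B * l2_norm L (\<lambda>x. g n x - g' x)" for n
  proof -
    let ?P = "\<lambda>x. p n x - p' x" and ?F = "\<lambda>x. - complex_of_real c * (f n x - f' x)"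
      and ?G = "\<lambda>x. - complex_of_real (\<beta> x) * (g n x - g' x)"
    have P: "?P \<in> L2 L" by (rule L2_diff[OF pL lim(3)])
    have F: "?F \<in> L2 L" by (rule L2_cmult[OF L2_diff[OF fL lim(1)]])
    have ms: "(\<lambda>x. - complex_of_real (\<beta> x)) \<in> borel_measurable (leb L)" using beta_measurable by simp
    have bd: "AE x in leb L. cmod (- complex_of_real (\<beta> x)) \<le> B" using B(2) by simp
    note G = L2_mult_bounded[OF L2_diff[OF gL[of n] lim(2)] ms bd]
    have "l2_norm L (\<lambda>x. w n x - y x) = l2_norm L (\<lambda>x. (?P x + ?F x) + ?G x)"
    proof (rule L2_AE_cong(2)[OF L2_add[OF L2_add[OF P F] G(1)] L2_measurable[OF L2_diff[OF wL yL]]])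
      show "AE x in leb L. (?P x + ?F x) + ?G x = w n x - y x"
        using w(2)[of n] by (rule AE_mp) (auto simp: y_def algebra_simps)
    qed
    also have "\<dots> \<le> l2_norm L (\<lambda>x. ?P x + ?F x) + l2_norm L ?G" by (rule l2_norm_triangle[OF L2_add[OF P F] G(1)])
    also have "\<dots> \<le> (l2_norm L ?P + l2_norm L ?F) + B * l2_norm L (\<lambda>x. g n x - g' x)"
      by (rule add_mono[OF l2_norm_triangle[OF P F] G(2)[OF B(1)]])
    finally show ?thesis unfolding l2_norm_cmult by simp
  qed
  have "(\<lambda>n. l2_norm L (\<lambda>x. p n x - p' x) + \<bar>c\<bar> * l2_norm L (\<lambda>x. f n x - f' x) + B * l2_norm L (\<lambda>x. g n x - g' x))
      \<longlonglongrightarrow> 0 + \<bar>c\<bar> * 0 + B * 0"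
    by (intro tendsto_intros lf lg lp)
  then have b0: "(\<lambda>n. l2_norm L (\<lambda>x. p n x - p' x) + \<bar>c\<bar> * l2_norm L (\<lambda>x. f n x - f' x) + B * l2_norm L (\<lambda>x. g n x - g' x)) \<longlonglongrightarrow> 0"
    by simp
  have "(\<lambda>n. l2_norm L (\<lambda>x. w n x - y x)) \<longlonglongrightarrow> 0"
    by (rule tendsto_sandwich[OF _ _ tendsto_const b0]) (use le in \<open>auto intro!: always_eventually\<close>)
  then have "dirichlet_graph L f' y" by (rule dirichlet_graph_limit[OF L_pos w(1) lim(1) yL lf])
  then show ?thesis unfolding heat_graph_def by (intro exI[of _ y]) (simp add: y_def)
qed

lemma A_dom_graph:
  assumes "u \<in> A_dom L \<alpha>"
  shows "op_graph u (A_op L c \<beta> u)"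
proof -
  obtain f g h where u: "u = (f, g, h)" by (cases u)
  have d: "f \<in> H2 L" "g \<in> H2 L" "h \<in> H1 L" "pt_value L f 0 = 0" "pt_value L f L = 0" "pt_value L g 0 = 0"
    "pt_value L h 0 = 0" "pt_value L (wderiv L g) L + complex_of_real \<alpha> * pt_value L h L = 0"
    using assms by (auto simp: u A_dom_def)
  have "f \<in> dirichlet_dom L" using d by (simp add: dirichlet_dom_def)
  then have "heat_graph f g (\<lambda>x. wderiv L (wderiv L f) x + complex_of_real c * f x + complex_of_real (\<beta> x) * g x)"
    unfolding heat_graph_def using dirichlet_dom_graph[OF L_pos] by (intro exI[of _ "wderiv L (wderiv L f)"]) simp
  moreover have "wave_graph g h h (wderiv L (wderiv L g))"
  proof -
    obtain G G' r where P: "is_prim L G G'" "is_prim L G' r" "AE x in leb L. g x = G x"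
      "AE x in leb L. wderiv L g x = G' x" "AE x in leb L. wderiv L (wderiv L g) x = r x"
      by (rule H2_is_prim[OF L_pos d(2)])
    obtain H where H: "is_prim L H (wderiv L h)" "AE x in leb L. h x = H x" by (rule H1_is_prim[OF L_pos d(3)])
    have "AE x in leb L. r x = wderiv L (wderiv L g) x" using P(5) by auto
    then have "is_prim L G' (wderiv L (wderiv L g))" by (rule is_prim_AE_cong[OF P(2)])
    moreover have "G 0 = 0" using is_prim_H2(4)[OF L_pos P(1-3), of 0] d(6) L_pos by simp
    moreover have "H 0 = 0" using is_prim_H1(3)[OF L_pos H, of 0] d(7) L_pos by simp
    moreover have "G' L + complex_of_real \<alpha> * H L = 0"
      using is_prim_H2(5)[OF L_pos P(1-3), of L] is_prim_H1(3)[OF L_pos H, of L] d(8) L_pos by simp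
    ultimately show ?thesis unfolding wave_graph_def using P(1,3) H by blast
  qed
  ultimately show ?thesis by (simp add: u A_op_def)
qed

lemma op_graph_A_dom:
  assumes "op_graph u z"
  shows "u \<in> A_dom L \<alpha>"
proof -
  obtain f g h p q r where u: "u = (f, g, h)" and hw: "heat_graph f g p" "wave_graph g h q r"
    by (rule op_graph_mem[OF assms])
  obtain w where w: "dirichlet_graph L f w" using hw(1) unfolding heat_graph_def by blast
  have f: "f \<in> H2 L" "pt_value L f 0 = 0" "pt_value L f L = 0"
    using dirichlet_graph_dom(1)[OF L_pos w] by (auto simp: dirichlet_dom_def)
  obtain G G' H v where P: "is_prim L G G'" "is_prim L G' r" "AE x in leb L. g x = G x" "G 0 = 0"
    "is_prim L H v" "AE x in leb L. h x = H x" "H 0 = 0" "G' L + complex_of_real \<alpha> * H L = 0"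
    using hw(2) unfolding wave_graph_def by blast
  note g = is_prim_H2[OF L_pos P(1-3)]
  note h = is_prim_H1[OF L_pos P(5,6)]
  show ?thesis
    using f g(1) h(1) g(4)[of 0] g(5)[of L] h(3)[of 0] h(3)[of L] P(4,7,8) L_pos by (simp add: u A_dom_def)
qed

lemma op_graph_unique:
  assumes "op_graph u z" "op_graph u z'"
  shows "H0_norm L (z - z') = 0"
proof -
  obtain f g h p q r w v where 1: "u = (f, g, h)" "z = (p, q, r)" "heat_graph f g p" "wave_graph g h q r"
    "f \<in> L2 L" "h1_graph L g w" "h \<in> L2 L" "p \<in> L2 L" "h1_graph L q v" "r \<in> L2 L" "AE x in leb L. q x = h x"
    by (rule op_graph_mem[OF assms(1)])
  obtain f' g' h' p' q' r' w' v' where 2: "u = (f', g', h')" "z' = (p', q', r')" "heat_graph f' g' p'" "wave_graph g' h' q' r'"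
    "f' \<in> L2 L" "h1_graph L g' w'" "h' \<in> L2 L" "p' \<in> L2 L" "h1_graph L q' v'" "r' \<in> L2 L" "AE x in leb L. q' x = h' x"
    by (rule op_graph_mem[OF assms(2)])
  have [simp]: "f' = f" "g' = g" "h' = h" using 1(1) 2(1) by auto
  have "AE x in leb L. p x = p' x"
  proof -
    obtain w where w: "dirichlet_graph L f w"
      "AE x in leb L. p x = w x + complex_of_real c * f x + complex_of_real (\<beta> x) * g x"
      using 1(3) unfolding heat_graph_def by blast
    obtain w' where w': "dirichlet_graph L f w'"
      "AE x in leb L. p' x = w' x + complex_of_real c * f x + complex_of_real (\<beta> x) * g x"
      using 2(3) unfolding heat_graph_def by auto
    have "AE x in leb L. p x = w' x + complex_of_real c * f x + complex_of_real (\<beta> x) * g x"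
      using w(2) dirichlet_graph_unique[OF L_pos w(1) w'(1)] by (rule AE_mp[OF _ AE_mp]) auto
    then show ?thesis using w'(2) by (rule AE_mp[OF _ AE_mp]) auto
  qed
  moreover have "AE x in leb L. v x = v' x"
  proof (rule h1_graph_unique[OF L_pos 1(9) 2(9)])
    show "AE x in leb L. q x = q' x" using 1(11) 2(11) by (rule AE_mp[OF _ AE_mp]) auto
  qed
  moreover have "AE x in leb L. r x = r' x"
  proof -
    obtain G G' where P: "is_prim L G G'" "is_prim L G' r" "AE x in leb L. g x = G x"
      using 1(4) unfolding wave_graph_def by blast
    obtain K K' where Q: "is_prim L K K'" "is_prim L K' r'" "AE x in leb L. g x = K x"
      using 2(4) unfolding wave_graph_def by auto
    have "AE x in leb L. r x = wderiv L (wderiv L g) x" using is_prim_H2(3)[OF L_pos P] by auto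
    then show ?thesis using is_prim_H2(3)[OF L_pos Q] by (rule AE_mp[OF _ AE_mp]) auto
  qed
  ultimately show ?thesis
    unfolding 1(2) 2(2) H0_null_iff[OF L_pos 1(8,9,10) 2(8,9,10)] by blast
qed

text \<open>The seminorm sees \<open>g\<close> only through its derivative;
  \<open>h1_graph_eq_AE\<close> recovers \<open>g\<close> itself, which occurs in the coupling
  term.\<close>

lemma op_graph_null:
  assumes "op_graph u z" "u' \<in> H0 L" "H0_norm L (u - u') = 0"
  shows "op_graph u' z"
proof -
  obtain f g h p q r w v where 1: "u = (f, g, h)" "z = (p, q, r)" "heat_graph f g p" "wave_graph g h q r"
    "f \<in> L2 L" "h1_graph L g w" "h \<in> L2 L"
    by (rule op_graph_mem[OF assms(1)])
  obtain f' g' h' w' where 2: "u' = (f', g', h')" "f' \<in> L2 L" "h1_graph L g' w'" "h' \<in> L2 L"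
    by (rule H0_cases[OF L_pos assms(2)])
  have ae: "AE x in leb L. f x = f' x" "AE x in leb L. w x = w' x" "AE x in leb L. h x = h' x"
    using assms(3) unfolding 1(1) 2(1) H0_null_iff[OF L_pos 1(5-7) 2(2-4)] by auto
  have gg: "AE x in leb L. g x = g' x" by (rule h1_graph_eq_AE[OF L_pos 1(6) 2(3) ae(2)])
  obtain w1 where w1: "dirichlet_graph L f w1"
    "AE x in leb L. p x = w1 x + complex_of_real c * f x + complex_of_real (\<beta> x) * g x"
    using 1(3) unfolding heat_graph_def by blast
  have "AE x in leb L. p x = w1 x + complex_of_real c * f' x + complex_of_real (\<beta> x) * g' x"
    using w1(2) ae(1) gg by (rule AE_mp[OF _ AE_mp[OF _ AE_mp]]) auto
  then have "heat_graph f' g' p"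
    unfolding heat_graph_def using dirichlet_graph_AE[OF w1(1) ae(1)] by (intro exI[of _ w1]) auto
  moreover have "wave_graph g' h' q r"
  proof -
    obtain G G' H v where P: "is_prim L G G'" "is_prim L G' r" "AE x in leb L. g x = G x" "G 0 = 0"
      "is_prim L H v" "AE x in leb L. h x = H x" "AE x in leb L. q x = H x" "H 0 = 0" "G' L + complex_of_real \<alpha> * H L = 0"
      using 1(4) unfolding wave_graph_def by blast
    have "AE x in leb L. g' x = G x" using P(3) gg by (rule AE_mp[OF _ AE_mp]) auto
    moreover have "AE x in leb L. h' x = H x" using P(6) ae(3) by (rule AE_mp[OF _ AE_mp]) auto
    ultimately show ?thesis unfolding wave_graph_def using P by blast
  qed
  ultimately show ?thesis by (simp add: 1(2) 2(1))
qed

lemma op_graph_limit: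
  assumes g: "\<And>n::nat. op_graph (u n) (z n)" and xy: "x \<in> H0 L" "y \<in> H0 L"
    and lu: "(\<lambda>n. H0_norm L (u n - x)) \<longlonglongrightarrow> 0" and lz: "(\<lambda>n. H0_norm L (z n - y)) \<longlonglongrightarrow> 0"
  shows "op_graph x y"
proof -
  have "\<exists>f g h p q r w v. u n = (f, g, h) \<and> z n = (p, q, r) \<and> heat_graph f g p \<and> wave_graph g h q r \<and>
    f \<in> L2 L \<and> h1_graph L g w \<and> h \<in> L2 L \<and> p \<in> L2 L \<and> h1_graph L q v \<and> r \<in> L2 L" for n
    by (rule op_graph_mem[OF g[of n]]) blast
  then obtain f g h p q r w v where 1: "\<And>n. u n = (f n, g n, h n)" "\<And>n. z n = (p n, q n, r n)"
    "\<And>n. heat_graph (f n) (g n) (p n)" "\<And>n. wave_graph (g n) (h n) (q n) (r n)" "\<And>n. f n \<in> L2 L"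
    "\<And>n. h1_graph L (g n) (w n)" "\<And>n. h n \<in> L2 L" "\<And>n. p n \<in> L2 L" "\<And>n. h1_graph L (q n) (v n)" "\<And>n. r n \<in> L2 L"
    by metis
  obtain f' g' h' w' where 2: "x = (f', g', h')" "f' \<in> L2 L" "h1_graph L g' w'" "h' \<in> L2 L"
    by (rule H0_cases[OF L_pos xy(1)])
  obtain p' q' r' v' where 3: "y = (p', q', r')" "p' \<in> L2 L" "h1_graph L q' v'" "r' \<in> L2 L"
    by (rule H0_cases[OF L_pos xy(2)])
  have squeeze: "a \<longlonglongrightarrow> 0" if "\<And>n. 0 \<le> a n" "\<And>n. a n \<le> b n" "b \<longlonglongrightarrow> 0" for a b :: "nat \<Rightarrow> real"
    by (rule tendsto_sandwich[OF _ _ tendsto_const that(3)]) (use that in \<open>auto intro!: always_eventually\<close>)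
  have bu: "l2_norm L (\<lambda>t. f n t - f' t) \<le> H0_norm L (u n - x)"
    "l2_norm L (\<lambda>t. w n t - w' t) \<le> H0_norm L (u n - x)"
    "l2_norm L (\<lambda>t. h n t - h' t) \<le> H0_norm L (u n - x)" for n
    unfolding 1(1) 2(1) by (rule H0_norm_diff_bounds[OF L_pos 1(5,6,7) 2(2,3,4)])+
  have bz: "l2_norm L (\<lambda>t. p n t - p' t) \<le> H0_norm L (z n - y)"
    "l2_norm L (\<lambda>t. v n t - v' t) \<le> H0_norm L (z n - y)"
    "l2_norm L (\<lambda>t. r n t - r' t) \<le> H0_norm L (z n - y)" for n
    unfolding 1(2) 3(1) by (rule H0_norm_diff_bounds[OF L_pos 1(8,9,10) 3(2,3,4)])+
  have lf: "(\<lambda>n. l2_norm L (\<lambda>t. f n t - f' t)) \<longlonglongrightarrow> 0" by (rule squeeze[OF l2_norm_nonneg bu(1) lu])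
  have lw: "(\<lambda>n. l2_norm L (\<lambda>t. w n t - w' t)) \<longlonglongrightarrow> 0" by (rule squeeze[OF l2_norm_nonneg bu(2) lu])
  have lh: "(\<lambda>n. l2_norm L (\<lambda>t. h n t - h' t)) \<longlonglongrightarrow> 0" by (rule squeeze[OF l2_norm_nonneg bu(3) lu])
  have lp: "(\<lambda>n. l2_norm L (\<lambda>t. p n t - p' t)) \<longlonglongrightarrow> 0" by (rule squeeze[OF l2_norm_nonneg bz(1) lz])
  have lv: "(\<lambda>n. l2_norm L (\<lambda>t. v n t - v' t)) \<longlonglongrightarrow> 0" by (rule squeeze[OF l2_norm_nonneg bz(2) lz])
  have lr: "(\<lambda>n. l2_norm L (\<lambda>t. r n t - r' t)) \<longlonglongrightarrow> 0" by (rule squeeze[OF l2_norm_nonneg bz(3) lz])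
  have gL: "g n \<in> L2 L" for n by (rule h1_graphD(3)[OF L_pos 1(6)])
  have lg: "(\<lambda>n. l2_norm L (\<lambda>t. g n t - g' t)) \<longlonglongrightarrow> 0"
    by (rule squeeze[OF l2_norm_nonneg h1_graphD(5)[OF L_pos h1_graph_diff[OF 1(6) 2(3)]] tendsto_mult_right_zero[OF lw]])
  have "heat_graph f' g' p'"
    by (rule heat_graph_limit[OF 1(3) gL 2(2) h1_graphD(3)[OF L_pos 2(3)] 3(2) lf lg lp])
  moreover have "wave_graph g' h' q' r'"
    by (rule wave_graph_limit[OF 1(4,6,9) 2(3,4) 3(3,4) lw lh lv lr])
  ultimately show ?thesis by (simp add: 2(1) 3(1))
qed

lemma op_graph_scale:
  assumes "op_graph u z"
  shows "op_graph (a *\<^sub>C u) (a *\<^sub>C z)"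
proof -
  obtain f g h p q r where 1: "u = (f, g, h)" "z = (p, q, r)" "heat_graph f g p" "wave_graph g h q r"
    by (rule op_graph_mem[OF assms])
  show ?thesis
    using heat_graph_scale[OF 1(3), of a] wave_graph_scale[OF 1(4), of a]
    by (simp add: 1(1,2) scaleC_prod_def scaleC_fun_def scaleC_complex_def)
qed

lemma op_graph_add:
  assumes "op_graph u z" "op_graph u' z'"
  shows "op_graph (u + u') (z + z')"
proof -
  obtain f g h p q r where 1: "u = (f, g, h)" "z = (p, q, r)" "heat_graph f g p" "wave_graph g h q r"
    by (rule op_graph_mem[OF assms(1)])
  obtain f' g' h' p' q' r' where 2: "u' = (f', g', h')" "z' = (p', q', r')" "heat_graph f' g' p'" "wave_graph g' h' q' r'"
    by (rule op_graph_mem[OF assms(2)])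
  show ?thesis
    using heat_graph_add[OF 1(3) 2(3)] wave_graph_add[OF 1(4) 2(4)]
    by (simp add: 1(1,2) 2(1,2) plus_fun_def)
qed

lemma op_graph_zero: "op_graph 0 0"
  using heat_graph_zero wave_graph_zero by (simp add: zero_prod_def zero_fun_def)

lemma A_op_closed: "closed_operator (H0 L) (H0_norm L) (A_dom L \<alpha>) (A_op L c \<beta>)"
proof (rule closed_operator_graph[where R = op_graph])
  show "seminormed_space (H0 L) (H0_norm L)" by (rule seminormed_space_H0[OF L_pos])
  show "u \<in> H0 L \<and> w \<in> H0 L" if "op_graph u w" for u w
    by (rule op_graph_mem[OF that]) (auto intro: H0_I[OF L_pos])
qed (fact A_dom_graph op_graph_A_dom op_graph_unique op_graph_zero op_graph_add op_graph_scale
    op_graph_null op_graph_limit)+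

text \<open>The wave equations decouple: g'' = k^2 g with g 0 = 0, and the damping condition forces
  g' 0 (cosh (k L) + \<alpha> sinh (k L)) = 0 with a positive bracket. With \<open>g\<close> gone,
  f'' = (k - c) f under Dirichlet conditions leaves only zero.\<close>

lemma op_graph_injective:
  assumes k: "0 < k" "c < k" and u: "op_graph u z" "H0_norm L (z - complex_of_real k *\<^sub>C u) = 0"
  shows "H0_norm L u = 0"
proof -
  obtain f g h p q r w v where 1: "u = (f, g, h)" "z = (p, q, r)" "heat_graph f g p" "wave_graph g h q r"
    "f \<in> L2 L" "h1_graph L g w" "h \<in> L2 L" "p \<in> L2 L" "h1_graph L q v" "r \<in> L2 L" "AE x in leb L. q x = h x"
    by (rule op_graph_mem[OF u(1)])
  let ?k = "complex_of_real k"
  have ku: "?k *\<^sub>C u = (\<lambda>x. ?k * f x, \<lambda>x. ?k * g x, \<lambda>x. ?k * h x)"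
    by (simp add: 1(1) scaleC_prod_def scaleC_fun_def scaleC_complex_def)
  have ae: "AE x in leb L. p x = ?k * f x" "AE x in leb L. v x = ?k * w x" "AE x in leb L. r x = ?k * h x"
    using u(2) unfolding ku 1(2)
      H0_null_iff[OF L_pos 1(8,9,10) L2_cmult[OF 1(5)] h1_graph_scale[OF 1(6)] L2_cmult[OF 1(7)]] by auto
  have qg: "AE x in leb L. q x = ?k * g x"
    by (rule h1_graph_eq_AE[OF L_pos 1(9) h1_graph_scale[OF 1(6)] ae(2)])
  obtain G G' H v' where P: "is_prim L G G'" "is_prim L G' r" "AE x in leb L. g x = G x" "G 0 = 0"
    "is_prim L H v'" "AE x in leb L. h x = H x" "AE x in leb L. q x = H x" "H 0 = 0" "G' L + complex_of_real \<alpha> * H L = 0"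
    using 1(4) unfolding wave_graph_def by blast
  have "AE x in leb L. H x = ?k * g x" using qg P(7) by (rule AE_mp[OF _ AE_mp]) auto
  then have HG: "AE x in leb L. H x = ?k * G x" using P(3) by (rule AE_mp[OF _ AE_mp]) auto
  have HL: "H x = ?k * G x" if "x \<in> {0..L}" for x
    by (rule is_prim_unique_AE(2)[OF L_pos P(5) is_prim_cmult[OF P(1)] HG that])
  have "AE x in leb L. r x = ?k * H x" using ae(3) P(6) by (rule AE_mp[OF _ AE_mp]) auto
  then have rG: "AE x in leb L. r x = ?k\<^sup>2 * G x"
    using HG by (rule AE_mp[OF _ AE_mp]) (auto simp: power2_eq_square)
  note sol = second_order_solution[OF L_pos P(1,2,4) rG]
  have "G' L + complex_of_real \<alpha> * (?k * G L) = G' 0 * complex_of_real (cosh (k * L) + \<alpha> * sinh (k * L))"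
    using sol[of L] L_pos by (simp add: algebra_simps)
  moreover have "0 < cosh (k * L) + \<alpha> * sinh (k * L)"
    using k(1) alpha L_pos by (intro add_pos_pos mult_pos_pos) auto
  then have "complex_of_real (cosh (k * L) + \<alpha> * sinh (k * L)) \<noteq> 0" by (simp only: of_real_eq_0_iff)
  ultimately have G'0: "G' 0 = 0" using P(9) HL[of L] L_pos by auto
  have Gz: "G x = 0" and G'z: "G' x = 0" if "x \<in> {0..L}" for x
    using sol[OF that] G'0 k(1) by auto
  have g0: "AE x in leb L. g x = 0"
    using P(3) by (rule AE_mp) (auto intro!: AE_I2 simp: Gz)
  have h0: "AE x in leb L. h x = 0"
    using P(6) by (rule AE_mp) (auto intro!: AE_I2 simp: Gz HL)
  have w0: "AE x in leb L. w x = 0"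
    by (rule h1_graph_unique[OF L_pos 1(6) h1_graph_zero g0])
  obtain w1 where w1: "dirichlet_graph L f w1"
    "AE x in leb L. p x = w1 x + complex_of_real c * f x + complex_of_real (\<beta> x) * g x"
    using 1(3) unfolding heat_graph_def by blast
  \<comment> \<open>Since \<open>k - c\<close> is positive, its square root can play the part of
    \<open>k\<close> in \<open>dirichlet_injective\<close>.\<close>
  have sq: "(complex_of_real (sqrt (k - c)))\<^sup>2 = ?k - complex_of_real c"
    using k(2) by (simp flip: of_real_power)
  have "AE x in leb L. ?k * f x = w1 x + complex_of_real c * f x + complex_of_real (\<beta> x) * g x"
    using w1(2) ae(1) by (rule AE_mp[OF _ AE_mp]) auto
  then have "AE x in leb L. w1 x = (complex_of_real (sqrt (k - c)))\<^sup>2 * f x"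
    using g0 unfolding sq by (rule AE_mp[OF _ AE_mp]) (auto simp: algebra_simps)
  then have f0: "AE x in leb L. f x = 0"
    by (rule dirichlet_injective[OF L_pos w1(1), rotated]) (use k(2) in simp)
  have "H0_norm L ((f, g, h) - (\<lambda>x. 0, \<lambda>x. 0, \<lambda>x. 0)) = 0"
    using H0_null_iff[OF L_pos 1(5-7) L2_zero h1_graph_zero L2_zero] f0 w0 h0 by simp
  moreover have "(f, g, h) - (\<lambda>x. 0, \<lambda>x. 0, \<lambda>x. 0) = u" by (simp add: 1(1) fun_diff_def)
  ultimately show ?thesis by simp
qed

section \<open>The eigenvalues and the conclusion\<close>

definition eigen :: "nat + int \<Rightarrow> complex"
  where "eigen = case_sum (\<lambda>n. complex_of_real (c - (real n * pi / L)\<^sup>2)) ev2"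

lemma phi1_graph: "op_graph (phi1 L n) (eigen (Inl n) *\<^sub>C phi1 L n)"
proof -
  have "heat_graph (sine_basis L n) (\<lambda>x. 0) (\<lambda>x. eigen (Inl n) * sine_basis L n x)"
    unfolding heat_graph_def
    by (rule exI, rule conjI[OF sine_basis_dirichlet[OF L_pos]]) (simp add: eigen_def algebra_simps)
  then show ?thesis
    using wave_graph_zero by (simp add: phi1_eq scaleC_prod_def scaleC_fun_def scaleC_complex_def)
qed

lemma phi2_graph: "op_graph (phi2 L c \<beta> \<alpha> m) (eigen (Inr m) *\<^sub>C phi2 L c \<beta> \<alpha> m)"
proof -
  obtain w where w: "dirichlet_graph L (\<phi>1 m) w"
    "AE x in leb L. w x - (ev2 m - complex_of_real c) * \<phi>1 m x = - complex_of_real (\<beta> x) * \<phi>2 m x"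
    using phi2_fst_graph by blast
  have "AE x in leb L. ev2 m * \<phi>1 m x = w x + complex_of_real c * \<phi>1 m x + complex_of_real (\<beta> x) * \<phi>2 m x"
    using w(2) by (rule AE_mp) (auto intro!: AE_I2 simp: algebra_simps eq_neg_iff_add_eq_0)
  then have "heat_graph (\<phi>1 m) (\<phi>2 m) (\<lambda>x. ev2 m * \<phi>1 m x)"
    unfolding heat_graph_def using w(1) by blast
  moreover have "wave_graph (\<phi>2 m) (\<phi>3 m) (\<lambda>x. ev2 m * \<phi>2 m x) (\<lambda>x. ev2 m * \<phi>3 m x)"
    unfolding wave_graph_def using phi2_snd_is_prim[of m] wave_deriv_is_prim[of m] phi2_thd_is_prim[of m] boundary_condition[of m]
    by (intro exI[of _ "\<phi>2 m"] exI[of _ "wave_deriv m"] exI[of _ "\<phi>3 m"] exI[of _ "\<lambda>x. ev2 m * wave_deriv m x"])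
      (simp add: phi2_thd_snd phi2_snd_def)
  ultimately show ?thesis
    by (simp add: phi2_def eigen_def scaleC_prod_def scaleC_fun_def scaleC_complex_def)
qed

lemma Phi_graph: "op_graph (Phi L c \<beta> \<alpha> i) (eigen i *\<^sub>C Phi L c \<beta> \<alpha> i)"
  using phi1_graph phi2_graph by (cases i) (simp_all add: Phi_def)

lemma eigen_inj: "inj_on eigen Phi_index"
proof (rule inj_onI)
  \<comment> \<open>Equality of the real parts alone already contradicts
    \<open>nonresonance\<close>.\<close>
  have 12: "eigen (Inl n) \<noteq> eigen (Inr m)" if "1 \<le> n" for n m
  proof
    assume "eigen (Inl n) = eigen (Inr m)"
    then have "Re (eigen (Inl n)) = Re (eigen (Inr m))" by simp
    then have "c - (real n * pi / L)\<^sup>2 = - \<mu>" unfolding eigen_def sum.case ev2_eq by simp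
    then show False using nonresonance[OF that] by (simp add: mu_def power_mult_distrib power_divide)
  qed
  fix i j assume ij: "i \<in> Phi_index" "j \<in> Phi_index" "eigen i = eigen j"
  show "i = j"
  proof (cases i; cases j)
    fix n k assume e: "i = Inl n" "j = Inl k"
    then have "complex_of_real (c - (real n * pi / L)\<^sup>2) = complex_of_real (c - (real k * pi / L)\<^sup>2)"
      using ij(3) by (simp only: eigen_def sum.case)
    then have "(real n * pi / L)\<^sup>2 = (real k * pi / L)\<^sup>2" by (simp only: of_real_eq_iff)
    then have "real n * pi / L = real k * pi / L" by (rule power2_eq_imp_eq) (use L_pos in auto)
    then show ?thesis using L_pos e by simp
  next
    fix m l assume e: "i = Inr m" "j = Inr l"
    then have "Im (ev2 m) = Im (ev2 l)" using ij(3) by (simp add: eigen_def)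
    then have "of_int m * pi / L = of_int l * pi / L" unfolding ev2_eq by simp
    then show ?thesis using L_pos e by simp
  next
    fix n m assume "i = Inl n" "j = Inr m"
    then show ?thesis using 12[of n m] ij by (auto simp: Phi_index_def)
  next
    fix n m assume "i = Inr m" "j = Inl n"
    then show ?thesis using 12[of n m] ij by (auto simp: Phi_index_def)
  qed
qed

text \<open>Each of the two families is uniformly separated, by \<pi> / L and by its square
  respectively, hence closed.\<close>

lemma eigen_closed: "closed (eigen ` Phi_index)"
proof -
  have "eigen ` Phi_index = (\<lambda>n. complex_of_real (c - (real n * pi / L)\<^sup>2)) ` {1..} \<union> range ev2"
    unfolding Phi_index_def Plus_def image_Un image_image eigen_def by simp
  moreover have "closed (range ev2)"
  proof (rule discrete_imp_closed[of "pi / L"])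
    show "0 < pi / L" using L_pos by simp
    show "\<forall>x\<in>range ev2. \<forall>y\<in>range ev2. dist y x < pi / L \<longrightarrow> y = x"
    proof (intro ballI impI)
      fix x y assume "x \<in> range ev2" "y \<in> range ev2" and d: "dist y x < pi / L"
      then obtain m l where ml: "x = ev2 m" "y = ev2 l" by blast
      have "\<bar>Im (ev2 l - ev2 m)\<bar> < pi / L"
        using abs_Im_le_cmod[of "y - x"] d by (simp add: ml dist_norm)
      moreover have "Im (ev2 l - ev2 m) = of_int (l - m) * (pi / L)"
        unfolding ev2_eq by (simp add: algebra_simps diff_divide_distrib)
      ultimately have "\<bar>of_int (l - m) :: real\<bar> * (pi / L) < 1 * (pi / L)"
        using L_pos by (simp add: abs_mult)
      then have "\<bar>of_int (l - m) :: real\<bar> < 1" using L_pos by (simp only: mult_less_cancel_right_pos divide_pos_pos pi_gt_zero)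
      then have "l = m" by linarith
      then show "y = x" by (simp add: ml)
    qed
  qed
  moreover have "closed ((\<lambda>n. complex_of_real (c - (real n * pi / L)\<^sup>2)) ` {1..})"
  proof (rule discrete_imp_closed[of "(pi / L)\<^sup>2"])
    show "0 < (pi / L)\<^sup>2" using L_pos by simp
    have sep: "(pi / L)\<^sup>2 \<le> (real k * pi / L)\<^sup>2 - (real n * pi / L)\<^sup>2" if "n < k" for n k :: nat
    proof -
      have "n\<^sup>2 + 1 \<le> k\<^sup>2"
        using power_mono[of "Suc n" k 2] that by (simp add: power2_eq_square)
      then have "1 \<le> (real k)\<^sup>2 - (real n)\<^sup>2" by (simp flip: of_nat_power add: le_diff_eq)
      then have "1 * (pi / L)\<^sup>2 \<le> ((real k)\<^sup>2 - (real n)\<^sup>2) * (pi / L)\<^sup>2" by (rule mult_right_mono) simp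
      then show ?thesis by (simp add: power_mult_distrib power_divide left_diff_distrib diff_divide_distrib)
    qed
    show "\<forall>x\<in>(\<lambda>n. complex_of_real (c - (real n * pi / L)\<^sup>2)) ` {1..}.
        \<forall>y\<in>(\<lambda>n. complex_of_real (c - (real n * pi / L)\<^sup>2)) ` {1..}. dist y x < (pi / L)\<^sup>2 \<longrightarrow> y = x"
    proof clarify
      fix n k :: nat
      assume d: "dist (complex_of_real (c - (real k * pi / L)\<^sup>2)) (complex_of_real (c - (real n * pi / L)\<^sup>2)) < (pi / L)\<^sup>2"
      then have "\<bar>(real n * pi / L)\<^sup>2 - (real k * pi / L)\<^sup>2\<bar> < (pi / L)\<^sup>2"
        by (simp only: dist_of_real dist_real_def)
      then have "n = k" using sep[of n k] sep[of k n] by (cases n k rule: linorder_cases) auto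
      then show "complex_of_real (c - (real k * pi / L)\<^sup>2) = complex_of_real (c - (real n * pi / L)\<^sup>2)" by simp
    qed
  qed
  ultimately show ?thesis by (simp only: closed_Un)
qed

lemma eigen_Re: "Re (eigen i) \<le> max c 0"
proof (cases i)
  case (Inr m)
  then show ?thesis unfolding eigen_def Inr sum.case ev2_eq using mu_pos by simp
next
  case (Inl n)
  have "c - (real n * pi / L)\<^sup>2 \<le> max c 0" using zero_le_power2[of "real n * pi / L"] by linarith
  then show ?thesis unfolding eigen_def Inl sum.case Re_complex_of_real .
qed

lemma Phi_index_bij: "bij_betw (from_nat_into Phi_index) UNIV Phi_index"
proof (rule bij_betw_from_nat_into)
  show "countable Phi_index" by simp
  show "infinite Phi_index"
    using infinite_UNIV_int unfolding Phi_index_def by (auto simp: finite_Plus_iff)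
qed

lemma A_op_spectral_and_generator:
  "riesz_spectral_operator (H0 L) (H0_norm L) (A_dom L \<alpha>) (A_op L c \<beta>)"
  "generates_C0_semigroup (H0 L) (H0_norm L) (A_dom L \<alpha>) (A_op L c \<beta>)"
proof -
  let ?e = "from_nat_into Phi_index"
  \<comment> \<open>A real point at distance at least 1 to the right of all eigenvalues, and both
    positive and larger than \<open>c\<close>, as \<open>op_graph_injective\<close>
    requires.\<close>
  let ?k = "max c 0 + 1"
  obtain m M where rs: "riesz_sequence_space (H0 L) (H0_norm L) (Phi L c \<beta> \<alpha> \<circ> ?e) m M"
    using riesz_basis_sequence[OF complete_seminormed_space_H0[OF L_pos] Phi_riesz_basis Phi_index_bij]
    by (elim exE) (rule that)
  interpret R: riesz_sequence_space "H0 L" "H0_norm L" "Phi L c \<beta> \<alpha> \<circ> ?e" m M by (rule rs)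
  have "diagonal_operator (H0 L) (H0_norm L) (Phi L c \<beta> \<alpha> \<circ> ?e) m M (A_dom L \<alpha>) (A_op L c \<beta>)
      (eigen \<circ> ?e) (complex_of_real ?k) 1"
  proof unfold_locales
    show "closed_operator (H0 L) (H0_norm L) (A_dom L \<alpha>) (A_op L c \<beta>)" by (rule A_op_closed)
    show "(Phi L c \<beta> \<alpha> \<circ> ?e) i \<in> A_dom L \<alpha>" for i
      using op_graph_A_dom[OF Phi_graph] by simp
    show "H0_norm L (A_op L c \<beta> ((Phi L c \<beta> \<alpha> \<circ> ?e) i) - (eigen \<circ> ?e) i *\<^sub>C (Phi L c \<beta> \<alpha> \<circ> ?e) i) = 0" for i
      using op_graph_unique[OF A_dom_graph[OF op_graph_A_dom[OF Phi_graph]] Phi_graph] by simp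
    show "1 \<le> cmod ((eigen \<circ> ?e) i - complex_of_real ?k)" for i
    proof -
      have "1 \<le> \<bar>Re ((eigen \<circ> ?e) i - complex_of_real ?k)\<bar>" using eigen_Re[of "?e i"] by simp
      also have "\<dots> \<le> cmod ((eigen \<circ> ?e) i - complex_of_real ?k)" by (rule abs_Re_le_cmod)
      finally show ?thesis .
    qed
    show "H0_norm L u = 0"
      if "u \<in> A_dom L \<alpha>" "H0_norm L (A_op L c \<beta> u - complex_of_real ?k *\<^sub>C u) = 0" for u
      by (rule op_graph_injective[OF _ _ A_dom_graph[OF that(1)] that(2)]) auto
  qed simp
  then interpret diagonal_operator "H0 L" "H0_norm L" "Phi L c \<beta> \<alpha> \<circ> ?e" m M "A_dom L \<alpha>" "A_op L c \<beta>"
    "eigen \<circ> ?e" "complex_of_real ?k" 1 .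
  have "inj (eigen \<circ> ?e)"
    using Phi_index_bij eigen_inj by (auto simp: bij_betw_def intro: comp_inj_on)
  moreover have "range ?e = Phi_index" using Phi_index_bij by (simp add: bij_betw_def)
  then have "range (eigen \<circ> ?e) = eigen ` Phi_index" by (subst image_comp[symmetric]) simp
  ultimately show "riesz_spectral_operator (H0 L) (H0_norm L) (A_dom L \<alpha>) (A_op L c \<beta>)"
    using is_riesz_spectral_operator eigen_closed by simp
  show "generates_C0_semigroup (H0 L) (H0_norm L) (A_dom L \<alpha>) (A_op L c \<beta>)"
    by (rule is_generator[of "max c 0"]) (simp only: comp_apply eigen_Re)
qed

end

theorem lemma7:
  fixes L c \<alpha> :: real and \<beta> :: "real \<Rightarrow> real"
  assumes "L > 0"
    and "\<beta> \<in> Linf_real L"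
    and "\<alpha> > 1"
    and "\<And>n::nat. n \<ge> 1 \<Longrightarrow> c \<noteq> 1 / (2 * L) * ln ((\<alpha> - 1) / (\<alpha> + 1)) + (real n)\<^sup>2 * pi\<^sup>2 / L\<^sup>2"
  shows "riesz_basis (H0 L) (H0_norm L) Phi_index (Phi L c \<beta> \<alpha>)
    \<and> riesz_spectral_operator (H0 L) (H0_norm L) (A_dom L \<alpha>) (A_op L c \<beta>)
    \<and> generates_C0_semigroup (H0 L) (H0_norm L) (A_dom L \<alpha>) (A_op L c \<beta>)"
proof -
  interpret coupled_system L c \<alpha> \<beta> by unfold_locales (fact assms)+
  show ?thesis using Phi_riesz_basis A_op_spectral_and_generator by blast
qed

end
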